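(* Let $f\colon M^{2n}\to\mathbb{H}^{2n+2}$, $n\geq 3$, be an isometric immersion of a Kaehler manifold $M^{2n}$ of real dimension $2n$ which does not contain a (nonempty) open subset of flat points. Then one of the following holds: (a) $n=3$ and, up to an isometry of $\mathbb{H}^8$, $f(M)$ is an open subset of an extrinsic product $\mathbb{H}^2_{c_1}\times\mathbb{S}^2_{c_2}\times\mathbb{S}^2_{c_3}\subset\mathbb{H}^8\subset\mathbb{L}^9=\mathbb{L}^3\times\mathbb{R}^3\times\mathbb{R}^3$ of umbilical surfaces $\mathbb{H}^2_{c_1}\subset\mathbb{L}^3$, $\mathbb{S}^2_{c_2}\subset\mathbb{R}^3$ and $\mathbb{S}^2_{c_3}\subset\mathbb{R}^3$, where $c_1<0$, $c_2,c_3>0$ and $1/c_1+1/c_2+1/c_3=-1$; (b) there is a composition of isometric immersions $f=j\circ g$ where $g\colon M^{2n}\to\mathbb{R}^{2n+1}$ is a real Kaehler hypersurface (that is, an isometric immersion of the Kaehler manifold $M^{2n}$ into Euclidean space) and $j\colon\mathbb{R}^{2n+1}\to\mathbb{H}^{2n+2}$ is a horosphere.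
   Context: A Kaehler manifold $(M^{2n},J)$ is a (connected) Riemannian manifold of real dimension $2n$ with an orthogonal almost complex structure $J$ that is parallel with respect to the Levi-Civita connection. A flat point is a point where the curvature tensor of $M^{2n}$ vanishes. $\mathbb{H}^{N}$ is the hyperbolic space of constant sectional curvature $-1$, viewed as (one sheet of) the hyperboloid $\{\langle x,x\rangle=-1\}$ in the flat Lorentzian space $\mathbb{L}^{N+1}$. $\mathbb{H}^2_{c}\subset\mathbb{L}^3$ with $c<0$ is (one sheet of) $\{\langle x,x\rangle=1/c\}$ and $\mathbb{S}^2_c\subset\mathbb{R}^3$ with $c>0$ is $\{\langle x,x\rangle=1/c\}$. The extrinsic product of inclusions $g_1,g_2,g_3$ is $(x_1,x_2,x_3)\mapsto(g_1(x_1),g_2(x_2),g_3(x_3))$. A horosphere $j\colon\mathbb{R}^{N-1}\to\mathbb{H}^{N}$ is the isometric umbilical embedding of Euclidean space onto a horosphere of $\mathbb{H}^{N}$. *)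

theory Defs
  imports "HOL-Analysis.Analysis"
begin

section \<open>Smooth maps between Euclidean spaces\<close>

text \<open>Both notions are meant for open domains \<^term>\<open>S\<close> of a finite-dimensional space, where
  \<open>C\<^sup>k\<close> is equivalent to all directional derivatives being \<open>C\<^sup>k\<^sup>-\<^sup>1\<close>.\<close>

primrec Ck_on :: "nat \<Rightarrow> ('m::euclidean_space \<Rightarrow> 'b::real_normed_vector) \<Rightarrow> 'm set \<Rightarrow> bool" where
  "Ck_on 0 f S \<longleftrightarrow> continuous_on S f"
| "Ck_on (Suc k) f S \<longleftrightarrow>
     (\<forall>x\<in>S. f differentiable (at x)) \<and> (\<forall>v. Ck_on k (\<lambda>x. frechet_derivative f (at x) v) S)"

definition smooth_on :: "('m::euclidean_space \<Rightarrow> 'b::real_normed_vector) \<Rightarrow> 'm set \<Rightarrow> bool" where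
  "smooth_on f S \<longleftrightarrow> (\<forall>k. Ck_on k f S)"

section \<open>Smooth manifolds\<close>

type_synonym ('a, 'm) chart = "'a set \<times> ('a \<Rightarrow> 'm)"

definition coord_image :: "('a, 'm) chart \<Rightarrow> 'm set" where
  "coord_image c = snd c ` fst c"

definition param :: "('a, 'm) chart \<Rightarrow> 'm \<Rightarrow> 'a" where
  "param c = inv_into (fst c) (snd c)"

definition transition :: "('a, 'm) chart \<Rightarrow> ('a, 'm) chart \<Rightarrow> 'm \<Rightarrow> 'm" where
  "transition c d = snd d \<circ> param c"

locale smooth_manifold =
  fixes X :: "'a topology" and A :: "('a, 'm::euclidean_space) chart set"
  assumes hausdorff: "Hausdorff_space X"
    and second_countable: "second_countable X"
    and charts_cover: "(\<Union>c\<in>A. fst c) = topspace X"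
    and open_domain: "c \<in> A \<Longrightarrow> openin X (fst c)"
    and open_image: "c \<in> A \<Longrightarrow> open (coord_image c)"
    and chart_homeomorphic:
      "c \<in> A \<Longrightarrow> homeomorphic_map (subtopology X (fst c)) (top_of_set (coord_image c)) (snd c)"
    and smooth_transition:
      "c \<in> A \<Longrightarrow> d \<in> A \<Longrightarrow> smooth_on (transition c d) (snd c ` (fst c \<inter> fst d))"

section \<open>Riemannian metrics, Levi-Civita connection and curvature\<close>

text \<open>Tensor fields are given by their coordinate expressions in the charts of the atlas, subject to
  the transformation law under change of chart: \<^term>\<open>g c x u v\<close> is the value of the metric at the
  point with coordinates \<^term>\<open>x\<close> in the chart \<^term>\<open>c\<close>, on the tangent vectors with
  components \<^term>\<open>u\<close> and \<^term>\<open>v\<close>.\<close>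

type_synonym ('a, 'm) metric = "('a, 'm) chart \<Rightarrow> 'm \<Rightarrow> 'm \<Rightarrow> 'm \<Rightarrow> real"
type_synonym ('a, 'm) endo_field = "('a, 'm) chart \<Rightarrow> 'm \<Rightarrow> 'm \<Rightarrow> 'm"

locale riemannian_manifold = smooth_manifold X A
  for X :: "'a topology" and A :: "('a, 'm::euclidean_space) chart set" +
  fixes g :: "('a, 'm) metric"
  assumes metric_bilinear: "c \<in> A \<Longrightarrow> x \<in> coord_image c \<Longrightarrow> bilinear (g c x)"
    and metric_sym: "c \<in> A \<Longrightarrow> x \<in> coord_image c \<Longrightarrow> g c x u v = g c x v u"
    and metric_pos: "c \<in> A \<Longrightarrow> x \<in> coord_image c \<Longrightarrow> u \<noteq> 0 \<Longrightarrow> g c x u u > 0"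
    and metric_smooth: "c \<in> A \<Longrightarrow> smooth_on (\<lambda>x. g c x u v) (coord_image c)"
    and metric_transition:
      "c \<in> A \<Longrightarrow> d \<in> A \<Longrightarrow> x \<in> snd c ` (fst c \<inter> fst d) \<Longrightarrow>
       g d (transition c d x) (frechet_derivative (transition c d) (at x) u)
                              (frechet_derivative (transition c d) (at x) v) = g c x u v"

text \<open>In a fixed chart, \<open>\<nabla>\<^sub>u V = D\<^sub>u V + \<Gamma>(u, V)\<close>. The Levi-Civita connection is the unique torsion-free
  (symmetric \<open>\<Gamma>\<close>) connection for which the metric \<^term>\<open>h\<close> is parallel.\<close>

definition christoffel ::
  "('m::euclidean_space \<Rightarrow> 'm \<Rightarrow> 'm \<Rightarrow> real) \<Rightarrow> 'm \<Rightarrow> 'm \<Rightarrow> 'm \<Rightarrow> 'm" where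
  "christoffel h x = (THE \<Gamma>. bilinear \<Gamma> \<and> (\<forall>u v. \<Gamma> u v = \<Gamma> v u) \<and>
     (\<forall>u v w. frechet_derivative (\<lambda>y. h y v w) (at x) u = h x (\<Gamma> u v) w + h x v (\<Gamma> u w)))"

text \<open>\<open>R(u, v)w = \<nabla>\<^sub>u\<nabla>\<^sub>v w - \<nabla>\<^sub>v\<nabla>\<^sub>u w\<close> for vector fields \<open>u\<close>, \<open>v\<close>, \<open>w\<close> with constant components.\<close>

definition curvature ::
  "('m::euclidean_space \<Rightarrow> 'm \<Rightarrow> 'm \<Rightarrow> real) \<Rightarrow> 'm \<Rightarrow> 'm \<Rightarrow> 'm \<Rightarrow> 'm \<Rightarrow> 'm" where
  "curvature h x u v w =
     frechet_derivative (\<lambda>y. christoffel h y v w) (at x) u + christoffel h x u (christoffel h x v w)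
   - (frechet_derivative (\<lambda>y. christoffel h y u w) (at x) v + christoffel h x v (christoffel h x u w))"

definition flat_point ::
  "('a, 'm::euclidean_space) chart set \<Rightarrow> ('a, 'm) metric \<Rightarrow> 'a \<Rightarrow> bool" where
  "flat_point A g p \<longleftrightarrow>
     (\<forall>c\<in>A. p \<in> fst c \<longrightarrow> (\<forall>u v w. curvature (g c) (snd c p) u v w = 0))"

section \<open>Kaehler manifolds\<close>

text \<open>The last axiom is \<open>(\<nabla>\<^sub>u J)v = \<nabla>\<^sub>u(Jv) - J(\<nabla>\<^sub>u v) = 0\<close> for \<open>v\<close> with constant components.\<close>

locale kaehler_manifold = riemannian_manifold X A g
  for X :: "'a topology" and A :: "('a, 'm::euclidean_space) chart set" and g :: "('a, 'm) metric" +
  fixes J :: "('a, 'm) endo_field"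
  assumes connected: "connected_space X"
    and J_linear: "c \<in> A \<Longrightarrow> x \<in> coord_image c \<Longrightarrow> linear (J c x)"
    and J_smooth: "c \<in> A \<Longrightarrow> smooth_on (\<lambda>x. J c x u) (coord_image c)"
    and J_transition:
      "c \<in> A \<Longrightarrow> d \<in> A \<Longrightarrow> x \<in> snd c ` (fst c \<inter> fst d) \<Longrightarrow>
       J d (transition c d x) (frechet_derivative (transition c d) (at x) u)
         = frechet_derivative (transition c d) (at x) (J c x u)"
    and J_square: "c \<in> A \<Longrightarrow> x \<in> coord_image c \<Longrightarrow> J c x (J c x u) = - u"
    and J_orthogonal: "c \<in> A \<Longrightarrow> x \<in> coord_image c \<Longrightarrow> g c x (J c x u) (J c x v) = g c x u v"
    and J_parallel:
      "c \<in> A \<Longrightarrow> x \<in> coord_image c \<Longrightarrow>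
       frechet_derivative (\<lambda>y. J c y v) (at x) u + christoffel (g c) x u (J c x v)
         - J c x (christoffel (g c) x u v) = 0"

section \<open>Lorentzian space and hyperbolic space\<close>

text \<open>If \<^typ>\<open>'h\<close> has dimension \<open>N\<close>, then \<^typ>\<open>'h \<times> real\<close> with the form below is the flat Lorentzian
  space of dimension \<open>N + 1\<close>; the last coordinate is the time coordinate.\<close>

definition lorentz :: "'h::euclidean_space \<times> real \<Rightarrow> 'h \<times> real \<Rightarrow> real" where
  "lorentz x y = fst x \<bullet> fst y - snd x * snd y"

definition hyperboloid :: "real \<Rightarrow> ('h::euclidean_space \<times> real) set" where
  "hyperboloid c = {x. lorentz x x = 1 / c \<and> snd x > 0}"

abbreviation hyperbolic_space :: "('h::euclidean_space \<times> real) set" where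
  "hyperbolic_space \<equiv> hyperboloid (- 1)"

definition hyperbolic_dist :: "'h::euclidean_space \<times> real \<Rightarrow> 'h \<times> real \<Rightarrow> real" where
  "hyperbolic_dist x y = arcosh (- lorentz x y)"

text \<open>Source and target may be models of the same dimension over different Euclidean spaces.\<close>

definition hyperbolic_isometry ::
  "('h::euclidean_space \<times> real \<Rightarrow> 'k::euclidean_space \<times> real) \<Rightarrow> bool" where
  "hyperbolic_isometry \<Phi> \<longleftrightarrow>
     bij_betw \<Phi> hyperbolic_space hyperbolic_space \<and>
     (\<forall>x\<in>hyperbolic_space. \<forall>y\<in>hyperbolic_space.
        hyperbolic_dist (\<Phi> x) (\<Phi> y) = hyperbolic_dist x y)"

section \<open>Isometric immersions\<close>

text \<open>The target is a submanifold \<^term>\<open>T\<close> of a vector space with the metric induced by the bilinear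
  form \<^term>\<open>b\<close>. A map with \<open>b(df u, df v) = g(u, v)\<close> is an immersion because \<open>g\<close> is positive
  definite.\<close>

definition isometric_immersion ::
  "'a topology \<Rightarrow> ('a, 'm::euclidean_space) chart set \<Rightarrow> ('a, 'm) metric \<Rightarrow>
   'b::real_normed_vector set \<Rightarrow> ('b \<Rightarrow> 'b \<Rightarrow> real) \<Rightarrow> ('a \<Rightarrow> 'b) \<Rightarrow> bool" where
  "isometric_immersion X A g T b f \<longleftrightarrow>
     f ` topspace X \<subseteq> T \<and>
     (\<forall>c\<in>A. smooth_on (f \<circ> param c) (coord_image c) \<and>
        (\<forall>x\<in>coord_image c. \<forall>u v.
           b (frechet_derivative (f \<circ> param c) (at x) u) (frechet_derivative (f \<circ> param c) (at x) v)
             = g c x u v))"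

abbreviation isometric_immersion_hyperbolic ::
  "'a topology \<Rightarrow> ('a, 'm::euclidean_space) chart set \<Rightarrow> ('a, 'm) metric \<Rightarrow>
   ('a \<Rightarrow> 'h::euclidean_space \<times> real) \<Rightarrow> bool" where
  "isometric_immersion_hyperbolic X A g f \<equiv> isometric_immersion X A g hyperbolic_space lorentz f"

abbreviation isometric_immersion_euclidean ::
  "'a topology \<Rightarrow> ('a, 'm::euclidean_space) chart set \<Rightarrow> ('a, 'm) metric \<Rightarrow>
   ('a \<Rightarrow> 'r::euclidean_space) \<Rightarrow> bool" where
  "isometric_immersion_euclidean X A g f \<equiv> isometric_immersion X A g UNIV inner f"

text \<open>Second fundamental form of an isometric immersion \<^term>\<open>f\<close> into hyperbolic space, in a chart
  \<^term>\<open>c\<close> with \<open>F = f \<circ> param c\<close>. The flat derivative of Lorentzian space decomposes as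
  \<open>D\<^sup>2F(u, v) = dF(\<Gamma>(u, v)) + \<alpha>(u, v) + g(u, v) F\<close>, the last summand being the second fundamental form
  of the hyperboloid \<open>\<langle>x, x\<rangle> = - 1\<close>.\<close>

definition hyperbolic_sff ::
  "('a, 'm::euclidean_space) metric \<Rightarrow> ('a \<Rightarrow> 'h::euclidean_space \<times> real) \<Rightarrow>
   ('a, 'm) chart \<Rightarrow> 'm \<Rightarrow> 'm \<Rightarrow> 'm \<Rightarrow> 'h \<times> real" where
  "hyperbolic_sff g f c x u v =
     frechet_derivative (\<lambda>y. frechet_derivative (f \<circ> param c) (at y) v) (at x) u
   - frechet_derivative (f \<circ> param c) (at x) (christoffel (g c) x u v)
   - g c x u v *\<^sub>R f (param c x)"

definition umbilical ::
  "('a, 'm::euclidean_space) chart set \<Rightarrow> ('a, 'm) metric \<Rightarrow>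
   ('a \<Rightarrow> 'h::euclidean_space \<times> real) \<Rightarrow> bool" where
  "umbilical A g f \<longleftrightarrow>
     (\<forall>c\<in>A. \<forall>x\<in>coord_image c. \<exists>\<eta>. \<forall>u v. hyperbolic_sff g f c x u v = g c x u v *\<^sub>R \<eta>)"

section \<open>Horospheres\<close>

definition euclidean_atlas :: "('r::euclidean_space, 'r) chart set" where
  "euclidean_atlas = {(UNIV, id)}"

definition euclidean_metric :: "('r::euclidean_space, 'r) metric" where
  "euclidean_metric c x u v = u \<bullet> v"

text \<open>A horosphere is the intersection of hyperbolic space with a degenerate affine hyperplane, with
  future-pointing lightlike normal \<^term>\<open>w\<close>; rescaling \<^term>\<open>w\<close> normalises the level to \<open>- 1\<close>.\<close>

definition is_horosphere :: "('h::euclidean_space \<times> real) set \<Rightarrow> bool" where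
  "is_horosphere S \<longleftrightarrow>
     (\<exists>w. lorentz w w = 0 \<and> snd w > 0 \<and> S = {x \<in> hyperbolic_space. lorentz x w = - 1})"

definition horosphere_embedding ::
  "('r::euclidean_space \<Rightarrow> 'h::euclidean_space \<times> real) \<Rightarrow> bool" where
  "horosphere_embedding j \<longleftrightarrow>
     isometric_immersion_hyperbolic euclidean euclidean_atlas euclidean_metric j \<and>
     embedding_map euclidean euclidean j \<and>
     umbilical euclidean_atlas euclidean_metric j \<and>
     is_horosphere (range j)"

section \<open>The extrinsic product of three surfaces\<close>

definition sphere_curv :: "real \<Rightarrow> (real ^ 3) set" where
  "sphere_curv c = {y. y \<bullet> y = 1 / c}"

text \<open>The splitting of nine-dimensional Lorentzian space into a three-dimensional Lorentzian factor and
  two Euclidean factors is \<open>((x, y, z), t) \<mapsto> ((x, t), y, z)\<close>, since the time coordinate is last.\<close>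

definition extrinsic_product ::
  "real \<Rightarrow> real \<Rightarrow> real \<Rightarrow> (((real ^ 2) \<times> (real ^ 3) \<times> (real ^ 3)) \<times> real) set" where
  "extrinsic_product c1 c2 c3 =
     {((x, y, z), t) | x y z t.
        (x, t) \<in> hyperboloid c1 \<and> y \<in> sphere_curv c2 \<and> z \<in> sphere_curv c3}"

end

theory Submission
  imports Defs
begin

text \<open>View \<open>f\<close> as a map into Lorentzian space and let \<open>A\<close> be the normal part of its flat second
  derivative, so that \<open>\<langle>A(u, v), f\<rangle> = - g(u, v)\<close>. By the Gauss equation and \<open>\<nabla>J = 0\<close> the form
  \<open>\<langle>A(u, z), A(v, w)\<rangle> - \<langle>A(u, w), A(v, z)\<rangle>\<close> is \<open>J\<close>-invariant in \<open>w, z\<close>. Since \<open>A\<close> has only two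
  components besides \<open>g\<close>, this purely algebraic condition leaves two possibilities at a point: there is
  a null vector \<open>w\<close>, normal to the immersion, with \<open>\<langle>w, A\<rangle> = 0\<close> and \<open>\<langle>w, f\<rangle> = - 1\<close>; or \<open>n = 3\<close> and \<open>A\<close> is
  the sum of three pieces carried by orthogonal complex lines with orthogonal non-null values \<open>\<eta>\<^sub>i\<close>.

  In the second case the linearised Gauss equation and the Codazzi equation give \<open>\<nabla>A = 0\<close>. The Lorentzian
  projectors \<open>P\<^sub>i\<close> onto the spans of the \<open>i\<close>-th complex line and \<open>\<eta>\<^sub>i\<close> at one point then satisfy
  \<open>\<langle>P\<^sub>i f, f\<rangle> = 1 / \<langle>\<eta>\<^sub>i, \<eta>\<^sub>i\<rangle>\<close> nearby by uniqueness for linear differential equations; this excludes the first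
  possibility, so it propagates over the connected manifold and places \<open>f\<close> in an extrinsic product.

  If the first possibility holds everywhere, the Codazzi equation shows that \<open>w\<close> is constant, flat
  points being nowhere dense. Hence \<open>\<langle>f, w\<rangle> = - 1\<close>, which is a horosphere.\<close>

section \<open>Calculus\<close>

text \<open>The obstacle is the horospherical case. Where \<open>A\<close> differs from
  \<open>g w\<close>, the null normal \<open>w\<close> solves a linear system of full rank and is
  differentiable; where \<open>A = g w\<close> the system degenerates. Such points are flat, hence
  nowhere dense, but a continuous map whose derivative vanishes on an open dense set need not be
  constant (a Cantor function). So the derivative of \<open>w\<close> is computed at the degenerate
  points too, by rescaling \<open>A - g w\<close> along sequences: the limits again obey the
  quadratic Kaehler identity and equal the totally symmetric normal derivative of \<open>A\<close>
  shifted by a multiple of the metric. An algebraic lemma on cubic forms makes the shift zero. In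
  the product case no smooth eigenframe is constructed. The projectors are frozen at one point as
  operators of the ambient space; that they go on respecting the splitting into tangent and normal
  space is expressed by two tensors solving a closed linear system once \<open>A\<close> is
  parallel. The resulting scalar equations do not mention a chart, which allows continuation from
  chart to chart.\<close>

lemma has_derivative_cong_open:
  assumes "open S" "x \<in> S" "\<And>y. y \<in> S \<Longrightarrow> f y = g y"
  shows "(f has_derivative D) (at x) \<longleftrightarrow> (g has_derivative D) (at x)"
  using has_derivative_transform_within_open[of f D x UNIV S g]
    has_derivative_transform_within_open[of g D x UNIV S f] assms by auto

lemma frechet_derivative_cong_open:
  assumes "open S" "x \<in> S" "\<And>y. y \<in> S \<Longrightarrow> f y = g y"
  shows "frechet_derivative f (at x) = frechet_derivative g (at x)"
  unfolding frechet_derivative_def using has_derivative_cong_open[OF assms] by simp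

lemma Ck_on_cong:
  assumes "open S" "\<And>y. y \<in> S \<Longrightarrow> f y = g y"
  shows "Ck_on k f S \<longleftrightarrow> Ck_on k g S"
  using assms(2)
proof (induction k arbitrary: f g)
  case 0
  then show ?case by (auto cong: continuous_on_cong)
next
  case (Suc k)
  have "f differentiable (at x) \<longleftrightarrow> g differentiable (at x)" if "x \<in> S" for x
    using has_derivative_cong_open[OF assms(1) that Suc.prems] by (auto simp: differentiable_def)
  moreover have "frechet_derivative f (at x) = frechet_derivative g (at x)" if "x \<in> S" for x
    using frechet_derivative_cong_open[OF assms(1) that] Suc.prems by blast
  then have "Ck_on k (\<lambda>x. frechet_derivative f (at x) v) S
      \<longleftrightarrow> Ck_on k (\<lambda>x. frechet_derivative g (at x) v) S" for v
    using Suc.IH[of "\<lambda>x. frechet_derivative f (at x) v" "\<lambda>x. frechet_derivative g (at x) v"] by auto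
  ultimately show ?case by auto
qed

lemma smooth_onD:
  assumes "smooth_on f S"
  shows smooth_on_differentiable: "\<And>x. x \<in> S \<Longrightarrow> f differentiable (at x)"
    and smooth_on_derivative: "\<And>v. smooth_on (\<lambda>x. frechet_derivative f (at x) v) S"
    and smooth_on_continuous: "continuous_on S f"
proof -
  have "Ck_on (Suc k) f S" for k using assms by (auto simp: smooth_on_def)
  then show "\<And>x. x \<in> S \<Longrightarrow> f differentiable (at x)"
    "\<And>v. smooth_on (\<lambda>x. frechet_derivative f (at x) v) S" by (auto simp: smooth_on_def)
  have "Ck_on 0 f S" using assms unfolding smooth_on_def by blast
  then show "continuous_on S f" by simp
qed

lemma smooth_on_has_derivative:
  assumes "smooth_on f S" "x \<in> S"
  shows "(f has_derivative frechet_derivative f (at x)) (at x)"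
  using smooth_on_differentiable[OF assms] frechet_derivative_works by blast

lemma Ck_on_linear_compose:
  fixes L :: "'b::real_normed_vector \<Rightarrow> 'c::real_normed_vector"
  assumes L: "bounded_linear L" and S: "open S" and "Ck_on k f S"
  shows "Ck_on k (\<lambda>x. L (f x)) S"
  using assms(3)
proof (induction k arbitrary: f)
  case 0
  then show ?case using bounded_linear.continuous_on[OF L] by simp
next
  case (Suc k)
  have D: "((\<lambda>x. L (f x)) has_derivative (\<lambda>v. L (frechet_derivative f (at x) v))) (at x)"
    if "x \<in> S" for x
    by (rule bounded_linear.has_derivative[OF L])
      (use Suc.prems that in \<open>auto simp: frechet_derivative_works[symmetric]\<close>)
  have "frechet_derivative (\<lambda>x. L (f x)) (at x) v = L (frechet_derivative f (at x) v)"
    if "x \<in> S" for x v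
    using fun_cong[OF frechet_derivative_at[OF D[OF that]]] by simp
  then have "Ck_on k (\<lambda>x. frechet_derivative (\<lambda>x. L (f x)) (at x) v) S" for v
    using Ck_on_cong[OF S, of "\<lambda>x. frechet_derivative (\<lambda>x. L (f x)) (at x) v"
        "\<lambda>x. L (frechet_derivative f (at x) v)" k] Suc by auto
  then show ?case using D by (auto simp: differentiable_def)
qed

lemma smooth_on_linear_compose:
  assumes "bounded_linear L" "open S" "smooth_on f S"
  shows "smooth_on (\<lambda>x. L (f x)) S"
  using assms Ck_on_linear_compose unfolding smooth_on_def by blast

lemma smooth_on_const: "smooth_on (\<lambda>x. a :: 'b::real_normed_vector) (S::'m::euclidean_space set)"
proof -
  have "Ck_on k (\<lambda>x::'m. a) S" for k :: nat and a :: 'b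
    by (induction k arbitrary: a) (auto simp: frechet_derivative_const)
  then show ?thesis by (simp add: smooth_on_def)
qed

text \<open>Reduces smoothness to that of an explicitly known derivative, so that a polynomial map
  is handled by differentiating until a constant appears.\<close>

lemma smooth_onI:
  assumes "open S" "\<And>x. x \<in> S \<Longrightarrow> (f has_derivative f' x) (at x)" "\<And>v. smooth_on (\<lambda>x. f' x v) S"
  shows "smooth_on f S"
  unfolding smooth_on_def
proof
  fix k
  have d: "f differentiable (at x)" if "x \<in> S" for x
    using assms(2)[OF that] by (auto simp: differentiable_def)
  show "Ck_on k f S"
  proof (cases k)
    case 0
    then show ?thesis using d
      by (auto intro!: differentiable_imp_continuous_on differentiable_at_imp_differentiable_on)
  next
    case (Suc l)
    have "Ck_on l (\<lambda>x. frechet_derivative f (at x) v) S" for v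
    proof -
      have "frechet_derivative f (at x) v = f' x v" if "x \<in> S" for x
        using fun_cong[OF frechet_derivative_at[OF assms(2)[OF that]]] by simp
      then show ?thesis
        using Ck_on_cong[OF assms(1), of "\<lambda>x. frechet_derivative f (at x) v" "\<lambda>x. f' x v" l]
          assms(3)[of v] by (auto simp: smooth_on_def)
    qed
    then show ?thesis using d Suc by auto
  qed
qed

section \<open>Symmetry of second derivatives\<close>

lemma second_difference_mean_value:
  fixes f :: "'a::real_normed_vector \<Rightarrow> real"
  assumes d1: "\<And>y. y \<in> U \<Longrightarrow> (f has_derivative f1 y) (at y)"
    and d2: "\<And>y v. y \<in> U \<Longrightarrow> ((\<lambda>z. f1 z v) has_derivative f2 y v) (at y)"
    and s: "s > 0"
    and U: "\<And>t1 t2. 0 \<le> t1 \<Longrightarrow> t1 \<le> s \<Longrightarrow> 0 \<le> t2 \<Longrightarrow> t2 \<le> s \<Longrightarrow> x + t1 *\<^sub>R u + t2 *\<^sub>R v \<in> U"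
  shows "\<exists>t1 t2. 0 < t1 \<and> t1 < s \<and> 0 < t2 \<and> t2 < s \<and>
    f (x + s *\<^sub>R u + s *\<^sub>R v) - f (x + s *\<^sub>R u) - f (x + s *\<^sub>R v) + f x
      = s * s * f2 (x + t1 *\<^sub>R u + t2 *\<^sub>R v) u v"
proof -
  \<comment> \<open>The first difference in the direction \<open>v\<close>. The mean value theorem
    for it in the direction \<open>u\<close>, followed by one for \<open>f1 _ u\<close> in the
    direction \<open>v\<close>, produces the mixed derivative.\<close>
  define g where "g = (\<lambda>t. f (x + t *\<^sub>R u + s *\<^sub>R v) - f (x + t *\<^sub>R u))"
  have "(g has_real_derivative (f1 (x + t *\<^sub>R u + s *\<^sub>R v) u - f1 (x + t *\<^sub>R u) u)) (at t)"
    if t: "0 \<le> t" "t \<le> s" for t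
  proof -
    have A: "((\<lambda>t. f (x + t *\<^sub>R u + s *\<^sub>R v)) has_derivative (\<lambda>h. f1 (x + t *\<^sub>R u + s *\<^sub>R v) (h *\<^sub>R u))) (at t)"
      by (rule has_derivative_compose[where g = f, of "\<lambda>t. x + t *\<^sub>R u + s *\<^sub>R v", OF _ d1])
        (use t s U[of t s] in \<open>auto intro!: derivative_eq_intros\<close>)
    have B: "((\<lambda>t. f (x + t *\<^sub>R u)) has_derivative (\<lambda>h. f1 (x + t *\<^sub>R u) (h *\<^sub>R u))) (at t)"
      by (rule has_derivative_compose[where g = f, of "\<lambda>t. x + t *\<^sub>R u", OF _ d1])
        (use t s U[of t 0] in \<open>auto intro!: derivative_eq_intros\<close>)
    have l: "linear (f1 (x + t *\<^sub>R u + s *\<^sub>R v))" "linear (f1 (x + t *\<^sub>R u))"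
      using d1[of "x + t *\<^sub>R u + s *\<^sub>R v"] d1[of "x + t *\<^sub>R u"] U[of t s] U[of t 0] t s
      by (auto intro: has_derivative_linear)
    show ?thesis
      unfolding has_field_derivative_def g_def
      by (rule has_derivative_eq_rhs[OF has_derivative_diff[OF A B]])
        (simp only: linear_cmul[OF l(1)] linear_cmul[OF l(2)] fun_eq_iff, simp add: algebra_simps)
  qed
  from MVT2[OF s this, simplified] obtain t1 where t1: "0 < t1" "t1 < s"
    and e1: "g s - g 0 = s * (f1 (x + t1 *\<^sub>R u + s *\<^sub>R v) u - f1 (x + t1 *\<^sub>R u) u)" by auto
  have "((\<lambda>t. f1 (x + t1 *\<^sub>R u + t *\<^sub>R v) u) has_real_derivative f2 (x + t1 *\<^sub>R u + t *\<^sub>R v) u v) (at t)"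
    if t: "0 \<le> t" "t \<le> s" for t
  proof -
    have A: "((\<lambda>t. f1 (x + t1 *\<^sub>R u + t *\<^sub>R v) u) has_derivative (\<lambda>h. f2 (x + t1 *\<^sub>R u + t *\<^sub>R v) u (h *\<^sub>R v))) (at t)"
      by (rule has_derivative_compose[where g = "\<lambda>z. f1 z u", of "\<lambda>t. x + t1 *\<^sub>R u + t *\<^sub>R v", OF _ d2])
        (use t t1 U[of t1 t] in \<open>auto intro!: derivative_eq_intros\<close>)
    have l: "linear (f2 (x + t1 *\<^sub>R u + t *\<^sub>R v) u)"
      using d2[of "x + t1 *\<^sub>R u + t *\<^sub>R v" u] U[of t1 t] t1 t by (auto intro: has_derivative_linear)
    show ?thesis
      unfolding has_field_derivative_def
      by (rule has_derivative_eq_rhs[OF A]) (auto simp: l linear_cmul)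
  qed
  from MVT2[OF s this, simplified] obtain t2 where t2: "0 < t2" "t2 < s"
    and e2: "f1 (x + t1 *\<^sub>R u + s *\<^sub>R v) u - f1 (x + t1 *\<^sub>R u) u = s * f2 (x + t1 *\<^sub>R u + t2 *\<^sub>R v) u v" by auto
  show ?thesis
    using t1 t2 e1 unfolding e2 g_def by (intro exI[of _ t1] exI[of _ t2]) (auto simp: algebra_simps)
qed

text \<open>The second difference of \<open>f\<close> over a small parallelogram does not depend on
  the order of its sides, while in either order it equals \<open>s * s\<close> times a value of
  \<open>f2\<close> near \<open>x\<close>. Continuity then identifies the two mixed
  derivatives.\<close>

lemma symmetric_second_derivative_real:
  fixes f :: "'a::real_normed_vector \<Rightarrow> real"
  assumes U: "open U" "x \<in> U"
    and d1: "\<And>y. y \<in> U \<Longrightarrow> (f has_derivative f1 y) (at y)"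
    and d2: "\<And>y v. y \<in> U \<Longrightarrow> ((\<lambda>z. f1 z v) has_derivative f2 y v) (at y)"
    and cont: "\<And>u v. continuous_on U (\<lambda>y. f2 y u v)"
  shows "f2 x u v = f2 x v u"
proof (rule ccontr)
  assume ne: "f2 x u v \<noteq> f2 x v u"
  define e where "e = \<bar>f2 x u v - f2 x v u\<bar> / 2"
  have e: "e > 0" using ne by (simp add: e_def)
  have c: "isCont (\<lambda>y. f2 y u v) x" for u v
    using cont U by (simp add: continuous_on_eq_continuous_at)
  obtain d where d: "d > 0" "ball x d \<subseteq> U" using U openE by blast
  obtain d' where d': "d' > 0" "\<And>y. dist y x < d' \<Longrightarrow> dist (f2 y u v) (f2 x u v) < e"
    using c[of u v, unfolded continuous_at_eps_delta] e by (auto simp: dist_norm)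
  obtain d'' where d'': "d'' > 0" "\<And>y. dist y x < d'' \<Longrightarrow> dist (f2 y v u) (f2 x v u) < e"
    using c[of v u, unfolded continuous_at_eps_delta] e by (auto simp: dist_norm)
  define D where "D = min d (min d' d'')"
  \<comment> \<open>With this side length every point of the parallelogram is closer than
    \<open>D\<close> to \<open>x\<close>; the summand 1 avoids division by zero.\<close>
  define s where "s = D / (2 * (norm u + norm v + 1))"
  have D: "D > 0" using d d' d'' by (simp add: D_def)
  have n1: "norm u + norm v + 1 > 0" by (smt (verit) norm_ge_zero)
  have s: "s > 0" using D n1 by (simp add: s_def)
  have s2: "s * (norm u + norm v) < D"
  proof -
    have "s * (norm u + norm v) < s * (2 * (norm u + norm v + 1))"
      using s by (intro mult_strict_left_mono) (auto, smt (verit) norm_ge_zero)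
    also have "\<dots> = D" using n1 unfolding s_def by simp
    finally show ?thesis .
  qed
  have close: "dist (x + t1 *\<^sub>R u + t2 *\<^sub>R v) x < D"
    if t: "0 \<le> t1" "t1 \<le> s" "0 \<le> t2" "t2 \<le> s" for t1 t2 u' v'
  proof -
    have "dist (x + t1 *\<^sub>R u + t2 *\<^sub>R v) x \<le> t1 * norm u + t2 * norm v"
      using norm_triangle_ineq[of "t1 *\<^sub>R u" "t2 *\<^sub>R v"] t by (simp add: dist_norm)
    also have "\<dots> \<le> s * norm u + s * norm v" using t by (intro add_mono mult_right_mono) auto
    finally show ?thesis using s2 by (simp add: algebra_simps)
  qed
  have in_U: "x + t1 *\<^sub>R u + t2 *\<^sub>R v \<in> U"
    if t: "0 \<le> t1" "t1 \<le> s" "0 \<le> t2" "t2 \<le> s" for t1 t2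
    using close[OF that] d by (auto simp: D_def dist_commute subset_iff)
  obtain a b where ab: "0 < a" "a < s" "0 < b" "b < s" and
    1: "f (x + s *\<^sub>R u + s *\<^sub>R v) - f (x + s *\<^sub>R u) - f (x + s *\<^sub>R v) + f x = s * s * f2 (x + a *\<^sub>R u + b *\<^sub>R v) u v"
    using second_difference_mean_value[of U f f1 f2 s x u v] d1 d2 s in_U by blast
  have in_U': "x + t1 *\<^sub>R v + t2 *\<^sub>R u \<in> U"
    if t: "0 \<le> t1" "t1 \<le> s" "0 \<le> t2" "t2 \<le> s" for t1 t2
    using in_U[of t2 t1] that by (simp add: ac_simps)
  obtain a' b' where ab': "0 < a'" "a' < s" "0 < b'" "b' < s" and
    2: "f (x + s *\<^sub>R v + s *\<^sub>R u) - f (x + s *\<^sub>R v) - f (x + s *\<^sub>R u) + f x = s * s * f2 (x + a' *\<^sub>R v + b' *\<^sub>R u) v u"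
    using second_difference_mean_value[of U f f1 f2 s x v u] d1 d2 s in_U' by blast
  have "s * s * f2 (x + a *\<^sub>R u + b *\<^sub>R v) u v = s * s * f2 (x + a' *\<^sub>R v + b' *\<^sub>R u) v u"
  proof -
    have "x + s *\<^sub>R v + s *\<^sub>R u = x + s *\<^sub>R u + s *\<^sub>R v" by simp
    then show ?thesis using 1 2 by (simp only:)
  qed
  moreover have "x + a' *\<^sub>R v + b' *\<^sub>R u = x + b' *\<^sub>R u + a' *\<^sub>R v" by simp
  ultimately have 3: "f2 (x + a *\<^sub>R u + b *\<^sub>R v) u v = f2 (x + b' *\<^sub>R u + a' *\<^sub>R v) v u"
    using s by (simp only: mult_cancel_left) auto
  have "dist (f2 (x + a *\<^sub>R u + b *\<^sub>R v) u v) (f2 x u v) < e"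
    using close[of a b] ab d'(2) by (auto simp: D_def)
  moreover have "dist (f2 (x + b' *\<^sub>R u + a' *\<^sub>R v) v u) (f2 x v u) < e"
    using close[of b' a'] ab' d''(2) by (auto simp: D_def)
  ultimately have "\<bar>f2 x u v - f2 x v u\<bar> < 2 * e"
    unfolding 3 dist_real_def by linarith
  then show False by (simp add: e_def)
qed

lemma smooth_on_symmetric_second_derivative:
  fixes f :: "'m::euclidean_space \<Rightarrow> 'b::euclidean_space"
  assumes U: "open U" "x \<in> U" and f: "smooth_on f U"
  shows "frechet_derivative (\<lambda>y. frechet_derivative f (at y) u) (at x) v
       = frechet_derivative (\<lambda>y. frechet_derivative f (at y) v) (at x) u"
proof (rule euclidean_eqI)
  fix b :: 'b assume "b \<in> Basis"
  let ?f2 = "\<lambda>y u v. frechet_derivative (\<lambda>y. frechet_derivative f (at y) u) (at y) v \<bullet> b"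
  show "?f2 x u v = ?f2 x v u"
  proof (rule symmetric_second_derivative_real[OF U, of "\<lambda>y. f y \<bullet> b" "\<lambda>y v. frechet_derivative f (at y) v \<bullet> b"])
    show "((\<lambda>y. f y \<bullet> b) has_derivative (\<lambda>v. frechet_derivative f (at y) v \<bullet> b)) (at y)" if "y \<in> U" for y
      using smooth_on_has_derivative[OF f that] by (rule has_derivative_inner_left)
    show "((\<lambda>z. frechet_derivative f (at z) v \<bullet> b) has_derivative ?f2 y v) (at y)" if "y \<in> U" for y v
      using smooth_on_has_derivative[OF smooth_on_derivative[OF f] that] by (rule has_derivative_inner_left)
    show "continuous_on U (\<lambda>y. ?f2 y u v)" for u v
      using smooth_on_continuous[OF smooth_on_derivative[OF smooth_on_derivative[OF f]]]
      by (intro continuous_intros)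
  qed
qed

section \<open>Differentiability of solutions of linear systems\<close>

lemma has_derivative_scaleR_vanishing:
  fixes r :: "'a::real_normed_vector \<Rightarrow> 'b::real_normed_vector"
  assumes r: "(r has_derivative r') (at x)" "r x = 0" and c: "isCont c x"
  shows "((\<lambda>y. c y *\<^sub>R r y) has_derivative (\<lambda>h. c x *\<^sub>R r' h)) (at x)"
proof -
  have 1: "((\<lambda>y. c x *\<^sub>R r y) has_derivative (\<lambda>h. c x *\<^sub>R r' h)) (at x)"
    using r(1) by (rule has_derivative_scaleR_right)
  \<comment> \<open>\<open>r y\<close> is of the order of \<open>norm (y - x)\<close>, so the factor
    \<open>c y - c x\<close>, which tends to 0, makes the product negligible; no derivative of
    \<open>c\<close> enters.\<close>
  have 2: "((\<lambda>y. (c y - c x) *\<^sub>R r y) has_derivative (\<lambda>h. 0)) (at x)"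
    unfolding has_derivative_iff_norm
  proof (intro conjI)
    obtain e K where "e > 0" and K: "\<And>y. norm (y - x) < e \<Longrightarrow> norm (r y) \<le> K * norm (y - x)"
    proof -
      obtain K where K: "\<And>h. norm (r' h) \<le> norm h * K"
        using bounded_linear.bounded[OF has_derivative_bounded_linear[OF r(1)]] by blast
      obtain d where d: "d > 0" "\<And>y. norm (y - x) < d \<Longrightarrow> norm (r y - r x - r' (y - x)) \<le> 1 * norm (y - x)"
        using r(1)[unfolded has_derivative_at_alt] by (metis zero_less_one)
      have "norm (r y) \<le> (K + 1) * norm (y - x)" if "norm (y - x) < d" for y
        using d(2)[OF that] K[of "y - x"] norm_triangle_ineq2[of "r y" "r' (y - x)"] r(2)
        by (simp add: algebra_simps)
      then show ?thesis using that d(1) by blast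
    qed
    have lim: "((\<lambda>y. \<bar>c y - c x\<bar> * \<bar>K\<bar>) \<longlongrightarrow> 0) (at x)"
      using c unfolding isCont_def by (auto intro!: tendsto_eq_intros)
    show "((\<lambda>y. norm ((c y - c x) *\<^sub>R r y - (c x - c x) *\<^sub>R r x - 0) / norm (y - x)) \<longlongrightarrow> 0) (at x)"
    proof (rule tendsto_sandwich[OF _ _ tendsto_const lim])
      show "\<forall>\<^sub>F y in at x. norm ((c y - c x) *\<^sub>R r y - (c x - c x) *\<^sub>R r x - 0) / norm (y - x) \<le> \<bar>c y - c x\<bar> * \<bar>K\<bar>"
        unfolding eventually_at
      proof (intro exI[of _ e] conjI ballI impI)
        fix y assume y: "y \<noteq> x \<and> dist y x < e"
        have "norm (r y) \<le> \<bar>K\<bar> * norm (y - x)"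
          using K[of y] y by (smt (verit) dist_norm mult_right_mono norm_ge_zero abs_ge_self)
        then have "\<bar>c y - c x\<bar> * norm (r y) \<le> \<bar>c y - c x\<bar> * (\<bar>K\<bar> * norm (y - x))"
          by (intro mult_left_mono) auto
        then show "norm ((c y - c x) *\<^sub>R r y - (c x - c x) *\<^sub>R r x - 0) / norm (y - x) \<le> \<bar>c y - c x\<bar> * \<bar>K\<bar>"
          using y by (simp add: divide_simps mult_ac)
      qed (rule \<open>e > 0\<close>)
    qed (auto intro!: always_eventually)
  qed simp
  show ?thesis using has_derivative_add[OF 1 2] by (simp add: algebra_simps)
qed

text \<open>Writing \<open>N x\<close> as the identity plus a perturbation expresses
  \<open>s\<close> as \<open>d\<close> minus a combination of the \<open>r b\<close>, which vanish
  at \<open>x0\<close>, with coefficients taken from \<open>s\<close> itself. This bootstraps: it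
  bounds \<open>s\<close> by twice \<open>d\<close>, then gives continuity, then differentiability
  by \<open>has_derivative_scaleR_vanishing\<close>.\<close>

lemma solution_of_perturbed_identity_differentiable:
  fixes N :: "'a::real_normed_vector \<Rightarrow> 'y::euclidean_space \<Rightarrow> 'y"
  assumes U: "open U" "x0 \<in> U"
    and lin: "\<And>x. x \<in> U \<Longrightarrow> linear (N x)"
    and N0: "\<And>y. N x0 y = y"
    and diffN: "\<And>y. (\<lambda>x. N x y) differentiable (at x0)"
    and diffd: "(\<lambda>x. N x (s x)) differentiable (at x0)"
  shows "s differentiable (at x0)"
proof -
  define d where "d = (\<lambda>x. N x (s x))"
  define r where "r = (\<lambda>b x. N x b - b)"
  have s_eq: "s x = d x - (\<Sum>b\<in>Basis. (s x \<bullet> b) *\<^sub>R r b x)" if "x \<in> U" for x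
  proof -
    have "N x (s x) = (\<Sum>b\<in>Basis. (s x \<bullet> b) *\<^sub>R N x b)"
      by (subst euclidean_representation[of "s x", symmetric])
        (simp add: linear_sum[OF lin[OF that]] linear_cmul[OF lin[OF that]])
    moreover have "s x = (\<Sum>b\<in>Basis. (s x \<bullet> b) *\<^sub>R b)" by (simp add: euclidean_representation)
    ultimately show ?thesis
      unfolding d_def r_def by (simp add: scaleR_diff_right sum_subtractf euclidean_representation)
  qed
  have r_diff: "r b differentiable (at x0)" for b
    unfolding r_def using diffN by (intro differentiable_diff) auto
  have r0: "r b x0 = 0" for b by (simp add: r_def N0)
  have r_cont: "isCont (r b) x0" for b
    using r_diff differentiable_imp_continuous_within by blast
  have d_cont: "isCont d x0" using diffd differentiable_imp_continuous_within unfolding d_def by blast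
  have sum0: "((\<lambda>x. \<Sum>b\<in>Basis. norm (r b x)) \<longlongrightarrow> (\<Sum>b\<in>(Basis::'y set). 0)) (at x0)"
    by (intro tendsto_sum) (metis r_cont r0 isCont_def tendsto_norm_zero)
  have bound: "norm (s x) \<le> norm (d x) + norm (s x) * (\<Sum>b\<in>Basis. norm (r b x))" if "x \<in> U" for x
  proof -
    have "norm (\<Sum>b\<in>Basis. (s x \<bullet> b) *\<^sub>R r b x) \<le> (\<Sum>b\<in>Basis. norm (s x) * norm (r b x))"
      by (intro sum_norm_le) (auto intro!: mult_right_mono simp: Basis_le_norm)
    then show ?thesis
      using norm_triangle_ineq4[of "d x" "\<Sum>b\<in>Basis. (s x \<bullet> b) *\<^sub>R r b x"] s_eq[OF that]
      by (simp add: sum_distrib_left)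
  qed
  have ev: "\<forall>\<^sub>F x in at x0. x \<in> U \<and> (\<Sum>b\<in>Basis. norm (r b x)) < 1/2"
    using order_tendstoD(2)[OF sum0, of "1/2"] eventually_at_in_open'[OF U]
    by (simp add: eventually_conj_iff)
  have s_bd: "\<forall>\<^sub>F x in at x0. norm (s x) \<le> 2 * norm (d x)"
  proof (rule eventually_mono[OF ev])
    fix x assume x: "x \<in> U \<and> (\<Sum>b\<in>Basis. norm (r b x)) < 1/2"
    then have "norm (s x) * (\<Sum>b\<in>Basis. norm (r b x)) \<le> norm (s x) * (1/2)"
      by (intro mult_left_mono) auto
    then show "norm (s x) \<le> 2 * norm (d x)" using bound[of x] x by simp
  qed
  have s0: "s x0 = d x0" using s_eq[OF U(2)] r0 by simp
  have s_cont: "isCont s x0"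
  proof -
    have lim: "((\<lambda>x. 2 * norm (d x) * (\<Sum>b\<in>Basis. norm (r b x))) \<longlongrightarrow> 2 * norm (d x0) * (\<Sum>b\<in>(Basis::'y set). 0)) (at x0)"
      using d_cont unfolding isCont_def by (intro tendsto_intros sum0)
    have "((\<lambda>x. s x - d x) \<longlongrightarrow> 0) (at x0)"
    proof (rule tendsto_norm_zero_cancel, rule tendsto_sandwich[OF _ _ tendsto_const])
      show "((\<lambda>x. 2 * norm (d x) * (\<Sum>b\<in>Basis. norm (r b x))) \<longlongrightarrow> 0) (at x0)" using lim by simp
      show "\<forall>\<^sub>F x in at x0. norm (s x - d x) \<le> 2 * norm (d x) * (\<Sum>b\<in>Basis. norm (r b x))"
        using ev s_bd
      proof eventually_elim
        case (elim x)
        have "norm (\<Sum>b\<in>Basis. (s x \<bullet> b) *\<^sub>R r b x) \<le> (\<Sum>b\<in>Basis. norm (s x) * norm (r b x))"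
          by (intro sum_norm_le) (auto intro!: mult_right_mono simp: Basis_le_norm)
        also have "\<dots> \<le> 2 * norm (d x) * (\<Sum>b\<in>Basis. norm (r b x))"
          unfolding sum_distrib_left[symmetric] using elim by (intro mult_right_mono) (auto intro: sum_nonneg)
        moreover have "norm (s x - d x) = norm (\<Sum>b\<in>Basis. (s x \<bullet> b) *\<^sub>R r b x)"
          using s_eq[of x] elim by (metis add_diff_cancel_left' diff_add_cancel norm_minus_commute)
        ultimately show ?case by simp
      qed
    qed (auto intro!: always_eventually)
    from tendsto_add[OF this d_cont[unfolded isCont_def]] show ?thesis
      unfolding isCont_def s0 by simp
  qed
  obtain r' where r': "\<And>b. (r b has_derivative r' b) (at x0)"
    using r_diff unfolding differentiable_def by metis
  obtain d' where d': "(d has_derivative d') (at x0)" using diffd unfolding d_def differentiable_def by blast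
  have "((\<lambda>x. d x - (\<Sum>b\<in>Basis. (s x \<bullet> b) *\<^sub>R r b x)) has_derivative
      (\<lambda>h. d' h - (\<Sum>b\<in>Basis. (s x0 \<bullet> b) *\<^sub>R r' b h))) (at x0)"
    using s_cont by (intro has_derivative_diff d' has_derivative_sum has_derivative_scaleR_vanishing r' r0)
      (auto intro!: continuous_intros)
  then show ?thesis
    using has_derivative_cong_open[OF U, of s "\<lambda>x. d x - (\<Sum>b\<in>Basis. (s x \<bullet> b) *\<^sub>R r b x)"] s_eq
    unfolding differentiable_def by blast
qed

text \<open>Least squares: \<open>N\<close> is formed with the coefficient vectors frozen at
  \<open>x0\<close>, so that \<open>N x0\<close> is a Gram operator and injective; a left inverse
  \<open>K\<close> then turns it into the identity at \<open>x0\<close>. The lemma serves objects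
  given only by equations: Christoffel symbols, shape operators, the null normal.\<close>

lemma linear_system_solution_differentiable:
  fixes B :: "'i \<Rightarrow> 'a::real_normed_vector \<Rightarrow> 'y::euclidean_space \<Rightarrow> real"
  assumes I: "finite I" and U: "open U" "x0 \<in> U"
    and lin: "\<And>i x. i \<in> I \<Longrightarrow> x \<in> U \<Longrightarrow> linear (B i x)"
    and diffB: "\<And>i y. i \<in> I \<Longrightarrow> (\<lambda>x. B i x y) differentiable (at x0)"
    and eq: "\<And>i x. i \<in> I \<Longrightarrow> x \<in> U \<Longrightarrow> B i x (s x) = c i x"
    and diffc: "\<And>i. i \<in> I \<Longrightarrow> c i differentiable (at x0)"
    and inj: "\<And>y. (\<And>i. i \<in> I \<Longrightarrow> B i x0 y = 0) \<Longrightarrow> y = 0"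
  shows "s differentiable (at x0)"
proof -
  define g where "g i = (\<Sum>b\<in>Basis. B i x0 b *\<^sub>R b)" for i
  have g: "B i x0 y = g i \<bullet> y" if "i \<in> I" for i y
    by (subst euclidean_representation[of y, symmetric])
      (simp add: linear_sum[OF lin[OF that U(2)]] linear_cmul[OF lin[OF that U(2)]] g_def inner_sum_left
        inner_commute[of _ y] inner_sum_right mult.commute del: euclidean_representation)
  define N where "N x y = (\<Sum>i\<in>I. B i x y *\<^sub>R g i)" for x y
  have linN: "linear (N x)" if "x \<in> U" for x
    unfolding N_def
  proof (intro linear_compose_sum ballI)
    fix i assume "i \<in> I"
    then show "linear (\<lambda>y. B i x y *\<^sub>R g i)"
      by (intro linearI) (simp_all add: linear_add[OF lin[OF _ that]] linear_cmul[OF lin[OF _ that]] scaleR_add_left)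
  qed
  have "N x0 y = 0 \<Longrightarrow> y = 0" for y
  proof -
    assume "N x0 y = 0"
    moreover have "(\<Sum>i\<in>I. (B i x0 y)\<^sup>2) = N x0 y \<bullet> y"
      by (simp add: N_def inner_sum_left g power2_eq_square)
    ultimately have "(\<Sum>i\<in>I. (B i x0 y)\<^sup>2) = 0" by simp
    then show "y = 0" using I inj by (simp add: sum_nonneg_eq_0_iff)
  qed
  then have "inj (N x0)" using linN[OF U(2)] by (simp add: linear_injective_0)
  then obtain K where K: "linear K" "\<And>y. K (N x0 y) = y"
    using linear_injective_left_inverse[OF linN[OF U(2)]] by (metis comp_apply id_apply)
  have Kd: "(\<lambda>x. K (\<phi> x)) differentiable (at x0)" if "\<phi> differentiable (at x0)" for \<phi> :: "'a \<Rightarrow> 'y"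
    using that linear_conv_bounded_linear[of K] K(1) bounded_linear.has_derivative unfolding differentiable_def
    by blast
  show ?thesis
  proof (rule solution_of_perturbed_identity_differentiable[OF U, of "\<lambda>x y. K (N x y)"])
    show "linear (\<lambda>y. K (N x y))" if "x \<in> U" for x
      using linear_compose[OF linN[OF that] K(1)] by (simp add: o_def)
    show "(\<lambda>x. K (N x y)) differentiable (at x0)" for y
      unfolding N_def by (intro Kd differentiable_sum I ballI differentiable_scaleR differentiable_const) (use diffB I in auto)
    have "(\<lambda>x. \<Sum>i\<in>I. c i x *\<^sub>R g i) differentiable (at x0)"
      by (intro differentiable_sum I ballI differentiable_scaleR differentiable_const) (use diffc I in auto)
    from Kd[OF this] have "(\<lambda>x. K (\<Sum>i\<in>I. c i x *\<^sub>R g i)) differentiable (at x0)" .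
    moreover have "K (N x (s x)) = K (\<Sum>i\<in>I. c i x *\<^sub>R g i)" if "x \<in> U" for x
      unfolding N_def using eq that by simp
    ultimately show "(\<lambda>x. K (N x (s x))) differentiable (at x0)"
      using has_derivative_cong_open[OF U, of "\<lambda>x. K (N x (s x))" "\<lambda>x. K (\<Sum>i\<in>I. c i x *\<^sub>R g i)"]
      unfolding differentiable_def by blast
  qed (rule K(2))
qed

text \<open>A product rule in which \<open>B\<close> is differentiated only at fixed second
  argument; expanding in the finite basis replaces differentiability of the family of
  operators.\<close>

lemma has_derivative_linear_family:
  fixes B :: "'a::real_normed_vector \<Rightarrow> 'y::euclidean_space \<Rightarrow> 'z::real_normed_vector"
  assumes U: "open U" "x \<in> U"
    and lin: "\<And>y. y \<in> U \<Longrightarrow> linear (B y)"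
    and B: "\<And>v. ((\<lambda>y. B y v) has_derivative B' v) (at x)"
    and p: "(p has_derivative p') (at x)"
  shows "((\<lambda>y. B y (p y)) has_derivative (\<lambda>h. B' (p x) h + B x (p' h))) (at x)"
proof -
  have ex: "B y v = (\<Sum>b\<in>Basis. (v \<bullet> b) *\<^sub>R B y b)" if "y \<in> U" for y v
    by (subst euclidean_representation[of v, symmetric])
      (simp add: linear_sum[OF lin[OF that]] linear_cmul[OF lin[OF that]])
  have "((\<lambda>y. \<Sum>b\<in>Basis. (p x \<bullet> b) *\<^sub>R B y b) has_derivative (\<lambda>h. \<Sum>b\<in>Basis. (p x \<bullet> b) *\<^sub>R B' b h)) (at x)"
    by (intro has_derivative_sum has_derivative_scaleR_right B)
  then have "((\<lambda>y. B y (p x)) has_derivative (\<lambda>h. \<Sum>b\<in>Basis. (p x \<bullet> b) *\<^sub>R B' b h)) (at x)"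
    by (subst has_derivative_cong_open[OF U ex])
  from has_derivative_unique[OF this B]
  have B'_ex: "B' (p x) = (\<lambda>h. \<Sum>b\<in>Basis. (p x \<bullet> b) *\<^sub>R B' b h)" by simp
  have "((\<lambda>y. \<Sum>b\<in>Basis. (p y \<bullet> b) *\<^sub>R B y b) has_derivative
      (\<lambda>h. \<Sum>b\<in>Basis. (p x \<bullet> b) *\<^sub>R B' b h + (p' h \<bullet> b) *\<^sub>R B x b)) (at x)"
    by (intro has_derivative_sum has_derivative_scaleR B has_derivative_inner_left p)
  moreover have "(\<lambda>h. \<Sum>b\<in>Basis. (p x \<bullet> b) *\<^sub>R B' b h + (p' h \<bullet> b) *\<^sub>R B x b) = (\<lambda>h. B' (p x) h + B x (p' h))"
    unfolding B'_ex by (rule ext, subst (2) ex[OF U(2)]) (simp add: sum.distrib)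
  ultimately show ?thesis
    by (subst has_derivative_cong_open[OF U ex]) auto
qed

text \<open>A Gronwall argument: the sum of squares, damped by an exponential, cannot increase.\<close>

lemma linear_ode_zero:
  fixes \<phi> :: "'i \<Rightarrow> real \<Rightarrow> real"
  assumes I: "finite I"
    and D: "\<And>i t. i \<in> I \<Longrightarrow> 0 \<le> t \<Longrightarrow> t \<le> 1 \<Longrightarrow> (\<phi> i has_real_derivative \<phi>' i t) (at t)"
    and bd: "\<And>i t. i \<in> I \<Longrightarrow> 0 \<le> t \<Longrightarrow> t \<le> 1 \<Longrightarrow> \<bar>\<phi>' i t\<bar> \<le> K * (\<Sum>j\<in>I. \<bar>\<phi> j t\<bar>)"
    and init: "\<And>i. i \<in> I \<Longrightarrow> \<phi> i 0 = 0"
    and i: "i \<in> I"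
  shows "\<phi> i 1 = 0"
proof -
  \<comment> \<open>The factor 2 comes from differentiating squares, \<open>card I\<close> from
    Cauchy-Schwarz for the sum of absolute values.\<close>
  define c where "c = 2 * \<bar>K\<bar> * card I"
  define Q where "Q t = (\<Sum>j\<in>I. (\<phi> j t)\<^sup>2)" for t
  define Q' where "Q' t = (\<Sum>j\<in>I. 2 * \<phi> j t * \<phi>' j t)" for t
  have QD: "(Q has_real_derivative Q' t) (at t)" if "0 \<le> t" "t \<le> 1" for t
    unfolding Q_def Q'_def by (auto intro!: derivative_eq_intros D that sum.cong simp: mult_ac)
  have Q'_le: "Q' t \<le> c * Q t" if t: "0 \<le> t" "t \<le> 1" for t
  proof -
    let ?S = "\<Sum>j\<in>I. \<bar>\<phi> j t\<bar>"
    have S0: "?S \<ge> 0" by (simp add: sum_nonneg)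
    have "Q' t \<le> (\<Sum>j\<in>I. 2 * \<bar>\<phi> j t\<bar> * (\<bar>K\<bar> * ?S))"
      unfolding Q'_def
    proof (rule sum_mono)
      fix j assume j: "j \<in> I"
      have "2 * \<phi> j t * \<phi>' j t \<le> 2 * \<bar>\<phi> j t\<bar> * \<bar>\<phi>' j t\<bar>"
        by (metis abs_ge_self abs_mult abs_numeral)
      also have "\<dots> \<le> 2 * \<bar>\<phi> j t\<bar> * (\<bar>K\<bar> * ?S)"
        using bd[OF j t] mult_right_mono[OF abs_ge_self[of K] S0] by (intro mult_left_mono) auto
      finally show "2 * \<phi> j t * \<phi>' j t \<le> 2 * \<bar>\<phi> j t\<bar> * (\<bar>K\<bar> * ?S)" .
    qed
    also have "\<dots> = 2 * \<bar>K\<bar> * ?S\<^sup>2"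
      by (simp add: sum_distrib_right[symmetric] sum_distrib_left[symmetric] power2_eq_square mult_ac)
    also have "\<dots> \<le> 2 * \<bar>K\<bar> * (card I * (\<Sum>j\<in>I. \<bar>\<phi> j t\<bar>\<^sup>2))"
      using sum_squared_le_sum_of_squares[of "\<lambda>j. \<bar>\<phi> j t\<bar>" I] I
      by (intro mult_left_mono) (auto simp: mult.commute)
    finally show ?thesis unfolding c_def Q_def by (simp add: mult_ac)
  qed
  have "exp (- c * 1) * Q 1 \<le> exp (- c * 0) * Q 0"
  proof (rule DERIV_nonpos_imp_nonincreasing[where f = "\<lambda>t. exp (- c * t) * Q t"])
    fix t :: real assume t: "0 \<le> t" "t \<le> 1"
    have "((\<lambda>t. exp (- c * t) * Q t) has_real_derivative exp (- c * t) * (Q' t - c * Q t)) (at t)"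
      by (auto intro!: derivative_eq_intros QD t simp: algebra_simps)
    moreover have "exp (- c * t) * (Q' t - c * Q t) \<le> 0"
      using Q'_le[OF t] by (simp add: mult_le_0_iff)
    ultimately show "\<exists>y. ((\<lambda>t. exp (- c * t) * Q t) has_real_derivative y) (at t) \<and> y \<le> 0" by blast
  qed simp
  moreover have "Q 0 = 0" using init by (simp add: Q_def)
  moreover have "Q 1 \<ge> 0" by (simp add: Q_def sum_nonneg)
  ultimately have "Q 1 = 0" by (simp add: mult_le_0_iff)
  then show ?thesis using I i by (simp add: Q_def sum_nonneg_eq_0_iff)
qed

section \<open>Bilinear forms\<close>

lemma bilinearD:
  assumes "bilinear B"
  shows bil_add_left: "B (x + y) z = B x z + B y z" and bil_add_right: "B z (x + y) = B z x + B z y"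
    and bil_diff_left: "B (x - y) z = B x z - B y z" and bil_diff_right: "B z (x - y) = B z x - B z y"
    and bil_scale_left: "B (c *\<^sub>R x) z = c *\<^sub>R B x z" and bil_scale_right: "B z (c *\<^sub>R x) = c *\<^sub>R B z x"
    and bil_neg_left: "B (- x) z = - B x z" and bil_neg_right: "B z (- x) = - B z x"
    and bil_zero_left: "B 0 z = 0" and bil_zero_right: "B z 0 = 0"
  using assms by (simp_all add: bilinear_ladd bilinear_radd bilinear_lsub bilinear_rsub bilinear_lmul
      bilinear_rmul bilinear_lneg bilinear_rneg bilinear_lzero bilinear_rzero)

lemma bil_sum_left: "bilinear B \<Longrightarrow> B (sum f S) z = (\<Sum>i\<in>S. B (f i) z)"
  using linear_sum[of "\<lambda>x. B x z"] by (simp add: bilinear_def)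

lemma bil_sum_right: "bilinear B \<Longrightarrow> B z (sum f S) = (\<Sum>i\<in>S. B z (f i))"
  by (simp add: bilinear_def linear_sum)

section \<open>Orthogonal bases\<close>

lemma orthogonal_set_independent:
  fixes \<beta> :: "'a::real_vector \<Rightarrow> 'a \<Rightarrow> real"
  assumes b: "bilinear \<beta>" and S: "finite S" "\<And>s. s \<in> S \<Longrightarrow> \<beta> s s \<noteq> 0"
    and o: "\<And>s t. s \<in> S \<Longrightarrow> t \<in> S \<Longrightarrow> s \<noteq> t \<Longrightarrow> \<beta> s t = 0"
  shows "independent S"
proof (rule real_vector.independent_if_scalars_zero[OF S(1)])
  fix c t assume 0: "(\<Sum>s\<in>S. c s *\<^sub>R s) = 0" and t: "t \<in> S"
  have "\<beta> (\<Sum>s\<in>S. c s *\<^sub>R s) t = (\<Sum>s\<in>S. c s * \<beta> s t)"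
    by (simp add: bil_sum_left[OF b] bil_scale_left[OF b])
  also have "\<dots> = (\<Sum>s\<in>S. if s = t then c t * \<beta> t t else 0)"
    by (rule sum.cong) (auto simp: o t)
  also have "\<dots> = c t * \<beta> t t" using S t by simp
  finally show "c t = 0" using S(2)[OF t] 0 by (simp add: bil_zero_left[OF b])
qed

lemma orthogonal_basis_expansion:
  fixes \<beta> :: "'a::euclidean_space \<Rightarrow> 'a \<Rightarrow> real"
  assumes b: "bilinear \<beta>" and S: "finite S" "\<And>s. s \<in> S \<Longrightarrow> \<beta> s s \<noteq> 0"
    and o: "\<And>s t. s \<in> S \<Longrightarrow> t \<in> S \<Longrightarrow> s \<noteq> t \<Longrightarrow> \<beta> s t = 0"
    and card: "card S = DIM('a)"
  shows "z = (\<Sum>s\<in>S. (\<beta> z s / \<beta> s s) *\<^sub>R s)"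
proof -
  have "independent S" by (rule orthogonal_set_independent[OF b S o])
  then have "UNIV \<subseteq> span S" using card by (intro card_ge_dim_independent) (auto simp: dim_UNIV)
  then have "z \<in> range (\<lambda>u. \<Sum>s\<in>S. u s *\<^sub>R s)" unfolding span_finite[OF S(1), symmetric] by blast
  then obtain c where c: "z = (\<Sum>s\<in>S. c s *\<^sub>R s)" by blast
  have "\<beta> z t / \<beta> t t = c t" if t: "t \<in> S" for t
  proof -
    have "\<beta> z t = (\<Sum>s\<in>S. c s * \<beta> s t)"
      unfolding c by (simp add: bil_sum_left[OF b] bil_scale_left[OF b])
    also have "\<dots> = (\<Sum>s\<in>S. if s = t then c t * \<beta> t t else 0)"
      by (rule sum.cong) (auto simp: o t)
    also have "\<dots> = c t * \<beta> t t" using S t by simp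
    finally show ?thesis using S(2)[OF t] by simp
  qed
  then show ?thesis using c by simp
qed

text \<open>Gram-Schmidt by induction on the missing dimension: a vector outside the span, minus its
  projection, is normalised and added.\<close>

lemma orthonormal_extension:
  fixes g :: "'a::euclidean_space \<Rightarrow> 'a \<Rightarrow> real"
  assumes b: "bilinear g" and sym: "\<And>x y. g x y = g y x" and pos: "\<And>x. x \<noteq> 0 \<Longrightarrow> g x x > 0"
    and S: "finite S" "\<And>s. s \<in> S \<Longrightarrow> g s s = 1" "\<And>s t. s \<in> S \<Longrightarrow> t \<in> S \<Longrightarrow> s \<noteq> t \<Longrightarrow> g s t = 0"
  shows "\<exists>S'. S \<subseteq> S' \<and> finite S' \<and> card S' = DIM('a) \<and> (\<forall>s\<in>S'. g s s = 1) \<and> (\<forall>s\<in>S'. \<forall>t\<in>S'. s \<noteq> t \<longrightarrow> g s t = 0)"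
  using S
proof (induction "DIM('a) - card S" arbitrary: S rule: less_induct)
  case less
  have ind: "independent S"
    by (rule orthogonal_set_independent[OF b less.prems(1) _ less.prems(3)]) (auto simp: less.prems(2))
  then have le: "card S \<le> DIM('a)" using independent_bound by blast
  show ?case
  proof (cases "card S = DIM('a)")
    case True
    then show ?thesis using less.prems by blast
  next
    case False
    then have "card S < DIM('a)" using le by simp
    moreover have "dim (span S) \<le> card S"
      using dim_le_card'[OF less.prems(1)] by simp
    ultimately have "span S \<noteq> UNIV" by (metis dim_UNIV leD)
    then obtain z where z: "z \<notin> span S" by blast
    define y where "y = z - (\<Sum>s\<in>S. g z s *\<^sub>R s)"
    have "y \<noteq> 0" using z unfolding y_def
      by (metis (no_types, lifting) eq_iff_diff_eq_0 span_base span_scale span_sum)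
    have yo: "g y t = 0" if t: "t \<in> S" for t
    proof -
      have "g y t = g z t - (\<Sum>s\<in>S. g z s * g s t)"
        unfolding y_def by (simp add: bil_diff_left[OF b] bil_sum_left[OF b] bil_scale_left[OF b])
      also have "(\<Sum>s\<in>S. g z s * g s t) = (\<Sum>s\<in>S. if s = t then g z t else 0)"
        using less.prems t by (intro sum.cong) auto
      finally show ?thesis using less.prems(1) t by simp
    qed
    define w where "w = (1 / sqrt (g y y)) *\<^sub>R y"
    have ww: "g w w = 1" using pos[OF \<open>y \<noteq> 0\<close>]
      by (simp add: w_def bil_scale_left[OF b] bil_scale_right[OF b])
    have wo: "g w t = 0" "g t w = 0" if "t \<in> S" for t
      using yo[OF that] sym[of t w] by (auto simp: w_def bil_scale_left[OF b])
    have "w \<notin> S" using wo ww by fastforce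
    then have "DIM('a) - card (insert w S) < DIM('a) - card S"
      using \<open>card S < DIM('a)\<close> less.prems(1) by simp
    from less.hyps[OF this] obtain S' where "S' \<supseteq> insert w S \<and> finite S' \<and> card S' = DIM('a) \<and>
        (\<forall>s\<in>S'. g s s = 1) \<and> (\<forall>s\<in>S'. \<forall>t\<in>S'. s \<noteq> t \<longrightarrow> g s t = 0)"
      using less.prems ww wo by (metis finite_insert insert_iff)
    then show ?thesis by (intro exI[of _ S']) auto
  qed
qed

text \<open>Identifies a tangent space and its metric with the standard inner product, for which the
  algebraic part is stated.\<close>

lemma linear_isometry_from_inner:
  fixes g :: "'a::euclidean_space \<Rightarrow> 'a \<Rightarrow> real"
  assumes b: "bilinear g" and sym: "\<And>x y. g x y = g y x" and pos: "\<And>x. x \<noteq> 0 \<Longrightarrow> g x x > 0"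
  obtains B :: "'a \<Rightarrow> 'a" where "linear B" "bij B" "\<And>u v. g (B u) (B v) = u \<bullet> v"
proof -
  from orthonormal_extension[OF b sym pos, of "{}"] obtain S where
    S: "finite S" "card S = DIM('a)" "\<And>s. s \<in> S \<Longrightarrow> g s s = 1"
      "\<And>s t. s \<in> S \<Longrightarrow> t \<in> S \<Longrightarrow> s \<noteq> t \<Longrightarrow> g s t = 0" by auto
  then obtain \<phi> where \<phi>: "bij_betw \<phi> (Basis :: 'a set) S"
    using finite_same_card_bij[of "Basis :: 'a set" S] by auto
  define B where "B v = (\<Sum>c\<in>Basis. (v \<bullet> c) *\<^sub>R \<phi> c)" for v
  have lB: "linear B"
    unfolding B_def by (intro linearI)
      (simp_all add: inner_add_left scaleR_add_left sum.distrib scaleR_sum_right)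
  have gB: "g (B u) (B v) = u \<bullet> v" for u v
  proof -
    have "g (B u) (B v) = (\<Sum>c\<in>Basis. (u \<bullet> c) * (\<Sum>d\<in>Basis. (v \<bullet> d) * g (\<phi> c) (\<phi> d)))"
      unfolding B_def[of u] bil_sum_left[OF b] bil_scale_left[OF b]
      unfolding B_def[of v] bil_sum_right[OF b] bil_scale_right[OF b] by simp
    also have "\<dots> = (\<Sum>c\<in>Basis. (u \<bullet> c) * (v \<bullet> c))"
    proof (rule sum.cong[OF refl])
      fix c :: 'a assume c: "c \<in> Basis"
      have "(\<Sum>d\<in>Basis. (v \<bullet> d) * g (\<phi> c) (\<phi> d)) = (\<Sum>d\<in>Basis. if d = c then v \<bullet> c else 0)"
      proof (rule sum.cong[OF refl])
        fix d :: 'a assume d: "d \<in> Basis"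
        have "\<phi> c \<in> S" "\<phi> d \<in> S" using \<phi> c d by (auto simp: bij_betw_def)
        moreover have "\<phi> c = \<phi> d \<longleftrightarrow> c = d" using \<phi> c d by (auto simp: bij_betw_def inj_on_def)
        ultimately show "(v \<bullet> d) * g (\<phi> c) (\<phi> d) = (if d = c then v \<bullet> c else 0)"
          using S by auto
      qed
      then show "(u \<bullet> c) * (\<Sum>d\<in>Basis. (v \<bullet> d) * g (\<phi> c) (\<phi> d)) = (u \<bullet> c) * (v \<bullet> c)" using c by simp
    qed
    also have "\<dots> = u \<bullet> v" by (simp add: euclidean_inner[of u v])
    finally show ?thesis .
  qed
  have "inj B"
  proof (subst linear_injective_0[OF lB], intro allI impI)
    fix v assume "B v = 0"
    then show "v = 0" using gB[of v v] by (simp add: bil_zero_left[OF b])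
  qed
  then have "bij B" using linear_injective_imp_surjective[OF lB] by (simp add: bij_def)
  then show ?thesis using that lB gB by blast
qed

section \<open>The Lorentzian form and adapted frames\<close>

lemma bilinear_lorentz: "bilinear lorentz"
  unfolding bilinear_def lorentz_def
  by (auto intro!: linearI simp: inner_add_left inner_add_right algebra_simps)

lemma lorentz_sym: "lorentz x y = lorentz y x"
  by (simp add: lorentz_def inner_commute mult.commute)

lemmas lorentz_simps = bilinearD[OF bilinear_lorentz] bil_sum_left[OF bilinear_lorentz] bil_sum_right[OF bilinear_lorentz]

lemma bounded_bilinear_lorentz: "bounded_bilinear lorentz"
  using bilinear_lorentz bilinear_conv_bounded_bilinear by blast

text \<open>In components, the hypotheses read \<open>a \<bullet> b = s * t\<close> and
  \<open>b \<bullet> b = t * t - 1\<close>, so Cauchy-Schwarz bounds \<open>lorentz y y\<close>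
  times the square of \<open>t\<close> from below by \<open>a \<bullet> a\<close>, which is positive
  unless \<open>y\<close> is zero.\<close>

lemma lorentz_orthogonal_timelike:
  assumes p: "lorentz p p = -1" and y: "lorentz y p = 0" "y \<noteq> 0"
  shows "lorentz y y > 0"
proof -
  obtain a s where ya: "y = (a, s)" by (cases y)
  obtain b t where pb: "p = (b, t)" by (cases p)
  have 1: "b \<bullet> b = t * t - 1" using p by (simp add: lorentz_def pb)
  have 2: "a \<bullet> b = s * t" using y(1) by (simp add: lorentz_def pb ya)
  have "(a \<bullet> b)\<^sup>2 \<le> (a \<bullet> a) * (b \<bullet> b)" by (rule Cauchy_Schwarz_ineq)
  then have 3: "t\<^sup>2 * (a \<bullet> a - s * s) \<ge> a \<bullet> a" unfolding 1 2 by (simp add: power2_eq_square algebra_simps)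
  have t: "t \<noteq> 0" using 1 inner_ge_zero[of b] by auto
  have a: "a \<noteq> 0" using 2 t y(2) ya by (auto simp: zero_prod_def)
  then have "a \<bullet> a > 0" by simp
  then have "t\<^sup>2 * (a \<bullet> a - s * s) > 0" using 3 by linarith
  then have "a \<bullet> a - s * s > 0" using t by (simp add: zero_less_mult_iff)
  then show ?thesis by (simp add: lorentz_def ya)
qed

text \<open>The form \<open>\<langle>x, y\<rangle> + 2\<langle>x, p\<rangle>\<langle>y, p\<rangle>\<close> is positive definite when \<open>p\<close> is unit timelike, which allows
  Gram-Schmidt orthonormalisation in Lorentzian space.\<close>

lemma normal_frame:
  fixes T :: "'m::euclidean_space \<Rightarrow> 'h::euclidean_space \<times> real"
  assumes dim: "DIM('h) = DIM('m) + 2" and T: "linear T"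
    and p: "lorentz p p = -1" "\<And>u. lorentz (T u) p = 0" and pos: "\<And>u. u \<noteq> 0 \<Longrightarrow> T u \<noteq> 0"
  obtains \<xi> \<zeta> where "lorentz \<xi> \<xi> = 1" "lorentz \<zeta> \<zeta> = 1" "lorentz \<xi> \<zeta> = 0"
    "lorentz \<xi> p = 0" "lorentz \<zeta> p = 0" "\<And>u. lorentz \<xi> (T u) = 0" "\<And>u. lorentz \<zeta> (T u) = 0"
    "\<And>z. (\<And>u. lorentz z (T u) = 0) \<Longrightarrow> z = (- lorentz z p) *\<^sub>R p + lorentz z \<xi> *\<^sub>R \<xi> + lorentz z \<zeta> *\<^sub>R \<zeta>"
    "\<And>z. lorentz z p = 0 \<Longrightarrow> lorentz z \<xi> = 0 \<Longrightarrow> lorentz z \<zeta> = 0 \<Longrightarrow> \<exists>u. z = T u"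
proof -
  define q where "q x y = lorentz x y + 2 * lorentz x p * lorentz y p" for x y
  define h where "h u v = lorentz (T u) (T v)" for u v
  have bh: "bilinear h"
    unfolding bilinear_def h_def
    by (intro conjI allI linearI) (simp_all add: linear_add[OF T] linear_cmul[OF T] lorentz_simps)
  have hpos: "h u u > 0" if "u \<noteq> 0" for u
    unfolding h_def by (rule lorentz_orthogonal_timelike[OF p(1) p(2) pos[OF that]])
  have hsym: "h u v = h v u" for u v by (simp add: h_def lorentz_sym)
  from orthonormal_extension[OF bh hsym hpos, of "{}"] obtain S0 where
    S0: "finite S0" "card S0 = DIM('m)" "\<And>s. s \<in> S0 \<Longrightarrow> h s s = 1"
      "\<And>s t. s \<in> S0 \<Longrightarrow> t \<in> S0 \<Longrightarrow> s \<noteq> t \<Longrightarrow> h s t = 0" by auto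
  have bq: "bilinear q"
    unfolding bilinear_def q_def
    by (intro conjI allI linearI) (simp_all only: lorentz_simps real_scaleR_def, simp_all add: algebra_simps)
  have qsym: "q x y = q y x" for x y by (simp add: q_def lorentz_sym mult_ac)
  have qpos: "q x x > 0" if "x \<noteq> 0" for x
  proof (cases "x + lorentz x p *\<^sub>R p = 0")
    case True
    then have x: "x = (- lorentz x p) *\<^sub>R p" by (simp add: add_eq_0_iff)
    have "lorentz x x = - (lorentz x p)\<^sup>2"
      by (subst (2) x) (simp add: lorentz_simps power2_eq_square)
    moreover have "lorentz x p \<noteq> 0" using x that by auto
    then have "lorentz x p * lorentz x p > 0" using not_square_less_zero by (metis mult_eq_0_iff linorder_neqE_linordered_idom)
    ultimately show ?thesis unfolding q_def power2_eq_square by simp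
  next
    case False
    have "lorentz (x + lorentz x p *\<^sub>R p) p = 0" by (simp add: lorentz_simps p)
    from lorentz_orthogonal_timelike[OF p(1) this False] have "lorentz x x + (lorentz x p)\<^sup>2 > 0"
      by (simp add: lorentz_simps p lorentz_sym[of p x] power2_eq_square)
    then show ?thesis using zero_le_power2[of "lorentz x p"] unfolding q_def power2_eq_square by linarith
  qed
  have injT: "inj_on T S0" using pos T by (meson inj_on_subset linear_injective_0 top_greatest)
  have pT: "p \<notin> T ` S0"
  proof
    assume "p \<in> T ` S0"
    then obtain s where "p = T s" by blast
    then show False using p(1) p(2)[of s] by simp
  qed
  define S1 where "S1 = insert p (T ` S0)"
  have cS1: "card S1 = DIM('m) + 1" "finite S1"
    using pT S0 injT by (simp_all add: S1_def card_image)
  have q1: "q s s = 1" if "s \<in> S1" for s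
    using that S0(3) p unfolding S1_def q_def h_def by (elim insertE imageE) simp_all
  have q0: "q s t = 0" if "s \<in> S1" "t \<in> S1" "s \<noteq> t" for s t
    using that S0(4) p p(2)[unfolded lorentz_sym[of _ p]] unfolding S1_def q_def h_def
    by (elim insertE imageE) (simp_all, metis)
  from orthonormal_extension[OF bq qsym qpos cS1(2) q1 q0] obtain S where
    S: "S \<supseteq> S1" "finite S" "card S = DIM('h \<times> real)" "\<And>s. s \<in> S \<Longrightarrow> q s s = 1"
      "\<And>s t. s \<in> S \<Longrightarrow> t \<in> S \<Longrightarrow> s \<noteq> t \<Longrightarrow> q s t = 0" by auto
  \<comment> \<open>\<open>S\<close> has \<open>DIM('m) + 3\<close> members, of which
    \<open>p\<close> and the tangent basis account for \<open>DIM('m) + 1\<close>.\<close>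
  have "card (S - S1) = 2" using S cS1 dim by (simp add: card_Diff_subset)
  then obtain \<xi> \<zeta> where xz: "S - S1 = {\<xi>, \<zeta>}" "\<xi> \<noteq> \<zeta>" by (auto simp: card_2_iff)
  then have Seq: "S = insert \<xi> (insert \<zeta> S1)" and nin: "\<xi> \<notin> S1" "\<zeta> \<notin> S1" "\<xi> \<in> S" "\<zeta> \<in> S" using S(1) by auto
  have pS: "p \<in> S1" by (simp add: S1_def)
  have orth_p: "lorentz x p = 0" if "x \<in> S" "x \<noteq> p" for x
    using S(5)[OF that(1) _ that(2)] pS S(1) p by (auto simp: q_def)
  have xp: "lorentz \<xi> p = 0" "lorentz \<zeta> p = 0"
    using orth_p nin pS by metis+
  have orth_T: "lorentz x (T s) = 0" if "x \<in> {\<xi>, \<zeta>}" "s \<in> S0" for x s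
  proof -
    have "x \<noteq> T s" "x \<in> S" "T s \<in> S" using that nin S(1) by (auto simp: S1_def)
    from S(5)[OF this(2,3,1)] show ?thesis by (simp add: q_def p)
  qed
  have exp0: "u = (\<Sum>s\<in>S0. h u s *\<^sub>R s)" for u
    using orthogonal_basis_expansion[OF bh S0(1) _ S0(4) S0(2), of u] S0(3) by simp
  have orth_T': "lorentz x (T u) = 0" if "x \<in> {\<xi>, \<zeta>}" for x u
    using orth_T[OF that] by (subst exp0) (simp add: linear_sum[OF T] linear_cmul[OF T] lorentz_simps)
  have qe: "z = (\<Sum>s\<in>S. q z s *\<^sub>R s)" for z
    using orthogonal_basis_expansion[OF bq S(2) _ S(5) S(3), of z] S(4) by simp
  have ex: "z = (- lorentz z p) *\<^sub>R p + (\<Sum>s\<in>S0. lorentz z (T s) *\<^sub>R T s) + lorentz z \<xi> *\<^sub>R \<xi> + lorentz z \<zeta> *\<^sub>R \<zeta>" for z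
  proof -
    have "z = q z \<xi> *\<^sub>R \<xi> + (q z \<zeta> *\<^sub>R \<zeta> + (q z p *\<^sub>R p + (\<Sum>s\<in>S0. q z (T s) *\<^sub>R T s)))"
      by (subst qe[of z], subst Seq, subst sum.insert, use cS1 nin xz in simp, use nin xz in simp,
          subst sum.insert, use cS1 nin xz in simp, use nin xz in simp,
          subst S1_def, subst sum.insert, use S0 in simp, rule pT, simp add: sum.reindex[OF injT])
    then show ?thesis by (simp add: q_def xp p algebra_simps)
  qed
  show ?thesis
  proof (rule that[of \<xi> \<zeta>])
    show "lorentz \<xi> \<xi> = 1" "lorentz \<zeta> \<zeta> = 1" "lorentz \<xi> \<zeta> = 0"
      using S(4)[of \<xi>] S(4)[of \<zeta>] S(5)[of \<xi> \<zeta>] nin xz xp by (auto simp: q_def)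
    show "z = (- lorentz z p) *\<^sub>R p + lorentz z \<xi> *\<^sub>R \<xi> + lorentz z \<zeta> *\<^sub>R \<zeta>" if "\<And>u. lorentz z (T u) = 0" for z
      by (subst ex[of z]) (simp add: that)
    show "\<exists>u. z = T u" if "lorentz z p = 0" "lorentz z \<xi> = 0" "lorentz z \<zeta> = 0" for z
      using ex[of z] that by (intro exI[of _ "\<Sum>s\<in>S0. lorentz z (T s) *\<^sub>R s"])
        (simp add: linear_sum[OF T] linear_cmul[OF T])
  qed (use xp orth_T' in auto)
qed

lemma unit_vector_orthogonal_to_finite:
  fixes S :: "'a::euclidean_space set"
  assumes "finite S" "card S < DIM('a)"
  obtains z where "z \<bullet> z = 1" "\<And>s. s \<in> S \<Longrightarrow> z \<bullet> s = 0"
proof -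
  have "dim S < DIM('a)" using assms dim_le_card'[of S] by simp
  then obtain x where x: "x \<noteq> 0" "\<And>y. y \<in> span S \<Longrightarrow> orthogonal x y"
    using orthogonal_to_subspace_exists by blast
  show ?thesis
  proof (rule that[of "x /\<^sub>R norm x"])
    show "(x /\<^sub>R norm x) \<bullet> (x /\<^sub>R norm x) = 1"
      using x(1) by (simp add: power2_norm_eq_inner[symmetric] power2_eq_square)
    show "(x /\<^sub>R norm x) \<bullet> s = 0" if "s \<in> S" for s
      using x(2)[OF span_base[OF that]] by (simp add: orthogonal_def)
  qed
qed

text \<open>The difference of \<open>r\<close> times the inner product and \<open>B\<close> is
  nonnegative on \<open>H\<close> and zero at \<open>x\<close>; a nonnegative form has each of its
  zeros in its kernel.\<close>

lemma symmetric_form_maximum: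
  fixes B :: "'a::real_inner \<Rightarrow> 'a \<Rightarrow> real"
  assumes b: "bilinear B" and sym: "\<And>x y. B x y = B y x" and H: "subspace H"
    and le: "\<And>z. z \<in> H \<Longrightarrow> B z z \<le> r * (z \<bullet> z)" and x: "x \<in> H" "B x x = r * (x \<bullet> x)" and y: "y \<in> H"
  shows "B x y = r * (x \<bullet> y)"
proof (rule ccontr)
  define d where "d = r * (x \<bullet> y) - B x y"
  define k where "k = r * (y \<bullet> y) - B y y"
  assume "B x y \<noteq> r * (x \<bullet> y)"
  then have d: "d \<noteq> 0" by (simp add: d_def)
  have k: "k \<ge> 0" using le[OF y] by (simp add: k_def)
  have *: "2 * t * d + t\<^sup>2 * k \<ge> 0" for t
  proof -
    have "x + t *\<^sub>R y \<in> H" using H x y by (simp add: subspace_add subspace_scale)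
    from le[OF this] show ?thesis
      using x(2) sym[of y x]
      by (simp add: d_def k_def bilinearD[OF b] inner_add_left inner_add_right inner_commute[of y x]
          power2_eq_square algebra_simps)
  qed
  \<comment> \<open>Close to the minimum of the parabola in \<open>*\<close>; \<open>k + 1\<close>
    instead of \<open>k\<close> covers the case \<open>k = 0\<close>.\<close>
  have "2 * (- d / (k + 1)) * d + (- d / (k + 1))\<^sup>2 * k = - (d\<^sup>2 * (k + 2)) / (k + 1)\<^sup>2"
    using k by (simp add: divide_simps power2_eq_square) (simp add: algebra_simps)
  moreover have "- (d\<^sup>2 * (k + 2)) / (k + 1)\<^sup>2 < 0" using k d by (simp add: divide_simps)
  ultimately show False using *[of "- d / (k + 1)"] by simp
qed

section \<open>Curvature-like forms on a Hermitian space\<close>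

text \<open>The right side of the Gauss equation for a hypersurface with second fundamental form
  \<alpha>.\<close>

definition wedge_form :: "('m \<Rightarrow> 'm \<Rightarrow> real) \<Rightarrow> 'm \<Rightarrow> 'm \<Rightarrow> 'm \<Rightarrow> 'm \<Rightarrow> real" where
  "wedge_form \<alpha> x y z w = \<alpha> x w * \<alpha> y z - \<alpha> x z * \<alpha> y w"

locale hermitian_space =
  fixes J :: "'m::euclidean_space \<Rightarrow> 'm"
  assumes linJ: "linear J" and J2: "J (J x) = - x" and Jorth: "J x \<bullet> J y = x \<bullet> y"
begin

lemma J_add: "J (x + y) = J x + J y" and J_scale: "J (c *\<^sub>R x) = c *\<^sub>R J x" and J_neg: "J (- x) = - J x"
  and J_diff: "J (x - y) = J x - J y" and J_zero: "J 0 = 0"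
  using linJ by (simp_all add: linear_add linear_cmul linear_neg linear_diff linear_0)

lemma J_inner: "J x \<bullet> y = - (x \<bullet> J y)"
  using Jorth[of x "J y"] by (simp add: J2)

lemma J_inner_self [simp]: "x \<bullet> J x = 0" "J x \<bullet> x = 0"
  using J_inner[of x x] by (simp_all add: inner_commute)

text \<open>The invariant part \<open>inv_part\<close> of a symmetric form is Hermitian, \<open>anti_part\<close> is the complementary
  type. The form \<open>cwedge p q\<close> is the real part of the product of \<open>p\<close> and \<open>q\<close> on complex bivectors.\<close>

definition inv_part :: "('m \<Rightarrow> 'm \<Rightarrow> real) \<Rightarrow> 'm \<Rightarrow> 'm \<Rightarrow> real" where
  "inv_part \<alpha> x y = (\<alpha> x y + \<alpha> (J x) (J y)) / 2"

definition anti_part :: "('m \<Rightarrow> 'm \<Rightarrow> real) \<Rightarrow> 'm \<Rightarrow> 'm \<Rightarrow> real" where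
  "anti_part \<alpha> x y = (\<alpha> x y - \<alpha> (J x) (J y)) / 2"

definition cwedge :: "('m \<Rightarrow> 'm \<Rightarrow> real) \<Rightarrow> ('m \<Rightarrow> 'm \<Rightarrow> real) \<Rightarrow> 'm \<Rightarrow> 'm \<Rightarrow> 'm \<Rightarrow> 'm \<Rightarrow> real" where
  "cwedge p q x y z w = p x w * q y z - p x z * q y w - p x (J w) * q y (J z) + p x (J z) * q y (J w)"

text \<open>The obstruction to invariance under \<open>J\<close> in the last pair, a symmetry that
  the curvature of a Kaehler manifold has.\<close>

definition wedge_defect :: "('m \<Rightarrow> 'm \<Rightarrow> real) \<Rightarrow> 'm \<Rightarrow> 'm \<Rightarrow> 'm \<Rightarrow> 'm \<Rightarrow> real" where
  "wedge_defect \<alpha> x y z w = wedge_form \<alpha> x y z w - wedge_form \<alpha> x y (J z) (J w)"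

text \<open>Replacing arguments by their images under \<open>J\<close> separates the types of the
  factors: with these signs only products of two invariant parts survive. The expression is linear
  in \<open>wedge_defect\<close>, so a linear relation between defects descends to the products;
  \<open>cwedge_inv_anti\<close> does the same for mixed products.\<close>

lemma cwedge_inv_inv:
  assumes "bilinear \<alpha>"
  shows "4 * cwedge (inv_part \<alpha>) (inv_part \<alpha>) x y z w = wedge_defect \<alpha> x y z w
    - wedge_defect \<alpha> (J x) (J y) z w + wedge_defect \<alpha> (J x) y (J z) w + wedge_defect \<alpha> x (J y) (J z) w"
  unfolding cwedge_def inv_part_def wedge_defect_def wedge_form_def
  by (simp add: J2 J_neg bilinearD[OF assms] field_simps)

lemma cwedge_inv_anti:
  assumes "bilinear \<alpha>"
  shows "4 * cwedge (inv_part \<alpha>) (anti_part \<alpha>) x y z w = wedge_defect \<alpha> x y z w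
    + wedge_defect \<alpha> (J x) (J y) z w + wedge_defect \<alpha> (J x) y (J z) w - wedge_defect \<alpha> x (J y) (J z) w"
  unfolding cwedge_def inv_part_def anti_part_def wedge_defect_def wedge_form_def
  by (simp add: J2 J_neg bilinearD[OF assms] field_simps)

lemma inv_part_inner: "inv_part inner = inner" and anti_part_inner: "anti_part inner x y = 0"
  by (auto simp: inv_part_def anti_part_def Jorth fun_eq_iff)

text \<open>The real parts of Hermitian forms for the complex structure \<open>J\<close>.\<close>

definition hform :: "('m \<Rightarrow> 'm \<Rightarrow> real) \<Rightarrow> bool" where
  "hform p \<longleftrightarrow> bilinear p \<and> (\<forall>x y. p x y = p y x) \<and> (\<forall>x y. p (J x) (J y) = p x y)"

lemma hform_J_swap: "hform p \<Longrightarrow> p (J x) y = - p x (J y)"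
  unfolding hform_def by (metis J2 bil_neg_right)

lemma hform_J_self: "hform p \<Longrightarrow> p x (J x) = 0"
  using hform_J_swap[of p x x] unfolding hform_def by (metis equal_neg_zero)

lemma hform_inv_part:
  assumes "bilinear \<alpha>" "\<And>x y. \<alpha> x y = \<alpha> y x" shows "hform (inv_part \<alpha>)"
  unfolding hform_def bilinear_def inv_part_def
  using assms(2) by (auto intro!: linearI simp: J2 J_add J_scale bilinearD[OF assms(1)] field_simps)

lemma hform_combination:
  assumes "hform p" "hform q" shows "hform (\<lambda>x y. a * p x y + b * q x y)"
proof -
  have b: "bilinear p" "bilinear q" using assms by (auto simp: hform_def)
  show ?thesis using assms unfolding hform_def
    by (auto simp: bilinear_def algebra_simps bilinearD[OF b(1)] bilinearD[OF b(2)] intro!: linearI)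
qed

text \<open>Orthogonality for the Hermitian inner product, that is, of the complex lines through
  \<open>x\<close> and \<open>y\<close>.\<close>

definition corth :: "'m \<Rightarrow> 'm \<Rightarrow> bool" where
  "corth x y \<longleftrightarrow> x \<bullet> y = 0 \<and> x \<bullet> J y = 0"

lemma corth_sym: "corth x y \<longleftrightarrow> corth y x"
  unfolding corth_def using J_inner[of x y] by (auto simp: inner_commute)

lemma corth_J: "corth x y \<Longrightarrow> corth x (J y)" "corth x y \<Longrightarrow> corth (J x) y"
  unfolding corth_def by (auto simp: J2 Jorth J_inner)

lemma exists_corth_unit:
  assumes "2 * length xs < DIM('m)"
  shows "\<exists>z. z \<bullet> z = 1 \<and> (\<forall>s\<in>set xs. corth z s)"
proof -
  let ?S = "set (xs @ map J xs)"
  have "card ?S < DIM('m)" using card_length[of "xs @ map J xs"] assms by simp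
  then obtain z where z: "z \<bullet> z = 1" "\<And>s. s \<in> ?S \<Longrightarrow> z \<bullet> s = 0"
    using unit_vector_orthogonal_to_finite[of ?S] by blast
  show ?thesis by (rule exI[of _ z]) (use z in \<open>auto simp: corth_def\<close>)
qed

lemma complex_component:
  fixes e z :: 'm
  assumes "e \<bullet> e = 1"
  defines "z' \<equiv> z - (z \<bullet> e) *\<^sub>R e - (z \<bullet> J e) *\<^sub>R J e"
  shows "corth z' e" and "\<And>f. corth e f \<Longrightarrow> corth z f \<Longrightarrow> corth z' f"
    and "z = (z \<bullet> e) *\<^sub>R e + (z \<bullet> J e) *\<^sub>R J e + z'"
proof -
  show "corth z' e"
    using assms(1) by (simp add: corth_def z'_def inner_diff_left Jorth)
  show "corth z' f" if "corth e f" "corth z f" for f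
  proof -
    have "J e \<bullet> f = 0" using corth_J(2)[OF that(1)] by (simp add: corth_def)
    moreover have "J e \<bullet> J f = 0" using that(1) by (simp add: corth_def Jorth)
    ultimately show ?thesis using that by (simp add: corth_def z'_def inner_diff_left)
  qed
qed (simp add: z'_def)

definition eigen :: "('m \<Rightarrow> 'm \<Rightarrow> real) \<Rightarrow> real \<Rightarrow> 'm \<Rightarrow> bool" where
  "eigen p l e \<longleftrightarrow> (\<forall>z. p e z = l * (e \<bullet> z))"

lemma eigen_J:
  assumes "hform p" "eigen p l e" shows "eigen p l (J e)"
  unfolding eigen_def
proof
  fix z
  have "p (J e) z = - p e (J z)" by (rule hform_J_swap[OF assms(1)])
  also have "\<dots> = l * (J e \<bullet> z)" using assms(2) by (simp add: eigen_def J_inner)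
  finally show "p (J e) z = l * (J e \<bullet> z)" .
qed

text \<open>This is the Gram determinant on the pair of the Hermitian form with real part
  \<open>p\<close>: up to sign, the squared entries are the real and imaginary parts of its value on
  \<open>x\<close> and \<open>y\<close>.\<close>

lemma cwedge_pair_eq:
  assumes "hform p"
  shows "corth x y \<Longrightarrow> cwedge p p x y y x = p x x * p y y - (p x y)\<^sup>2 - (p x (J y))\<^sup>2"
proof -
  have "p y (J x) = - p x (J y)" using hform_J_swap[OF assms, of x y] assms by (simp add: hform_def)
  then show ?thesis
    using assms by (simp add: cwedge_def hform_J_self power2_eq_square) (simp add: hform_def)
qed

end

text \<open>\<open>p1\<close> and \<open>p2\<close> stand for the Hermitian parts of the two
  spacelike normal components of \<open>A\<close>, and \<open>LL\<close> for the Hermitian part of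
  the Kaehler condition. The right side of \<open>LL\<close> comes from the timelike component,
  which is the metric.\<close>

locale hermitian_pair = hermitian_space J for J :: "'m::euclidean_space \<Rightarrow> 'm" +
  fixes p1 p2 :: "'m \<Rightarrow> 'm \<Rightarrow> real"
  assumes h1: "hform p1" and h2: "hform p2" and dim6: "DIM('m) \<ge> 6"
    and LL: "cwedge p1 p1 x y z w + cwedge p2 p2 x y z w = cwedge inner inner x y z w"
begin

lemma b1: "bilinear p1" and b2: "bilinear p2" and s1: "p1 x y = p1 y x" and s2: "p2 x y = p2 y x"
  using h1 h2 unfolding hform_def by auto

lemma star:
  assumes "corth x y"
  shows "p1 x x * p1 y y - (p1 x y)\<^sup>2 - (p1 x (J y))\<^sup>2 + (p2 x x * p2 y y - (p2 x y)\<^sup>2 - (p2 x (J y))\<^sup>2)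
    = (x \<bullet> x) * (y \<bullet> y)"
  using LL[of x y y x] assms unfolding cwedge_pair_eq[OF h1 assms] cwedge_pair_eq[OF h2 assms]
  by (simp add: cwedge_def corth_def inner_commute)

end

text \<open>\<open>X\<close> maximises the length of \<open>(p1 z z, p2 z z)\<close> on the unit
  sphere, after a rotation of the plane that puts the maximal value on the first axis.\<close>

locale hermitian_pair_max = hermitian_pair J p1 p2 for J :: "'m::euclidean_space \<Rightarrow> 'm" and p1 p2 +
  fixes X :: 'm and r :: real
  assumes X1: "X \<bullet> X = 1" and pX1: "p1 X X = r" and pX2: "p2 X X = 0" and r0: "r \<ge> 0"
    and mx: "(p1 z z)\<^sup>2 + (p2 z z)\<^sup>2 \<le> (r * (z \<bullet> z))\<^sup>2"
begin

lemma p1_X: "eigen p1 r X"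
proof -
  have "p1 z z \<le> r * (z \<bullet> z)" for z
  proof (rule power2_le_imp_le)
    show "(p1 z z)\<^sup>2 \<le> (r * (z \<bullet> z))\<^sup>2" using mx[of z] zero_le_power2[of "p2 z z"] by linarith
  qed (simp add: r0)
  then show ?thesis
    unfolding eigen_def using symmetric_form_maximum[OF b1 s1 subspace_UNIV, of r X] X1 pX1 by auto
qed

lemma star_X:
  assumes "corth X y"
  shows "r * p1 y y = (y \<bullet> y) + (p2 X y)\<^sup>2 + (p2 X (J y))\<^sup>2"
proof -
  have "p1 X y = 0" "p1 X (J y) = 0" using p1_X assms by (simp_all add: eigen_def corth_def)
  with star[OF assms] show ?thesis unfolding X1 pX1 pX2 by simp
qed

text \<open>For a unit \<open>y\<close> complex orthogonal to \<open>X\<close>,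
  \<open>star_X\<close> gives \<open>r * p1 y y \<ge> 1\<close>, while maximality gives
  \<open>p1 y y \<le> r\<close>.\<close>

lemma r1: "r \<ge> 1"
proof -
  obtain y where y: "y \<bullet> y = 1" "corth y X" using exists_corth_unit[of "[X]"] dim6 by auto
  have "r * p1 y y \<ge> 1" using star_X[of y] y corth_sym by simp
  moreover have "p1 y y \<le> r"
  proof (rule power2_le_imp_le)
    show "(p1 y y)\<^sup>2 \<le> r\<^sup>2"
      using mx[of y, unfolded y(1) mult_1_right] zero_le_power2[of "p2 y y"] by linarith
  qed (rule r0)
  then have "r * p1 y y \<le> r * r" using r0 by (intro mult_left_mono)
  ultimately have "1\<^sup>2 \<le> r\<^sup>2" by (simp add: power2_eq_square)
  then show ?thesis using r0 by (rule power2_le_imp_le)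
qed

text \<open>If \<open>p2 X\<close> were dual to \<rho> times a unit vector \<open>Y\<close> with
  \<rho> positive, the identities \<open>LL\<close>, \<open>star_X\<close> and \<open>star\<close>
  would force \<open>p1 Y Y = r\<close>. Then \<open>p1\<close> is \<open>r\<close> times the metric
  on the plane of \<open>X\<close> and \<open>Y\<close>, so maximality leaves no room for
  \<open>p2\<close> there, although \<open>p2 X Y = \<rho>\<close>.\<close>

lemma p2_X: "p2 X z = 0"
proof (rule ccontr)
  assume ne: "p2 X z \<noteq> 0"
  define v where "v = (\<Sum>b\<in>Basis. p2 X b *\<^sub>R b)"
  have v: "p2 X z = v \<bullet> z" for z
    by (subst (1 2) euclidean_representation[of z, symmetric])
      (simp add: v_def bil_sum_right[OF b2] bil_scale_right[OF b2] inner_sum_left inner_sum_right mult.commute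
        inner_Basis if_distrib[of "\<lambda>x. _ * x"] cong: if_cong del: euclidean_representation)
  define \<rho> where "\<rho> = norm v"
  have \<rho>: "\<rho> > 0" using ne v[of z] by (auto simp: \<rho>_def)
  define Y where "Y = (1 / \<rho>) *\<^sub>R v"
  have vY: "v = \<rho> *\<^sub>R Y" using \<rho> by (simp add: Y_def)
  have Y1: "Y \<bullet> Y = 1" using \<rho> unfolding Y_def \<rho>_def
    by (simp add: power2_norm_eq_inner[symmetric] power2_eq_square)
  have p2Y: "p2 X z = \<rho> * (Y \<bullet> z)" for z by (simp add: v vY)
  have XY: "corth X Y"
    using p2Y[of X] p2Y[of "J X"] pX2 hform_J_self[OF h2, of X] \<rho> J_inner[of Y X]
    by (simp add: corth_def inner_commute)
  obtain Y' where Y': "Y' \<bullet> Y' = 1" "corth Y' X" "corth Y' Y"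
    using exists_corth_unit[of "[X, Y]"] dim6 by auto
  have XY': "corth X Y'" "corth Y Y'" using Y' corth_sym by auto
  have z0: "p2 z Y' = 0" for z
  proof -
    have "X \<bullet> Y = 0" "X \<bullet> J Y = 0" "X \<bullet> Y' = 0" "X \<bullet> J Y' = 0" "Y \<bullet> Y' = 0" "Y \<bullet> J Y' = 0"
      using XY XY' by (auto simp: corth_def)
    \<comment> \<open>All other terms of \<open>LL\<close> at these arguments vanish.\<close>
    then have "\<rho> * p2 z Y' = 0"
      using LL[of X z Y' Y] p1_X by (simp add: cwedge_def eigen_def p2Y Y1)
    then show ?thesis using \<rho> by simp
  qed
  have z1: "p2 z (J Y') = 0" for z
    using z0[of "J z"] hform_J_swap[OF h2, of z Y'] by simp
  have YJY: "Y \<bullet> Y' = 0" "Y \<bullet> J Y' = 0" "Y \<bullet> J Y = 0" using XY' by (auto simp: corth_def)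
  have c: "r * p1 Y Y = 1 + \<rho>\<^sup>2" "r * p1 Y' Y' = 1"
    using star_X[OF XY] star_X[OF XY'(1)] by (simp_all add: p2Y Y1 Y' YJY)
  have "corth X (Y + Y')" using XY XY' by (simp add: corth_def inner_add_right J_add)
  from star_X[OF this] have "r * (p1 Y Y + 2 * p1 Y Y' + p1 Y' Y') = 2 + \<rho>\<^sup>2"
    using YJY by (simp add: bilinearD[OF b1] s1[of Y' Y] p2Y inner_add_left inner_add_right J_add Y1 Y'
        inner_commute[of Y' Y] algebra_simps)
  then have d1: "p1 Y Y' = 0" using c r1 by (simp add: algebra_simps)
  have "corth X (Y + J Y')" using XY corth_J(1)[OF XY'(1)] by (simp add: corth_def inner_add_right J_add)
  from star_X[OF this] have "r * (p1 Y Y + 2 * p1 Y (J Y') + p1 (J Y') (J Y')) = 2 + \<rho>\<^sup>2"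
    using YJY by (simp add: bilinearD[OF b1] s1[of "J Y'" Y] p2Y inner_add_left inner_add_right J_add Y1 Y' J2
        inner_commute[of "J Y'" Y] Jorth algebra_simps)
  moreover have "p1 (J Y') (J Y') = p1 Y' Y'" using h1 by (simp add: hform_def)
  ultimately have d2: "p1 Y (J Y') = 0" using c r1 by (simp add: algebra_simps)
  have "p1 Y Y * p1 Y' Y' = 1" using star[OF XY'(2)] d1 d2 z0 z1 by (simp add: Y1 Y')
  then have "(1 + \<rho>\<^sup>2) * 1 = r\<^sup>2" using c r1
    by (metis (no_types, opaque_lifting) mult.assoc mult.commute mult.right_neutral power2_eq_square)
  then have rr: "1 + \<rho>\<^sup>2 = r\<^sup>2" by simp
  then have a: "p1 Y Y = r" using c(1) r1 by (simp add: power2_eq_square)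
  define b where "b = p2 Y Y"
  \<comment> \<open>Maximality at \<open>X + t *\<^sub>R Y\<close>, where the first component alone
    already attains the bound.\<close>
  have *: "(2 * t * \<rho> + t\<^sup>2 * b)\<^sup>2 \<le> 0" for t
  proof -
    have e1: "p1 (X + t *\<^sub>R Y) (X + t *\<^sub>R Y) = r * (1 + t\<^sup>2)"
      using p1_X XY a pX1 by (simp add: bilinearD[OF b1] s1[of Y X] eigen_def corth_def power2_eq_square algebra_simps)
    have e2: "p2 (X + t *\<^sub>R Y) (X + t *\<^sub>R Y) = 2 * t * \<rho> + t\<^sup>2 * b"
      using pX2 by (simp add: bilinearD[OF b2] s2[of Y X] p2Y Y1 b_def power2_eq_square algebra_simps)
    have e3: "(X + t *\<^sub>R Y) \<bullet> (X + t *\<^sub>R Y) = 1 + t\<^sup>2"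
      using X1 Y1 XY by (simp add: corth_def inner_add_left inner_add_right inner_commute[of Y X] power2_eq_square)
    show ?thesis using mx[of "X + t *\<^sub>R Y"] unfolding e1 e2 e3 by simp
  qed
  have "2 * t * \<rho> + t\<^sup>2 * b = 0" for t using *[of t] by simp
  from this[of 1] this[of "-1"] show False using \<rho> by simp
qed

lemma p2_X_left: "p2 z X = 0" "p2 z (J X) = 0" "p2 (J X) z = 0"
  by (simp_all only: s2[of z X] s2[of z "J X"] hform_J_swap[OF h2, of X z] p2_X minus_zero)

lemma p1_H: "corth X y \<Longrightarrow> corth X z \<Longrightarrow> r * p1 y z = y \<bullet> z"
proof -
  assume a: "corth X y" "corth X z"
  then have "corth X (y + z)" by (simp add: corth_def inner_add_right J_add)
  from star_X[OF this] star_X[OF a(1)] star_X[OF a(2)] show "r * p1 y z = y \<bullet> z"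
    using r1 by (simp add: p2_X bilinearD[OF b1] s1[of z y] inner_add_left inner_add_right inner_commute[of z y] algebra_simps)
qed

text \<open>On the complex complement \<open>H\<close> of \<open>X\<close> the first form is the
  metric divided by \<open>r\<close>. A unit \<open>Y\<close> maximising the absolute value of
  \<open>p2\<close> on \<open>H\<close> is an eigenvector of \<open>p2\<close>, and
  \<open>star\<close> at \<open>Y\<close> then determines \<open>p2\<close> on everything complex
  orthogonal to \<open>X\<close> and \<open>Y\<close>, unless \<open>l = 0\<close>; in that case
  \<open>p2\<close> vanishes on \<open>H\<close> by the choice of \<open>Y\<close>.\<close>

lemma eigenvectors:
  obtains Y l m where "Y \<bullet> Y = 1" "corth X Y" "eigen p1 (1/r) Y" "eigen p2 l Y" "eigen p2 0 X"
    "\<And>z. corth X z \<Longrightarrow> corth Y z \<Longrightarrow> eigen p1 (1/r) z \<and> eigen p2 m z"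
    "1 / r * (1 / r) + l * m = 1"
proof -
  define H where "H = {z. corth X z}"
  have subH: "subspace H"
    unfolding H_def corth_def by (auto simp: subspace_def inner_add_right J_add J_scale J_zero)
  have e1H: "eigen p1 (1/r) y" if y: "corth X y" for y
    unfolding eigen_def
  proof
    fix z
    define z' where "z' = z - (z \<bullet> X) *\<^sub>R X - (z \<bullet> J X) *\<^sub>R J X"
    have z: "z = (z \<bullet> X) *\<^sub>R X + (z \<bullet> J X) *\<^sub>R J X + z'" and cz: "corth X z'"
      using complex_component[OF X1, of z] unfolding z'_def[symmetric] by (auto simp: corth_sym)
    have yX: "y \<bullet> X = 0" "y \<bullet> J X = 0" using y corth_sym unfolding corth_def by auto
    have "p1 y X = 0" "p1 y (J X) = 0"
      unfolding s1[of y X] s1[of y "J X"]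
      using p1_X eigen_J[OF h1 p1_X] yX by (simp_all add: eigen_def inner_commute)
    then have "p1 y z = p1 y z'" by (subst z) (simp add: bilinearD[OF b1])
    moreover have "y \<bullet> z = y \<bullet> z'" by (subst z) (simp add: inner_add_right yX)
    ultimately show "p1 y z = 1 / r * (y \<bullet> z)" using p1_H[OF y cz] r1 by (simp add: field_simps)
  qed
  let ?S = "{z \<in> H. norm z = 1}"
  have "?S = H \<inter> sphere 0 1" by (auto simp: sphere_def)
  then have cS: "compact ?S" using closed_subspace[OF subH] by (simp add: closed_Int_compact)
  obtain y0 where "y0 \<bullet> y0 = 1" "corth y0 X" using exists_corth_unit[of "[X]"] dim6 by auto
  then have neS: "?S \<noteq> {}" using corth_sym by (auto simp: H_def norm_eq_sqrt_inner)
  have cont: "continuous_on ?S (\<lambda>z. \<bar>p2 z z\<bar>)"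
  proof -
    have "bounded_bilinear p2" using b2 bilinear_conv_bounded_bilinear by blast
    then show ?thesis by (intro continuous_intros bounded_bilinear.continuous_on[of p2])
  qed
  from continuous_attains_sup[OF cS neS this] obtain Y where "Y \<in> ?S" and "\<forall>z\<in>?S. \<bar>p2 z z\<bar> \<le> \<bar>p2 Y Y\<bar>"
    by blast
  then have Y: "Y \<in> H" "norm Y = 1" and Ymax: "\<And>z. z \<in> H \<Longrightarrow> norm z = 1 \<Longrightarrow> \<bar>p2 z z\<bar> \<le> \<bar>p2 Y Y\<bar>"
    by auto
  define l where "l = p2 Y Y"
  have Y1: "Y \<bullet> Y = 1" using Y(2) by (simp add: norm_eq_1)
  have bd: "\<bar>p2 z z\<bar> \<le> \<bar>l\<bar> * (z \<bullet> z)" if z: "z \<in> H" for z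
  proof (cases "z = 0")
    case False
    have "\<bar>p2 (z /\<^sub>R norm z) (z /\<^sub>R norm z)\<bar> \<le> \<bar>l\<bar>"
      unfolding l_def using False subH z by (intro Ymax subspace_scale) auto
    then show ?thesis using False
      by (simp add: bilinearD[OF b2] abs_mult divide_simps power2_norm_eq_inner[symmetric] power2_eq_square mult_ac)
  qed (simp add: bil_zero_left[OF b2])
  have YX: "Y \<bullet> X = 0" "Y \<bullet> J X = 0" using Y(1) corth_sym unfolding H_def corth_def by auto
  \<comment> \<open>The maximum principle is applied to \<open>p2\<close> or to its negative,
    according to the sign of the extremal value.\<close>
  have p2YH: "p2 Y z = l * (Y \<bullet> z)" if z: "z \<in> H" for z
  proof (cases "l \<ge> 0")
    case True
    have "p2 z z \<le> l * (z \<bullet> z)" if "z \<in> H" for z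
      using bd[OF that] True by linarith
    moreover have "p2 Y Y = l * (Y \<bullet> Y)" by (simp only: Y1 l_def mult_1_right)
    ultimately show ?thesis by (rule symmetric_form_maximum[OF b2 s2 subH _ Y(1) _ z])
  next
    case False
    have sm: "- p2 x y = - p2 y x" for x y by (subst s2) (rule refl)
    have bm: "bilinear (\<lambda>x y. - p2 x y)"
      using b2 unfolding bilinear_def by (auto intro: linear_compose_neg)
    have "- p2 z z \<le> - l * (z \<bullet> z)" if "z \<in> H" for z
      using bd[OF that] False by (simp add: abs_if split: if_splits)
    moreover have "- p2 Y Y = - l * (Y \<bullet> Y)" by (simp only: Y1 l_def mult_1_right)
    ultimately have "- p2 Y z = - l * (Y \<bullet> z)"
      by (rule symmetric_form_maximum[OF bm sm subH _ Y(1) _ z])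
    then show ?thesis by simp
  qed
  have e2Y: "eigen p2 l Y"
    unfolding eigen_def
  proof
    fix z
    define z' where "z' = z - (z \<bullet> X) *\<^sub>R X - (z \<bullet> J X) *\<^sub>R J X"
    have z: "z = (z \<bullet> X) *\<^sub>R X + (z \<bullet> J X) *\<^sub>R J X + z'" and cz: "z' \<in> H"
      using complex_component[OF X1, of z] unfolding z'_def[symmetric] H_def by (auto simp: corth_sym)
    have "p2 Y z = p2 Y z'" by (subst z) (simp add: bilinearD[OF b2] p2_X_left)
    moreover have "Y \<bullet> z = Y \<bullet> z'" by (subst z) (simp add: inner_add_right YX)
    ultimately show "p2 Y z = l * (Y \<bullet> z)" using p2YH[OF cz] by simp
  qed
  have cXY: "corth X Y" using Y(1) by (simp add: H_def)
  have e1Y: "eigen p1 (1/r) Y" by (rule e1H[OF cXY])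
  have starY: "1 / r * (1 / r) * (z \<bullet> z) + l * p2 z z = z \<bullet> z" if z: "corth X z" "corth Y z" for z
  proof -
    have "p1 Y Y = 1 / r" "p1 z z = 1 / r * (z \<bullet> z)" "p1 Y z = 0" "p1 Y (J z) = 0"
      "p2 Y Y = l" "p2 Y z = 0" "p2 Y (J z) = 0"
      using e1Y e2Y e1H[OF z(1)] Y1 z(2) by (auto simp: eigen_def corth_def)
    with star[OF z(2)] Y1 show ?thesis by (simp only: mult_1 power2_eq_square mult_zero_left diff_zero mult.assoc)
  qed
  \<comment> \<open>The value 0 for \<open>l = 0\<close> is the right one: the maximum of the
    absolute value of \<open>p2\<close> on unit vectors of \<open>H\<close> is then 0.\<close>
  define m where "m = (if l = 0 then 0 else (1 - 1 / r * (1 / r)) / l)"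
  have p2K: "p2 z z = m * (z \<bullet> z)" if z: "corth X z" "corth Y z" for z
  proof (cases "l = 0")
    case True
    then show ?thesis using bd[of z] z(1) by (simp add: m_def H_def)
  next
    case False
    then show ?thesis using starY[OF z] by (simp add: m_def field_simps)
  qed
  obtain z0 where z0: "z0 \<bullet> z0 = 1" "corth z0 X" "corth z0 Y"
    using exists_corth_unit[of "[X, Y]"] dim6 by auto
  then have z0': "corth X z0" "corth Y z0" using corth_sym by auto
  have rel: "1 / r * (1 / r) + l * m = 1" using starY[OF z0'] p2K[OF z0'] z0 by simp
  have p2K': "p2 z w = m * (z \<bullet> w)" if z: "corth X z" "corth Y z" and w: "corth X w" "corth Y w" for z w
  proof -
    have "corth X (z + w)" "corth Y (z + w)" using z w by (auto simp: corth_def inner_add_right J_add)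
    from p2K[OF this] p2K[OF z] p2K[OF w] show ?thesis
      by (simp add: bilinearD[OF b2] s2[of w z] inner_add_left inner_add_right inner_commute[of w z] algebra_simps)
  qed
  have e2K: "eigen p2 m z" if z: "corth X z" "corth Y z" for z
    unfolding eigen_def
  proof
    fix w
    define w' where "w' = w - (w \<bullet> X) *\<^sub>R X - (w \<bullet> J X) *\<^sub>R J X"
    define w'' where "w'' = w' - (w' \<bullet> Y) *\<^sub>R Y - (w' \<bullet> J Y) *\<^sub>R J Y"
    have w: "w = (w \<bullet> X) *\<^sub>R X + (w \<bullet> J X) *\<^sub>R J X + w'" and cw: "corth X w'"
      using complex_component[OF X1, of w] unfolding w'_def[symmetric] by (auto simp: corth_sym)
    have w': "w' = (w' \<bullet> Y) *\<^sub>R Y + (w' \<bullet> J Y) *\<^sub>R J Y + w''" by (simp add: w''_def)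
    have cw': "corth Y w''" "corth X w''"
      using complex_component(1)[OF Y1, of w'] complex_component(2)[OF Y1, of X w'] cw cXY
      unfolding w''_def[symmetric] corth_sym[of Y w''] corth_sym[of X w''] corth_sym[of Y X]
        corth_sym[of w' X] by simp_all
    have zz: "z \<bullet> X = 0" "z \<bullet> J X = 0" "z \<bullet> Y = 0" "z \<bullet> J Y = 0"
      using z corth_sym unfolding corth_def by auto
    have "p2 z Y = 0" "p2 z (J Y) = 0"
      unfolding s2[of z Y] s2[of z "J Y"]
      using e2Y eigen_J[OF h2 e2Y] zz by (simp_all add: eigen_def inner_commute)
    then have "p2 z w' = p2 z w''" by (subst w') (simp add: bilinearD[OF b2])
    moreover have "z \<bullet> w' = z \<bullet> w''" by (subst w') (simp add: inner_add_right zz)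
    moreover have "p2 z w = p2 z w'" by (subst w) (simp add: bilinearD[OF b2] p2_X_left)
    moreover have "z \<bullet> w = z \<bullet> w'" by (subst w) (simp add: inner_add_right zz)
    ultimately show "p2 z w = m * (z \<bullet> w)" using p2K'[OF z cw'(2,1)] by simp
  qed
  show ?thesis
    by (rule that[OF Y1 cXY e1Y e2Y]) (use e1H e2K rel p2_X in \<open>auto simp: eigen_def\<close>)
qed

end

context hermitian_pair
begin

text \<open>\<open>LL\<close> is unchanged when the pair is rotated, so the normalised case applies,
  and rotating back keeps dot products. The outcome is three vectors of simultaneous eigenvalues in
  the plane, any two with dot product 1, the last one serving the whole remaining
  complement.\<close>

lemma common_eigenvectors:
  obtains e1 e2 l1 l2 m1 m2 n1 n2 where "e1 \<bullet> e1 = 1" "e2 \<bullet> e2 = 1" "corth e1 e2"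
    "eigen p1 l1 e1" "eigen p2 l2 e1" "eigen p1 m1 e2" "eigen p2 m2 e2"
    "\<And>z. corth e1 z \<Longrightarrow> corth e2 z \<Longrightarrow> eigen p1 n1 z \<and> eigen p2 n2 z"
    "l1 * m1 + l2 * m2 = 1" "l1 * n1 + l2 * n2 = 1" "m1 * n1 + m2 * n2 = 1"
proof -
  let ?N = "\<lambda>z. (p1 z z)\<^sup>2 + (p2 z z)\<^sup>2"
  have "bounded_bilinear p1" "bounded_bilinear p2"
    using b1 b2 bilinear_conv_bounded_bilinear by blast+
  then have cont: "continuous_on (sphere 0 1) ?N"
    by (intro continuous_intros bounded_bilinear.continuous_on[of p1] bounded_bilinear.continuous_on[of p2])
  have ne: "sphere (0::'m) 1 \<noteq> {}" by simp
  from continuous_attains_sup[OF compact_sphere ne cont]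
  obtain X where "X \<in> sphere 0 1" and "\<forall>z\<in>sphere 0 1. ?N z \<le> ?N X" by blast
  then have X: "norm X = 1" and Xmax: "\<And>z. norm z = 1 \<Longrightarrow> ?N z \<le> ?N X" by auto
  have X1: "X \<bullet> X = 1" using X by (simp add: norm_eq_1)
  define r where "r = sqrt (?N X)"
  have r2: "r\<^sup>2 = ?N X" and r0: "r \<ge> 0" by (simp_all add: r_def)
  have mx0: "?N z \<le> (r * (z \<bullet> z))\<^sup>2" for z
  proof (cases "z = 0")
    case True
    then show ?thesis by (simp add: bil_zero_left[OF b1] bil_zero_left[OF b2])
  next
    case False
    have "?N (z /\<^sub>R norm z) \<le> r\<^sup>2" unfolding r2 using False by (intro Xmax) simp
    then have "?N z / (norm z ^ 2)\<^sup>2 \<le> r\<^sup>2" using False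
      by (simp add: bilinearD[OF b1] bilinearD[OF b2] power2_eq_square divide_simps mult_ac)
    then show ?thesis using False
      by (simp add: power2_norm_eq_inner[symmetric] divide_simps power_mult_distrib)
  qed
  \<comment> \<open>The rotation that takes the value at \<open>X\<close> to \<open>(r, 0)\<close>;
    if both forms vanish at \<open>X\<close>, the identity will do.\<close>
  define c where "c = (if r = 0 then 1 else p1 X X / r)"
  define s where "s = (if r = 0 then 0 else p2 X X / r)"
  have cs: "c * c + s * s = 1"
  proof (cases "r = 0")
    case False
    then have "c * c + s * s = ?N X / r\<^sup>2"
      by (simp add: c_def s_def power2_eq_square add_divide_distrib)
    then show ?thesis using False by (simp only: r2[symmetric]) simp
  qed (simp add: c_def s_def)
  define q1 where "q1 x y = c * p1 x y + s * p2 x y" for x y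
  define q2 where "q2 x y = (- s) * p1 x y + c * p2 x y" for x y
  have hq: "hform q1" "hform q2"
    unfolding q1_def q2_def by (rule hform_combination[OF h1 h2])+
  have rot: "(c * a + s * b) * (c * a' + s * b') + ((- s) * a + c * b) * ((- s) * a' + c * b') = a * a' + b * b'"
    for a b a' b' :: real
  proof -
    have "(c * a + s * b) * (c * a' + s * b') + ((- s) * a + c * b) * ((- s) * a' + c * b')
        = (c * c + s * s) * (a * a' + b * b')" by (simp add: algebra_simps)
    then show ?thesis by (simp add: cs)
  qed
  have mx: "(q1 z z)\<^sup>2 + (q2 z z)\<^sup>2 \<le> (r * (z \<bullet> z))\<^sup>2" for z
    using mx0[of z] rot[of "p1 z z" "p2 z z" "p1 z z" "p2 z z"] by (simp add: q1_def q2_def power2_eq_square)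
  have LLq: "cwedge q1 q1 x y z w + cwedge q2 q2 x y z w = cwedge inner inner x y z w" for x y z w
  proof -
    have "cwedge q1 q1 x y z w + cwedge q2 q2 x y z w = cwedge p1 p1 x y z w + cwedge p2 p2 x y z w"
      unfolding cwedge_def q1_def q2_def
      using rot[of "p1 x w" "p2 x w" "p1 y z" "p2 y z"] rot[of "p1 x z" "p2 x z" "p1 y w" "p2 y w"]
        rot[of "p1 x (J w)" "p2 x (J w)" "p1 y (J z)" "p2 y (J z)"]
        rot[of "p1 x (J z)" "p2 x (J z)" "p1 y (J w)" "p2 y (J w)"] by linarith
    then show ?thesis using LL by simp
  qed
  have q1X: "q1 X X = r" and q2X: "q2 X X = 0"
  proof -
    show "q2 X X = 0" by (simp add: q2_def c_def s_def)
        (metis power2_less_0 r2 sum_power2_eq_zero_iff power_zero_numeral)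
    show "q1 X X = r"
    proof (cases "r = 0")
      case True
      then show ?thesis using r2 by (simp add: q1_def c_def s_def)
    next
      case False
      then have "q1 X X = ?N X / r" by (simp add: q1_def c_def s_def power2_eq_square add_divide_distrib)
      then show ?thesis using False unfolding r2[symmetric] by (simp add: power2_eq_square)
    qed
  qed
  interpret M: hermitian_pair_max J q1 q2 X r
    by unfold_locales (use hq dim6 LLq X1 q1X q2X r0 mx in auto)
  obtain Y l m where Y: "Y \<bullet> Y = 1" "corth X Y" "eigen q1 (1/r) Y" "eigen q2 l Y" "eigen q2 0 X"
    and K: "\<And>z. corth X z \<Longrightarrow> corth Y z \<Longrightarrow> eigen q1 (1/r) z \<and> eigen q2 m z"
    and lm: "1 / r * (1 / r) + l * m = 1"
    using M.eigenvectors by blast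
  have unrot: "eigen p1 (c * a - s * b) e" "eigen p2 (s * a + c * b) e" if "eigen q1 a e" "eigen q2 b e" for a b e
  proof -
    have "p1 e z = c * q1 e z - s * q2 e z" "p2 e z = s * q1 e z + c * q2 e z" for z
    proof -
      have "c * q1 e z - s * q2 e z = (c * c + s * s) * p1 e z" by (simp add: q1_def q2_def algebra_simps)
      then show "p1 e z = c * q1 e z - s * q2 e z" using cs by simp
      have "s * q1 e z + c * q2 e z = (c * c + s * s) * p2 e z" by (simp add: q1_def q2_def algebra_simps)
      then show "p2 e z = s * q1 e z + c * q2 e z" using cs by simp
    qed
    then show "eigen p1 (c * a - s * b) e" "eigen p2 (s * a + c * b) e"
      using that by (simp_all add: eigen_def algebra_simps)
  qed
  have dot: "(c * a - s * b) * (c * a' - s * b') + (s * a + c * b) * (s * a' + c * b') = a * a' + b * b'"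
    for a b a' b' :: real
  proof -
    have "(c * a - s * b) * (c * a' - s * b') + (s * a + c * b) * (s * a' + c * b')
        = (c * c + s * s) * (a * a' + b * b')" by (simp add: algebra_simps)
    then show ?thesis by (simp add: cs)
  qed
  show ?thesis
  proof (rule that[of X Y "c * r - s * 0" "s * r + c * 0" "c * (1/r) - s * l" "s * (1/r) + c * l"
        "c * (1/r) - s * m" "s * (1/r) + c * m"])
    show "eigen p1 (c * r - s * 0) X" "eigen p2 (s * r + c * 0) X"
      by (rule unrot[OF M.p1_X Y(5)])+
    show "eigen p1 (c * (1/r) - s * l) Y" "eigen p2 (s * (1/r) + c * l) Y"
      by (rule unrot[OF Y(3,4)])+
    show "eigen p1 (c * (1/r) - s * m) z \<and> eigen p2 (s * (1/r) + c * m) z" if "corth X z" "corth Y z" for z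
      using unrot K[OF that] by blast
  qed (use X1 Y lm M.r1 in \<open>simp_all only: dot, simp_all\<close>)
qed

end

section \<open>The pointwise alternative and its linearisation\<close>

context hermitian_space
begin

text \<open>For a unit vector \<open>e\<close>, the metric restricted to the complex line of
  \<open>e\<close> and extended by zero.\<close>

definition line_form :: "'m \<Rightarrow> 'm \<Rightarrow> 'm \<Rightarrow> real" where
  "line_form e x y = (x \<bullet> e) * (y \<bullet> e) + (x \<bullet> J e) * (y \<bullet> J e)"

definition unitary_frame :: "(3 \<Rightarrow> 'm) \<Rightarrow> bool" where
  "unitary_frame e \<longleftrightarrow> (\<forall>i. e i \<bullet> e i = 1) \<and> (\<forall>i j. i \<noteq> j \<longrightarrow> corth (e i) (e j))"

lemma unitary_frame_expansion:
  assumes dim: "DIM('m) = 6" and e: "unitary_frame e"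
  shows "z = (\<Sum>i\<in>UNIV. (z \<bullet> e i) *\<^sub>R e i + (z \<bullet> J (e i)) *\<^sub>R J (e i))"
proof -
  have u: "e i \<bullet> e i = 1" for i using e by (simp add: unitary_frame_def)
  have o: "e i \<bullet> e j = 0" "e i \<bullet> J (e j) = 0" if "i \<noteq> j" for i j
    using e that by (auto simp: unitary_frame_def corth_def)
  have o': "J (e i) \<bullet> e j = 0" for i j
    using o[of j i] by (cases "i = j") (auto simp: inner_commute)
  have o'': "e i \<bullet> J (e j) = 0" for i j
    using o[of i j] by (cases "i = j") auto
  have i1: "inj e" using u o(1) by (metis injI zero_neq_one)
  have i2: "inj (\<lambda>i. J (e i))"
  proof (rule injI)
    fix i j assume "J (e i) = J (e j)"
    then have "e i \<bullet> e j = 1" using Jorth[of "e i" "e j"] Jorth[of "e i" "e i"] u by simp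
    then show "i = j" using o(1) by force
  qed
  have dj: "range e \<inter> range (\<lambda>i. J (e i)) = {}"
  proof -
    have "e i \<noteq> J (e j)" for i j using u[of i] o''[of i j] by auto
    then show ?thesis by blast
  qed
  define S where "S = range e \<union> range (\<lambda>i. J (e i))"
  have S: "finite S" "card S = DIM('m)"
    using i1 i2 dj dim by (simp_all add: S_def card_Un_disjoint card_image)
  have uS: "s \<bullet> s = 1" if "s \<in> S" for s using that u by (auto simp: S_def Jorth)
  have oS: "s \<bullet> t = 0" if "s \<in> S" "t \<in> S" "s \<noteq> t" for s t
  proof -
    from that(1,2) consider (1) i j where "s = e i" "t = e j" | (2) i j where "s = e i" "t = J (e j)"
      | (3) i j where "s = J (e i)" "t = e j" | (4) i j where "s = J (e i)" "t = J (e j)"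
      unfolding S_def by blast
    then show ?thesis
    proof cases
      case 1 then show ?thesis using that(3) o(1)[of i j] by auto
    next
      case 4 then show ?thesis using that(3) o(1)[of i j] by (auto simp: Jorth)
    qed (simp_all add: o' o'')
  qed
  have bi: "bilinear (inner :: 'm \<Rightarrow> 'm \<Rightarrow> real)"
    by (simp add: bilinear_conv_bounded_bilinear bounded_bilinear_inner)
  have "z = (\<Sum>s\<in>S. (z \<bullet> s / (s \<bullet> s)) *\<^sub>R s)"
    by (rule orthogonal_basis_expansion[OF bi S(1) _ oS S(2)]) (simp_all add: uS)
  also have "\<dots> = (\<Sum>s\<in>S. (z \<bullet> s) *\<^sub>R s)" by (rule sum.cong) (simp_all add: uS)
  also have "\<dots> = (\<Sum>i\<in>UNIV. (z \<bullet> e i) *\<^sub>R e i) + (\<Sum>i\<in>UNIV. (z \<bullet> J (e i)) *\<^sub>R J (e i))"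
    unfolding S_def by (subst sum.union_disjoint) (use dj i1 i2 in \<open>simp_all add: sum.reindex\<close>)
  finally show ?thesis by (simp add: sum.distrib)
qed

lemma bilinear_anti_part: "bilinear \<alpha> \<Longrightarrow> bilinear (anti_part \<alpha>)"
proof -
  assume b: "bilinear \<alpha>"
  show ?thesis unfolding bilinear_def anti_part_def
    by (intro conjI allI linearI) (simp_all add: J_add J_scale bilinearD[OF b] field_simps)
qed

text \<open>The Hermitian parts have simultaneous eigenvalue vectors with pairwise dot product 1. If
  two complex orthogonal eigenvectors share their value, this value is a unit vector
  \<open>(c, s)\<close> and the first alternative holds; from dimension 8 on this always happens.
  What remains in dimension 6 is three distinct values; they are pairwise independent, and this
  kills the complementary parts \<open>q1\<close> and \<open>q2\<close>.\<close>

lemma kaehler_dichotomy: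
  assumes ba: "bilinear \<alpha>1" "bilinear \<alpha>2" and sa: "\<And>x y. \<alpha>1 x y = \<alpha>1 y x" "\<And>x y. \<alpha>2 x y = \<alpha>2 y x"
    and dim: "DIM('m) = 6 \<or> DIM('m) \<ge> 8"
    and K: "\<And>x y z w. wedge_defect \<alpha>1 x y z w + wedge_defect \<alpha>2 x y z w = wedge_defect inner x y z w"
  shows "(\<exists>c s. c\<^sup>2 + s\<^sup>2 = 1 \<and> (\<forall>x y. c * \<alpha>1 x y + s * \<alpha>2 x y = x \<bullet> y)) \<or>
    (DIM('m) = 6 \<and> (\<exists>e l m. unitary_frame e \<and>
      (\<forall>x y. \<alpha>1 x y = (\<Sum>i\<in>UNIV. l i * line_form (e i) x y)) \<and>
      (\<forall>x y. \<alpha>2 x y = (\<Sum>i\<in>UNIV. m i * line_form (e i) x y)) \<and>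
      (\<forall>i j. i \<noteq> j \<longrightarrow> l i * l j + m i * m j = 1) \<and> (\<forall>i. (l i)\<^sup>2 + (m i)\<^sup>2 \<noteq> 1)))"
    (is "?A \<or> ?B")
proof -
  define p1 where "p1 = inv_part \<alpha>1"
  define p2 where "p2 = inv_part \<alpha>2"
  define q1 where "q1 = anti_part \<alpha>1"
  define q2 where "q2 = anti_part \<alpha>2"
  have bi: "bilinear (inner :: 'm \<Rightarrow> 'm \<Rightarrow> real)"
    by (simp add: bilinear_conv_bounded_bilinear bounded_bilinear_inner)
  have bq: "bilinear q1" "bilinear q2" unfolding q1_def q2_def by (intro bilinear_anti_part ba)+
  have \<alpha>pq: "\<alpha>1 x y = p1 x y + q1 x y" "\<alpha>2 x y = p2 x y + q2 x y" for x y
    by (simp_all add: p1_def p2_def q1_def q2_def inv_part_def anti_part_def field_simps)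
  have hp: "hform p1" "hform p2" unfolding p1_def p2_def by (intro hform_inv_part ba sa)+
  have LL: "cwedge p1 p1 x y z w + cwedge p2 p2 x y z w = cwedge inner inner x y z w" for x y z w
    using cwedge_inv_inv[OF ba(1), of x y z w] cwedge_inv_inv[OF ba(2), of x y z w]
      cwedge_inv_inv[OF bi, of x y z w] K[of x y z w] K[of "J x" "J y" z w] K[of "J x" y "J z" w]
      K[of x "J y" "J z" w] unfolding p1_def p2_def inv_part_inner by linarith
  have LQ: "cwedge p1 q1 x y z w + cwedge p2 q2 x y z w = 0" for x y z w
  proof -
    have "cwedge inner (anti_part inner) x y z w = 0" by (simp add: cwedge_def anti_part_inner)
    then show ?thesis
      using cwedge_inv_anti[OF ba(1), of x y z w] cwedge_inv_anti[OF ba(2), of x y z w]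
      cwedge_inv_anti[OF bi, of x y z w] K[of x y z w] K[of "J x" "J y" z w] K[of "J x" y "J z" w]
      K[of x "J y" "J z" w] unfolding p1_def p2_def q1_def q2_def inv_part_inner by linarith
  qed
  interpret HP: hermitian_pair J p1 p2
    by unfold_locales (use hp LL dim in auto)
  obtain e1 e2 l1 l2 m1 m2 n1 n2 where E: "e1 \<bullet> e1 = 1" "e2 \<bullet> e2 = 1" "corth e1 e2"
    "eigen p1 l1 e1" "eigen p2 l2 e1" "eigen p1 m1 e2" "eigen p2 m2 e2"
    and EK: "\<And>z. corth e1 z \<Longrightarrow> corth e2 z \<Longrightarrow> eigen p1 n1 z \<and> eigen p2 n2 z"
    and rel: "l1 * m1 + l2 * m2 = 1" "l1 * n1 + l2 * n2 = 1" "m1 * n1 + m2 * n2 = 1"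
    using HP.common_eigenvectors by metis
  \<comment> \<open>The mixed identity \<open>LQ\<close> at an eigenvector: the value of
    \<open>(q1, q2)\<close> is orthogonal in the plane to the eigenvalue vector.\<close>
  have Qvanish: "l * q1 y z + m * q2 y z = 0"
    if x: "x \<bullet> x = 1" "eigen p1 l x" "eigen p2 m x" and z: "corth x z" for x y z l m
  proof -
    have "p1 x x = l" "p1 x z = 0" "p1 x (J x) = 0" "p1 x (J z) = 0"
      "p2 x x = m" "p2 x z = 0" "p2 x (J x) = 0" "p2 x (J z) = 0"
      using x z by (auto simp: eigen_def corth_def)
    then show ?thesis using LQ[of x y z x] by (simp add: cwedge_def)
  qed
  \<comment> \<open>The lines of \<open>e1\<close> and \<open>e2\<close> and their common complement
    span, so it is enough that \<open>(c, s)\<close> has dot product 1 with each eigenvalue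
    vector.\<close>
  have pU: "c * p1 z x + s * p2 z x = z \<bullet> x"
    if u: "c * l1 + s * l2 = 1" "c * m1 + s * m2 = 1" "c * n1 + s * n2 = 1" for c s x z
  proof -
    have eU: "c * p1 a x + s * p2 a x = a \<bullet> x" if "eigen p1 k1 a" "eigen p2 k2 a" "c * k1 + s * k2 = 1" for a k1 k2
    proof -
      have "c * p1 a x + s * p2 a x = (c * k1 + s * k2) * (a \<bullet> x)"
        using that(1,2) by (simp add: eigen_def algebra_simps)
      then show ?thesis using that by simp
    qed
    define z' where "z' = z - (z \<bullet> e1) *\<^sub>R e1 - (z \<bullet> J e1) *\<^sub>R J e1"
    define z'' where "z'' = z' - (z' \<bullet> e2) *\<^sub>R e2 - (z' \<bullet> J e2) *\<^sub>R J e2"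
    have zz: "z = (z \<bullet> e1) *\<^sub>R e1 + (z \<bullet> J e1) *\<^sub>R J e1 + ((z' \<bullet> e2) *\<^sub>R e2 + (z' \<bullet> J e2) *\<^sub>R J e2 + z'')"
      by (simp add: z''_def) (simp add: z'_def)
    have c1: "corth z' e1" unfolding z'_def by (rule complex_component(1)[OF E(1)])
    have c2: "corth z'' e2" unfolding z''_def by (rule complex_component(1)[OF E(2)])
    have c3: "corth z'' e1" unfolding z''_def
      by (rule complex_component(2)[OF E(2) _ c1]) (use E(3) corth_sym in blast)
    have "eigen p1 n1 z'' \<and> eigen p2 n2 z''" using EK[of z''] c2 c3 corth_sym by blast
    note eq = eU[OF E(4,5) u(1)] eU[OF eigen_J[OF hp(1) E(4)] eigen_J[OF hp(2) E(5)] u(1)]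
      eU[OF E(6,7) u(2)] eU[OF eigen_J[OF hp(1) E(6)] eigen_J[OF hp(2) E(7)] u(2)]
      eU[OF conjunct1[OF this] conjunct2[OF this] u(3)]
    define w where "w = (z \<bullet> e1) *\<^sub>R e1 + (z \<bullet> J e1) *\<^sub>R J e1 + ((z' \<bullet> e2) *\<^sub>R e2 + (z' \<bullet> J e2) *\<^sub>R J e2 + z'')"
    have "c * p1 w x + s * p2 w x = (z \<bullet> e1) * (c * p1 e1 x + s * p2 e1 x) + (z \<bullet> J e1) * (c * p1 (J e1) x + s * p2 (J e1) x)
       + (z' \<bullet> e2) * (c * p1 e2 x + s * p2 e2 x) + (z' \<bullet> J e2) * (c * p1 (J e2) x + s * p2 (J e2) x) + (c * p1 z'' x + s * p2 z'' x)"
      unfolding w_def by (simp add: bilinearD[OF HP.b1] bilinearD[OF HP.b2] algebra_simps)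
    also have "\<dots> = w \<bullet> x" unfolding eq w_def by (simp add: inner_add_left)
    finally show ?thesis using zz by (simp add: w_def)
  qed
  \<comment> \<open>Every \<open>z\<close> is a part complex orthogonal to \<open>e\<close> plus a
    part in the line of \<open>e\<close>, which is complex orthogonal to \<open>e'\<close>;
    \<open>Qvanish\<close> covers both with the same coefficients.\<close>
  have U2: ?A if e: "e \<bullet> e = 1" "e' \<bullet> e' = 1" "corth e e'" and eg: "eigen p1 c e" "eigen p2 s e" "eigen p1 c e'" "eigen p2 s e'"
    and u: "c * l1 + s * l2 = 1" "c * m1 + s * m2 = 1" "c * n1 + s * n2 = 1" and cs: "c\<^sup>2 + s\<^sup>2 = 1" for e e' c s
  proof -
    have "c * q1 y z + s * q2 y z = 0" for y z
    proof -
      define z' where "z' = z - (z \<bullet> e) *\<^sub>R e - (z \<bullet> J e) *\<^sub>R J e"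
      have zz: "z = (z \<bullet> e) *\<^sub>R e + (z \<bullet> J e) *\<^sub>R J e + z'" by (simp add: z'_def)
      have "corth e z'" unfolding z'_def using complex_component(1)[OF e(1)] corth_sym by blast
      then have 1: "c * q1 y z' + s * q2 y z' = 0" by (rule Qvanish[OF e(1) eg(1,2)])
      have "corth e' e" using e(3) corth_sym by blast
      then have 2: "c * q1 y e + s * q2 y e = 0" "c * q1 y (J e) + s * q2 y (J e) = 0"
        using Qvanish[OF e(2) eg(3,4)] corth_J(1) by blast+
      define w where "w = (z \<bullet> e) *\<^sub>R e + (z \<bullet> J e) *\<^sub>R J e + z'"
      have "c * q1 y w + s * q2 y w = (z \<bullet> e) * (c * q1 y e + s * q2 y e)
          + (z \<bullet> J e) * (c * q1 y (J e) + s * q2 y (J e)) + (c * q1 y z' + s * q2 y z')"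
        unfolding w_def by (simp add: bilinearD[OF bq(1)] bilinearD[OF bq(2)] algebra_simps)
      then show ?thesis using zz unfolding 1 2 by (simp add: w_def)
    qed
    then have "c * \<alpha>1 x y + s * \<alpha>2 x y = x \<bullet> y" for x y
      using pU[OF u, of x y] by (simp add: \<alpha>pq algebra_simps)
    then show ?A using cs by blast
  qed
  obtain e3 where e3: "e3 \<bullet> e3 = 1" "corth e3 e1" "corth e3 e2"
    using exists_corth_unit[of "[e1, e2]"] dim by auto
  then have e3': "corth e1 e3" "corth e2 e3" using corth_sym by auto
  note E3 = EK[OF e3']
  show ?thesis
  proof (cases "DIM('m) = 6")
    case False
    then obtain e4 where e4: "e4 \<bullet> e4 = 1" "corth e4 e1" "corth e4 e2" "corth e4 e3"
      using exists_corth_unit[of "[e1, e2, e3]"] dim by auto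
    then have e4': "corth e1 e4" "corth e2 e4" "corth e3 e4" using corth_sym by auto
    note E4 = EK[OF e4'(1,2)]
    \<comment> \<open>\<open>e3\<close> and \<open>e4\<close> share the eigenvalues
      \<open>n1\<close> and \<open>n2\<close>, so \<open>star\<close> makes this pair a unit
      vector.\<close>
    have "n1\<^sup>2 + n2\<^sup>2 = 1"
      using HP.star[OF e4'(3)] E3 E4 e3(1) e4(1) e4'(3) by (simp add: eigen_def corth_def power2_eq_square)
    then have ?A using U2[of e3 e4 n1 n2] E3 E4 e3(1) e4(1) e4'(3) rel
      by (simp add: mult.commute power2_eq_square)
    then show ?thesis ..
  next
    case True
    define e :: "3 \<Rightarrow> 'm" where "e i = (if i = 1 then e1 else if i = 2 then e2 else e3)" for i
    define l :: "3 \<Rightarrow> real" where "l i = (if i = 1 then l1 else if i = 2 then m1 else n1)" for i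
    define m :: "3 \<Rightarrow> real" where "m i = (if i = 1 then l2 else if i = 2 then m2 else n2)" for i
    have uf: "unitary_frame e"
      using E e3 e3' corth_sym[of e2 e1] unfolding unitary_frame_def forall_3 e_def by simp
    have eg: "eigen p1 (l i) (e i)" "eigen p2 (m i) (e i)" for i
      using E E3 exhaust_3[of i] by (auto simp: e_def l_def m_def)
    have r: "l i * l j + m i * m j = 1" if "i \<noteq> j" for i j
    proof -
      have "\<forall>i j. i \<noteq> j \<longrightarrow> l i * l j + m i * m j = 1"
        using rel unfolding forall_3 l_def m_def by (simp add: mult.commute)
      then show ?thesis using that by blast
    qed
    have pu: "l i * p1 x y + m i * p2 x y = x \<bullet> y" if "(l i)\<^sup>2 + (m i)\<^sup>2 = 1" for i x y
    proof (rule pU)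
      have "l i * l j + m i * m j = 1" for j using r[of i j] that by (cases "i = j") (auto simp: power2_eq_square)
      from this[of 1] this[of 2] this[of 3]
      show "l i * l1 + m i * l2 = 1" "l i * m1 + m i * m2 = 1" "l i * n1 + m i * n2 = 1"
        by (simp_all add: l_def m_def)
    qed
    have ue: "e i \<bullet> e i = 1" "i \<noteq> j \<Longrightarrow> corth (e i) (e j)" for i j using uf by (auto simp: unitary_frame_def)
    show ?thesis
    proof (cases "\<exists>i j. i \<noteq> j \<and> l i = l j \<and> m i = m j")
      case True
      then obtain i j where ij: "i \<noteq> j" "l i = l j" "m i = m j" by blast
      then have n: "(l i)\<^sup>2 + (m i)\<^sup>2 = 1" using r[of i j] by (simp add: power2_eq_square)
      have "l i * l k + m i * m k = 1" for k using r[of i k] n by (cases "i = k") (auto simp: power2_eq_square)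
      from this[of 1] this[of 2] this[of 3]
      have "l i * l1 + m i * l2 = 1" "l i * m1 + m i * m2 = 1" "l i * n1 + m i * n2 = 1"
        by (simp_all add: l_def m_def)
      then have ?A using U2[of "e i" "e j" "l i" "m i"] ue(1)[of i] ue(1)[of j] ue(2)[of i j] ij n eg[of i] eg[of j]
        by simp
      then show ?thesis ..
    next
      case False
      \<comment> \<open>Two parallel vectors with dot product 1 against the same third vector
        coincide.\<close>
      have det: "l j * m k - l k * m j \<noteq> 0" if "j \<noteq> k" "i \<noteq> j" "i \<noteq> k" for i j k
      proof
        assume d: "l j * m k - l k * m j = 0"
        have a: "l j * l i + m j * m i = 1" "l k * l i + m k * m i = 1" using r that by auto
        have "l j = l k" using a d by algebra
        moreover have "m j = m k" using a d by algebra
        ultimately show False using False that by blast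
      qed
      have Q0: "q1 y z = 0 \<and> q2 y z = 0" if z: "z = e i \<or> z = J (e i)" for i y z
      proof -
        obtain j k where jk: "j \<noteq> k" "i \<noteq> j" "i \<noteq> k"
        proof -
          have "\<forall>i::3. \<exists>j k. j \<noteq> k \<and> i \<noteq> j \<and> i \<noteq> k" unfolding forall_3
            by (intro conjI exI[of _ "1::3"] exI[of _ "2::3"] exI[of _ "3::3"]) (auto intro: exI[of _ "1::3"] exI[of _ "2::3"] exI[of _ "3::3"])
          then show ?thesis using that by blast
        qed
        have "corth (e j) z" "corth (e k) z" using z ue(2)[of j i] ue(2)[of k i] jk corth_J(1) by auto
        then have a: "l j * q1 y z + m j * q2 y z = 0" "l k * q1 y z + m k * q2 y z = 0"
          using Qvanish[OF ue(1) eg] by blast+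
        have "(l j * m k - l k * m j) * q1 y z = 0" using a by algebra
        moreover have "(l j * m k - l k * m j) * q2 y z = 0" using a by algebra
        ultimately show ?thesis using det[OF jk] by simp
      qed
      have Q0': "q1 y (e i) = 0" "q1 y (J (e i)) = 0" "q2 y (e i) = 0" "q2 y (J (e i)) = 0" for y i
        using Q0 by blast+
      have Qzero: "q1 y z = 0" "q2 y z = 0" for y z
        by (subst unitary_frame_expansion[OF \<open>DIM('m) = 6\<close> uf, of z],
            simp add: bilinearD[OF bq(1)] bilinearD[OF bq(2)] bil_sum_right[OF bq(1)] bil_sum_right[OF bq(2)] Q0')+
      have \<alpha>p: "\<alpha>1 x y = p1 x y" "\<alpha>2 x y = p2 x y" for x y by (simp_all add: \<alpha>pq Qzero)
      show ?thesis
      proof (cases "\<exists>i. (l i)\<^sup>2 + (m i)\<^sup>2 = 1")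
        case True
        then obtain i where i: "(l i)\<^sup>2 + (m i)\<^sup>2 = 1" by blast
        have ?A unfolding \<alpha>p
          by (rule exI[of _ "l i"], rule exI[of _ "m i"]) (use i pu[OF i] in blast)
        then show ?thesis ..
      next
        case no: False
        have ex: "p x y = (\<Sum>i\<in>UNIV. k i * line_form (e i) x y)"
          if p: "bilinear p" "hform p" and k: "\<And>i. eigen p (k i) (e i)" for p k x y
        proof -
          have "p (e i) y = k i * (y \<bullet> e i)" "p (J (e i)) y = k i * (y \<bullet> J (e i))" for i
            using k[of i] eigen_J[OF p(2) k[of i]] by (simp_all add: eigen_def inner_commute)
          then show ?thesis
            by (subst unitary_frame_expansion[OF \<open>DIM('m) = 6\<close> uf, of x])
              (simp add: bilinearD[OF p(1)] bil_sum_left[OF p(1)] line_form_def algebra_simps)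
        qed
        show ?thesis
          apply (rule disjI2, rule conjI, rule \<open>DIM('m) = 6\<close>, rule exI[of _ e], rule exI[of _ l], rule exI[of _ m])
          using uf ex[OF HP.b1 hp(1) eg(1)] ex[OF HP.b2 hp(2) eg(2)] r no unfolding \<alpha>p by blast
      qed
    qed
  qed
qed

text \<open>Put \<open>u\<close> itself into the last slot: of the four products only
  \<open>(u \<bullet> u) * b y z\<close> survives. So all rows of a nonzero form of this kind lie in
  one complex line.\<close>

lemma kaehler_form_kernel:
  assumes b: "bilinear b" and K: "\<And>x y z w. wedge_defect b x y z w = 0"
    and u: "\<And>z. b x z = u \<bullet> z" "u \<noteq> 0" and z: "corth u z"
  shows "b y z = 0"
proof -
  have "u \<bullet> z = 0" "u \<bullet> J z = 0" using z by (auto simp: corth_def)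
  then have "(u \<bullet> u) * b y z = 0"
    using K[of x y z u] by (simp add: wedge_defect_def wedge_form_def u)
  then show ?thesis using u(2) by simp
qed

text \<open>The wedge form of a multiple of the metric is a curvature tensor of constant curvature,
  which is not of Kaehler type in complex dimension at least two unless it is zero.\<close>

lemma kaehler_multiple_of_metric:
  assumes "DIM('m) \<ge> 4" and K: "\<And>x y z w. wedge_defect (\<lambda>x y. k * (x \<bullet> y)) x y z w = 0"
  shows "k = 0"
proof -
  obtain x :: 'm where x: "x \<bullet> x = 1" using exists_corth_unit[of "[]"] assms(1) by auto
  obtain y where y: "y \<bullet> y = 1" "corth y x" using exists_corth_unit[of "[x]"] assms(1) by auto
  then have "corth x y" using corth_sym by blast
  then show ?thesis
    using K[of x y y x] x y by (simp add: wedge_defect_def wedge_form_def corth_def inner_commute)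
qed

text \<open>If \<open>\<psi> z \<noteq> 0\<close> for some \<open>z\<close>, then \<open>\<psi>\<close> vanishes nowhere on a suitable complex line,
  on which it is nevertheless linear.\<close>

lemma cubic_form_kaehler_shift:
  assumes dim: "DIM('m) \<ge> 6"
    and t: "\<And>z. bilinear (t z)" "\<And>x y. linear (\<lambda>z. t z x y)"
    and sym: "\<And>x y z. t z x y = t z y x" "\<And>x y z. t z x y = t x z y"
    and K: "\<And>z x y w v. wedge_defect (\<lambda>x y. t z x y - \<psi> z * (x \<bullet> y)) x y w v = 0"
  shows "\<psi> Z = 0"
proof (rule ccontr)
  assume c: "\<psi> Z \<noteq> 0"
  define b where "b z x y = t z x y - \<psi> z * (x \<bullet> y)" for z x y
  have bb: "bilinear (b z)" for z
    unfolding bilinear_def b_def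
    by (intro conjI allI linearI) (simp_all add: bilinearD[OF t(1)] inner_add_left inner_add_right algebra_simps)
  have Kb: "wedge_defect (b z) x y w v = 0" for z x y w v
    using K[of z x y w v] unfolding b_def .
  have repr: "\<exists>u. \<forall>w. b z x w = u \<bullet> w" for z x
  proof (intro exI allI)
    fix w
    show "b z x w = (\<Sum>i\<in>Basis. b z x i *\<^sub>R i) \<bullet> w"
      by (subst euclidean_representation[of w, symmetric])
        (simp add: bil_sum_right[OF bb] bil_scale_right[OF bb] inner_sum_left inner_sum_right
          inner_commute[of _ w] mult.commute del: euclidean_representation)
  qed
  \<comment> \<open>All rows of \<open>b Z\<close> lie in the complex line of a single vector
    \<open>a\<close>, which is arbitrary when \<open>b Z\<close> is zero.\<close>
  have "\<exists>a. \<forall>y w. corth a w \<longrightarrow> b Z y w = 0"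
  proof (cases "\<forall>x w. b Z x w = 0")
    case False
    then obtain x w where xw: "b Z x w \<noteq> 0" by blast
    obtain u where u: "\<And>w. b Z x w = u \<bullet> w" using repr by blast
    then have "u \<noteq> 0" using xw by auto
    then show ?thesis using kaehler_form_kernel[OF bb Kb u] by blast
  qed auto
  then obtain a where a: "\<And>y w. corth a w \<Longrightarrow> b Z y w = 0" by blast
  obtain Y where Y: "Y \<bullet> Y = 1" "corth Y a" "corth Y Z"
    using exists_corth_unit[of "[a, Z]"] dim by auto
  obtain X where X: "X \<bullet> X = 1" "corth X Y" "corth X Z"
    using exists_corth_unit[of "[Y, Z]"] dim by auto
  \<comment> \<open>Where \<open>b Z\<close> annihilates \<open>W\<close>, the symmetry of
    \<open>t\<close> computes the row of \<open>b W\<close> at \<open>Z\<close>.\<close>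
  have bYZ: "b W Z x = (\<psi> Z *\<^sub>R W - \<psi> W *\<^sub>R Z) \<bullet> x" if "corth a W" for W x
  proof -
    have "t Z W x = \<psi> Z * (W \<bullet> x)" using a[OF that, of x] sym(1)[of Z x W] by (simp add: b_def inner_commute)
    then show ?thesis using sym(2)[of W Z x] by (simp add: b_def inner_diff_left)
  qed
  \<comment> \<open>If \<open>\<psi> W = 0\<close>, that row is a multiple of \<open>W\<close>,
    hence complex orthogonal to \<open>Z\<close>, and \<open>b W W Z\<close> must vanish; but it
    equals \<open>\<psi> Z * (W \<bullet> W)\<close>.\<close>
  have ne: "\<psi> W \<noteq> 0" if W: "corth a W" "corth W Z" "W \<noteq> 0" for W
  proof
    assume 0: "\<psi> W = 0"
    have "b W W Z = 0"
      by (rule kaehler_form_kernel[OF bb Kb bYZ[OF W(1)]]) (use 0 c W in \<open>auto simp: corth_def\<close>)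
    moreover have "b W W Z = b W Z W" using sym(1)[of W W Z] by (simp add: b_def inner_commute)
    ultimately show False using bYZ[OF W(1), of W] 0 c W(3) by simp
  qed
  have tX: "t W X X = \<psi> W" if W: "corth a W" "corth W Z" "W \<noteq> 0" "corth W X" for W
  proof -
    have "b W X X = 0"
    proof (rule kaehler_form_kernel[OF bb Kb bYZ[OF W(1)]])
      show "\<psi> Z *\<^sub>R W - \<psi> W *\<^sub>R Z \<noteq> 0"
      proof
        assume "\<psi> Z *\<^sub>R W - \<psi> W *\<^sub>R Z = 0"
        then have "(\<psi> Z *\<^sub>R W - \<psi> W *\<^sub>R Z) \<bullet> W = 0" by simp
        then show False using W(2,3) c by (simp add: inner_diff_left inner_diff_right corth_def inner_commute)
      qed
      show "corth (\<psi> Z *\<^sub>R W - \<psi> W *\<^sub>R Z) X"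
        using W(4) X(3) corth_sym[of X Z] by (simp add: corth_def inner_diff_left)
    qed
    then show ?thesis using X(1) by (simp add: b_def)
  qed
  \<comment> \<open>The combination that \<open>\<psi>\<close> would annihilate if it were linear on
    the line of \<open>Y\<close>. It is annihilated by \<open>t _ X X\<close>, which is linear and
    agrees with \<open>\<psi>\<close> there.\<close>
  define W where "W = \<psi> (J Y) *\<^sub>R Y - \<psi> Y *\<^sub>R J Y"
  have cY: "corth a Y" "corth Y X" "corth a (J Y)" "corth (J Y) X" "corth (J Y) Z"
    using Y X corth_sym corth_J by blast+
  have JY0: "J Y \<noteq> 0" "Y \<noteq> 0" using Y(1) Jorth[of Y Y] by auto
  have p: "\<psi> Y \<noteq> 0" "\<psi> (J Y) \<noteq> 0" using ne cY Y JY0 by blast+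
  have cW: "corth a W" "corth W Z" "corth W X"
    using cY Y(3) by (simp_all add: W_def corth_def inner_diff_left inner_diff_right J_diff J_scale)
  have "W \<bullet> Y = \<psi> (J Y)" using Y(1) by (simp add: W_def inner_diff_left)
  then have W0: "W \<noteq> 0" using p by auto
  have "t W X X = \<psi> (J Y) * t Y X X - \<psi> Y * t (J Y) X X"
    unfolding W_def by (simp add: linear_diff[OF t(2)] linear_cmul[OF t(2)])
  also have "\<dots> = 0" using tX cY Y(3) JY0 by simp
  finally show False using tX[OF cW(1,2) W0 cW(3)] ne[OF cW(1,2) W0] by simp
qed

text \<open>The Kaehler condition on the curvature, linearised at the second fundamental form of a product of
  three surfaces.\<close>

lemma linearised_kaehler_invariant:
  assumes dim: "DIM('m) = 6" and e: "unitary_frame e"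
    and t: "\<And>j. bilinear (t j)" "\<And>j x y. t j x y = t j y x"
    and c: "\<And>j. c j \<noteq> 0" and F: "\<And>x y. (\<Sum>j\<in>UNIV. t j x y / c j) = 0"
    and R': "\<And>x y z w. R' x y z w = (\<Sum>j\<in>UNIV. line_form (e j) y z * t j x w + line_form (e j) x w * t j y z
        - line_form (e j) y w * t j x z - line_form (e j) x z * t j y w)"
    and K: "\<And>x y z w. R' x y z w = R' x y (J z) (J w)"
  shows "t k (J x) (J y) = t k x y"
proof -
  \<comment> \<open>In dimension 6 this is the complex line of \<open>e i\<close>.\<close>
  define D where "D i = {x. \<forall>j. j \<noteq> i \<longrightarrow> corth (e j) x}" for i
  have DJ: "J x \<in> D i" if "x \<in> D i" for x i using that corth_J(1) by (auto simp: D_def)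
  have Dadd: "x + y \<in> D i" if "x \<in> D i" "y \<in> D i" for x y i
    using that by (auto simp: D_def corth_def inner_add_right J_add)
  have De: "e i \<in> D i" for i using e by (auto simp: D_def unitary_frame_def)
  have th0: "line_form (e j) x y = 0" "line_form (e j) y x = 0" if "x \<in> D i" "j \<noteq> i" for i j x y
    using that unfolding D_def corth_def line_form_def by (auto simp: inner_commute[of x] J_inner)
  have tot: "x \<bullet> y = (\<Sum>j\<in>UNIV. line_form (e j) x y)" for x y
    by (subst unitary_frame_expansion[OF dim e, of y])
      (simp add: inner_sum_right inner_add_right line_form_def mult.commute)
  have thi: "line_form (e i) x y = x \<bullet> y" if "x \<in> D i" for i x y
    unfolding tot[of x y] by (subst sum.remove[of _ i]) (auto simp: th0[OF that])
  have sum_only: "(\<Sum>j\<in>UNIV. f j) = f i + f i'" if "i \<noteq> i'" "\<And>j. j \<noteq> i \<Longrightarrow> j \<noteq> i' \<Longrightarrow> f j = 0" for f :: "3 \<Rightarrow> real" and i i'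
  proof -
    have "sum f UNIV = sum f {i, i'}" using that by (intro sum.mono_neutral_right) auto
    then show ?thesis using that(1) by simp
  qed
  have orth: "x \<bullet> y = 0" if "x \<in> D i" "y \<in> D j" "i \<noteq> j" for x y i j
    unfolding thi[OF that(1), symmetric] using th0(2)[OF that(2,3)] by simp
  \<comment> \<open>The arguments come from two different lines; after inserting \<open>J\<close>
    every line form in \<open>R'\<close> vanishes.\<close>
  have dia: "(y \<bullet> y) * t j x x + (x \<bullet> x) * t i y y = 0" if x: "x \<in> D i" and y: "y \<in> D j" and ij: "i \<noteq> j" for i j x y
  proof -
    have A: "R' x y y x = (y \<bullet> y) * t j x x + (x \<bullet> x) * t i y y"
      unfolding R' by (subst sum_only[OF ij])
        (use ij th0[OF x] th0[OF y] thi[OF x] thi[OF y] in \<open>auto simp: orth[OF x y ij] orth[OF y x ij[symmetric]]\<close>)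
    have B: "R' x y (J y) (J x) = 0"
      unfolding R' by (subst sum_only[OF ij])
        (use ij th0[OF x] th0[OF y] thi[OF x] thi[OF y] orth[OF x DJ[OF y] ij] orth[OF y DJ[OF x] ij[symmetric]] th0[OF DJ[OF x]] th0[OF DJ[OF y]] in auto)
    show ?thesis using K[of x y y x] A B by simp
  qed
  have dinv: "t j (J x) (J x) = t j x x" if x: "x \<in> D i" and ij: "i \<noteq> j" for i j x
  proof -
    have "e j \<bullet> e j = 1" using e by (simp add: unitary_frame_def)
    then show ?thesis using dia[OF x De[of j] ij] dia[OF DJ[OF x] De[of j] ij] by (simp add: Jorth)
  qed
  have dinv2: "t j (J x) (J y) = t j x y" if x: "x \<in> D i" and y: "y \<in> D i" and ij: "i \<noteq> j" for i j x y
    using dinv[OF Dadd[OF x y] ij] dinv[OF x ij] dinv[OF y ij]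
    by (simp add: J_add bilinearD[OF t(1)] t(2)[of _ y x] t(2)[of _ "J y" "J x"])
  \<comment> \<open>The relation \<open>F\<close> expresses \<open>t i\<close> through the other two
    forms, whose invariance on the line \<open>D i\<close> is already known.\<close>
  have dinv3: "t i (J x) (J y) = t i x y" if x: "x \<in> D i" and y: "y \<in> D i" for i x y
  proof -
    have "t i x y / c i = - (\<Sum>j\<in>UNIV - {i}. t j x y / c j)" for x y
      using F[of x y] by (subst (asm) sum.remove[of _ i]) auto
    moreover have "(\<Sum>j\<in>UNIV - {i}. t j (J x) (J y) / c j) = (\<Sum>j\<in>UNIV - {i}. t j x y / c j)"
      using dinv2[OF x y] by (intro sum.cong) auto
    ultimately have "t i (J x) (J y) / c i = t i x y / c i" by simp
    then show ?thesis using c[of i] by simp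
  qed
  have off0: "t k x y = 0" if x: "x \<in> D i" and y: "y \<in> D j" and d: "i \<noteq> j" "i \<noteq> k" "j \<noteq> k" for i j k x y
  proof -
    have z: "e k \<in> D k" "e k \<bullet> e k = 1" using De e by (auto simp: unitary_frame_def)
    have "R' x (e k) (e k) y = t k x y"
      unfolding R' by (subst sum_only[OF d(2)])
        (use d th0[OF x] th0[OF y] th0[OF z(1)] thi[OF x] thi[OF z(1)] orth[OF x y d(1)] orth[OF z(1) y] z orth[OF x z(1)] in auto)
    moreover have "R' x (e k) (J (e k)) (J y) = 0"
      unfolding R' by (subst sum_only[OF d(2)])
        (use d th0[OF x] th0[OF DJ[OF y]] th0[OF z(1)] thi[OF x] thi[OF z(1)] orth[OF x DJ[OF y] d(1)] orth[OF z(1) DJ[OF y]]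
          orth[OF x DJ[OF z(1)]] th0[OF DJ[OF z(1)]] in auto)
    ultimately show ?thesis using K[of x "e k" "e k" y] by simp
  qed
  \<comment> \<open>The Kaehler identity with \<open>x\<close> and \<open>J x\<close> in one line
    and \<open>y\<close> in another compares the two values directly.\<close>
  have off1: "t i (J x) (J y) = t i x y" if x: "x \<in> D i" and y: "y \<in> D j" and ij: "i \<noteq> j" for i j x y
  proof (cases "x = 0")
    case True
    then show ?thesis by (simp add: J_zero bil_zero_left[OF t(1)])
  next
    case False
    have A: "R' x (J x) x (J y) = - ((x \<bullet> x) * t i (J x) (J y))"
      unfolding R' by (subst sum_only[OF ij])
        (use ij th0[OF x] th0[OF DJ[OF x]] th0[OF DJ[OF y]] thi[OF x] thi[OF DJ[OF x]] orth[OF x DJ[OF y] ij] orth[OF DJ[OF x] DJ[OF y] ij] in auto)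
    have neg: "line_form a z (- y) = - line_form a z y" for a z by (simp add: line_form_def)
    have B: "R' x (J x) (J x) (J (J y)) = - ((x \<bullet> x) * t i x y)"
      unfolding R' J2 by (subst sum_only[OF ij])
        (use ij th0[OF x] th0[OF DJ[OF x]] thi[OF x] thi[OF DJ[OF x]] orth[OF x y ij] orth[OF DJ[OF x] y ij] Jorth
          th0[OF y] in \<open>auto simp: bil_neg_right[OF t(1)] neg\<close>)
    show ?thesis using K[of x "J x" x "J y"] False unfolding A B by simp
  qed
  have all: "t k (J x) (J y) = t k x y" if x: "x \<in> D i" and y: "y \<in> D j" for i j k x y
  proof -
    consider "i = j" "i = k" | "i = j" "i \<noteq> k" | "i \<noteq> j" "k = i" | "i \<noteq> j" "k = j" | "i \<noteq> j" "i \<noteq> k" "j \<noteq> k" by blast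
    then show ?thesis
    proof cases
      case 1 then show ?thesis using dinv3 x y by blast
    next
      case 2 then show ?thesis using dinv2 x y by blast
    next
      case 3 then show ?thesis using off1 x y by blast
    next
      case 4 then show ?thesis using off1[OF y x] t(2)[of k x y] t(2)[of k "J x" "J y"] by simp
    next
      case 5 then show ?thesis using off0[OF x y] off0[OF DJ[OF x] DJ[OF y]] by simp
    qed
  qed
  define pr where "pr z i = (z \<bullet> e i) *\<^sub>R e i + (z \<bullet> J (e i)) *\<^sub>R J (e i)" for z i
  have prD: "pr z i \<in> D i" for z i
  proof -
    have "r *\<^sub>R v \<in> D i" if "v \<in> D i" for r v using that by (auto simp: D_def corth_def J_scale)
    then show ?thesis unfolding pr_def using De DJ Dadd by blast
  qed
  have ex: "z = (\<Sum>i\<in>UNIV. pr z i)" for z unfolding pr_def by (rule unitary_frame_expansion[OF dim e])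
  have split: "B x y = (\<Sum>i\<in>UNIV. \<Sum>j\<in>UNIV. B (pr x i) (pr y j))" if B: "bilinear B"
    for B :: "'m \<Rightarrow> 'm \<Rightarrow> real"
  proof -
    have "B x y = B (\<Sum>i\<in>UNIV. pr x i) (\<Sum>j\<in>UNIV. pr y j)" by (simp only: ex[symmetric])
    then show ?thesis unfolding bil_sum_left[OF B] unfolding bil_sum_right[OF B] .
  qed
  have "bilinear (\<lambda>x y. t k (J x) (J y))"
    unfolding bilinear_def
    by (intro conjI allI linearI) (simp_all add: J_add J_scale bilinearD[OF t(1)])
  from split[OF this]
  have "t k (J x) (J y) = (\<Sum>i\<in>UNIV. \<Sum>j\<in>UNIV. t k (J (pr x i)) (J (pr y j)))" .
  also have "\<dots> = (\<Sum>i\<in>UNIV. \<Sum>j\<in>UNIV. t k (pr x i) (pr y j))" by (simp add: all[OF prD prD])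
  also have "\<dots> = t k x y" by (rule split[OF t(1), symmetric])
  finally show ?thesis .
qed

end

text \<open>\<open>J\<close> can be moved from one slot to another at the cost of a sign. Passing it
  once around the three slots returns the same value after an odd number of signs.\<close>

lemma trilinear_J_invariant_zero:
  fixes s :: "'m::real_vector \<Rightarrow> 'm \<Rightarrow> 'm \<Rightarrow> real"
  assumes b: "\<And>z. bilinear (s z)" and sym: "\<And>x y z. s x y z = s y x z" "\<And>x y z. s x y z = s x z y"
    and J: "\<And>x. J (J x) = - x" "\<And>x y z. s z (J x) (J y) = s z x y"
  shows "s x y z = 0"
proof -
  have sw: "s z (J x) y = - s z x (J y)" for x y z
    using J(2)[of z x "J y"] by (simp add: J(1) bil_neg_right[OF b])
  have "s x (J y) z = 0" for x y z
  proof -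
  have "s x (J y) z = - s x y (J z)" by (rule sw)
  also have "s x y (J z) = s y (J z) x" using sym by metis
  also have "\<dots> = - s y z (J x)" by (rule sw)
  also have "s y z (J x) = s z (J x) y" using sym by metis
  also have "\<dots> = - s z x (J y)" by (rule sw)
  also have "s z x (J y) = s x (J y) z" using sym by metis
  finally show ?thesis by simp
  qed
  from this[of x "J y" z] show ?thesis by (simp add: J(1) bil_neg_left[OF b])
qed

section \<open>Kaehler submanifolds of hyperbolic space in a chart\<close>

lemma riesz_form:
  fixes g :: "'a::euclidean_space \<Rightarrow> 'a \<Rightarrow> real"
  assumes b: "bilinear g" and sym: "\<And>x y. g x y = g y x" and pos: "\<And>x. x \<noteq> 0 \<Longrightarrow> g x x > 0"
    and \<phi>: "linear \<phi>"
  shows "\<exists>s. \<forall>w. g s w = \<phi> w"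
proof -
  obtain B :: "'a \<Rightarrow> 'a" where B: "linear B" "bij B" "\<And>u v. g (B u) (B v) = u \<bullet> v"
    using linear_isometry_from_inner[OF b sym pos] by blast
  define s where "s = B (\<Sum>i\<in>Basis. \<phi> (B i) *\<^sub>R i)"
  have "g s w = \<phi> w" for w
  proof -
    obtain v where w: "w = B v" using B(2) by (metis bij_pointE)
    have "\<phi> (B v) = (\<Sum>i\<in>Basis. (v \<bullet> i) * \<phi> (B i))"
      by (subst euclidean_representation[of v, symmetric])
        (simp add: linear_sum[OF B(1)] linear_cmul[OF B(1)] linear_sum[OF \<phi>] linear_cmul[OF \<phi>]
          del: euclidean_representation)
    then show ?thesis unfolding s_def w B(3)
      by (simp add: inner_sum_left inner_sum_right inner_commute[of _ v] mult.commute)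
  qed
  then show ?thesis by blast
qed

lemma form_eqI:
  assumes b: "bilinear g" and pos: "\<And>x. x \<noteq> 0 \<Longrightarrow> g x x > (0::real)" and e: "\<And>w. g x w = g y w"
  shows "x = y"
  using pos[of "x - y"] e[of "x - y"] by (force simp: bil_diff_left[OF b])

lemma has_derivative_locally_constant:
  assumes "open S" "x \<in> S" "(f has_derivative f') (at x)" "\<And>y. y \<in> S \<Longrightarrow> f y = c"
  shows "f' u = 0"
proof -
  have "((\<lambda>y. c) has_derivative f') (at x)"
    using has_derivative_cong_open[OF assms(1,2), of f "\<lambda>y. c" f'] assms(3,4) by simp
  then show ?thesis using has_derivative_unique[OF _ has_derivative_const] by metis
qed

lemma has_derivative_lorentz:
  assumes "(f has_derivative f') (at x)" "(g has_derivative g') (at x)"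
  shows "((\<lambda>y. lorentz (f y) (g y)) has_derivative (\<lambda>u. lorentz (f x) (g' u) + lorentz (f' u) (g x))) (at x)"
  by (rule bounded_bilinear.FDERIV[OF bounded_bilinear_lorentz assms])

text \<open>The immersion read in coordinates on an open set \<open>U\<close>. The alternative
  \<open>dim_m\<close> stands for an even dimension of at least 6, evenness excluding 7.\<close>

locale hyperbolic_chart =
  fixes U :: "'m::euclidean_space set" and F :: "'m \<Rightarrow> 'h::euclidean_space \<times> real"
    and h :: "'m \<Rightarrow> 'm \<Rightarrow> 'm \<Rightarrow> real" and J :: "'m \<Rightarrow> 'm \<Rightarrow> 'm"
  assumes open_U: "open U" and F_smooth: "smooth_on F U"
    and F_hyp: "x \<in> U \<Longrightarrow> F x \<in> hyperbolic_space"
    and F_isom: "x \<in> U \<Longrightarrow> lorentz (frechet_derivative F (at x) u) (frechet_derivative F (at x) v) = h x u v"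
    and h_bil: "x \<in> U \<Longrightarrow> bilinear (h x)" and h_sym: "x \<in> U \<Longrightarrow> h x u v = h x v u"
    and h_pos: "x \<in> U \<Longrightarrow> u \<noteq> 0 \<Longrightarrow> h x u u > 0"
    and J_lin: "x \<in> U \<Longrightarrow> linear (J x)" and J_smooth: "smooth_on (\<lambda>x. J x u) U"
    and J_sq: "x \<in> U \<Longrightarrow> J x (J x u) = - u" and J_orth: "x \<in> U \<Longrightarrow> h x (J x u) (J x v) = h x u v"
    and J_par: "x \<in> U \<Longrightarrow> frechet_derivative (\<lambda>y. J y v) (at x) u
        + christoffel h x u (J x v) - J x (christoffel h x u v) = 0"
    and dim_h: "DIM('h) = DIM('m) + 2" and dim_m: "DIM('m) = 6 \<or> DIM('m) \<ge> 8"
begin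

definition D1 where "D1 x u = frechet_derivative F (at x) u"
definition D2 where "D2 x u v = frechet_derivative (\<lambda>y. D1 y v) (at x) u"
definition D3 where "D3 x u v w = frechet_derivative (\<lambda>y. D2 y v w) (at x) u"

lemma smooth_D1: "smooth_on (\<lambda>x. D1 x u) U"
  unfolding D1_def by (rule smooth_on_derivative[OF F_smooth])

lemma smooth_D2: "smooth_on (\<lambda>x. D2 x u v) U"
  unfolding D2_def by (rule smooth_on_derivative[OF smooth_D1])

lemma smooth_D3: "smooth_on (\<lambda>x. D3 x u v w) U"
  unfolding D3_def by (rule smooth_on_derivative[OF smooth_D2])

lemma deriv_F: "x \<in> U \<Longrightarrow> (F has_derivative D1 x) (at x)"
  using smooth_on_has_derivative[OF F_smooth] unfolding D1_def[abs_def] by (simp add: eta_contract_eq)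

lemma deriv_D1: "x \<in> U \<Longrightarrow> ((\<lambda>y. D1 y v) has_derivative (\<lambda>u. D2 x u v)) (at x)"
  using smooth_on_has_derivative[OF smooth_D1] unfolding D2_def by simp

lemma deriv_D2: "x \<in> U \<Longrightarrow> ((\<lambda>y. D2 y v w) has_derivative (\<lambda>u. D3 x u v w)) (at x)"
  using smooth_on_has_derivative[OF smooth_D2] unfolding D3_def by simp

lemma D1_linear: "x \<in> U \<Longrightarrow> linear (D1 x)"
  using deriv_F has_derivative_linear by blast

lemma D2_sym: "x \<in> U \<Longrightarrow> D2 x u v = D2 x v u"
  unfolding D2_def D1_def using smooth_on_symmetric_second_derivative[OF open_U _ F_smooth] by blast

lemma D2_bilinear: "x \<in> U \<Longrightarrow> bilinear (D2 x)"
proof -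
  assume x: "x \<in> U"
  have l: "linear (\<lambda>u. D2 x u v)" for v using deriv_D1[OF x] has_derivative_linear by blast
  then have "linear (D2 x v)" for v by (subst (asm) D2_sym[OF x]) (simp add: eta_contract_eq)
  with l show ?thesis by (simp add: bilinear_def)
qed

lemma D3_sym1: "x \<in> U \<Longrightarrow> D3 x u v w = D3 x v u w"
  unfolding D3_def D2_def using smooth_on_symmetric_second_derivative[OF open_U _ smooth_D1] by blast

lemma isom: "x \<in> U \<Longrightarrow> lorentz (D1 x u) (D1 x v) = h x u v"
  using F_isom by (simp add: D1_def)

lemma F_norm: "x \<in> U \<Longrightarrow> lorentz (F x) (F x) = -1"
  using F_hyp[of x] by (simp add: hyperboloid_def)

lemma F_D1: "x \<in> U \<Longrightarrow> lorentz (D1 x u) (F x) = 0"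
proof -
  assume x: "x \<in> U"
  have "lorentz (F x) (D1 x u) + lorentz (D1 x u) (F x) = 0"
    by (rule has_derivative_locally_constant[OF open_U x has_derivative_lorentz[OF deriv_F[OF x] deriv_F[OF x]]])
      (rule F_norm)
  then show ?thesis using lorentz_sym[of "F x" "D1 x u"] by simp
qed

lemma F_D2: "x \<in> U \<Longrightarrow> lorentz (D2 x u v) (F x) = - h x u v"
proof -
  assume x: "x \<in> U"
  have "lorentz (D1 x v) (D1 x u) + lorentz (D2 x u v) (F x) = 0"
    by (rule has_derivative_locally_constant[OF open_U x has_derivative_lorentz[OF deriv_D1[OF x] deriv_F[OF x]]])
      (rule F_D1)
  then show ?thesis using isom[OF x, of v u] h_sym[OF x, of u v] by simp
qed

lemma deriv_h:
  "x \<in> U \<Longrightarrow> ((\<lambda>y. h y v w) has_derivative (\<lambda>u. lorentz (D2 x u v) (D1 x w) + lorentz (D1 x v) (D2 x u w))) (at x)"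
proof -
  assume x: "x \<in> U"
  have "((\<lambda>y. lorentz (D1 y v) (D1 y w)) has_derivative (\<lambda>u. lorentz (D2 x u v) (D1 x w) + lorentz (D1 x v) (D2 x u w))) (at x)"
    using has_derivative_lorentz[OF deriv_D1[OF x] deriv_D1[OF x]] by (simp add: add.commute)
  then show ?thesis
    using has_derivative_cong_open[OF open_U x, of "\<lambda>y. h y v w" "\<lambda>y. lorentz (D1 y v) (D1 y w)"] isom by simp
qed

lemma D1_inj: "x \<in> U \<Longrightarrow> u \<noteq> 0 \<Longrightarrow> D1 x u \<noteq> 0"
  using h_pos[of x u] isom[of x u u] by (auto simp: lorentz_simps)

abbreviation \<Gamma> where "\<Gamma> \<equiv> christoffel h"

text \<open>\<open>christoffel\<close> is a definite description, so existence and uniqueness are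
  both required: the tangential part of the second derivative of \<open>F\<close> is a solution, and
  the Koszul formula gives uniqueness.\<close>

lemma christoffel_props:
  assumes x: "x \<in> U"
  shows \<Gamma>_bil: "bilinear (\<Gamma> x)" and \<Gamma>_sym: "\<Gamma> x u v = \<Gamma> x v u"
    and \<Gamma>_eq: "h x (\<Gamma> x u v) w = lorentz (D2 x u v) (D1 x w)"
proof -
  note hb = h_bil[OF x] and hs = h_sym[OF x] and hp = h_pos[OF x]
  have lD: "linear (\<lambda>w. lorentz z (D1 x w))" for z
    by (rule linearI) (simp_all add: linear_add[OF D1_linear[OF x]] linear_cmul[OF D1_linear[OF x]] lorentz_simps)
  have "\<exists>s. \<forall>w. h x s w = lorentz (D2 x u v) (D1 x w)" for u v
    by (rule riesz_form[OF hb hs _ lD]) (rule hp)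
  then have "\<exists>G. \<forall>u v w. h x (G u v) w = lorentz (D2 x u v) (D1 x w)"
    by metis
  then obtain G where G: "\<And>u v w. h x (G u v) w = lorentz (D2 x u v) (D1 x w)" by blast
  have eqI: "a = b" if "\<And>w. h x a w = h x b w" for a b by (rule form_eqI[of "h x", OF hb hp that])
  have G_sym: "G u v = G v u" for u v by (rule eqI) (simp add: G D2_sym[OF x, of u v])
  have lG: "linear (\<lambda>u. G u v)" for v
    by (rule linearI; rule eqI) (simp_all add: G bilinearD[OF hb] bilinearD[OF D2_bilinear[OF x]] lorentz_simps)
  then have "linear (G v)" for v by (subst (asm) G_sym) (simp add: eta_contract_eq)
  with lG have G_bil: "bilinear G" by (simp add: bilinear_def)
  have dh: "frechet_derivative (\<lambda>y. h y v w) (at x) u = lorentz (D2 x u v) (D1 x w) + lorentz (D1 x v) (D2 x u w)" for u v w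
    using fun_cong[OF frechet_derivative_at[OF deriv_h[OF x]]] by simp
  let ?P = "\<lambda>\<Gamma>. bilinear \<Gamma> \<and> (\<forall>u v. \<Gamma> u v = \<Gamma> v u) \<and>
     (\<forall>u v w. frechet_derivative (\<lambda>y. h y v w) (at x) u = h x (\<Gamma> u v) w + h x v (\<Gamma> u w))"
  have "?P G"
    using G_bil G_sym by (simp add: dh G hs[of _ "G _ _"] lorentz_sym)
  moreover have "\<Gamma>' = G" if "?P \<Gamma>'" for \<Gamma>'
  proof (intro ext eqI)
    fix u v w
    have k: "2 * h x (\<Gamma>' u v) w = frechet_derivative (\<lambda>y. h y v w) (at x) u
        + frechet_derivative (\<lambda>y. h y u w) (at x) v - frechet_derivative (\<lambda>y. h y u v) (at x) w"
      if "?P \<Gamma>'" for \<Gamma>'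
    proof -
      have s: "\<Gamma>' v u = \<Gamma>' u v" "\<Gamma>' w u = \<Gamma>' u w" "\<Gamma>' w v = \<Gamma>' v w" using that by blast+
      have d: "frechet_derivative (\<lambda>y. h y v w) (at x) u = h x (\<Gamma>' u v) w + h x v (\<Gamma>' u w)" for u v w
        using that by blast
      show ?thesis unfolding d s by (simp add: hs[of "\<Gamma>' u w"] hs[of u])
    qed
    show "h x (\<Gamma>' u v) w = h x (G u v) w" using k[OF that] k[OF \<open>?P G\<close>] by linarith
  qed
  ultimately have "christoffel h x = G" unfolding christoffel_def by (intro the_equality) auto
  then show "bilinear (\<Gamma> x)" "\<Gamma> x u v = \<Gamma> x v u" "h x (\<Gamma> x u v) w = lorentz (D2 x u v) (D1 x w)"
    using G G_bil G_sym by auto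
qed

text \<open>The normal part of the flat second derivative, including the component \<open>g(u, v) F\<close>.\<close>

definition A where "A x u v = D2 x u v - D1 x (\<Gamma> x u v)"

definition d\<Gamma> where "d\<Gamma> x u v w = frechet_derivative (\<lambda>y. \<Gamma> y v w) (at x) u"

definition dA where "dA x u v w = D3 x u v w - (D2 x u (\<Gamma> x v w) + D1 x (d\<Gamma> x u v w))"

text \<open>The shape operator of the normal vector \<open>A x v w\<close>, applied to
  \<open>u\<close>.\<close>

definition shape where "shape x v w u = (SOME s. \<forall>y. h x s y = lorentz (A x v w) (A x u y))"

text \<open>The derivative of \<open>A\<close> for the normal connection. By Weingarten the
  tangential part of \<open>dA\<close> is minus the image of \<open>shape\<close>, so adding that
  image leaves a normal vector.\<close>

definition nablaA where
  "nablaA x u v w = dA x u v w + D1 x (shape x v w u) - A x (\<Gamma> x u v) w - A x v (\<Gamma> x u w)"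

definition gauss where "gauss x u v w z = lorentz (A x u z) (A x v w) - lorentz (A x u w) (A x v z)"

text \<open>By \<open>\<Gamma>_eq\<close> the Christoffel symbols solve a nondegenerate linear
  system with differentiable coefficients.\<close>

lemma deriv_\<Gamma>:
  assumes x: "x \<in> U"
  shows "((\<lambda>y. \<Gamma> y v w) has_derivative (\<lambda>u. d\<Gamma> x u v w)) (at x)"
proof -
  have "(\<lambda>y. \<Gamma> y v w) differentiable (at x)"
  proof (rule linear_system_solution_differentiable[where I = "Basis" and U = U
        and B = "\<lambda>b y z. h y z b" and c = "\<lambda>b y. lorentz (D2 y v w) (D1 y b)"])
    show "linear (\<lambda>z. h y z b)" if "y \<in> U" for y b using h_bil[OF that] by (simp add: bilinear_def)
    show "(\<lambda>y. h y z b) differentiable (at x)" for z b using deriv_h[OF x] differentiable_def by blast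
    show "h y (\<Gamma> y v w) b = lorentz (D2 y v w) (D1 y b)" if "y \<in> U" for y b by (rule \<Gamma>_eq[OF that])
    show "(\<lambda>y. lorentz (D2 y v w) (D1 y b)) differentiable (at x)" for b
      using has_derivative_lorentz[OF deriv_D2[OF x] deriv_D1[OF x]] differentiable_def by blast
    show "z = 0" if z: "\<And>b. b \<in> Basis \<Longrightarrow> h x z b = 0" for z
    proof (rule ccontr)
      assume "z \<noteq> 0"
      have "h x z z = 0"
        by (subst (2) euclidean_representation[of z, symmetric])
          (simp add: bil_sum_right[OF h_bil[OF x]] bil_scale_right[OF h_bil[OF x]] z del: euclidean_representation)
      then show False using h_pos[OF x \<open>z \<noteq> 0\<close>] by simp
    qed
  qed (use open_U x in auto)
  then show ?thesis unfolding d\<Gamma>_def by (simp add: frechet_derivative_works)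
qed

lemma deriv_A:
  assumes x: "x \<in> U"
  shows "((\<lambda>y. A y v w) has_derivative (\<lambda>u. dA x u v w)) (at x)"
  unfolding A_def dA_def
  by (intro has_derivative_diff deriv_D2[OF x]
      has_derivative_linear_family[OF open_U x D1_linear deriv_D1[OF x] deriv_\<Gamma>[OF x]])

section \<open>The Gauss, Weingarten and Codazzi equations\<close>

context
  fixes x assumes x: "x \<in> U"
begin

lemmas hD = bilinearD[OF h_bil[OF x]] and \<Gamma>D = bilinearD[OF \<Gamma>_bil[OF x]]
  and D1D = linear_add[OF D1_linear[OF x]] linear_cmul[OF D1_linear[OF x]] linear_diff[OF D1_linear[OF x]]
    linear_neg[OF D1_linear[OF x]]
  and JD = linear_add[OF J_lin[OF x]] linear_cmul[OF J_lin[OF x]] linear_diff[OF J_lin[OF x]]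
    linear_neg[OF J_lin[OF x]]

lemma h_eqI: "(\<And>w. h x a w = h x b w) \<Longrightarrow> a = b"
  by (rule form_eqI[of "h x", OF h_bil[OF x] h_pos[OF x]])

lemma A_bil: "bilinear (A x)"
  unfolding bilinear_def A_def
  by (intro conjI allI linearI) (simp_all add: bilinearD[OF D2_bilinear[OF x]] \<Gamma>D D1D algebra_simps)

lemmas AD = bilinearD[OF A_bil]

lemma A_sym: "A x u v = A x v u"
  unfolding A_def using D2_sym[OF x] \<Gamma>_sym[OF x] by metis

lemma A_D1: "lorentz (A x u v) (D1 x w) = 0" "lorentz (D1 x w) (A x u v) = 0"
proof -
  show "lorentz (A x u v) (D1 x w) = 0" by (simp add: A_def lorentz_simps isom[OF x] \<Gamma>_eq[OF x])
  then show "lorentz (D1 x w) (A x u v) = 0" by (simp only: lorentz_sym)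
qed

lemma A_F: "lorentz (A x u v) (F x) = - h x u v" "lorentz (F x) (A x u v) = - h x u v"
proof -
  show "lorentz (A x u v) (F x) = - h x u v" by (simp add: A_def lorentz_simps F_D1[OF x] F_D2[OF x])
  then show "lorentz (F x) (A x u v) = - h x u v" by (simp only: lorentz_sym)
qed

lemma D2_A: "D2 x u v = A x u v + D1 x (\<Gamma> x u v)"
  by (simp add: A_def)

lemma shape_eq: "h x (shape x v w u) y = lorentz (A x v w) (A x u y)"
proof -
  have lin: "linear (\<lambda>y. lorentz (A x v w) (A x u y))"
    by (rule linearI) (simp_all add: AD lorentz_simps)
  have "\<exists>s. \<forall>y. h x s y = lorentz (A x v w) (A x u y)"
    by (rule riesz_form[OF h_bil[OF x] h_sym[OF x] _ lin]) (rule h_pos[OF x])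
  then have "\<forall>y. h x (shape x v w u) y = lorentz (A x v w) (A x u y)"
    unfolding shape_def by (rule someI_ex)
  then show ?thesis by blast
qed

lemma dA_D1: "lorentz (dA x u v w) (D1 x y) = - h x (shape x v w u) y"
proof -
  have "lorentz (A x v w) (D2 x u y) + lorentz (dA x u v w) (D1 x y) = 0"
    by (rule has_derivative_locally_constant[OF open_U x has_derivative_lorentz[OF deriv_A[OF x] deriv_D1[OF x]]])
      (rule hyperbolic_chart.A_D1[OF hyperbolic_chart_axioms])
  then show ?thesis by (simp add: shape_eq D2_A lorentz_simps A_D1)
qed

lemma deriv_h_\<Gamma>: "((\<lambda>y. h y v w) has_derivative (\<lambda>u. h x (\<Gamma> x u v) w + h x v (\<Gamma> x u w))) (at x)"
proof -
  have "lorentz (D2 x u v) (D1 x w) + lorentz (D1 x v) (D2 x u w) = h x (\<Gamma> x u v) w + h x v (\<Gamma> x u w)" for u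
    unfolding h_sym[OF x, of v "\<Gamma> x u w"] \<Gamma>_eq[OF x] lorentz_sym[of "D1 x v"] ..
  then show ?thesis using deriv_h[OF x, of v w] by simp
qed

lemma dA_F: "lorentz (dA x u v w) (F x) = - (h x (\<Gamma> x u v) w + h x v (\<Gamma> x u w))"
proof -
  have "((\<lambda>y. lorentz (A y v w) (F y) + h y v w) has_derivative (\<lambda>u. (lorentz (A x v w) (D1 x u) + lorentz (dA x u v w) (F x))
      + (h x (\<Gamma> x u v) w + h x v (\<Gamma> x u w)))) (at x)"
    by (intro has_derivative_add has_derivative_lorentz deriv_A[OF x] deriv_F[OF x] deriv_h_\<Gamma>)
  then have "(lorentz (A x v w) (D1 x u) + lorentz (dA x u v w) (F x)) + (h x (\<Gamma> x u v) w + h x v (\<Gamma> x u w)) = 0"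
    by (rule has_derivative_locally_constant[OF open_U x])
      (simp add: hyperbolic_chart.A_F[OF hyperbolic_chart_axioms])
  then show ?thesis by (simp add: A_D1)
qed

lemma nablaA_D1: "lorentz (nablaA x u v w) (D1 x y) = 0" "lorentz (D1 x y) (nablaA x u v w) = 0"
  unfolding lorentz_sym[of "D1 x y"]
  by (simp_all add: nablaA_def lorentz_simps dA_D1 isom[OF x] A_D1)

lemma nablaA_F: "lorentz (nablaA x u v w) (F x) = 0"
  by (simp add: nablaA_def lorentz_simps dA_F F_D1[OF x] A_F)

lemma shape_sym: "shape x v w u = shape x w v u"
  unfolding shape_def A_sym[of v w] ..

lemma dA_sym: "dA x u v w = dA x u w v"
proof -
  have "((\<lambda>y. A y w v) has_derivative (\<lambda>u. dA x u v w)) (at x)"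
    using has_derivative_cong_open[OF open_U x, of "\<lambda>y. A y v w" "\<lambda>y. A y w v"] deriv_A[OF x]
      hyperbolic_chart.A_sym[OF hyperbolic_chart_axioms] by blast
  from fun_cong[OF has_derivative_unique[OF this deriv_A[OF x]]] show ?thesis .
qed

lemma nablaA_sym2: "nablaA x u v w = nablaA x u w v"
  unfolding nablaA_def dA_sym[of u v w] shape_sym[of v w] A_sym[of v] A_sym[of "\<Gamma> x u v"] by simp

text \<open>By the symmetry of third derivatives of \<open>F\<close>, the antisymmetrisation of
  \<open>nablaA\<close> is the tangent vector \<open>D1 x q\<close>; but \<open>nablaA\<close> is
  normal, so both sides vanish. The left side gives Codazzi, the right side Gauss.\<close>

lemma codazzi_gauss:
  shows nablaA_sym1: "nablaA x u v w = nablaA x v u w"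
    and curvature_shape: "curvature h x u v w = shape x v w u - shape x u w v"
proof -
  define q where "q = shape x v w u - shape x u w v - curvature h x u v w"
  have cur: "curvature h x u v w = d\<Gamma> x u v w + \<Gamma> x u (\<Gamma> x v w) - (d\<Gamma> x v u w + \<Gamma> x v (\<Gamma> x u w))"
    by (simp add: curvature_def d\<Gamma>_def)
  have e: "nablaA x u v w - nablaA x v u w = D1 x q"
    unfolding nablaA_def dA_def q_def cur D2_A D3_sym1[OF x, of v u] \<Gamma>_sym[OF x, of v u]
    by (simp add: D1D A_sym[of u "\<Gamma> x v w"] A_sym[of v "\<Gamma> x u w"])
  have "h x q y = lorentz (nablaA x u v w - nablaA x v u w) (D1 x y)" for y
    by (simp add: e isom[OF x])
  then have "h x q y = h x 0 y" for y by (simp add: lorentz_simps nablaA_D1 hD)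
  then have "q = 0" by (rule h_eqI)
  then show "nablaA x u v w = nablaA x v u w" "curvature h x u v w = shape x v w u - shape x u w v"
    using e D1D(2)[of 0 0] by (simp_all add: q_def)
qed

lemma gauss_equation: "h x (curvature h x u v w) z = gauss x u v w z"
  unfolding curvature_shape gauss_def
  by (simp add: hD shape_eq lorentz_sym)

lemma deriv_J: "((\<lambda>y. J y w) has_derivative (\<lambda>u. J x (\<Gamma> x u w) - \<Gamma> x u (J x w))) (at x)"
proof -
  have "frechet_derivative (\<lambda>y. J y w) (at x) = (\<lambda>u. J x (\<Gamma> x u w) - \<Gamma> x u (J x w))"
  proof (rule ext)
    fix u
    have "frechet_derivative (\<lambda>y. J y w) (at x) u + \<Gamma> x u (J x w) = J x (\<Gamma> x u w)"
      using J_par[OF x, of w u] by simp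
    then show "frechet_derivative (\<lambda>y. J y w) (at x) u = J x (\<Gamma> x u w) - \<Gamma> x u (J x w)"
      by (simp only: eq_diff_eq)
  qed
  then show ?thesis using smooth_on_has_derivative[OF J_smooth x, of w] by simp
qed

end

text \<open>The Ricci identity for \<open>J\<close>: its mixed second derivatives agree, and by
  \<open>J_par\<close> their difference is the commutator of the curvature with
  \<open>J\<close>.\<close>

lemma curvature_J:
  assumes x: "x \<in> U"
  shows "curvature h x u v (J x w) = J x (curvature h x u v w)"
proof -
  have fd: "frechet_derivative (\<lambda>z. J z w) (at y) v = J y (\<Gamma> y v w) - \<Gamma> y v (J y w)" if "y \<in> U" for y v
    using fun_cong[OF frechet_derivative_at[OF deriv_J[OF that]]] by simp
  define E where "E u v = (J x (\<Gamma> x u (\<Gamma> x v w)) - \<Gamma> x u (J x (\<Gamma> x v w)) + J x (d\<Gamma> x u v w))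
      - (d\<Gamma> x u v (J x w) + \<Gamma> x v (J x (\<Gamma> x u w) - \<Gamma> x u (J x w)))" for u v
  have "((\<lambda>y. J y (\<Gamma> y v w) - \<Gamma> y v (J y w)) has_derivative (\<lambda>u. E u v)) (at x)" for v
    unfolding E_def
    by (intro has_derivative_diff has_derivative_linear_family[OF open_U x J_lin deriv_J[OF x] deriv_\<Gamma>[OF x]]
        has_derivative_linear_family[OF open_U x _ deriv_\<Gamma>[OF x] deriv_J[OF x]])
      (use \<Gamma>_bil in \<open>auto simp: bilinear_def\<close>)
  then have "((\<lambda>y. frechet_derivative (\<lambda>z. J z w) (at y) v) has_derivative (\<lambda>u. E u v)) (at x)" for v
    using has_derivative_cong_open[OF open_U x, of "\<lambda>y. frechet_derivative (\<lambda>z. J z w) (at y) v"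
        "\<lambda>y. J y (\<Gamma> y v w) - \<Gamma> y v (J y w)"] fd by simp
  then have "frechet_derivative (\<lambda>y. frechet_derivative (\<lambda>z. J z w) (at y) v) (at x) u = E u v" for u v
    using frechet_derivative_at by metis
  then have "E u v = E v u"
    using smooth_on_symmetric_second_derivative[OF open_U x J_smooth] by metis
  then show ?thesis
    unfolding E_def curvature_def d\<Gamma>_def[symmetric]
    by (simp add: linear_add[OF J_lin[OF x]] linear_diff[OF J_lin[OF x]] bilinearD[OF \<Gamma>_bil[OF x]] algebra_simps)
qed

lemma gauss_J: "x \<in> U \<Longrightarrow> gauss x u v (J x w) (J x z) = gauss x u v w z"
  unfolding gauss_equation[symmetric] curvature_J by (rule J_orth)

text \<open>The covariant derivative of \<open>gauss\<close> in the direction \<open>E\<close>, by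
  the product rule.\<close>

definition linearised_gauss where
  "linearised_gauss x E u v w z = lorentz (nablaA x E u z) (A x v w) + lorentz (A x u z) (nablaA x E v w)
     - lorentz (nablaA x E u w) (A x v z) - lorentz (A x u w) (nablaA x E v z)"

text \<open>The identity \<open>gauss_J\<close> is differentiated. All terms with Christoffel
  symbols are instances of \<open>gauss\<close> with one argument replaced, and cancel by
  \<open>gauss_J\<close> itself.\<close>

lemma linearised_gauss_J:
  assumes x: "x \<in> U"
  shows "linearised_gauss x E u v (J x w) (J x z) = linearised_gauss x E u v w z"
proof -
  have dA: "dA x E u v = nablaA x E u v - D1 x (shape x u v E) + A x (\<Gamma> x E u) v + A x u (\<Gamma> x E v)" for E u v
    by (simp add: nablaA_def)
  define dJ where "dJ E w = J x (\<Gamma> x E w) - \<Gamma> x E (J x w)" for E w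
  have dAJ: "((\<lambda>y. A y u (J y w)) has_derivative (\<lambda>E. dA x E u (J x w) + A x u (dJ E w))) (at x)" for u w
    unfolding dJ_def
    by (rule has_derivative_linear_family[OF open_U x _ deriv_A[OF x] deriv_J[OF x]])
      (use A_bil in \<open>auto simp: bilinear_def\<close>)
  have "((\<lambda>y. gauss y u v w z - gauss y u v (J y w) (J y z)) has_derivative
      (\<lambda>E. ((lorentz (A x u z) (dA x E v w) + lorentz (dA x E u z) (A x v w))
          - (lorentz (A x u w) (dA x E v z) + lorentz (dA x E u w) (A x v z)))
       - ((lorentz (A x u (J x z)) (dA x E v (J x w) + A x v (dJ E w)) + lorentz (dA x E u (J x z) + A x u (dJ E z)) (A x v (J x w)))
          - (lorentz (A x u (J x w)) (dA x E v (J x z) + A x v (dJ E z)) + lorentz (dA x E u (J x w) + A x u (dJ E w)) (A x v (J x z)))))) (at x)"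
    unfolding gauss_def
    by (intro has_derivative_diff has_derivative_lorentz deriv_A[OF x] dAJ)
  from has_derivative_locally_constant[OF open_U x this, of 0 E] gauss_J
  have 0: "((lorentz (A x u z) (dA x E v w) + lorentz (dA x E u z) (A x v w))
          - (lorentz (A x u w) (dA x E v z) + lorentz (dA x E u w) (A x v z)))
       = ((lorentz (A x u (J x z)) (dA x E v (J x w) + A x v (dJ E w)) + lorentz (dA x E u (J x z) + A x u (dJ E z)) (A x v (J x w)))
          - (lorentz (A x u (J x w)) (dA x E v (J x z) + A x v (dJ E z)) + lorentz (dA x E u (J x w) + A x u (dJ E w)) (A x v (J x z))))"
    by simp
  have L: "((lorentz (A x u z) (dA x E v w) + lorentz (dA x E u z) (A x v w))
          - (lorentz (A x u w) (dA x E v z) + lorentz (dA x E u w) (A x v z)))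
     = linearised_gauss x E u v w z + gauss x (\<Gamma> x E u) v w z + gauss x u (\<Gamma> x E v) w z + gauss x u v (\<Gamma> x E w) z + gauss x u v w (\<Gamma> x E z)"
    unfolding dA linearised_gauss_def gauss_def by (simp add: lorentz_simps A_D1[OF x])
  have R: "((lorentz (A x u (J x z)) (dA x E v (J x w) + A x v (dJ E w)) + lorentz (dA x E u (J x z) + A x u (dJ E z)) (A x v (J x w)))
          - (lorentz (A x u (J x w)) (dA x E v (J x z) + A x v (dJ E z)) + lorentz (dA x E u (J x w) + A x u (dJ E w)) (A x v (J x z))))
     = linearised_gauss x E u v (J x w) (J x z) + gauss x (\<Gamma> x E u) v (J x w) (J x z) + gauss x u (\<Gamma> x E v) (J x w) (J x z)
       + gauss x u v (J x (\<Gamma> x E w)) (J x z) + gauss x u v (J x w) (J x (\<Gamma> x E z))"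
    unfolding dA linearised_gauss_def gauss_def dJ_def by (simp add: lorentz_simps A_D1[OF x] bilinearD[OF A_bil[OF x]])
  show ?thesis using 0 unfolding L R gauss_J[OF x] by simp
qed

lemma dA_bil:
  assumes x: "x \<in> U" shows "bilinear (dA x u)"
proof -
  have l: "linear (\<lambda>v. dA x u v w)" for w
  proof (rule linearI)
    fix v v' c
    have "((\<lambda>y. A y (v + v') w) has_derivative (\<lambda>u. dA x u v w + dA x u v' w)) (at x)"
      using has_derivative_add[OF deriv_A[OF x, of v w] deriv_A[OF x, of v' w]]
        has_derivative_cong_open[OF open_U x, of "\<lambda>y. A y (v + v') w" "\<lambda>y. A y v w + A y v' w"]
        bil_add_left[OF A_bil] by blast
    from fun_cong[OF has_derivative_unique[OF deriv_A[OF x] this]] show "dA x u (v + v') w = dA x u v w + dA x u v' w" .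
    have "((\<lambda>y. A y (c *\<^sub>R v) w) has_derivative (\<lambda>u. c *\<^sub>R dA x u v w)) (at x)"
      using has_derivative_scaleR_right[OF deriv_A[OF x, of v w], of c]
        has_derivative_cong_open[OF open_U x, of "\<lambda>y. A y (c *\<^sub>R v) w" "\<lambda>y. c *\<^sub>R A y v w"]
        bil_scale_left[OF A_bil] by blast
    from fun_cong[OF has_derivative_unique[OF deriv_A[OF x] this]] show "dA x u (c *\<^sub>R v) w = c *\<^sub>R dA x u v w" .
  qed
  then have "linear (dA x u w)" for w by (subst (asm) dA_sym[OF x]) (simp add: eta_contract_eq)
  with l show ?thesis by (simp add: bilinear_def)
qed

lemma shape_linear:
  assumes x: "x \<in> U" shows "linear (\<lambda>v. shape x v w u)"
  by (rule linearI; rule h_eqI[OF x])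
    (simp_all add: shape_eq[OF x] bilinearD[OF h_bil[OF x]] bilinearD[OF A_bil[OF x]] lorentz_simps)

lemma nablaA_bil:
  assumes x: "x \<in> U" shows "bilinear (nablaA x u)"
proof -
  have l: "linear (\<lambda>v. nablaA x u v w)" for w
  proof -
    have "linear (\<lambda>v. D1 x (shape x v w u))"
      using linear_compose[OF shape_linear[OF x] D1_linear[OF x]] by (simp add: o_def)
    moreover have "linear (\<lambda>v. A x (\<Gamma> x u v) w)"
      by (rule linearI) (simp_all add: bilinearD[OF \<Gamma>_bil[OF x]] bilinearD[OF A_bil[OF x]])
    moreover have "linear (\<lambda>v. A x v (\<Gamma> x u w))" "linear (\<lambda>v. dA x u v w)"
      using A_bil[OF x] dA_bil[OF x] by (simp_all add: bilinear_def)
    ultimately show ?thesis unfolding nablaA_def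
      by (intro linear_compose_add linear_compose_sub)
  qed
  have "(\<lambda>v. nablaA x u v w) = nablaA x u w" for w by (rule ext) (rule nablaA_sym2[OF x])
  then have "linear (nablaA x u w)" for w using l[of w] by simp
  with l show ?thesis by (simp add: bilinear_def)
qed

lemma frame:
  assumes x: "x \<in> U"
  obtains \<xi> \<zeta> where "lorentz \<xi> \<xi> = 1" "lorentz \<zeta> \<zeta> = 1" "lorentz \<xi> \<zeta> = 0"
    "lorentz \<xi> (F x) = 0" "lorentz \<zeta> (F x) = 0" "\<And>u. lorentz \<xi> (D1 x u) = 0" "\<And>u. lorentz \<zeta> (D1 x u) = 0"
    "\<And>z. (\<And>u. lorentz z (D1 x u) = 0) \<Longrightarrow> z = (- lorentz z (F x)) *\<^sub>R F x + lorentz z \<xi> *\<^sub>R \<xi> + lorentz z \<zeta> *\<^sub>R \<zeta>"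
    "\<And>z. lorentz z (F x) = 0 \<Longrightarrow> lorentz z \<xi> = 0 \<Longrightarrow> lorentz z \<zeta> = 0 \<Longrightarrow> \<exists>u. z = D1 x u"
  apply (rule normal_frame[OF dim_h D1_linear[OF x] F_norm[OF x] F_D1[OF x]])
   apply (erule D1_inj[OF x])
  subgoal premises p for \<xi> \<zeta> by (rule that[of \<xi> \<zeta>]) (fact p)+
  done

end

section \<open>Null normals and split frames at a point\<close>

context hyperbolic_chart
begin

text \<open>Transports the Hermitian tangent space at \<open>x\<close> to the standard inner
  product, so that the lemmas of \<open>hermitian_space\<close> apply.\<close>

lemma pull_back:
  assumes x: "x \<in> U"
  obtains B :: "'m \<Rightarrow> 'm" and J' where "linear B" "bij B" "\<And>u v. h x (B u) (B v) = u \<bullet> v"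
    "hermitian_space J'" "\<And>u. B (J' u) = J x (B u)"
proof -
  obtain B :: "'m \<Rightarrow> 'm" where B: "linear B" "bij B" "\<And>u v. h x (B u) (B v) = u \<bullet> v"
    by (rule linear_isometry_from_inner[OF h_bil[OF x] h_sym[OF x] h_pos[OF x]]) (assumption, rule that, assumption+)
  define J' where "J' u = inv B (J x (B u))" for u
  have BJ: "B (J' u) = J x (B u)" for u
    unfolding J'_def using B(2) by (simp add: bij_is_surj surj_f_inv_f)
  have inj: "B u = B v \<Longrightarrow> u = v" for u v using B(2) by (simp add: bij_is_inj inj_eq)
  have 1: "linear J'"
    by (rule linearI; rule inj) (simp_all add: BJ linear_add[OF B(1)] linear_cmul[OF B(1)]
        linear_add[OF J_lin[OF x]] linear_cmul[OF J_lin[OF x]])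
  have 2: "J' (J' u) = - u" for u
    by (rule inj) (simp add: BJ J_sq[OF x] linear_neg[OF B(1)])
  have 3: "J' u \<bullet> J' v = u \<bullet> v" for u v
    unfolding B(3)[symmetric] BJ by (rule J_orth[OF x])
  have "hermitian_space J'" unfolding hermitian_space_def using 1 2 3 by blast
  then show ?thesis using that B BJ by blast
qed

text \<open>The last condition uses \<open>D2\<close> instead of the equivalent one on
  \<open>A\<close>, so that apart from nullity all conditions are linear in \<open>w\<close> with
  coefficients that are derivatives of \<open>F\<close>.\<close>

definition null_normal :: "'m \<Rightarrow> 'h \<times> real \<Rightarrow> bool" where
  "null_normal x w \<longleftrightarrow> lorentz w w = 0 \<and> lorentz w (F x) = -1 \<and> (\<forall>u. lorentz w (D1 x u) = 0)
    \<and> (\<forall>u v. lorentz w (D2 x u v) = 0)"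

lemma null_normalD:
  assumes "null_normal x w"
  shows "lorentz w w = 0" "lorentz w (F x) = -1" "lorentz w (D1 x u) = 0" "lorentz w (D2 x u v) = 0"
    "lorentz w (A x u v) = 0"
  using assms by (auto simp: null_normal_def A_def lorentz_simps)

lemma null_normalI:
  assumes "lorentz w w = 0" "lorentz w (F x) = -1" "\<And>u. lorentz w (D1 x u) = 0" "\<And>u v. lorentz w (A x u v) = 0"
  shows "null_normal x w"
proof -
  have "lorentz w (D2 x u v) = lorentz w (A x u v) + lorentz w (D1 x (\<Gamma> x u v))" for u v
    by (simp add: A_def lorentz_simps)
  then show ?thesis using assms by (simp add: null_normal_def)
qed

text \<open>The second order data of a product of three surfaces: three orthogonal complex lines,
  each contributing to \<open>A\<close> its own metric times its own normal.\<close>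

definition split_frame :: "'m \<Rightarrow> (3 \<Rightarrow> 'm) \<Rightarrow> (3 \<Rightarrow> 'h \<times> real) \<Rightarrow> bool" where
  "split_frame x e \<eta> \<longleftrightarrow>
    (\<forall>i. h x (e i) (e i) = 1) \<and> (\<forall>i j. i \<noteq> j \<longrightarrow> h x (e i) (e j) = 0 \<and> h x (e i) (J x (e j)) = 0) \<and>
    (\<forall>i u. lorentz (\<eta> i) (D1 x u) = 0) \<and> (\<forall>i. lorentz (\<eta> i) (F x) = -1) \<and>
    (\<forall>i j. i \<noteq> j \<longrightarrow> lorentz (\<eta> i) (\<eta> j) = 0) \<and> (\<forall>i. lorentz (\<eta> i) (\<eta> i) \<noteq> 0) \<and>
    (\<forall>u v. A x u v = (\<Sum>i\<in>UNIV. (h x u (e i) * h x v (e i) + h x u (J x (e i)) * h x v (J x (e i))) *\<^sub>R \<eta> i))"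

text \<open>In an orthonormal normal frame with timelike member \<open>F x\<close>,
  \<open>gauss\<close> is a sum of two wedge forms minus that of the metric, so that
  \<open>gauss_J\<close> is the hypothesis of \<open>kaehler_dichotomy\<close>. The coefficients
  returned there are the spacelike coordinates of the desired normals, each of which has component 1
  along \<open>F x\<close>.\<close>

lemma dichotomy:
  assumes x: "x \<in> U"
  shows "(\<exists>w. null_normal x w) \<or> (DIM('m) = 6 \<and> (\<exists>e \<eta>. split_frame x e \<eta>))"
proof -
  obtain \<xi> \<zeta> where fr: "lorentz \<xi> \<xi> = 1" "lorentz \<zeta> \<zeta> = 1" "lorentz \<xi> \<zeta> = 0"
    "lorentz \<xi> (F x) = 0" "lorentz \<zeta> (F x) = 0" "\<And>u. lorentz \<xi> (D1 x u) = 0" "\<And>u. lorentz \<zeta> (D1 x u) = 0"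
    and ex: "\<And>z. (\<And>u. lorentz z (D1 x u) = 0) \<Longrightarrow> z = (- lorentz z (F x)) *\<^sub>R F x + lorentz z \<xi> *\<^sub>R \<xi> + lorentz z \<zeta> *\<^sub>R \<zeta>"
    by (rule frame[OF x]) (assumption | blast)+
  obtain B :: "'m \<Rightarrow> 'm" and J' where B: "linear B" "bij B" "\<And>u v. h x (B u) (B v) = u \<bullet> v"
    and J': "hermitian_space J'" "\<And>u. B (J' u) = J x (B u)"
    by (rule pull_back[OF x]) (rule that, assumption+)
  interpret H: hermitian_space J' by (rule J'(1))
  have lF: "lorentz (F x) (F x) = -1" "lorentz (F x) \<xi> = 0" "lorentz (F x) \<zeta> = 0" "lorentz \<zeta> \<xi> = 0"
    using F_norm[OF x] fr by (simp_all add: lorentz_sym)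
  define \<alpha>1 where "\<alpha>1 u v = lorentz (A x (B u) (B v)) \<xi>" for u v
  define \<alpha>2 where "\<alpha>2 u v = lorentz (A x (B u) (B v)) \<zeta>" for u v
  have AB: "A x (B u) (B v) = (u \<bullet> v) *\<^sub>R F x + \<alpha>1 u v *\<^sub>R \<xi> + \<alpha>2 u v *\<^sub>R \<zeta>" for u v
    using ex[of "A x (B u) (B v)"] A_D1[OF x] by (simp add: A_F[OF x] \<alpha>1_def \<alpha>2_def B(3))
  have b: "bilinear \<alpha>1" "bilinear \<alpha>2"
    unfolding bilinear_def \<alpha>1_def \<alpha>2_def
    by (intro conjI allI linearI; simp add: linear_add[OF B(1)] linear_cmul[OF B(1)] bilinearD[OF A_bil[OF x]] lorentz_simps)+
  have s: "\<alpha>1 u v = \<alpha>1 v u" "\<alpha>2 u v = \<alpha>2 v u" for u v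
    by (simp_all add: \<alpha>1_def \<alpha>2_def A_sym[OF x, of "B u" "B v"])
  have AA: "lorentz (A x (B a) (B b)) (A x (B c) (B d)) = \<alpha>1 a b * \<alpha>1 c d + \<alpha>2 a b * \<alpha>2 c d - (a \<bullet> b) * (c \<bullet> d)" for a b c d
    unfolding AB by (simp add: lorentz_simps fr lF)
  have g: "gauss x (B u) (B v) (B w) (B z) = wedge_form \<alpha>1 u v w z + wedge_form \<alpha>2 u v w z - wedge_form inner u v w z" for u v w z
    unfolding gauss_def AA wedge_form_def by simp
  have K: "H.wedge_defect \<alpha>1 u v w z + H.wedge_defect \<alpha>2 u v w z = H.wedge_defect inner u v w z" for u v w z
    using gauss_J[OF x, of "B u" "B v" "B w" "B z"] unfolding J'(2)[symmetric] g H.wedge_defect_def by simp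
  have surj: "\<exists>u'. u = B u'" for u using B(2) by (metis bij_pointE)
  from H.kaehler_dichotomy[OF b s dim_m K] show ?thesis
  proof
    assume "\<exists>c s. c\<^sup>2 + s\<^sup>2 = 1 \<and> (\<forall>u v. c * \<alpha>1 u v + s * \<alpha>2 u v = u \<bullet> v)"
    then obtain c s where cs: "c\<^sup>2 + s\<^sup>2 = 1" "\<And>u v. c * \<alpha>1 u v + s * \<alpha>2 u v = u \<bullet> v" by blast
    have "null_normal x (F x + c *\<^sub>R \<xi> + s *\<^sub>R \<zeta>)"
    proof (rule null_normalI)
      show "lorentz (F x + c *\<^sub>R \<xi> + s *\<^sub>R \<zeta>) (F x + c *\<^sub>R \<xi> + s *\<^sub>R \<zeta>) = 0"
        using cs(1) by (simp add: lorentz_simps fr lF power2_eq_square)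
      show "lorentz (F x + c *\<^sub>R \<xi> + s *\<^sub>R \<zeta>) (A x u v) = 0" for u v
      proof -
        obtain u' v' where uv: "u = B u'" "v = B v'" using surj by metis
        show ?thesis unfolding uv AB using cs(2)[of u' v'] by (simp add: lorentz_simps fr lF algebra_simps)
      qed
    qed (use F_D1[OF x] in \<open>simp_all add: lorentz_simps fr lF lorentz_sym[of "F x" "D1 x _"]\<close>)
    then show ?thesis by blast
  next
    assume "DIM('m) = 6 \<and> (\<exists>e l m. H.unitary_frame e \<and>
      (\<forall>x y. \<alpha>1 x y = (\<Sum>i\<in>UNIV. l i * H.line_form (e i) x y)) \<and>
      (\<forall>x y. \<alpha>2 x y = (\<Sum>i\<in>UNIV. m i * H.line_form (e i) x y)) \<and>
      (\<forall>i j. i \<noteq> j \<longrightarrow> l i * l j + m i * m j = 1) \<and> (\<forall>i. (l i)\<^sup>2 + (m i)\<^sup>2 \<noteq> 1))"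
    then obtain e l m where six: "DIM('m) = 6" and e: "H.unitary_frame e"
      and al: "\<And>x y. \<alpha>1 x y = (\<Sum>i\<in>UNIV. l i * H.line_form (e i) x y)"
        "\<And>x y. \<alpha>2 x y = (\<Sum>i\<in>UNIV. m i * H.line_form (e i) x y)"
      and lm: "\<And>i j. i \<noteq> j \<Longrightarrow> l i * l j + m i * m j = 1" "\<And>i. (l i)\<^sup>2 + (m i)\<^sup>2 \<noteq> 1" by blast
    define \<eta> where "\<eta> i = F x + l i *\<^sub>R \<xi> + m i *\<^sub>R \<zeta>" for i
    have "split_frame x (\<lambda>i. B (e i)) \<eta>"
      unfolding split_frame_def
    proof (intro conjI allI impI)
      fix i j :: 3 and u v
      show "h x (B (e i)) (B (e i)) = 1" using e by (simp add: B(3) H.unitary_frame_def)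
      show "h x (B (e i)) (B (e j)) = 0" "h x (B (e i)) (J x (B (e j))) = 0" if "i \<noteq> j"
        unfolding J'(2)[symmetric] using e that by (auto simp: B(3) H.unitary_frame_def H.corth_def)
      show "lorentz (\<eta> i) (D1 x u) = 0" using F_D1[OF x, of u]
        by (simp add: \<eta>_def lorentz_simps fr lorentz_sym[of "F x" "D1 x _"])
      show "lorentz (\<eta> i) (F x) = -1" by (simp add: \<eta>_def lorentz_simps fr lF)
      show "lorentz (\<eta> i) (\<eta> j) = 0" if "i \<noteq> j" using lm(1)[OF that] by (simp add: \<eta>_def lorentz_simps fr lF mult.commute)
      show "lorentz (\<eta> i) (\<eta> i) \<noteq> 0" using lm(2)[of i] by (simp add: \<eta>_def lorentz_simps fr lF power2_eq_square)
      obtain u' v' where uv: "u = B u'" "v = B v'" using surj by metis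
      have "u' \<bullet> v' = (\<Sum>i\<in>UNIV. H.line_form (e i) u' v')"
        by (subst H.unitary_frame_expansion[OF six e, of v'])
          (simp add: inner_sum_right inner_add_right H.line_form_def mult.commute)
      then have "A x u v = (\<Sum>i\<in>UNIV. H.line_form (e i) u' v' *\<^sub>R \<eta> i)"
        unfolding uv AB al \<eta>_def
        by (simp add: scaleR_sum_left sum.distrib[symmetric] scaleR_add_right mult.commute)
      then show "A x u v = (\<Sum>i\<in>UNIV. (h x u (B (e i)) * h x v (B (e i)) + h x u (J x (B (e i))) * h x v (J x (B (e i)))) *\<^sub>R \<eta> i)"
        unfolding uv J'(2)[symmetric] B(3) H.line_form_def .
    qed
    then show ?thesis using six by blast
  qed
qed

text \<open>Six tangent directions and three orthogonal non-null normals exhaust the nine dimensions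
  of Lorentzian space.\<close>

lemma normal_basis:
  fixes y :: "3 \<Rightarrow> 'h \<times> real"
  assumes x: "x \<in> U" and six: "DIM('m) = 6"
    and T: "\<And>i u. lorentz (y i) (D1 x u) = 0" and o: "\<And>i j. i \<noteq> j \<Longrightarrow> lorentz (y i) (y j) = 0"
    and n: "\<And>i. lorentz (y i) (y i) \<noteq> 0"
  shows normal_expansion: "(\<And>u. lorentz z (D1 x u) = 0) \<Longrightarrow> z = (\<Sum>i\<in>UNIV. (lorentz z (y i) / lorentz (y i) (y i)) *\<^sub>R y i)"
    and tangent_if_orthogonal: "(\<And>i. lorentz z (y i) = 0) \<Longrightarrow> \<exists>u. z = D1 x u"
proof -
  obtain B :: "'m \<Rightarrow> 'm" where B: "linear B" "bij B" "\<And>u v. h x (B u) (B v) = u \<bullet> v"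
    by (rule linear_isometry_from_inner[OF h_bil[OF x] h_sym[OF x] h_pos[OF x]]) (assumption, rule that, assumption+)
  let ?T = "\<lambda>b. D1 x (B b)"
  have TT: "lorentz (?T a) (?T b) = a \<bullet> b" for a b by (simp add: isom[OF x] B(3))
  have iT: "inj_on ?T Basis"
  proof (rule inj_onI)
    fix a b assume ab: "a \<in> Basis" "b \<in> Basis" "?T a = ?T b"
    then have "a \<bullet> b = 1" using TT[of a b] TT[of a a] by simp
    then show "a = b" using ab inner_not_same_Basis by fastforce
  qed
  have iy: "inj y" using o n by (metis injI)
  have Ty: "lorentz (?T b) (y i) = 0" for b i using T[of i "B b"] by (simp add: lorentz_sym)
  have dj: "?T ` Basis \<inter> range y = {}"
  proof -
    have "?T b \<noteq> y i" if "b \<in> Basis" for b i using Ty[of b i] n[of i] by auto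
    then show ?thesis by blast
  qed
  define S where "S = ?T ` Basis \<union> range y"
  have fin: "finite S" by (simp add: S_def)
  have card: "card S = DIM('h \<times> real)"
    unfolding S_def using dj iT iy six dim_h by (simp add: card_Un_disjoint card_image)
  have nn: "lorentz s s \<noteq> 0" if "s \<in> S" for s using that n TT by (auto simp: S_def)
  have oo: "lorentz s t = 0" if st: "s \<in> S" "t \<in> S" "s \<noteq> t" for s t
  proof -
    from st consider (1) a b where "a \<in> Basis" "b \<in> Basis" "s = ?T a" "t = ?T b"
      | (2) a i where "s = ?T a" "t = y i" | (3) a i where "s = y i" "t = ?T a"
      | (4) i j where "s = y i" "t = y j" unfolding S_def by blast
    then show ?thesis
    proof cases
      case 1 then show ?thesis using TT[of a b] inner_not_same_Basis[of a b] st(3) by auto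
    next
      case 4 then show ?thesis using o[of i j] st(3) by auto
    qed (use Ty T in auto)
  qed
  have ex: "z = (\<Sum>b\<in>Basis. lorentz z (?T b) *\<^sub>R ?T b) + (\<Sum>i\<in>UNIV. (lorentz z (y i) / lorentz (y i) (y i)) *\<^sub>R y i)" for z
  proof -
    have "z = (\<Sum>s\<in>S. (lorentz z s / lorentz s s) *\<^sub>R s)"
      by (rule orthogonal_basis_expansion[OF bilinear_lorentz fin nn oo card])
    also have "\<dots> = (\<Sum>b\<in>Basis. (lorentz z (?T b) / lorentz (?T b) (?T b)) *\<^sub>R ?T b) + (\<Sum>i\<in>UNIV. (lorentz z (y i) / lorentz (y i) (y i)) *\<^sub>R y i)"
      unfolding S_def by (subst sum.union_disjoint) (use dj iT iy in \<open>simp_all add: sum.reindex\<close>)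
    finally show ?thesis by (simp add: TT)
  qed
  show "z = (\<Sum>i\<in>UNIV. (lorentz z (y i) / lorentz (y i) (y i)) *\<^sub>R y i)" if "\<And>u. lorentz z (D1 x u) = 0"
    using ex[of z] by (simp only: that scaleR_zero_left sum.neutral_const add_0_left)
  show "\<exists>u. z = D1 x u" if z: "\<And>i. lorentz z (y i) = 0"
  proof
    show "z = D1 x (\<Sum>b\<in>Basis. lorentz z (?T b) *\<^sub>R B b)"
      using ex[of z] by (simp only: z div_0 scaleR_zero_left sum.neutral_const add_0_right
          linear_sum[OF D1_linear[OF x]] linear_cmul[OF D1_linear[OF x]])
  qed
qed

lemma split_frameD:
  assumes "split_frame x e \<eta>"
  shows "h x (e i) (e i) = 1" "i \<noteq> j \<Longrightarrow> h x (e i) (e j) = 0" "i \<noteq> j \<Longrightarrow> h x (e i) (J x (e j)) = 0"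
    "lorentz (\<eta> i) (D1 x u) = 0" "lorentz (\<eta> i) (F x) = -1" "i \<noteq> j \<Longrightarrow> lorentz (\<eta> i) (\<eta> j) = 0"
    "lorentz (\<eta> i) (\<eta> i) \<noteq> 0"
    "A x u v = (\<Sum>i\<in>UNIV. (h x u (e i) * h x v (e i) + h x u (J x (e i)) * h x v (J x (e i))) *\<^sub>R \<eta> i)"
proof -
  note D = assms[unfolded split_frame_def]
  note D' = conjunct2[OF conjunct2[OF D]]
  note D'' = conjunct2[OF conjunct2[OF D']]
  show "h x (e i) (e i) = 1" using conjunct1[OF D] by simp
  show "i \<noteq> j \<Longrightarrow> h x (e i) (e j) = 0" "i \<noteq> j \<Longrightarrow> h x (e i) (J x (e j)) = 0"
    using conjunct1[OF conjunct2[OF D]] by simp_all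
  show "lorentz (\<eta> i) (D1 x u) = 0" using conjunct1[OF D'] by simp
  show "lorentz (\<eta> i) (F x) = -1" using conjunct1[OF conjunct2[OF D']] by simp
  show "i \<noteq> j \<Longrightarrow> lorentz (\<eta> i) (\<eta> j) = 0" using conjunct1[OF D''] by simp
  show "lorentz (\<eta> i) (\<eta> i) \<noteq> 0" using conjunct1[OF conjunct2[OF D'']] by simp
  show "A x u v = (\<Sum>i\<in>UNIV. (h x u (e i) * h x v (e i) + h x u (J x (e i)) * h x v (J x (e i))) *\<^sub>R \<eta> i)"
    by (rule conjunct2[OF conjunct2[OF D''], rule_format])
qed

lemma split_F:
  assumes x: "x \<in> U" and six: "DIM('m) = 6" and sp: "split_frame x e \<eta>"
  shows "F x = - (\<Sum>i\<in>UNIV. (1 / lorentz (\<eta> i) (\<eta> i)) *\<^sub>R \<eta> i)"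
proof -
  note D = split_frameD[OF sp]
  have "F x = (\<Sum>i\<in>UNIV. (lorentz (F x) (\<eta> i) / lorentz (\<eta> i) (\<eta> i)) *\<^sub>R \<eta> i)"
    by (rule normal_expansion[OF x six D(4) D(6) D(7)]) (simp_all add: lorentz_sym[of "F x" "D1 x _"] F_D1[OF x])
  then show ?thesis by (simp add: lorentz_sym[of "F x"] D(5) sum_negf)
qed

text \<open>The components of \<open>nablaA\<close> along the normals of the frame satisfy the
  hypotheses of \<open>linearised_kaehler_invariant\<close>, the linear relation among them because
  \<open>nablaA\<close> is orthogonal to \<open>F x\<close>. Invariance under \<open>J\<close> and
  the full symmetry from Codazzi leave only zero.\<close>

lemma split_nablaA_zero:
  assumes x: "x \<in> U" and six: "DIM('m) = 6" and sp: "split_frame x e \<eta>"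
  shows "nablaA x u v w = 0"
proof -
  note D = split_frameD[OF sp]
  obtain B :: "'m \<Rightarrow> 'm" and J' where B: "linear B" "bij B" "\<And>u v. h x (B u) (B v) = u \<bullet> v"
    and J': "hermitian_space J'" "\<And>u. B (J' u) = J x (B u)"
    by (rule pull_back[OF x]) (rule that, assumption+)
  interpret H: hermitian_space J' by (rule J'(1))
  have surj: "\<exists>u'. u = B u'" for u using B(2) by (metis bij_pointE)
  obtain e' where e': "\<And>i. e i = B (e' i)" using choice[of "\<lambda>i u'. e i = B u'"] surj by blast
  have uf: "H.unitary_frame e'"
    unfolding H.unitary_frame_def H.corth_def B(3)[symmetric] J'(2) e'[symmetric] using D(1,2,3) by blast
  have inv: "lorentz (nablaA x E (J x a) (J x b)) (\<eta> k) = lorentz (nablaA x E a b) (\<eta> k)" for E a b k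
  proof -
    define t where "t j y z = lorentz (nablaA x E (B y) (B z)) (\<eta> j)" for j y z
    have bt: "bilinear (t j)" for j
      unfolding bilinear_def t_def
      by (intro conjI allI linearI) (simp_all add: linear_add[OF B(1)] linear_cmul[OF B(1)] bilinearD[OF nablaA_bil[OF x]] lorentz_simps)
    have st: "t j y z = t j z y" for j y z unfolding t_def nablaA_sym2[OF x, of E "B y"] ..
    have Ft: "(\<Sum>j\<in>UNIV. t j y z / lorentz (\<eta> j) (\<eta> j)) = 0" for y z
    proof -
      have "lorentz (nablaA x E (B y) (B z)) (F x) = - (\<Sum>j\<in>UNIV. t j y z / lorentz (\<eta> j) (\<eta> j))"
        by (subst split_F[OF x six sp]) (simp add: lorentz_simps t_def)
      then show ?thesis by (simp add: nablaA_F[OF x])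
    qed
    have AB: "lorentz n (A x (B y) (B z)) = (\<Sum>j\<in>UNIV. H.line_form (e' j) y z * lorentz n (\<eta> j))" for n y z
      unfolding D(8) e' J'(2)[symmetric] B(3) by (simp add: lorentz_simps H.line_form_def)
    have R: "linearised_gauss x E (B p) (B q) (B r) (B s) = (\<Sum>j\<in>UNIV. H.line_form (e' j) q r * t j p s + H.line_form (e' j) p s * t j q r
        - H.line_form (e' j) q s * t j p r - H.line_form (e' j) p r * t j q s)" for p q r s
      unfolding linearised_gauss_def lorentz_sym[of "A x _ _" "nablaA x _ _ _"] AB t_def
      by (simp add: sum.distrib sum_subtractf)
    have "t k (J' y) (J' z) = t k y z" for y z
      by (rule H.linearised_kaehler_invariant[where c = "\<lambda>j. lorentz (\<eta> j) (\<eta> j)"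
            and R' = "\<lambda>p q r s. linearised_gauss x E (B p) (B q) (B r) (B s)", OF six uf bt st D(7) Ft R])
        (simp only: J'(2) linearised_gauss_J[OF x])
    then have "lorentz (nablaA x E (J x (B y)) (J x (B z))) (\<eta> k) = lorentz (nablaA x E (B y) (B z)) (\<eta> k)" for y z
      by (simp add: t_def J'(2))
    then show ?thesis using surj by metis
  qed
  have "lorentz (nablaA x u v w) (\<eta> k) = 0" for k
  proof (rule trilinear_J_invariant_zero[where J = "J x" and s = "\<lambda>u v w. lorentz (nablaA x u v w) (\<eta> k)"])
    show "bilinear (\<lambda>v w. lorentz (nablaA x z v w) (\<eta> k))" for z
      unfolding bilinear_def by (intro conjI allI linearI) (simp_all add: bilinearD[OF nablaA_bil[OF x]] lorentz_simps)
    show "lorentz (nablaA x a b c) (\<eta> k) = lorentz (nablaA x b a c) (\<eta> k)" for a b c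
      unfolding nablaA_sym1[OF x, of a b] ..
    show "lorentz (nablaA x a b c) (\<eta> k) = lorentz (nablaA x a c b) (\<eta> k)" for a b c
      unfolding nablaA_sym2[OF x, of a b] ..
  qed (rule J_sq[OF x], rule inv)
  moreover have "nablaA x u v w = (\<Sum>i\<in>UNIV. (lorentz (nablaA x u v w) (\<eta> i) / lorentz (\<eta> i) (\<eta> i)) *\<^sub>R \<eta> i)"
    by (rule normal_expansion[OF x six D(4) D(6) D(7)]) (auto simp: nablaA_D1[OF x])
  ultimately show ?thesis by simp
qed

text \<open>In the presence of a null normal \<open>w\<close> the form \<open>A - g w\<close> is a multiple \<open>b \<eta>\<close> of a unit normal;
  here \<open>b\<close> is the second fundamental form of the immersion into the horosphere.\<close>

lemma null_normal_frame:
  assumes x: "x \<in> U" and w: "null_normal x w"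
  obtains \<eta> where "lorentz \<eta> \<eta> = 1" "lorentz \<eta> (F x) = 0" "lorentz \<eta> w = 0" "\<And>u. lorentz \<eta> (D1 x u) = 0"
    "\<And>z. (\<And>u. lorentz z (D1 x u) = 0) \<Longrightarrow> lorentz z (F x) = 0 \<Longrightarrow> lorentz z w = 0 \<Longrightarrow> z = lorentz z \<eta> *\<^sub>R \<eta>"
    "\<And>z. (\<And>u. lorentz z (D1 x u) = 0) \<Longrightarrow> lorentz z (F x) = 0 \<Longrightarrow> z = lorentz z w *\<^sub>R (w - F x) + lorentz z \<eta> *\<^sub>R \<eta>"
proof -
  obtain \<xi> \<zeta> where fr: "lorentz \<xi> \<xi> = 1" "lorentz \<zeta> \<zeta> = 1" "lorentz \<xi> \<zeta> = 0"
    "lorentz \<xi> (F x) = 0" "lorentz \<zeta> (F x) = 0" "\<And>u. lorentz \<xi> (D1 x u) = 0" "\<And>u. lorentz \<zeta> (D1 x u) = 0"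
    and ex: "\<And>z. (\<And>u. lorentz z (D1 x u) = 0) \<Longrightarrow> z = (- lorentz z (F x)) *\<^sub>R F x + lorentz z \<xi> *\<^sub>R \<xi> + lorentz z \<zeta> *\<^sub>R \<zeta>"
    by (rule frame[OF x]) (assumption | blast)+
  have lF: "lorentz (F x) (F x) = -1" "lorentz (F x) \<xi> = 0" "lorentz (F x) \<zeta> = 0" "lorentz \<zeta> \<xi> = 0"
    using F_norm[OF x] fr by (simp_all add: lorentz_sym)
  define c where "c = lorentz w \<xi>"
  define s where "s = lorentz w \<zeta>"
  note W = null_normalD[OF w]
  have we: "w = F x + c *\<^sub>R \<xi> + s *\<^sub>R \<zeta>" using ex[of w] W by (simp add: c_def s_def)
  have "lorentz w w = lorentz w (F x) + c * lorentz w \<xi> + s * lorentz w \<zeta>"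
    by (subst (2) we) (simp add: lorentz_simps)
  then have "lorentz w w = -1 + (c * c + s * s)" using W(2) by (simp add: c_def s_def)
  then have cs: "c * c + s * s = 1" using W(1) by simp
  \<comment> \<open>\<open>w - F x\<close> is the unit vector with coordinates \<open>c\<close> and
    \<open>s\<close> in the normal plane; this is its quarter turn.\<close>
  define \<eta> where "\<eta> = (- s) *\<^sub>R \<xi> + c *\<^sub>R \<zeta>"
  have e2: "z = lorentz z w *\<^sub>R (w - F x) + lorentz z \<eta> *\<^sub>R \<eta>" if z: "\<And>u. lorentz z (D1 x u) = 0" "lorentz z (F x) = 0" for z
  proof -
    define p where "p = lorentz z \<xi>"
    define q where "q = lorentz z \<zeta>"
    have ze: "z = p *\<^sub>R \<xi> + q *\<^sub>R \<zeta>" using ex[OF z(1)] z(2) by (simp add: p_def q_def)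
    have L1: "lorentz z w = c * p + s * q" by (subst we) (simp add: lorentz_simps z(2) p_def q_def)
    have L2: "lorentz z \<eta> = c * q - s * p" by (simp add: \<eta>_def lorentz_simps p_def q_def)
    have L3: "w - F x = c *\<^sub>R \<xi> + s *\<^sub>R \<zeta>" by (subst we) simp
    have "lorentz z w *\<^sub>R (w - F x) + lorentz z \<eta> *\<^sub>R \<eta> = ((c * c + s * s) * p) *\<^sub>R \<xi> + ((c * c + s * s) * q) *\<^sub>R \<zeta>"
      unfolding L1 L2 L3 unfolding \<eta>_def by (simp add: algebra_simps)
    then show ?thesis unfolding cs using ze by simp
  qed
  show ?thesis
  proof (rule that[of \<eta>])
    show "lorentz \<eta> \<eta> = 1" using cs by (simp add: \<eta>_def lorentz_simps fr lF add.commute)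
    show "lorentz \<eta> w = 0" by (subst we) (simp add: \<eta>_def lorentz_simps fr lF)
    show "z = lorentz z \<eta> *\<^sub>R \<eta>" if "\<And>u. lorentz z (D1 x u) = 0" "lorentz z (F x) = 0" "lorentz z w = 0" for z
      using e2[OF that(1,2)] that(3) by simp
  qed (use e2 in \<open>auto simp: \<eta>_def lorentz_simps fr lF\<close>)
qed

text \<open>Since \<open>w\<close> is null and orthogonal to all values of \<open>A\<close>,
  subtracting the metric times \<open>w\<close> does not change products of values of
  \<open>A\<close>, but makes them orthogonal to \<open>F x\<close>.\<close>

lemma horospherical_form:
  assumes x: "x \<in> U" and w: "null_normal x w"
  shows "lorentz (A x a b - h x a b *\<^sub>R w) (D1 x u) = 0" "lorentz (A x a b - h x a b *\<^sub>R w) (F x) = 0"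
    "lorentz (A x a b - h x a b *\<^sub>R w) w = 0"
    "gauss x a b c d = lorentz (A x a d - h x a d *\<^sub>R w) (A x b c - h x b c *\<^sub>R w)
       - lorentz (A x a c - h x a c *\<^sub>R w) (A x b d - h x b d *\<^sub>R w)"
proof -
  have Aw: "lorentz (A x u v) w = 0" for u v using null_normalD(5)[OF w] by (subst lorentz_sym)
  note facts = null_normalD[OF w] A_D1[OF x] A_F[OF x] Aw
  show "lorentz (A x a b - h x a b *\<^sub>R w) (D1 x u) = 0" "lorentz (A x a b - h x a b *\<^sub>R w) (F x) = 0"
    "lorentz (A x a b - h x a b *\<^sub>R w) w = 0"
    "gauss x a b c d = lorentz (A x a d - h x a d *\<^sub>R w) (A x b c - h x b c *\<^sub>R w)
       - lorentz (A x a c - h x a c *\<^sub>R w) (A x b d - h x b d *\<^sub>R w)"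
    by (simp_all add: lorentz_simps gauss_def facts)
qed

lemma kaehler_line_valued:
  assumes x: "x \<in> U" and B: "\<And>u. B (J' u) = J x (B u)" "hermitian_space J'"
    and val: "\<And>u v. \<gamma> u v = b u v *\<^sub>R \<eta>" and \<eta>: "lorentz \<eta> \<eta> = 1"
    and K: "\<And>u v w z. lorentz (\<gamma> u (J x z)) (\<gamma> v (J x w)) - lorentz (\<gamma> u (J x w)) (\<gamma> v (J x z))
      = lorentz (\<gamma> u z) (\<gamma> v w) - lorentz (\<gamma> u w) (\<gamma> v z)"
  shows "hermitian_space.wedge_defect J' (\<lambda>u v. b (B u) (B v)) p q r s = 0"
  using K[of "B p" "B s" "B q" "B r"]
  by (simp add: hermitian_space.wedge_defect_def[OF B(2)] wedge_form_def val lorentz_simps \<eta> B(1) mult.commute)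

lemma kaehler_multiple_zero:
  assumes x: "x \<in> U"
    and val: "\<And>u v. \<gamma> u v = (k * h x u v) *\<^sub>R \<eta>" and \<eta>: "lorentz \<eta> \<eta> = 1"
    and K: "\<And>u v w z. lorentz (\<gamma> u (J x z)) (\<gamma> v (J x w)) - lorentz (\<gamma> u (J x w)) (\<gamma> v (J x z))
      = lorentz (\<gamma> u z) (\<gamma> v w) - lorentz (\<gamma> u w) (\<gamma> v z)"
  shows "k = 0"
proof -
  obtain B :: "'m \<Rightarrow> 'm" and J' where B: "linear B" "bij B" "\<And>u v. h x (B u) (B v) = u \<bullet> v"
    and J': "hermitian_space J'" "\<And>u. B (J' u) = J x (B u)"
    by (rule pull_back[OF x]) (rule that, assumption+)
  have d4: "4 \<le> DIM('m)" using dim_m by linarith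
  have wd: "hermitian_space.wedge_defect J' (\<lambda>u v. k * (u \<bullet> v)) p q r s = 0" for p q r s
    using kaehler_line_valued[of x B J' \<gamma> "\<lambda>u v. k * h x u v" \<eta> p q r s, OF x J'(2,1) val \<eta> K] by (simp add: B(3))
  show ?thesis by (rule hermitian_space.kaehler_multiple_of_metric[OF J'(1) d4 wd])
qed

lemma horospherical_kaehler:
  assumes x: "x \<in> U" and w: "null_normal x w"
  defines "\<gamma> \<equiv> \<lambda>u v. A x u v - h x u v *\<^sub>R w"
  shows "lorentz (\<gamma> u (J x z)) (\<gamma> v (J x y)) - lorentz (\<gamma> u (J x y)) (\<gamma> v (J x z))
      = lorentz (\<gamma> u z) (\<gamma> v y) - lorentz (\<gamma> u y) (\<gamma> v z)"
  using gauss_J[OF x, of u v y z] unfolding horospherical_form(4)[OF x w] \<gamma>_def .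

text \<open>The difference of two null normals is \<open>p (w - F x) + q \<eta>\<close>, and its
  orthogonality to \<open>A\<close> says that \<open>p\<close> times the metric plus
  \<open>q\<close> times the horospherical form is zero. If \<open>q\<close> is not zero, that form
  is a multiple of the metric, hence zero by the Kaehler condition; then \<open>p = 0\<close>, and
  \<open>w + q \<eta>\<close> is not null.\<close>

lemma null_normal_unique:
  assumes x: "x \<in> U" and w: "null_normal x w" and w': "null_normal x w'"
  shows "w = w'"
proof -
  obtain \<eta> where \<eta>: "lorentz \<eta> \<eta> = 1" "lorentz \<eta> (F x) = 0" "lorentz \<eta> w = 0" "\<And>u. lorentz \<eta> (D1 x u) = 0"
    and e1: "\<And>z. (\<And>u. lorentz z (D1 x u) = 0) \<Longrightarrow> lorentz z (F x) = 0 \<Longrightarrow> lorentz z w = 0 \<Longrightarrow> z = lorentz z \<eta> *\<^sub>R \<eta>"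
    and e2: "\<And>z. (\<And>u. lorentz z (D1 x u) = 0) \<Longrightarrow> lorentz z (F x) = 0 \<Longrightarrow> z = lorentz z w *\<^sub>R (w - F x) + lorentz z \<eta> *\<^sub>R \<eta>"
    by (rule null_normal_frame[OF x w]) (assumption | blast)+
  note W = null_normalD[OF w] and W' = null_normalD[OF w']
  define \<gamma> where "\<gamma> u v = A x u v - h x u v *\<^sub>R w" for u v
  have g\<eta>: "\<gamma> u v = lorentz (\<gamma> u v) \<eta> *\<^sub>R \<eta>" for u v
    unfolding \<gamma>_def by (rule e1) (rule horospherical_form[OF x w])+
  define d where "d = w' - w"
  have dT: "lorentz d (D1 x u) = 0" "lorentz d (F x) = 0" for u by (simp_all add: d_def lorentz_simps W W')
  define p where "p = lorentz d w"
  define q where "q = lorentz d \<eta>"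
  have d: "d = p *\<^sub>R (w - F x) + q *\<^sub>R \<eta>" unfolding p_def q_def by (rule e2[OF dT])
  have wF: "lorentz (F x) w = -1" "lorentz (F x) \<eta> = 0" "lorentz w \<eta> = 0" using W(2) \<eta> lorentz_sym by metis+
  have A: "p * h x u v + q * lorentz (\<gamma> u v) \<eta> = 0" for u v
  proof -
    have "0 = lorentz d (A x u v)" by (simp add: d_def lorentz_simps W W')
    also have "\<dots> = p * (- lorentz (F x) (A x u v)) + q * lorentz \<eta> (A x u v)"
      unfolding d by (simp add: lorentz_simps W)
    also have "lorentz \<eta> (A x u v) = lorentz (\<gamma> u v) \<eta>"
      unfolding \<gamma>_def lorentz_sym[of \<eta>] by (simp add: lorentz_simps wF)
    finally show ?thesis by (simp add: A_F[OF x])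
  qed
  obtain v :: 'm where v: "v \<noteq> 0" by (metis nonzero_Basis nonempty_Basis all_not_in_conv)
  have q0: "q = 0"
  proof (rule ccontr)
    assume q: "q \<noteq> 0"
    have val: "\<gamma> u v = (- p / q * h x u v) *\<^sub>R \<eta>" for u v
    proof -
      have "lorentz (\<gamma> u v) \<eta> = - p / q * h x u v" using A[of u v] q by (simp add: field_simps)
      then show ?thesis using g\<eta>[of u v] by simp
    qed
    have "- p / q = 0"
      by (rule kaehler_multiple_zero[OF x val \<eta>(1)]) (use horospherical_kaehler[OF x w] in \<open>simp add: \<gamma>_def\<close>)
    then have "p = 0" using q by simp
    then have "d = q *\<^sub>R \<eta>" using d by simp
    then have "w' = w + q *\<^sub>R \<eta>" by (simp add: d_def diff_eq_eq add.commute)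
    then have "lorentz w' w' = q * q" using W(1) \<eta> wF by (simp add: lorentz_simps)
    then show False using W'(1) q by simp
  qed
  then have "p = 0" using A[of v v] h_pos[OF x v] by simp
  then show ?thesis using d q0 by (simp add: d_def)
qed

end

section \<open>The horospherical case\<close>

text \<open>The scale \<open>s\<close> is not tied to the distance of \<open>X k\<close> from
  \<open>x\<close>. It will be that distance, a step along a fixed ray, or the increment of the null
  normal, in which case the limit direction is 0.\<close>

lemma has_derivative_sequential_quotient:
  fixes f :: "'a::real_normed_vector \<Rightarrow> 'b::real_normed_vector"
  assumes f: "(f has_derivative f') (at x)" and X: "X \<longlonglongrightarrow> x" and s: "\<And>k. s k > 0"
    and z: "(\<lambda>k. (X k - x) /\<^sub>R s k) \<longlonglongrightarrow> z"
  shows "(\<lambda>k. (f (X k) - f x) /\<^sub>R s k) \<longlonglongrightarrow> f' z"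
proof -
  have bl: "bounded_linear f'" using f by (rule has_derivative_bounded_linear)
  have 1: "(\<lambda>k. f' ((X k - x) /\<^sub>R s k)) \<longlonglongrightarrow> f' z"
    by (rule bounded_linear.tendsto[OF bl z])
  obtain M where M: "M > 0" "\<And>k. norm ((X k - x) /\<^sub>R s k) \<le> M"
  proof -
    have "Bseq (\<lambda>k. (X k - x) /\<^sub>R s k)" using z convergentI convergent_imp_Bseq by blast
    then show ?thesis using that unfolding Bseq_def by blast
  qed
  have 2: "(\<lambda>k. (f (X k) - f x - f' (X k - x)) /\<^sub>R s k) \<longlonglongrightarrow> 0"
  proof (rule LIMSEQ_I)
    fix r :: real assume r: "r > 0"
    define e where "e = r / (2 * M)"
    have e: "e > 0" using r M by (simp add: e_def)
    then obtain d where d: "d > 0" "\<And>y. norm (y - x) < d \<Longrightarrow> norm (f y - f x - f' (y - x)) \<le> e * norm (y - x)"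
      using f[unfolded has_derivative_at_alt] by meson
    obtain N where N: "\<And>k. k \<ge> N \<Longrightarrow> norm (X k - x) < d" using LIMSEQ_D[OF X d(1)] by blast
    have "norm ((f (X k) - f x - f' (X k - x)) /\<^sub>R s k - 0) < r" if "k \<ge> N" for k
    proof -
      have "norm ((f (X k) - f x - f' (X k - x)) /\<^sub>R s k) \<le> e * norm ((X k - x) /\<^sub>R s k)"
        using d(2)[OF N[OF that]] s[of k] by (simp add: divide_simps mult_ac)
      also have "\<dots> \<le> e * M" using M(2)[of k] e by (intro mult_left_mono) auto
      also have "\<dots> < r" using r M by (simp add: e_def)
      finally show ?thesis by simp
    qed
    then show "\<exists>no. \<forall>n\<ge>no. norm ((f (X n) - f x - f' (X n - x)) /\<^sub>R s n - 0) < r" by blast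
  qed
  have "(f (X k) - f x - f' (X k - x)) /\<^sub>R s k + f' ((X k - x) /\<^sub>R s k) = (f (X k) - f x) /\<^sub>R s k" for k
    unfolding linear_cmul[OF bounded_linear.linear[OF bl]] by (simp add: scaleR_diff_right)
  then show ?thesis using tendsto_add[OF 2 1] by simp
qed

lemma LIMSEQ_inverse_Suc:
  fixes X :: "nat \<Rightarrow> 'a::metric_space"
  assumes "\<And>k. dist (X k) x < 1 / real (Suc k)"
  shows "X \<longlonglongrightarrow> x"
proof (rule metric_LIMSEQ_I)
  fix r :: real assume "r > 0"
  then obtain N where N: "1 / real (Suc N) < r" using nat_approx_posE by blast
  have "dist (X n) x < r" if "n \<ge> N" for n
  proof -
    have "1 / real (Suc n) \<le> 1 / real (Suc N)" using that by (simp add: frac_le)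
    then show ?thesis using assms[of n] N by linarith
  qed
  then show "\<exists>no. \<forall>n\<ge>no. dist (X n) x < r" by blast
qed

lemmas tendsto_lorentz = bounded_bilinear.tendsto[OF bounded_bilinear_lorentz]

section \<open>Compactness of null normals\<close>

context hyperbolic_chart
begin

lemma isCont_F: "x \<in> U \<Longrightarrow> isCont F x" and isCont_D1: "x \<in> U \<Longrightarrow> isCont (\<lambda>y. D1 y u) x"
  and isCont_D2: "x \<in> U \<Longrightarrow> isCont (\<lambda>y. D2 y u v) x" and isCont_D3: "x \<in> U \<Longrightarrow> isCont (\<lambda>y. D3 y u v w) x"
  and isCont_h: "x \<in> U \<Longrightarrow> isCont (\<lambda>y. h y u v) x" and isCont_J: "x \<in> U \<Longrightarrow> isCont (\<lambda>y. J y u) x"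
  using deriv_F deriv_D1 deriv_D2 smooth_on_has_derivative[OF smooth_D3] deriv_h deriv_J has_derivative_continuous
  by blast+

text \<open>With \<open>w = (a, s)\<close> and \<open>F x = (b, t)\<close>, the level condition
  gives \<open>s * (t - norm b) \<le> 1\<close>, while
  \<open>(t - norm b) * (t + norm b) = 1\<close>, so \<open>s \<le> t + norm b\<close>. The norm of
  a null vector is at most twice its time component.\<close>

lemma null_normal_bound:
  assumes x: "x \<in> U" and w: "null_normal x w"
  shows "norm w \<le> 4 * norm (F x)" and "snd w > 0"
proof -
  obtain a s where wa: "w = (a, s)" by (cases w)
  obtain b t where Fb: "F x = (b, t)" by (cases "F x")
  have t: "t > 0" "b \<bullet> b - t * t = -1"
    using F_hyp[OF x] F_norm[OF x] unfolding hyperboloid_def Fb lorentz_def by simp_all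
  have s1: "a \<bullet> a = s * s" using null_normalD(1)[OF w] unfolding lorentz_def wa by simp
  have s2: "a \<bullet> b - s * t = -1" using null_normalD(2)[OF w] unfolding lorentz_def wa Fb by simp
  have na: "norm a = \<bar>s\<bar>" using s1 by (simp add: norm_eq_sqrt_inner power2_eq_square[symmetric])
  have nb: "norm b < t"
  proof (rule power2_less_imp_less)
    show "(norm b)\<^sup>2 < t\<^sup>2" unfolding power2_norm_eq_inner using t(2) by (simp add: power2_eq_square)
  qed (use t(1) in simp)
  have ab: "\<bar>a \<bullet> b\<bar> \<le> \<bar>s\<bar> * norm b" using Cauchy_Schwarz_ineq2[of a b] na by simp
  have sp: "s > 0"
  proof (rule ccontr)
    assume "\<not> s > 0"
    then have "s * t = - (\<bar>s\<bar> * t)" by simp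
    moreover have "\<bar>s\<bar> * norm b \<le> \<bar>s\<bar> * t" using nb by (intro mult_left_mono) auto
    ultimately show False using s2 ab by linarith
  qed
  then show "snd w > 0" by (simp add: wa)
  have "s * (t - norm b) \<le> 1" using s2 ab sp by (simp add: algebra_simps)
  moreover have "(t - norm b) * (t + norm b) = 1"
    using t(2) by (simp add: power2_norm_eq_inner[symmetric] power2_eq_square algebra_simps)
  ultimately have "(t - norm b) * s \<le> (t - norm b) * (t + norm b)" by (simp add: mult.commute)
  then have "s \<le> t + norm b" using nb by (simp only: mult_le_cancel_left_pos diff_gt_0_iff_gt)
  moreover have "t \<le> norm (F x)" "norm b \<le> norm (F x)"
    using norm_snd_le[of t b] norm_fst_le[of b t] t(1) by (auto simp: Fb)
  moreover have "norm w \<le> 2 * s" using norm_Pair_le[of a s] na sp by (simp add: wa)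
  ultimately show "norm w \<le> 4 * norm (F x)" by linarith
qed

lemma null_normal_limit:
  assumes x: "x \<in> U" and X: "X \<longlonglongrightarrow> x" and w: "\<And>k. null_normal (X k) (w k)" and l: "w \<longlonglongrightarrow> w0"
  shows "null_normal x w0"
proof -
  note c = isCont_tendsto_compose[OF _ X]
  have "(\<lambda>k. lorentz (w k) (w k)) \<longlonglongrightarrow> lorentz w0 w0" by (rule tendsto_lorentz[OF l l])
  then have 1: "lorentz w0 w0 = 0" by (simp add: null_normalD(1)[OF w] LIMSEQ_const_iff)
  have "(\<lambda>k. lorentz (w k) (F (X k))) \<longlonglongrightarrow> lorentz w0 (F x)" by (rule tendsto_lorentz[OF l c[OF isCont_F[OF x]]])
  then have 2: "lorentz w0 (F x) = -1" by (simp add: null_normalD(2)[OF w] LIMSEQ_const_iff)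
  have "(\<lambda>k. lorentz (w k) (D1 (X k) v)) \<longlonglongrightarrow> lorentz w0 (D1 x v)" for v by (rule tendsto_lorentz[OF l c[OF isCont_D1[OF x]]])
  then have 3: "lorentz w0 (D1 x v) = 0" for v by (simp add: null_normalD(3)[OF w] LIMSEQ_const_iff)
  have "(\<lambda>k. lorentz (w k) (D2 (X k) v y)) \<longlonglongrightarrow> lorentz w0 (D2 x v y)" for v y by (rule tendsto_lorentz[OF l c[OF isCont_D2[OF x]]])
  then have 4: "lorentz w0 (D2 x v y) = 0" for v y by (simp add: null_normalD(4)[OF w] LIMSEQ_const_iff)
  show ?thesis using 1 2 3 4 by (simp add: null_normal_def)
qed

text \<open>Null normals over a convergent sequence are bounded and their conditions are closed.
  This is the compactness behind \<open>open_no_null_normal\<close> and behind the continuity of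
  \<open>W\<close>.\<close>

lemma null_normal_subsequence:
  assumes x: "x \<in> U" and X: "X \<longlonglongrightarrow> x" "\<And>k. X k \<in> U" and w: "\<And>k. null_normal (X k) (w k)"
  shows "\<exists>w0 r. strict_mono r \<and> (w \<circ> r) \<longlonglongrightarrow> w0 \<and> null_normal x w0"
proof -
  have "convergent (\<lambda>k. F (X k))" using isCont_tendsto_compose[OF isCont_F[OF x] X(1)] convergentI by blast
  then have "Bseq (\<lambda>k. F (X k))" by (rule convergent_imp_Bseq)
  then obtain M where M: "\<And>k. norm (F (X k)) \<le> M" unfolding Bseq_def by blast
  have "bounded (range w)"
    unfolding bounded_iff using null_normal_bound(1)[OF X(2) w] M by (intro exI[of _ "4 * M"]) (auto, smt (verit))
  then obtain w0 r where r: "strict_mono r" "(w \<circ> r) \<longlonglongrightarrow> w0"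
    using bounded_imp_convergent_subsequence by blast
  have "(X \<circ> r) \<longlonglongrightarrow> x" using X(1) r(1) by (rule LIMSEQ_subseq_LIMSEQ)
  from null_normal_limit[OF x this _ r(2)] have "null_normal x w0" using w by simp
  then show ?thesis using r by blast
qed

lemma open_no_null_normal: "open {x \<in> U. \<not> (\<exists>w. null_normal x w)}"
proof -
  let ?C = "{x \<in> U. \<exists>w. null_normal x w}"
  have "x \<in> ?C" if x: "x \<in> U" and cl: "x \<in> closure ?C" for x
  proof -
    obtain X where X: "\<And>n. X n \<in> ?C" "X \<longlonglongrightarrow> x" using cl closure_sequential by blast
    then have "\<forall>n. \<exists>w. null_normal (X n) w" by blast
    then obtain w where "\<And>n. null_normal (X n) (w n)" by metis
    then show ?thesis using null_normal_subsequence[OF x X(2), of w] X(1) x by blast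
  qed
  then have 1: "x \<notin> closure ?C" if "x \<in> U" "\<not> (\<exists>w. null_normal x w)" for x using that by force
  have 2: "x \<notin> ?C" if "x \<notin> closure ?C" for x using that closure_subset by (rule contra_subsetD[rotated])
  have "{x \<in> U. \<not> (\<exists>w. null_normal x w)} = U - closure ?C"
  proof (intro equalityI subsetI)
    fix x assume "x \<in> {x \<in> U. \<not> (\<exists>w. null_normal x w)}"
    then have "x \<in> U" "\<not> (\<exists>w. null_normal x w)" by simp_all
    then show "x \<in> U - closure ?C" using 1 by (simp only: Diff_iff simp_thms)
  next
    fix x assume "x \<in> U - closure ?C"
    then have x: "x \<in> U" "x \<notin> closure ?C" by (simp_all only: Diff_iff simp_thms)
    from 2[OF x(2)] x(1) show "x \<in> {x \<in> U. \<not> (\<exists>w. null_normal x w)}"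
      by (simp only: mem_Collect_eq simp_thms)
  qed
  then show ?thesis using open_U by (simp add: open_Diff)
qed

definition kaehler_form :: "'m \<Rightarrow> ('m \<Rightarrow> 'm \<Rightarrow> real) \<Rightarrow> bool" where
  "kaehler_form x \<sigma> \<longleftrightarrow> (\<forall>u v w z. \<sigma> u (J x z) * \<sigma> v (J x w) - \<sigma> u (J x w) * \<sigma> v (J x z) = \<sigma> u z * \<sigma> v w - \<sigma> u w * \<sigma> v z)"

lemma kaehler_form_wedge_defect:
  assumes "kaehler_form x \<sigma>" "\<And>u. B (J' u) = J x (B u)" "hermitian_space J'"
  shows "hermitian_space.wedge_defect J' (\<lambda>u v. \<sigma> (B u) (B v)) p q r s = 0"
  using assms(1)[unfolded kaehler_form_def, rule_format, of "B p" "B s" "B q" "B r"]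
  by (simp add: hermitian_space.wedge_defect_def[OF assms(3)] wedge_form_def assms(2) mult.commute)

lemma kaehler_form_multiple:
  assumes x: "x \<in> U" and K: "kaehler_form x (\<lambda>u v. k * h x u v)"
  shows "k = 0"
proof -
  obtain B :: "'m \<Rightarrow> 'm" and J' where B: "linear B" "bij B" "\<And>u v. h x (B u) (B v) = u \<bullet> v"
    and J': "hermitian_space J'" "\<And>u. B (J' u) = J x (B u)"
    by (rule pull_back[OF x]) (rule that, assumption+)
  have d4: "4 \<le> DIM('m)" using dim_m by linarith
  have wd: "hermitian_space.wedge_defect J' (\<lambda>u v. k * (u \<bullet> v)) p q r s = 0" for p q r s
    using kaehler_form_wedge_defect[where x = x and B = B and J' = J' and \<sigma> = "\<lambda>u v. k * h x u v", OF K J'(2,1)] by (simp add: B(3))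
  show ?thesis by (rule hermitian_space.kaehler_multiple_of_metric[OF J'(1) d4 wd])
qed

lemma kaehler_shift_zero:
  assumes x: "x \<in> U" and t: "\<And>z. bilinear (t z)" "\<And>u v. linear (\<lambda>z. t z u v)"
    and sym: "\<And>u v z. t z u v = t z v u" "\<And>u v z. t z u v = t u z v"
    and K: "\<And>z. kaehler_form x (\<lambda>u v. t z u v - \<psi> z * h x u v)"
  shows "\<psi> Z = 0"
proof -
  obtain B :: "'m \<Rightarrow> 'm" and J' where B: "linear B" "bij B" "\<And>u v. h x (B u) (B v) = u \<bullet> v"
    and J': "hermitian_space J'" "\<And>u. B (J' u) = J x (B u)"
    by (rule pull_back[OF x]) (rule that, assumption+)
  have d6: "6 \<le> DIM('m)" using dim_m by linarith
  define t' where "t' z u v = t (B z) (B u) (B v)" for z u v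
  have bt: "bilinear (t' z)" for z
    unfolding bilinear_def t'_def
    by (intro conjI allI linearI) (simp_all add: linear_add[OF B(1)] linear_cmul[OF B(1)] bilinearD[OF t(1)])
  have lt: "linear (\<lambda>z. t' z u v)" for u v
    unfolding t'_def by (rule linearI) (simp_all add: linear_add[OF B(1)] linear_cmul[OF B(1)] linear_add[OF t(2)] linear_cmul[OF t(2)])
  have s1: "t' z u v = t' z v u" for u v z unfolding t'_def by (rule sym(1))
  have s2: "t' z u v = t' u z v" for u v z unfolding t'_def by (rule sym(2))
  have wd: "hermitian_space.wedge_defect J' (\<lambda>u v. t' z u v - \<psi> (B z) * (u \<bullet> v)) p q r s = 0" for z p q r s
    using kaehler_form_wedge_defect[where x = x and B = B and J' = J' and \<sigma> = "\<lambda>u v. t (B z) u v - \<psi> (B z) * h x u v", OF K J'(2,1), of p q r s] by (simp add: B(3) t'_def)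
  have "(\<psi> \<circ> B) z = 0" for z
    by (rule hermitian_space.cubic_form_kaehler_shift[OF J'(1) d6 bt lt s1 s2, of "\<psi> \<circ> B"]) (simp add: wd)
  then show ?thesis using B(2) by (metis bij_pointE comp_apply)
qed

end

section \<open>Constancy of the null normal\<close>

locale horospherical_chart = hyperbolic_chart U F h J
  for U :: "'m::euclidean_space set" and F :: "'m \<Rightarrow> 'h::euclidean_space \<times> real" and h J +
  assumes ex_null: "x \<in> U \<Longrightarrow> \<exists>w. null_normal x w"
    and nonflat: "open S \<Longrightarrow> S \<subseteq> U \<Longrightarrow> S \<noteq> {} \<Longrightarrow> \<exists>x\<in>S. \<exists>u v w z. gauss x u v w z \<noteq> 0"
begin

definition W where "W x = (SOME w. null_normal x w)"

lemma W: "x \<in> U \<Longrightarrow> null_normal x (W x)"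
  unfolding W_def using ex_null by (rule someI_ex)

lemmas WD = null_normalD[OF W]

text \<open>Along a sequence violating continuity the values subconverge to a null normal at
  \<open>x\<close>, which can only be \<open>W x\<close>.\<close>

lemma W_isCont:
  assumes x: "x \<in> U" shows "isCont W x"
proof (rule ccontr)
  assume "\<not> isCont W x"
  then obtain e where e: "e > 0" and ne: "\<And>d. d > 0 \<Longrightarrow> \<exists>y. dist y x < d \<and> \<not> dist (W y) (W x) < e"
    unfolding continuous_at_eps_delta dist_norm[symmetric] by blast
  obtain d where d: "d > 0" "ball x d \<subseteq> U" using open_U x openE by blast
  have "\<exists>y. dist y x < min d (1 / real (Suc k)) \<and> \<not> dist (W y) (W x) < e" for k
    using d(1) by (intro ne) simp
  then obtain X where X: "\<And>k. dist (X k) x < min d (1 / real (Suc k))" "\<And>k. \<not> dist (W (X k)) (W x) < e" by metis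
  have XU: "X k \<in> U" for k using X(1)[of k] d(2) by (auto simp: dist_commute subset_iff)
  have "X \<longlonglongrightarrow> x" by (rule LIMSEQ_inverse_Suc) (use X(1) in simp)
  from null_normal_subsequence[OF x this XU, of "\<lambda>k. W (X k)"] W[OF XU]
  obtain w0 r where r: "strict_mono r" "((\<lambda>k. W (X k)) \<circ> r) \<longlonglongrightarrow> w0" "null_normal x w0" by blast
  have "w0 = W x" using null_normal_unique[OF x r(3) W[OF x]] .
  then obtain N where "\<And>k. k \<ge> N \<Longrightarrow> dist (W (X (r k))) (W x) < e"
    using metric_LIMSEQ_D[OF r(2) e] by auto
  then show False using X(2)[of "r N"] by auto
qed

lemma derivative_W_orthogonal:
  assumes x: "x \<in> U" and D: "(W has_derivative W') (at x)"
  shows "lorentz (W' z) (F x) = 0" "lorentz (W' z) (D1 x u) = 0" "lorentz (W' z) (W x) = 0"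
    "lorentz (W' z) (D2 x u v) = - lorentz (W x) (D3 x z u v)"
proof -
  note c = has_derivative_locally_constant[OF open_U x has_derivative_lorentz[OF D]]
  have "lorentz (W x) (D1 x z) + lorentz (W' z) (F x) = 0"
    by (rule c[OF deriv_F[OF x]]) (rule WD(2))
  then show "lorentz (W' z) (F x) = 0" by (simp add: WD[OF x])
  have "lorentz (W x) (D2 x z u) + lorentz (W' z) (D1 x u) = 0"
    by (rule c[OF deriv_D1[OF x]]) (rule WD(3))
  then show "lorentz (W' z) (D1 x u) = 0" by (simp add: WD[OF x])
  have "lorentz (W x) (W' z) + lorentz (W' z) (W x) = 0"
    by (rule c[OF D]) (rule WD(1))
  then show "lorentz (W' z) (W x) = 0" by (simp add: lorentz_sym[of "W x" "W' z"])
  have "lorentz (W x) (D3 x z u v) + lorentz (W' z) (D2 x u v) = 0"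
    by (rule c[OF deriv_D2[OF x]]) (rule WD(4))
  then show "lorentz (W' z) (D2 x u v) = - lorentz (W x) (D3 x z u v)" by simp
qed

text \<open>Where the horospherical form is not zero, the second order jet of \<open>F\<close> spans
  the Lorentzian space. The argument is that of \<open>null_normal_unique\<close>, with
  \<open>ne\<close> in the place of nullity.\<close>

lemma orthogonal_jet_zero:
  assumes x: "x \<in> U" and ne: "A x a b \<noteq> h x a b *\<^sub>R W x"
    and y: "lorentz y (F x) = 0" "\<And>u. lorentz y (D1 x u) = 0" "\<And>u v. lorentz y (D2 x u v) = 0"
  shows "y = 0"
proof -
  obtain \<eta> where \<eta>: "lorentz \<eta> \<eta> = 1" "lorentz \<eta> (F x) = 0" "lorentz \<eta> (W x) = 0" "\<And>u. lorentz \<eta> (D1 x u) = 0"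
    and e1: "\<And>z. (\<And>u. lorentz z (D1 x u) = 0) \<Longrightarrow> lorentz z (F x) = 0 \<Longrightarrow> lorentz z (W x) = 0 \<Longrightarrow> z = lorentz z \<eta> *\<^sub>R \<eta>"
    and e2: "\<And>z. (\<And>u. lorentz z (D1 x u) = 0) \<Longrightarrow> lorentz z (F x) = 0 \<Longrightarrow> z = lorentz z (W x) *\<^sub>R (W x - F x) + lorentz z \<eta> *\<^sub>R \<eta>"
    by (rule null_normal_frame[OF x W[OF x]]) (assumption | blast)+
  define \<gamma> where "\<gamma> u v = A x u v - h x u v *\<^sub>R W x" for u v
  have g\<eta>: "\<gamma> u v = lorentz (\<gamma> u v) \<eta> *\<^sub>R \<eta>" for u v
    unfolding \<gamma>_def by (rule e1) (rule horospherical_form[OF x W[OF x]])+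
  define p where "p = lorentz y (W x)"
  define q where "q = lorentz y \<eta>"
  have ye: "y = p *\<^sub>R (W x - F x) + q *\<^sub>R \<eta>" unfolding p_def q_def by (rule e2[OF y(2,1)])
  have W\<eta>: "lorentz (W x) \<eta> = 0" using \<eta>(3) lorentz_sym by metis
  have eq: "p * h x u v + q * lorentz (\<gamma> u v) \<eta> = 0" for u v
  proof -
    have "0 = lorentz y (A x u v)" by (simp add: A_def lorentz_simps y)
    also have "\<dots> = p * h x u v + q * lorentz \<eta> (A x u v)"
      unfolding ye by (simp add: lorentz_simps WD[OF x] A_F[OF x])
    also have "lorentz \<eta> (A x u v) = lorentz (\<gamma> u v) \<eta>"
      unfolding \<gamma>_def lorentz_sym[of \<eta>] by (simp add: lorentz_simps W\<eta>)
    finally show ?thesis by simp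
  qed
  obtain v :: 'm where v: "v \<noteq> 0" by (metis nonzero_Basis nonempty_Basis all_not_in_conv)
  have q: "q = 0"
  proof (rule ccontr)
    assume q: "q \<noteq> 0"
    have val: "\<gamma> u v = (- p / q * h x u v) *\<^sub>R \<eta>" for u v
    proof -
      have "lorentz (\<gamma> u v) \<eta> = - p / q * h x u v" using eq[of u v] q by (simp add: field_simps)
      then show ?thesis using g\<eta>[of u v] by simp
    qed
    have "- p / q = 0"
      by (rule kaehler_multiple_zero[OF x val \<eta>(1)]) (use horospherical_kaehler[OF x W[OF x]] in \<open>simp add: \<gamma>_def\<close>)
    then have "p = 0" using q by simp
    then have "\<gamma> a b = 0" using val[of a b] by simp
    then show False using ne by (simp add: \<gamma>_def)
  qed
  then have "p = 0" using eq[of v v] h_pos[OF x v] by simp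
  then show ?thesis using ye q by simp
qed

lemma W_differentiable:
  assumes x: "x \<in> U" and ne: "A x a b \<noteq> h x a b *\<^sub>R W x"
  shows "W differentiable (at x)"
proof -
  \<comment> \<open>The linear conditions on the null normal as one indexed family: 0, 1, 2 is the
    order of the jet, the basis vectors are its arguments. Nullity is quadratic and is left
    out.\<close>
  define B where "B = (\<lambda>(k::nat, b::'m, c::'m) x y. if k = 0 then lorentz y (F x) else if k = 1 then lorentz y (D1 x b) else lorentz y (D2 x b c))"
  define C where "C = (\<lambda>(k::nat, b::'m, c::'m) (x::'m). if k = 0 then -1 else (0::real))"
  show ?thesis
  proof (rule linear_system_solution_differentiable[where I = "{0,1,2} \<times> Basis \<times> Basis" and U = U and B = B and c = C])
    have ll: "linear (\<lambda>y. lorentz y z)" for z :: "'h \<times> real" by (rule linearI) (simp_all add: lorentz_simps)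
    show "linear (B i x)" for i x
      by (cases i; cases "fst i = 0"; cases "fst i = 1") (simp_all add: B_def ll)
    have dl: "(\<lambda>x. lorentz y (f x)) differentiable (at x)" if "(f has_derivative f') (at x)" for y :: "'h \<times> real" and f f'
      using has_derivative_lorentz[OF has_derivative_const that] unfolding differentiable_def by blast
    show "(\<lambda>x. B i x y) differentiable (at x)" for i y
      by (cases i; cases "fst i = 0"; cases "fst i = 1")
        (simp_all add: B_def dl[OF deriv_F[OF x]] dl[OF deriv_D1[OF x]] dl[OF deriv_D2[OF x]])
    show "B i x (W x) = C i x" if "x \<in> U" for i x by (cases i) (auto simp: B_def C_def WD[OF that])
    show "C i differentiable (at x)" for i by (cases i) (simp add: C_def)
    show "y = 0" if y: "\<And>i. i \<in> {0,1,2} \<times> Basis \<times> Basis \<Longrightarrow> B i x y = 0" for y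
    proof (rule orthogonal_jet_zero[OF x ne])
      obtain b :: 'm where b: "b \<in> Basis" using nonempty_Basis by blast
      show "lorentz y (F x) = 0" using y[of "(0, b, b)"] b by (simp add: B_def)
      have 1: "lorentz y (D1 x c) = 0" if "c \<in> Basis" for c using y[of "(1, c, b)"] b that by (simp add: B_def)
      show "lorentz y (D1 x u) = 0" for u
        by (subst euclidean_representation[of u, symmetric])
          (simp add: linear_sum[OF D1_linear[OF x]] linear_cmul[OF D1_linear[OF x]] lorentz_simps 1 del: euclidean_representation)
      have 2: "lorentz y (D2 x c d) = 0" if "c \<in> Basis" "d \<in> Basis" for c d using y[of "(2, c, d)"] that by (simp add: B_def)
      note b2 = D2_bilinear[OF x]
      have 3: "lorentz y (D2 x u d) = 0" if "d \<in> Basis" for u d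
        by (subst euclidean_representation[of u, symmetric])
          (simp add: bil_sum_left[OF b2] bil_scale_left[OF b2] lorentz_simps 2 that del: euclidean_representation)
      show "lorentz y (D2 x u v) = 0" for u v
        by (subst euclidean_representation[of v, symmetric])
          (simp add: bil_sum_right[OF b2] bil_scale_right[OF b2] lorentz_simps 3 del: euclidean_representation)
    qed
  qed (use open_U x in auto)
qed

text \<open>By the Codazzi equation the derivative of the null normal has rank one and \<open>\<psi>(z) b(u, v)\<close> is symmetric
  in \<open>z, u\<close>, which forces \<open>b\<close> to have rank at most one unless \<open>\<psi> = 0\<close>.\<close>

lemma third_derivative_zero_nonflat:
  assumes x: "x \<in> U" and nf: "gauss x a b c d \<noteq> 0"
  shows "lorentz (W x) (D3 x z u v) = 0"
proof (rule ccontr)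
  assume n0: "lorentz (W x) (D3 x z u v) \<noteq> 0"
  obtain \<eta> where \<eta>: "lorentz \<eta> \<eta> = 1" "lorentz \<eta> (F x) = 0" "lorentz \<eta> (W x) = 0" "\<And>u. lorentz \<eta> (D1 x u) = 0"
    and e1: "\<And>z. (\<And>u. lorentz z (D1 x u) = 0) \<Longrightarrow> lorentz z (F x) = 0 \<Longrightarrow> lorentz z (W x) = 0 \<Longrightarrow> z = lorentz z \<eta> *\<^sub>R \<eta>"
    by (rule null_normal_frame[OF x W[OF x]]) (assumption | blast)+
  define \<gamma> where "\<gamma> u v = A x u v - h x u v *\<^sub>R W x" for u v
  define \<beta> where "\<beta> u v = lorentz (\<gamma> u v) \<eta>" for u v
  have g\<eta>: "\<gamma> u v = \<beta> u v *\<^sub>R \<eta>" for u v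
    unfolding \<gamma>_def \<beta>_def by (rule e1) (rule horospherical_form[OF x W[OF x]])+
  have gs: "gauss x u v w z = \<beta> u z * \<beta> v w - \<beta> u w * \<beta> v z" for u v w z
    unfolding horospherical_form(4)[OF x W[OF x]] \<gamma>_def[symmetric] g\<eta> by (simp add: lorentz_simps \<eta>)
  have "\<exists>p q. A x p q \<noteq> h x p q *\<^sub>R W x"
  proof (rule ccontr)
    assume "\<not> ?thesis"
    then have "\<gamma> p q = 0" for p q by (simp add: \<gamma>_def)
    then have "\<beta> p q = 0" for p q by (simp add: \<beta>_def lorentz_simps)
    then show False using nf gs by simp
  qed
  then obtain W' where D: "(W has_derivative W') (at x)"
    using W_differentiable[OF x] unfolding differentiable_def by blast
  note O = derivative_W_orthogonal[OF x D]
  define \<psi> where "\<psi> z = lorentz (W' z) \<eta>" for z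
  have W': "W' z = \<psi> z *\<^sub>R \<eta>" for z unfolding \<psi>_def by (rule e1[OF O(2,1,3)])
  have pb: "\<psi> z * \<beta> u v = - lorentz (W x) (D3 x z u v)" for z u v
  proof -
    have "lorentz (W' z) (D2 x u v) = lorentz (W' z) (\<gamma> u v)"
      unfolding D2_A[OF x] \<gamma>_def by (simp add: lorentz_simps O)
    then show ?thesis unfolding O(4) by (simp add: W' g\<eta> lorentz_simps \<eta>)
  qed
  have sw: "\<psi> z * \<beta> u v = \<psi> u * \<beta> z v" for z u v unfolding pb D3_sym1[OF x, of z u] ..
  have z0: "\<psi> z \<noteq> 0" using n0 pb[of z u v] by auto
  have b: "\<beta> p q = \<psi> p * (\<beta> z q / \<psi> z)" for p q using sw[of z p q] z0 by (simp add: field_simps)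
  have "gauss x a b c d = 0" unfolding gs b[of a] b[of b] by simp
  then show False using nf by simp
qed

text \<open>The function is continuous and vanishes at all points that are not flat; these are dense
  by \<open>nonflat\<close>.\<close>

lemma third_derivative_zero:
  assumes x: "x \<in> U"
  shows "lorentz (W x) (D3 x z u v) = 0"
proof (rule ccontr)
  let ?f = "\<lambda>x. lorentz (W x) (D3 x z u v)"
  assume ne: "?f x \<noteq> 0"
  have "continuous_on U ?f"
    by (rule bounded_bilinear.continuous_on[OF bounded_bilinear_lorentz])
      (use W_isCont isCont_D3 in \<open>auto intro: continuous_at_imp_continuous_on\<close>)
  then have op: "open (U \<inter> ?f -` (- {0}))" using open_U by (intro continuous_open_preimage) auto
  from nonflat[OF op] x ne obtain y where "y \<in> U" "?f y \<noteq> 0" "\<exists>u v w z. gauss y u v w z \<noteq> 0" by blast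
  then show False using third_derivative_zero_nonflat by blast
qed

text \<open>The derivative is orthogonal to the whole second order jet: to \<open>D2\<close> because
  this product is minus the one in \<open>third_derivative_zero\<close>, which vanishes at flat
  points as well.\<close>

lemma W_deriv_zero_nonumbilic:
  assumes x: "x \<in> U" and ne: "A x a b \<noteq> h x a b *\<^sub>R W x"
  shows "(W has_derivative (\<lambda>_. 0)) (at x)"
proof -
  obtain W' where D: "(W has_derivative W') (at x)"
    using W_differentiable[OF x ne] unfolding differentiable_def by blast
  note O = derivative_W_orthogonal[OF x D]
  have "W' z = 0" for z
    by (rule orthogonal_jet_zero[OF x ne]) (simp_all add: O third_derivative_zero[OF x])
  then have "W' = (\<lambda>_. 0)" by auto
  then show ?thesis using D by simp
qed

text \<open>At an umbilic point the horospherical form vanishes, so its quotients by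
  \<open>s k\<close> along the sequence have a limit \<open>G\<close>, computed from the derivatives
  of \<open>A\<close> and \<open>h\<close> and from \<omega>. The Kaehler identity is homogeneous of
  degree two and survives division and limit. As \<open>G\<close> is a multiple of \<eta>, it
  becomes a scalar form: the normal derivative of \<open>A\<close> minus \<psi> times the
  metric.\<close>

lemma umbilic_quotient_limit:
  assumes x: "x \<in> U" and um: "\<And>a b. A x a b = h x a b *\<^sub>R W x"
    and \<eta>: "lorentz \<eta> \<eta> = 1" "lorentz \<eta> (F x) = 0" "lorentz \<eta> (W x) = 0" "\<And>u. lorentz \<eta> (D1 x u) = 0"
    and e1: "\<And>z. (\<And>u. lorentz z (D1 x u) = 0) \<Longrightarrow> lorentz z (F x) = 0 \<Longrightarrow> lorentz z (W x) = 0 \<Longrightarrow> z = lorentz z \<eta> *\<^sub>R \<eta>"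
    and X: "X \<longlonglongrightarrow> x" "\<And>k. X k \<in> U" and s: "\<And>k. s k > 0"
    and z: "(\<lambda>k. (X k - x) /\<^sub>R s k) \<longlonglongrightarrow> z" and \<omega>: "(\<lambda>k. (W (X k) - W x) /\<^sub>R s k) \<longlonglongrightarrow> \<omega>"
  shows "\<exists>\<psi>. \<omega> = \<psi> *\<^sub>R \<eta> \<and> kaehler_form x (\<lambda>u v. lorentz (nablaA x z u v) \<eta> - \<psi> * h x u v)"
proof -
  note quo = has_derivative_sequential_quotient[OF _ X(1) s z]
  note c = isCont_tendsto_compose[OF _ X(1)]
  note uniq = LIMSEQ_unique
  have Wl: "(\<lambda>k. W (X k)) \<longlonglongrightarrow> W x" by (rule c[OF W_isCont[OF x]])
  have oF: "lorentz \<omega> (F x) = 0"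
  proof -
    have "lorentz ((W (X k) - W x) /\<^sub>R s k) (F (X k)) = - lorentz (W x) ((F (X k) - F x) /\<^sub>R s k)" for k
      by (simp add: lorentz_simps WD[OF X(2)] WD[OF x] algebra_simps)
    moreover have "(\<lambda>k. lorentz ((W (X k) - W x) /\<^sub>R s k) (F (X k))) \<longlonglongrightarrow> lorentz \<omega> (F x)"
      by (rule tendsto_lorentz[OF \<omega> c[OF isCont_F[OF x]]])
    moreover have "(\<lambda>k. - lorentz (W x) ((F (X k) - F x) /\<^sub>R s k)) \<longlonglongrightarrow> - lorentz (W x) (D1 x z)"
      by (intro tendsto_minus tendsto_lorentz tendsto_const quo[OF deriv_F[OF x]])
    ultimately have "lorentz \<omega> (F x) = - lorentz (W x) (D1 x z)" using uniq by simp
    then show ?thesis by (simp add: WD[OF x])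
  qed
  have oT: "lorentz \<omega> (D1 x u) = 0" for u
  proof -
    have "lorentz ((W (X k) - W x) /\<^sub>R s k) (D1 (X k) u) = - lorentz (W x) ((D1 (X k) u - D1 x u) /\<^sub>R s k)" for k
      by (simp add: lorentz_simps WD[OF X(2)] WD[OF x] algebra_simps)
    moreover have "(\<lambda>k. lorentz ((W (X k) - W x) /\<^sub>R s k) (D1 (X k) u)) \<longlonglongrightarrow> lorentz \<omega> (D1 x u)"
      by (rule tendsto_lorentz[OF \<omega> c[OF isCont_D1[OF x]]])
    moreover have "(\<lambda>k. - lorentz (W x) ((D1 (X k) u - D1 x u) /\<^sub>R s k)) \<longlonglongrightarrow> - lorentz (W x) (D2 x z u)"
      by (intro tendsto_minus tendsto_lorentz tendsto_const quo[OF deriv_D1[OF x]])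
    ultimately have "lorentz \<omega> (D1 x u) = - lorentz (W x) (D2 x z u)" using uniq by simp
    then show ?thesis by (simp add: WD[OF x])
  qed
  \<comment> \<open>The difference of two null vectors is orthogonal to their sum.\<close>
  have oW: "lorentz \<omega> (W x) = 0"
  proof -
    have "lorentz ((W (X k) - W x) /\<^sub>R s k) (W (X k) + W x) = 0" for k
      by (simp add: lorentz_simps WD[OF X(2)] WD[OF x] lorentz_sym[of "W x" "W (X k)"])
    moreover have "(\<lambda>k. lorentz ((W (X k) - W x) /\<^sub>R s k) (W (X k) + W x)) \<longlonglongrightarrow> lorentz \<omega> (W x + W x)"
      by (intro tendsto_lorentz \<omega> tendsto_add Wl tendsto_const)
    ultimately have "lorentz \<omega> (W x + W x) = 0" by (simp add: LIMSEQ_const_iff)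
    then show ?thesis by (simp add: lorentz_simps)
  qed
  define \<psi> where "\<psi> = lorentz \<omega> \<eta>"
  have \<omega>e: "\<omega> = \<psi> *\<^sub>R \<eta>" unfolding \<psi>_def by (rule e1[OF oT oF oW])
  define g where "g k u v = (A (X k) u v - h (X k) u v *\<^sub>R W (X k)) /\<^sub>R s k" for k u v
  define h' where "h' u v = h x (\<Gamma> x z u) v + h x u (\<Gamma> x z v)" for u v
  define G where "G u v = dA x z u v - (h x u v *\<^sub>R \<omega> + h' u v *\<^sub>R W x)" for u v
  have gl: "(\<lambda>k. g k u v) \<longlonglongrightarrow> G u v" for u v
  proof -
    have "g k u v = (A (X k) u v - A x u v) /\<^sub>R s k
       - (h (X k) u v *\<^sub>R ((W (X k) - W x) /\<^sub>R s k) + ((h (X k) u v - h x u v) /\<^sub>R s k) *\<^sub>R W x)" for k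
      unfolding g_def um by (simp add: algebra_simps)
    moreover have "(\<lambda>k. (A (X k) u v - A x u v) /\<^sub>R s k
       - (h (X k) u v *\<^sub>R ((W (X k) - W x) /\<^sub>R s k) + ((h (X k) u v - h x u v) /\<^sub>R s k) *\<^sub>R W x)) \<longlonglongrightarrow> G u v"
      unfolding G_def h'_def
      by (intro tendsto_diff tendsto_add tendsto_scaleR \<omega> tendsto_const quo[OF deriv_A[OF x]] quo[OF deriv_h_\<Gamma>[OF x]] c[OF isCont_h[OF x]])
    ultimately show ?thesis by simp
  qed
  have G_ex: "G u v = (lorentz (nablaA x z u v) \<eta> - \<psi> * h x u v) *\<^sub>R \<eta>" for u v
  proof -
    note hf = horospherical_form[OF X(2) W[OF X(2)]]
    have 0: "lorentz (g k u v) (F (X k)) = 0" "lorentz (g k u v) (D1 (X k) y) = 0" "lorentz (g k u v) (W (X k)) = 0" for k y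
      unfolding g_def by (simp_all add: lorentz_simps(5) hf)
    have "lorentz (G u v) (D1 x y) = 0" for y
      using tendsto_lorentz[OF gl[of u v] c[OF isCont_D1[OF x, of y]]] by (simp add: 0 LIMSEQ_const_iff)
    moreover have "lorentz (G u v) (F x) = 0"
      using tendsto_lorentz[OF gl[of u v] c[OF isCont_F[OF x]]] by (simp add: 0 LIMSEQ_const_iff)
    moreover have "lorentz (G u v) (W x) = 0"
      using tendsto_lorentz[OF gl[of u v] Wl] by (simp add: 0 LIMSEQ_const_iff)
    ultimately have "G u v = lorentz (G u v) \<eta> *\<^sub>R \<eta>" by (rule e1)
    moreover have W\<eta>: "lorentz (W x) \<eta> = 0" "lorentz (D1 x y) \<eta> = 0" for y using \<eta> lorentz_sym by metis+
    then have "lorentz (G u v) \<eta> = lorentz (nablaA x z u v) \<eta> - \<psi> * h x u v"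
      unfolding G_def nablaA_def um by (simp add: lorentz_simps \<omega>e \<eta>)
    ultimately show ?thesis by simp
  qed
  have G_bil: "bilinear G"
    unfolding G_ex[abs_def] bilinear_def
    by (intro conjI allI linearI) (simp_all add: bilinearD[OF nablaA_bil[OF x]] bilinearD[OF h_bil[OF x]] lorentz_simps algebra_simps)
  have g_bil: "bilinear (g k)" for k
    unfolding g_def bilinear_def
    by (intro conjI allI linearI) (simp_all add: bilinearD[OF A_bil[OF X(2)]] bilinearD[OF h_bil[OF X(2)]] algebra_simps)
  have gJ: "(\<lambda>k. g k u (J (X k) v)) \<longlonglongrightarrow> G u (J x v)" for u v
  proof -
    have ex: "B u y = (\<Sum>b\<in>Basis. (y \<bullet> b) *\<^sub>R B u b)" if "bilinear B" for B :: "'m \<Rightarrow> 'm \<Rightarrow> 'h \<times> real" and y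
      by (subst euclidean_representation[of y, symmetric])
        (simp add: bil_sum_right[OF that] bil_scale_right[OF that] del: euclidean_representation)
    have "(\<lambda>k. \<Sum>b\<in>Basis. (J (X k) v \<bullet> b) *\<^sub>R g k u b) \<longlonglongrightarrow> (\<Sum>b\<in>Basis. (J x v \<bullet> b) *\<^sub>R G u b)"
      by (intro tendsto_sum tendsto_scaleR tendsto_inner tendsto_const gl c[OF isCont_J[OF x]])
    moreover have "g k u (J (X k) v) = (\<Sum>b\<in>Basis. (J (X k) v \<bullet> b) *\<^sub>R g k u b)" for k by (rule ex[OF g_bil])
    moreover have "G u (J x v) = (\<Sum>b\<in>Basis. (J x v \<bullet> b) *\<^sub>R G u b)" by (rule ex[OF G_bil])
    ultimately show ?thesis by simp
  qed
  have "lorentz (G u (J x y)) (G v (J x w)) - lorentz (G u (J x w)) (G v (J x y))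
     = lorentz (G u y) (G v w) - lorentz (G u w) (G v y)" for u v w y
  proof -
    have "lorentz (g k u (J (X k) y)) (g k v (J (X k) w)) - lorentz (g k u (J (X k) w)) (g k v (J (X k) y))
     = lorentz (g k u y) (g k v w) - lorentz (g k u w) (g k v y)" for k
    proof -
      define q where "q a b = A (X k) a b - h (X k) a b *\<^sub>R W (X k)" for a b
      define i where "i = inverse (s k)"
      have e: "lorentz (g k a b) (g k c d) = i * i * lorentz (q a b) (q c d)" for a b c d
        unfolding g_def q_def[symmetric] i_def[symmetric] by (simp add: lorentz_simps)
      show ?thesis
        unfolding e right_diff_distrib[symmetric]
        using horospherical_kaehler[OF X(2) W[OF X(2)], of k u y v w] unfolding q_def by simp
    qed
    moreover have "(\<lambda>k. lorentz (g k u (J (X k) y)) (g k v (J (X k) w)) - lorentz (g k u (J (X k) w)) (g k v (J (X k) y)))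
      \<longlonglongrightarrow> lorentz (G u (J x y)) (G v (J x w)) - lorentz (G u (J x w)) (G v (J x y))"
      by (intro tendsto_diff tendsto_lorentz gJ)
    moreover have "(\<lambda>k. lorentz (g k u y) (g k v w) - lorentz (g k u w) (g k v y))
      \<longlonglongrightarrow> lorentz (G u y) (G v w) - lorentz (G u w) (G v y)"
      by (intro tendsto_diff tendsto_lorentz gl)
    ultimately show ?thesis using uniq by simp
  qed
  then have "kaehler_form x (\<lambda>u v. lorentz (nablaA x z u v) \<eta> - \<psi> * h x u v)"
    unfolding kaehler_form_def G_ex by (simp add: lorentz_simps \<eta>)
  then show ?thesis using \<omega>e by blast
qed

end

context horospherical_chart
begin

lemma umbilic_normal:
  assumes x: "x \<in> U"
  obtains \<eta> where "lorentz \<eta> \<eta> = 1" "lorentz \<eta> (F x) = 0" "lorentz \<eta> (W x) = 0" "\<And>u. lorentz \<eta> (D1 x u) = 0"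
    "\<And>z. (\<And>u. lorentz z (D1 x u) = 0) \<Longrightarrow> lorentz z (F x) = 0 \<Longrightarrow> lorentz z (W x) = 0 \<Longrightarrow> z = lorentz z \<eta> *\<^sub>R \<eta>"
  by (rule null_normal_frame[OF x W[OF x]]) (assumption | blast)+

text \<open>Otherwise rescale by the increment of \<open>W\<close>: the quotients subconverge to a
  unit vector, a multiple \<psi> of \<eta>, while the base points have limit direction 0. The
  limiting form is then minus \<psi> times the metric, which forces \<psi> to vanish.\<close>

lemma umbilic_lipschitz:
  assumes x: "x \<in> U" and um: "\<And>a b. A x a b = h x a b *\<^sub>R W x"
  shows "\<exists>C d. d > 0 \<and> (\<forall>y. dist y x < d \<longrightarrow> y \<in> U \<and> norm (W y - W x) \<le> C * norm (y - x))"
proof (rule ccontr)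
  assume neg: "\<not> ?thesis"
  obtain d where d: "d > 0" "ball x d \<subseteq> U" using open_U x openE by blast
  have "\<exists>y. dist y x < min d (1 / real (Suc k)) \<and> norm (W y - W x) > real k * norm (y - x)" for k
  proof (rule ccontr)
    assume c: "\<not> ?thesis"
    have "y \<in> U \<and> norm (W y - W x) \<le> real k * norm (y - x)" if y: "dist y x < min d (1 / real (Suc k))" for y
    proof
      show "y \<in> U" using y d(2) by (auto simp: dist_commute subset_iff)
      show "norm (W y - W x) \<le> real k * norm (y - x)"
        by (rule ccontr) (use c y not_le in blast)
    qed
    then have "\<forall>y. dist y x < min d (1 / real (Suc k)) \<longrightarrow> y \<in> U \<and> norm (W y - W x) \<le> real k * norm (y - x)"
      by blast
    moreover have "min d (1 / real (Suc k)) > 0" using d(1) by simp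
    ultimately show False using neg by blast
  qed
  then obtain X where X: "\<And>k. dist (X k) x < min d (1 / real (Suc k))"
    "\<And>k. norm (W (X k) - W x) > real k * norm (X k - x)" by metis
  have XU: "X k \<in> U" for k using X(1)[of k] d(2) by (auto simp: dist_commute subset_iff)
  have Xl: "X \<longlonglongrightarrow> x" by (rule LIMSEQ_inverse_Suc) (use X(1) in simp)
  define s where "s k = norm (W (X k) - W x)" for k
  have s: "s k > 0" for k
    using X(2)[of k] unfolding s_def by (smt (verit) mult_nonneg_nonneg norm_ge_zero of_nat_0_le_iff)
  define q where "q k = (W (X k) - W x) /\<^sub>R s k" for k
  have q1: "norm (q k) = 1" for k using s[of k] by (simp add: q_def s_def)
  then have "bounded (range q)" unfolding bounded_iff by (intro exI[of _ 1]) auto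
  then obtain \<omega> r where r: "strict_mono r" "(q \<circ> r) \<longlonglongrightarrow> \<omega>"
    using bounded_imp_convergent_subsequence by blast
  have "(\<lambda>k. norm ((q \<circ> r) k)) \<longlonglongrightarrow> norm \<omega>" using r(2) by (rule tendsto_norm)
  then have n\<omega>: "norm \<omega> = 1" using q1 by (simp add: LIMSEQ_const_iff)
  have dir: "(\<lambda>k. (X k - x) /\<^sub>R s k) \<longlonglongrightarrow> 0"
  proof (rule tendsto_norm_zero_cancel, rule tendsto_sandwich[OF _ _ tendsto_const lim_inverse_n])
    have "norm ((X k - x) /\<^sub>R s k) \<le> inverse (real k)" if "k \<ge> 1" for k
      using X(2)[of k] s[of k] that unfolding s_def[symmetric] by (simp add: divide_simps mult_ac)
    then show "\<forall>\<^sub>F k in sequentially. norm ((X k - x) /\<^sub>R s k) \<le> inverse (real k)"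
      unfolding eventually_sequentially by blast
  qed auto
  obtain \<eta> where \<eta>: "lorentz \<eta> \<eta> = 1" "lorentz \<eta> (F x) = 0" "lorentz \<eta> (W x) = 0" "\<And>u. lorentz \<eta> (D1 x u) = 0"
    and e1: "\<And>z. (\<And>u. lorentz z (D1 x u) = 0) \<Longrightarrow> lorentz z (F x) = 0 \<Longrightarrow> lorentz z (W x) = 0 \<Longrightarrow> z = lorentz z \<eta> *\<^sub>R \<eta>"
    by (rule umbilic_normal[OF x]) (assumption | blast)+
  have "\<exists>\<psi>. \<omega> = \<psi> *\<^sub>R \<eta> \<and> kaehler_form x (\<lambda>u v. lorentz (nablaA x 0 u v) \<eta> - \<psi> * h x u v)"
  proof (rule umbilic_quotient_limit[OF x um \<eta> e1, of "X \<circ> r" "s \<circ> r"])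
    show "(X \<circ> r) \<longlonglongrightarrow> x" using Xl r(1) by (rule LIMSEQ_subseq_LIMSEQ)
    show "(\<lambda>k. ((X \<circ> r) k - x) /\<^sub>R (s \<circ> r) k) \<longlonglongrightarrow> 0"
      using LIMSEQ_subseq_LIMSEQ[OF dir r(1)] by (simp add: o_def)
    show "(\<lambda>k. (W ((X \<circ> r) k) - W x) /\<^sub>R (s \<circ> r) k) \<longlonglongrightarrow> \<omega>" using r(2) by (simp add: o_def q_def)
  qed (use XU s in simp_all)
  then obtain \<psi> where \<psi>: "\<omega> = \<psi> *\<^sub>R \<eta>" "kaehler_form x (\<lambda>u v. lorentz (nablaA x 0 u v) \<eta> - \<psi> * h x u v)" by blast
  have "nablaA x 0 u v = 0" for u v
    using nablaA_sym1[OF x, of 0 u v] bil_zero_left[OF nablaA_bil[OF x]] by simp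
  then have "kaehler_form x (\<lambda>u v. (- \<psi>) * h x u v)" using \<psi>(2) by (simp add: lorentz_simps)
  then have "- \<psi> = 0" by (rule kaehler_form_multiple[OF x])
  then show False using \<psi>(1) n\<omega> by simp
qed

text \<open>The Lipschitz bound makes difference quotients subconverge, each limit being a multiple
  \<psi> of \<eta> for which the shifted cubic form is of Kaehler type. By
  \<open>kaehler_shift_zero\<close> every such \<psi> is 0; that lemma does not presuppose that
  \<psi> depends linearly on the direction.\<close>

lemma W_deriv_zero_umbilic:
  assumes x: "x \<in> U" and um: "\<And>a b. A x a b = h x a b *\<^sub>R W x"
  shows "(W has_derivative (\<lambda>_. 0)) (at x)"
proof -
  obtain C d where d: "d > 0" and L: "\<And>y. dist y x < d \<Longrightarrow> y \<in> U" "\<And>y. dist y x < d \<Longrightarrow> norm (W y - W x) \<le> C * norm (y - x)"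
    using umbilic_lipschitz[OF x um] by blast
  obtain \<eta> where \<eta>: "lorentz \<eta> \<eta> = 1" "lorentz \<eta> (F x) = 0" "lorentz \<eta> (W x) = 0" "\<And>u. lorentz \<eta> (D1 x u) = 0"
    and e1: "\<And>z. (\<And>u. lorentz z (D1 x u) = 0) \<Longrightarrow> lorentz z (F x) = 0 \<Longrightarrow> lorentz z (W x) = 0 \<Longrightarrow> z = lorentz z \<eta> *\<^sub>R \<eta>"
    by (rule umbilic_normal[OF x]) (assumption | blast)+
  note Q = umbilic_quotient_limit[OF x um \<eta> e1]
  define P where "P z \<psi> \<longleftrightarrow> kaehler_form x (\<lambda>u v. lorentz (nablaA x z u v) \<eta> - \<psi> * h x u v)" for z \<psi>
  have P_ex: "\<exists>\<psi>. P z \<psi>" for z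
  proof -
    \<comment> \<open>Steps small enough to stay in the ball where the Lipschitz bound
      holds.\<close>
    define s where "s k = d / (2 * (norm z + 1) * real (Suc k))" for k
    have s: "s k > 0" for k using d by (simp add: s_def add_nonneg_pos)
    have sl: "s \<longlonglongrightarrow> 0"
    proof -
      have "(\<lambda>k. d / (2 * (norm z + 1)) * inverse (real (Suc k))) \<longlonglongrightarrow> d / (2 * (norm z + 1)) * 0"
        by (intro tendsto_mult tendsto_const LIMSEQ_inverse_real_of_nat)
      then show ?thesis by (simp add: s_def[abs_def] divide_inverse mult_ac)
    qed
    define X where "X k = x + s k *\<^sub>R z" for k
    have sz: "s k * norm z < d" for k
    proof -
      have "s k \<le> d / (2 * (norm z + 1))"
        unfolding s_def using d by (intro divide_left_mono) (auto simp: add_nonneg_pos intro!: mult_pos_pos)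
      then have "s k * norm z \<le> d / (2 * (norm z + 1)) * norm z" by (intro mult_right_mono) auto
      also have "\<dots> < d" using d by (simp add: divide_simps add_nonneg_pos)
      finally show ?thesis .
    qed
    have Xd: "dist (X k) x < d" for k using sz[of k] s[of k] by (simp add: X_def dist_norm)
    have Xl: "X \<longlonglongrightarrow> x" unfolding X_def using tendsto_add[OF tendsto_const tendsto_scaleR[OF sl tendsto_const], of x z] by simp
    define q where "q k = (W (X k) - W x) /\<^sub>R s k" for k
    have "norm (q k) \<le> C * norm z" for k
      using L(2)[OF Xd[of k]] s[of k] by (simp add: q_def X_def divide_simps mult_ac)
    then have "bounded (range q)" unfolding bounded_iff by blast
    then obtain \<omega> r where r: "strict_mono r" "(q \<circ> r) \<longlonglongrightarrow> \<omega>"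
      using bounded_imp_convergent_subsequence by blast
    have "\<exists>\<psi>. \<omega> = \<psi> *\<^sub>R \<eta> \<and> kaehler_form x (\<lambda>u v. lorentz (nablaA x z u v) \<eta> - \<psi> * h x u v)"
    proof (rule Q[of "X \<circ> r" "s \<circ> r"])
      show "(X \<circ> r) \<longlonglongrightarrow> x" using Xl r(1) by (rule LIMSEQ_subseq_LIMSEQ)
      have "((X \<circ> r) k - x) /\<^sub>R (s \<circ> r) k = z" for k using s[of "r k"] by (simp add: X_def)
      then show "(\<lambda>k. ((X \<circ> r) k - x) /\<^sub>R (s \<circ> r) k) \<longlonglongrightarrow> z" by simp
      show "(\<lambda>k. (W ((X \<circ> r) k) - W x) /\<^sub>R (s \<circ> r) k) \<longlonglongrightarrow> \<omega>" using r(2) by (simp add: o_def q_def)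
    qed (use L(1)[OF Xd] s in simp_all)
    then show ?thesis unfolding P_def by blast
  qed
  have P0: "\<psi> = 0" if "P z \<psi>" for z \<psi>
  proof -
    obtain \<Psi> where \<Psi>: "\<And>z. P z (\<Psi> z)" using P_ex by metis
    \<comment> \<open>The cubic lemma speaks of a function of the direction. Overwriting a choice
      function at \<open>z\<close> makes it apply to an arbitrary admissible value there.\<close>
    have "(\<Psi>(z := \<psi>)) z = 0"
    proof (rule kaehler_shift_zero[OF x, of "\<lambda>z u v. lorentz (nablaA x z u v) \<eta>" "\<Psi>(z := \<psi>)"])
      show "bilinear (\<lambda>u v. lorentz (nablaA x z u v) \<eta>)" for z
        unfolding bilinear_def by (intro conjI allI linearI) (simp_all add: bilinearD[OF nablaA_bil[OF x]] lorentz_simps)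
      show "linear (\<lambda>z. lorentz (nablaA x z u v) \<eta>)" for u v
        unfolding nablaA_sym1[OF x, of _ u] by (rule linearI) (simp_all add: bilinearD[OF nablaA_bil[OF x]] lorentz_simps)
      show "lorentz (nablaA x z u v) \<eta> = lorentz (nablaA x z v u) \<eta>" for z u v
        unfolding nablaA_sym2[OF x, of z u] ..
      show "lorentz (nablaA x z u v) \<eta> = lorentz (nablaA x u z v) \<eta>" for z u v
        unfolding nablaA_sym1[OF x, of z u] ..
      show "kaehler_form x (\<lambda>u v. lorentz (nablaA x y u v) \<eta> - (\<Psi>(z := \<psi>)) y * h x u v)" for y
        using \<Psi>[of y] that by (simp add: P_def)
    qed
    then show ?thesis by simp
  qed
  show ?thesis
    unfolding has_derivative_at_alt
  proof (intro conjI allI impI)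
    show "bounded_linear (\<lambda>_. 0 :: 'h \<times> real)" by simp
    fix e :: real assume e: "e > 0"
    show "\<exists>d>0. \<forall>y. norm (y - x) < d \<longrightarrow> norm (W y - W x - 0) \<le> e * norm (y - x)"
    proof (rule ccontr)
      assume neg: "\<not> ?thesis"
      have "\<exists>y. norm (y - x) < min d (1 / real (Suc k)) \<and> norm (W y - W x) > e * norm (y - x)" for k
      proof -
        have neg': "\<exists>y. norm (y - x) < d' \<and> norm (W y - W x) > e * norm (y - x)" if "d' > 0" for d'
          using neg that by (auto simp: not_le)
        show ?thesis by (rule neg') (use d in simp)
      qed
      then obtain X where X: "\<And>k. norm (X k - x) < min d (1 / real (Suc k))"
        "\<And>k. norm (W (X k) - W x) > e * norm (X k - x)" by metis
      have Xd: "dist (X k) x < d" for k using X(1)[of k] by (simp add: dist_norm)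
      have Xl: "X \<longlonglongrightarrow> x" by (rule LIMSEQ_inverse_Suc) (use X(1) in \<open>simp add: dist_norm\<close>)
      define s where "s k = norm (X k - x)" for k
      have s: "s k > 0" for k using X(2)[of k] by (auto simp: s_def)
      \<comment> \<open>Directions and quotients are paired so that one subsequence makes both
        converge.\<close>
      define q where "q k = ((X k - x) /\<^sub>R s k, (W (X k) - W x) /\<^sub>R s k)" for k
      have q1: "norm (fst (q k)) = 1" for k using s[of k] by (simp add: q_def s_def)
      have q2: "norm (snd (q k)) \<le> C" for k
        using L(2)[OF Xd[of k]] s[of k] by (simp add: q_def s_def[symmetric] divide_simps mult_ac)
      have q3: "norm (snd (q k)) \<ge> e" for k
        using X(2)[of k] s[of k] by (simp add: q_def s_def[symmetric] divide_simps mult_ac)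
      have "norm (q k) \<le> 1 + C" for k
        using norm_Pair_le[of "fst (q k)" "snd (q k)"] q1[of k] q2[of k] by simp
      then have "bounded (range q)" unfolding bounded_iff by blast
      then obtain l r where r: "strict_mono r" "(q \<circ> r) \<longlonglongrightarrow> l"
        using bounded_imp_convergent_subsequence by blast
      have "\<exists>\<psi>. snd l = \<psi> *\<^sub>R \<eta> \<and> kaehler_form x (\<lambda>u v. lorentz (nablaA x (fst l) u v) \<eta> - \<psi> * h x u v)"
      proof (rule Q[of "X \<circ> r" "s \<circ> r"])
        show "(X \<circ> r) \<longlonglongrightarrow> x" using Xl r(1) by (rule LIMSEQ_subseq_LIMSEQ)
        show "(\<lambda>k. ((X \<circ> r) k - x) /\<^sub>R (s \<circ> r) k) \<longlonglongrightarrow> fst l"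
          using tendsto_fst[OF r(2)] by (simp add: o_def q_def)
        show "(\<lambda>k. (W ((X \<circ> r) k) - W x) /\<^sub>R (s \<circ> r) k) \<longlonglongrightarrow> snd l"
          using tendsto_snd[OF r(2)] by (simp add: o_def q_def)
      qed (use L(1)[OF Xd] s in simp_all)
      then have "snd l = 0" using P0 unfolding P_def by fastforce
      moreover have "norm (snd l) \<ge> e"
        using q3 by (intro tendsto_lowerbound[OF tendsto_norm[OF tendsto_snd[OF r(2)]]]) auto
      ultimately show False using e by simp
    qed
  qed
qed

lemma W_constant:
  assumes "convex U" shows "\<exists>w. \<forall>x\<in>U. null_normal x w"
proof -
  have "(W has_derivative (\<lambda>_. 0)) (at x)" if x: "x \<in> U" for x
    using W_deriv_zero_umbilic[OF x] W_deriv_zero_nonumbilic[OF x] by blast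
  then have "\<exists>c. \<forall>x\<in>U. W x = c"
    by (intro has_derivative_zero_constant[OF assms]) (auto intro: has_derivative_at_withinI)
  then show ?thesis using W by metis
qed

end

section \<open>The product case\<close>

lemma linear_bound_Basis:
  fixes f :: "'a::euclidean_space \<Rightarrow> real"
  assumes "linear f" shows "\<bar>f u\<bar> \<le> norm u * (\<Sum>m\<in>Basis. \<bar>f m\<bar>)"
proof -
  have "f u = (\<Sum>m\<in>Basis. (u \<bullet> m) * f m)"
    by (subst euclidean_representation[of u, symmetric])
      (simp add: linear_sum[OF assms] linear_cmul[OF assms] del: euclidean_representation)
  also have "\<bar>\<dots>\<bar> \<le> (\<Sum>m\<in>Basis. norm u * \<bar>f m\<bar>)"
    by (intro order_trans[OF sum_abs] sum_mono) (auto simp: abs_mult Basis_le_norm intro!: mult_right_mono)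
  finally show ?thesis by (simp add: sum_distrib_left)
qed

lemma trilinear_bound_Basis:
  fixes b :: "'a::euclidean_space \<Rightarrow> 'a \<Rightarrow> 'a \<Rightarrow> real"
  assumes l: "\<And>v w. linear (\<lambda>u. b u v w)" "\<And>u w. linear (\<lambda>v. b u v w)" "\<And>u v. linear (\<lambda>w. b u v w)"
  shows "\<bar>b u v w\<bar> \<le> norm u * norm v * norm w * (\<Sum>(m, n, p)\<in>Basis \<times> Basis \<times> Basis. \<bar>b m n p\<bar>)"
proof -
  have "\<bar>b u v w\<bar> \<le> norm u * (\<Sum>m\<in>Basis. \<bar>b m v w\<bar>)" by (rule linear_bound_Basis[OF l(1)])
  also have "\<dots> \<le> norm u * (\<Sum>m\<in>Basis. norm v * (\<Sum>n\<in>Basis. \<bar>b m n w\<bar>))"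
    by (intro mult_left_mono sum_mono linear_bound_Basis[OF l(2)]) auto
  also have "\<dots> \<le> norm u * (\<Sum>m\<in>Basis. norm v * (\<Sum>n\<in>Basis. norm w * (\<Sum>p\<in>Basis. \<bar>b m n p\<bar>)))"
    by (intro mult_left_mono sum_mono linear_bound_Basis[OF l(3)]) auto
  finally show ?thesis by (simp add: sum_distrib_left[symmetric] sum.cartesian_product mult.assoc)
qed

lemma quadrilinear_bound_Basis:
  fixes b :: "'a::euclidean_space \<Rightarrow> 'a \<Rightarrow> 'a \<Rightarrow> 'a \<Rightarrow> real"
  assumes l: "\<And>u v w. linear (\<lambda>z. b z u v w)" "\<And>z v w. linear (\<lambda>u. b z u v w)" "\<And>z u w. linear (\<lambda>v. b z u v w)"
    "\<And>z u v. linear (\<lambda>w. b z u v w)"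
  shows "\<bar>b z u v w\<bar> \<le> norm z * norm u * norm v * norm w * (\<Sum>(l, m, n, p)\<in>Basis \<times> Basis \<times> Basis \<times> Basis. \<bar>b l m n p\<bar>)"
proof -
  have "\<bar>b z u v w\<bar> \<le> norm z * (\<Sum>l\<in>Basis. \<bar>b l u v w\<bar>)" by (rule linear_bound_Basis[OF l(1)])
  also have "\<dots> \<le> norm z * (\<Sum>l\<in>Basis. norm u * norm v * norm w * (\<Sum>(m, n, p)\<in>Basis \<times> Basis \<times> Basis. \<bar>b l m n p\<bar>))"
    by (intro mult_left_mono sum_mono trilinear_bound_Basis[OF l(2-4)]) auto
  finally show ?thesis by (simp add: sum_distrib_left[symmetric] sum.cartesian_product mult.assoc)
qed

text \<open>Orthogonal projectors for the Lorentzian form. \<open>P_rank\<close> says that each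
  image has dimension at least two, in the form that yields an image vector orthogonal to
  \<open>P i (F x)\<close>.\<close>

locale lorentz_splitting =
  fixes P :: "3 \<Rightarrow> 'h::euclidean_space \<times> real \<Rightarrow> 'h \<times> real"
  assumes P_lin: "linear (P i)" and P_adj: "lorentz (P i y) z = lorentz y (P i z)"
    and P_idem: "P i (P i z) = P i z" and P_orth: "i \<noteq> j \<Longrightarrow> P i (P j z) = 0"
    and P_rank: "\<exists>z. z \<noteq> 0 \<and> P i z = z \<and> lorentz z y = 0"

locale split_chart = hyperbolic_chart U F h J + lorentz_splitting P
  for U :: "'m::euclidean_space set" and F :: "'m \<Rightarrow> 'h::euclidean_space \<times> real" and h J
    and P :: "3 \<Rightarrow> 'h \<times> real \<Rightarrow> 'h \<times> real" +
  fixes k :: "3 \<Rightarrow> real"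
  assumes six: "DIM('m) = 6" and k0: "k i \<noteq> 0"
begin

lemmas PD = linear_add[OF P_lin] linear_diff[OF P_lin] linear_cmul[OF P_lin] linear_neg[OF P_lin] linear_0[OF P_lin]

text \<open>\<open>b = 0\<close> says that \<open>P\<^sub>i\<close> respects the splitting into tangent and normal space; \<open>e\<close> is the covariant
  derivative of \<open>b\<close> when \<open>A\<close> is parallel.\<close>

definition b where "b i x u v w = lorentz (P i (D1 x u)) (A x v w)"

definition e where "e i x z u v w = lorentz (P i (A x z u)) (A x v w) - lorentz (P i (D1 x u)) (D1 x (shape x v w z))"

lemma shape_linear3:
  assumes x: "x \<in> U" shows "linear (\<lambda>z. shape x v w z)"
  by (rule linearI; rule h_eqI[OF x])
    (simp_all add: shape_eq[OF x] bilinearD[OF h_bil[OF x]] bilinearD[OF A_bil[OF x]] lorentz_simps)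

lemma shape_linear2: "x \<in> U \<Longrightarrow> linear (\<lambda>w. shape x v w z)"
  using shape_linear[of x v z] shape_sym[of x v] by simp

lemma b_linear:
  assumes x: "x \<in> U"
  shows "linear (\<lambda>u. b i x u v w)" "linear (\<lambda>v. b i x u v w)" "linear (\<lambda>w. b i x u v w)"
  unfolding b_def
  by (rule linearI, simp_all add: PD D1D[OF x] bilinearD[OF A_bil[OF x]] lorentz_simps)+

lemma e_linear:
  assumes x: "x \<in> U"
  shows "linear (\<lambda>z. e i x z u v w)" "linear (\<lambda>u. e i x z u v w)" "linear (\<lambda>v. e i x z u v w)" "linear (\<lambda>w. e i x z u v w)"
  unfolding e_def
  by (rule linearI, simp_all add: PD D1D[OF x] bilinearD[OF A_bil[OF x]] linear_add[OF shape_linear[OF x]]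
      linear_cmul[OF shape_linear[OF x]] linear_add[OF shape_linear2[OF x]] linear_cmul[OF shape_linear2[OF x]]
      linear_add[OF shape_linear3[OF x]] linear_cmul[OF shape_linear3[OF x]] lorentz_simps algebra_simps)+

lemma shape_differentiable:
  assumes x: "x \<in> U"
  shows "(\<lambda>y. shape y v w z) differentiable (at x)"
proof (rule linear_system_solution_differentiable[where I = "Basis" and U = U
        and B = "\<lambda>b y s. h y s b" and c = "\<lambda>b y. lorentz (A y v w) (A y z b)"])
  show "linear (\<lambda>z. h y z b)" if "y \<in> U" for y b using h_bil[OF that] by (simp add: bilinear_def)
  show "(\<lambda>y. h y z b) differentiable (at x)" for z b using deriv_h[OF x] differentiable_def by blast
  show "h y (shape y v w z) b = lorentz (A y v w) (A y z b)" if "y \<in> U" for y b by (rule shape_eq[OF that])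
  show "(\<lambda>y. lorentz (A y v w) (A y z b)) differentiable (at x)" for b
    using has_derivative_lorentz[OF deriv_A[OF x] deriv_A[OF x]] differentiable_def by blast
  show "z = 0" if z: "\<And>b. b \<in> Basis \<Longrightarrow> h x z b = 0" for z
  proof (rule ccontr)
    assume "z \<noteq> 0"
    have "h x z z = 0"
      by (subst (2) euclidean_representation[of z, symmetric])
        (simp add: bil_sum_right[OF h_bil[OF x]] bil_scale_right[OF h_bil[OF x]] z del: euclidean_representation)
    then show False using h_pos[OF x \<open>z \<noteq> 0\<close>] by simp
  qed
qed (use open_U x in auto)

lemma dA_parallel:
  assumes x: "x \<in> U" and par: "\<And>u v w. nablaA x u v w = 0"
  shows "dA x d v w = A x (\<Gamma> x d v) w + A x v (\<Gamma> x d w) - D1 x (shape x v w d)"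
  using par[of d v w] by (simp add: nablaA_def algebra_simps)

text \<open>\<open>shape\<close> is built from \<open>h\<close> and \<open>A\<close> alone, so it is
  parallel when they are.\<close>

lemma deriv_shape:
  assumes x: "x \<in> U" and par: "\<And>u v w. nablaA x u v w = 0"
  shows "((\<lambda>y. shape y v w z) has_derivative (\<lambda>d. shape x (\<Gamma> x d v) w z + shape x v (\<Gamma> x d w) z
    + shape x v w (\<Gamma> x d z) - \<Gamma> x d (shape x v w z))) (at x)"
proof -
  obtain S' where S': "((\<lambda>y. shape y v w z) has_derivative S') (at x)"
    using shape_differentiable[OF x] unfolding differentiable_def by blast
  have hd: "((\<lambda>y. h y a c) has_derivative (\<lambda>d. h x (\<Gamma> x d a) c + h x a (\<Gamma> x d c))) (at x)" for a c
    by (rule deriv_h_\<Gamma>[OF x])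
  have "S' d = shape x (\<Gamma> x d v) w z + shape x v (\<Gamma> x d w) z + shape x v w (\<Gamma> x d z) - \<Gamma> x d (shape x v w z)" for d
  proof (rule h_eqI[OF x])
    fix c
    have "((\<lambda>y. h y (shape y v w z) c - lorentz (A y v w) (A y z c)) has_derivative
      (\<lambda>d. ((h x (\<Gamma> x d (shape x v w z)) c + h x (shape x v w z) (\<Gamma> x d c)) + h x (S' d) c)
        - (lorentz (A x v w) (dA x d z c) + lorentz (dA x d v w) (A x z c)))) (at x)"
      by (intro has_derivative_diff has_derivative_lorentz deriv_A[OF x]
          has_derivative_linear_family[OF open_U x _ hd S']) (use h_bil in \<open>auto simp: bilinear_def\<close>)
    then have "((h x (\<Gamma> x d (shape x v w z)) c + h x (shape x v w z) (\<Gamma> x d c)) + h x (S' d) c)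
        - (lorentz (A x v w) (dA x d z c) + lorentz (dA x d v w) (A x z c)) = 0"
      by (rule has_derivative_locally_constant[OF open_U x]) (simp add: shape_eq)
    then show "h x (S' d) c = h x (shape x (\<Gamma> x d v) w z + shape x v (\<Gamma> x d w) z + shape x v w (\<Gamma> x d z) - \<Gamma> x d (shape x v w z)) c"
      by (simp add: dA_parallel[OF x par] lorentz_simps A_D1[OF x] bilinearD[OF h_bil[OF x]] shape_eq[OF x])
  qed
  then show ?thesis using S' by (simp add: has_derivative_eq_rhs fun_eq_iff)
qed

text \<open>The covariant derivative of \<open>b\<close> is \<open>e\<close>: the Gauss formula
  differentiates the first factor, the Weingarten formula the second.\<close>

lemma deriv_b:
  assumes x: "x \<in> U" and par: "\<And>u v w. nablaA x u v w = 0"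
  shows "((\<lambda>y. b i y u v w) has_derivative (\<lambda>d. b i x (\<Gamma> x d u) v w + b i x u (\<Gamma> x d v) w + b i x u v (\<Gamma> x d w)
      + e i x d u v w)) (at x)"
proof -
  have PdD1: "((\<lambda>y. P i (D1 y u)) has_derivative (\<lambda>d. P i (D2 x d u))) (at x)"
    by (rule bounded_linear.has_derivative[OF linear_conv_bounded_linear[THEN iffD1, OF P_lin] deriv_D1[OF x]])
  show ?thesis
    unfolding b_def
    by (rule has_derivative_eq_rhs[OF has_derivative_lorentz[OF PdD1 deriv_A[OF x]]])
      (simp add: fun_eq_iff e_def dA_parallel[OF x par] D2_A[OF x] PD lorentz_simps)
qed

text \<open>The covariant derivative of \<open>e\<close> involves only \<open>b\<close>, with
  coefficients from \<open>shape\<close>; this closes the system.\<close>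

lemma deriv_e:
  assumes x: "x \<in> U" and par: "\<And>u v w. nablaA x u v w = 0"
  shows "((\<lambda>y. e i y z u v w) has_derivative (\<lambda>d. e i x (\<Gamma> x d z) u v w + e i x z (\<Gamma> x d u) v w
      + e i x z u (\<Gamma> x d v) w + e i x z u v (\<Gamma> x d w)
      - b i x (shape x z u d) v w - b i x (shape x v w d) z u - b i x (shape x v w z) d u - b i x u d (shape x v w z))) (at x)"
proof -
  note bl = linear_conv_bounded_linear[THEN iffD1, OF P_lin]
  have PdD1: "((\<lambda>y. P i (D1 y u)) has_derivative (\<lambda>d. P i (D2 x d u))) (at x)"
    by (rule bounded_linear.has_derivative[OF bl deriv_D1[OF x]])
  have PdA: "((\<lambda>y. P i (A y z u)) has_derivative (\<lambda>d. P i (dA x d z u))) (at x)"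
    by (rule bounded_linear.has_derivative[OF bl deriv_A[OF x]])
  note dS = has_derivative_linear_family[OF open_U x D1_linear deriv_D1[OF x] deriv_shape[OF x par]]
  have sw: "lorentz (P i y) z = lorentz (P i z) y" for y z using P_adj[of i y z] lorentz_sym by metis
  have sw': "lorentz (P i (A x p q)) (D1 x r) = lorentz (P i (D1 x r)) (A x p q)" for p q r by (rule sw)
  show ?thesis
    unfolding e_def
  proof (rule has_derivative_eq_rhs[OF has_derivative_diff[OF has_derivative_lorentz[OF PdA deriv_A[OF x]] has_derivative_lorentz[OF PdD1 dS]]], assumption, rule ext)
    fix d
    show "lorentz (P i (A x z u)) (dA x d v w) + lorentz (P i (dA x d z u)) (A x v w) -
        (lorentz (P i (D1 x u)) (D2 x d (shape x v w z) + D1 x (shape x (\<Gamma> x d v) w z + shape x v (\<Gamma> x d w) z +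
            shape x v w (\<Gamma> x d z) - \<Gamma> x d (shape x v w z))) + lorentz (P i (D2 x d u)) (D1 x (shape x v w z)))
      = lorentz (P i (A x (\<Gamma> x d z) u)) (A x v w) - lorentz (P i (D1 x u)) (D1 x (shape x v w (\<Gamma> x d z))) +
        (lorentz (P i (A x z (\<Gamma> x d u))) (A x v w) - lorentz (P i (D1 x (\<Gamma> x d u))) (D1 x (shape x v w z))) +
        (lorentz (P i (A x z u)) (A x (\<Gamma> x d v) w) - lorentz (P i (D1 x u)) (D1 x (shape x (\<Gamma> x d v) w z))) +
        (lorentz (P i (A x z u)) (A x v (\<Gamma> x d w)) - lorentz (P i (D1 x u)) (D1 x (shape x v (\<Gamma> x d w) z))) -
        b i x (shape x z u d) v w - b i x (shape x v w d) z u - b i x (shape x v w z) d u - b i x u d (shape x v w z)"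
      unfolding b_def dA_parallel[OF x par] D2_A[OF x] PD D1D[OF x] lorentz_simps sw' by simp
  qed
qed

text \<open>For a parallel second fundamental form the functions \<open>b\<close> and \<open>e\<close> satisfy a closed linear system of
  differential equations along segments.\<close>

lemma parallel_zero_propagates:
  assumes S: "convex S" "S \<subseteq> U" and x: "x \<in> S" "y \<in> S"
    and par: "\<And>x u v w. x \<in> S \<Longrightarrow> nablaA x u v w = 0"
    and init: "\<And>u v w. b i x u v w = 0" "\<And>z u v w. e i x z u v w = 0"
  shows "b i y u v w = 0 \<and> e i y z u v w = 0"
proof -
  define d where "d = y - x"
  define c where "c t = x + t *\<^sub>R d" for t :: real
  have cS: "c t \<in> S" if "0 \<le> t" "t \<le> 1" for t
  proof -
    have "c t = (1 - t) *\<^sub>R x + t *\<^sub>R y" by (simp add: c_def d_def algebra_simps)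
    then show ?thesis using S(1) x that by (simp add: convexD_alt)
  qed
  then have cU: "c t \<in> U" if "0 \<le> t" "t \<le> 1" for t using S(2) that by blast
  \<comment> \<open>Controls all coefficients of the system on basis vectors; the third slot of
    \<open>shape\<close> also receives the direction \<open>d\<close> of the segment.\<close>
  define \<rho> where "\<rho> y = (\<Sum>u\<in>Basis. norm (\<Gamma> y d u)) + (\<Sum>(v, w, z)\<in>Basis \<times> Basis \<times> insert d Basis. norm (shape y v w z))" for y
  have "isCont \<rho> y" if "y \<in> U" for y
  proof -
    have "isCont (\<lambda>y. \<Gamma> y d u) y" for u using has_derivative_continuous[OF deriv_\<Gamma>[OF that]] .
    moreover have "isCont (\<lambda>y. shape y v w z) y" for v w z
      using shape_differentiable[OF that] differentiable_imp_continuous_within by blast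
    ultimately show ?thesis unfolding \<rho>_def by (intro continuous_intros) (auto intro!: continuous_intros)
  qed
  then have "continuous_on (c ` {0..1}) \<rho>" using cU by (intro continuous_at_imp_continuous_on) auto
  moreover have "compact (c ` {0..1})"
    unfolding c_def by (intro compact_continuous_image continuous_intros) auto
  ultimately have "bounded (\<rho> ` (c ` {0..1}))" using compact_continuous_image compact_imp_bounded by blast
  then obtain G where "\<And>r. r \<in> \<rho> ` (c ` {0..1}) \<Longrightarrow> norm r \<le> G" unfolding bounded_iff by blast
  then have G0: "\<bar>\<rho> (c t)\<bar> \<le> G" if "0 \<le> t" "t \<le> 1" for t using that by force
  have G\<Gamma>: "norm (\<Gamma> (c t) d u) \<le> G" if t: "0 \<le> t" "t \<le> 1" and u: "u \<in> Basis" for t u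
  proof -
    have "norm (\<Gamma> (c t) d u) \<le> (\<Sum>u\<in>Basis. norm (\<Gamma> (c t) d u))" by (rule member_le_sum) (use u in auto)
    moreover have "0 \<le> (\<Sum>(v, w, z)\<in>Basis \<times> Basis \<times> insert d Basis. norm (shape (c t) v w z))" by (auto intro!: sum_nonneg)
    ultimately show ?thesis using G0[OF t] unfolding \<rho>_def by linarith
  qed
  have Gs: "norm (shape (c t) v w z) \<le> G" if t: "0 \<le> t" "t \<le> 1" and u: "v \<in> Basis" "w \<in> Basis" "z \<in> insert d Basis" for t v w z
  proof -
    have "(\<lambda>(v, w, z). norm (shape (c t) v w z)) (v, w, z) \<le> (\<Sum>(v, w, z)\<in>Basis \<times> Basis \<times> insert d Basis. norm (shape (c t) v w z))"
      by (rule member_le_sum) (use u in auto)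
    moreover have "0 \<le> (\<Sum>u\<in>Basis. norm (\<Gamma> (c t) d u))" by (auto intro!: sum_nonneg)
    ultimately show ?thesis using G0[OF t] unfolding \<rho>_def by simp
  qed
  have Gp: "G \<ge> 0" using G0[of 0] by simp
  define I :: "('m \<times> 'm \<times> 'm + 'm \<times> 'm \<times> 'm \<times> 'm) set" where "I = Inl ` (Basis \<times> Basis \<times> Basis) \<union> Inr ` (Basis \<times> Basis \<times> Basis \<times> Basis) "
  define \<phi> where "\<phi> j t = (case j of Inl (u, v, w) \<Rightarrow> b i (c t) u v w | Inr (z, u, v, w) \<Rightarrow> e i (c t) z u v w)" for j t
  define \<phi>' where "\<phi>' j t = (case j of Inl (u, v, w) \<Rightarrow> b i (c t) (\<Gamma> (c t) d u) v w + b i (c t) u (\<Gamma> (c t) d v) w + b i (c t) u v (\<Gamma> (c t) d w) + e i (c t) d u v w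
     | Inr (z, u, v, w) \<Rightarrow> e i (c t) (\<Gamma> (c t) d z) u v w + e i (c t) z (\<Gamma> (c t) d u) v w
      + e i (c t) z u (\<Gamma> (c t) d v) w + e i (c t) z u v (\<Gamma> (c t) d w)
      - b i (c t) (shape (c t) z u d) v w - b i (c t) (shape (c t) v w d) z u - b i (c t) (shape (c t) v w z) d u - b i (c t) u d (shape (c t) v w z))" for j t
  define \<Sigma> where "\<Sigma> t = (\<Sum>j\<in>I. \<bar>\<phi> j t\<bar>)" for t
  have \<Sigma>_eq: "\<Sigma> t = (\<Sum>(m, n, p)\<in>Basis \<times> Basis \<times> Basis. \<bar>b i (c t) m n p\<bar>) + (\<Sum>(l, m, n, p)\<in>Basis \<times> Basis \<times> Basis \<times> Basis. \<bar>e i (c t) l m n p\<bar>)" for t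
    unfolding \<Sigma>_def I_def
    by (subst sum.union_disjoint) (auto simp: sum.reindex \<phi>_def case_prod_beta o_def)
  have \<Sigma>p: "\<Sigma> t \<ge> 0" for t by (simp add: \<Sigma>_def sum_nonneg)
  have bb: "\<bar>b i (c t) u v w\<bar> \<le> norm u * norm v * norm w * \<Sigma> t" if "0 \<le> t" "t \<le> 1" for t u v w
  proof -
    have "(\<Sum>(m, n, p)\<in>Basis \<times> Basis \<times> Basis. \<bar>b i (c t) m n p\<bar>) \<le> \<Sigma> t"
      unfolding \<Sigma>_eq by (auto intro!: sum_nonneg)
    then have "norm u * norm v * norm w * (\<Sum>(m, n, p)\<in>Basis \<times> Basis \<times> Basis. \<bar>b i (c t) m n p\<bar>) \<le> norm u * norm v * norm w * \<Sigma> t"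
      by (intro mult_left_mono) auto
    with trilinear_bound_Basis[OF b_linear[OF cU[OF that]], of i u v w] show ?thesis by (rule order_trans)
  qed
  have ee: "\<bar>e i (c t) z u v w\<bar> \<le> norm z * norm u * norm v * norm w * \<Sigma> t" if "0 \<le> t" "t \<le> 1" for t z u v w
  proof -
    have "(\<Sum>(l, m, n, p)\<in>Basis \<times> Basis \<times> Basis \<times> Basis. \<bar>e i (c t) l m n p\<bar>) \<le> \<Sigma> t"
      unfolding \<Sigma>_eq by (auto intro!: sum_nonneg)
    then have "norm z * norm u * norm v * norm w * (\<Sum>(l, m, n, p)\<in>Basis \<times> Basis \<times> Basis \<times> Basis. \<bar>e i (c t) l m n p\<bar>) \<le> norm z * norm u * norm v * norm w * \<Sigma> t"
      by (intro mult_left_mono) auto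
    with quadrilinear_bound_Basis[OF e_linear[OF cU[OF that]], of i z u v w] show ?thesis by (rule order_trans)
  qed
  \<comment> \<open>The equations for \<open>b\<close> need \<open>3 * G + norm d\<close>, those for
    \<open>e\<close> need \<open>6 * G + 2 * G * norm d\<close>; this is the sum.\<close>
  define K where "K = 9 * G + norm d + 2 * G * norm d"
  have "\<phi> j 1 = 0" if j: "j \<in> I" for j
  proof (rule linear_ode_zero[where I = I and \<phi> = \<phi> and \<phi>' = \<phi>' and K = K])
    show "finite I" by (simp add: I_def)
    show "(\<phi> j has_real_derivative \<phi>' j t) (at t)" if j: "j \<in> I" and t: "0 \<le> t" "t \<le> 1" for j t
    proof -
      have dc: "(c has_derivative (\<lambda>s. s *\<^sub>R d)) (at t)" unfolding c_def by (auto intro!: derivative_eq_intros)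
      note p = par[OF cS[OF t]] and u = cU[OF t]
      from j consider (1) u v w where "j = Inl (u, v, w)" | (2) z u v w where "j = Inr (z, u, v, w)"
        unfolding I_def by blast
      then show ?thesis
      proof cases
        case 1
        note D = has_derivative_compose[OF dc deriv_b[OF u p]]
        have \<phi>: "\<phi> j = (\<lambda>t. b i (c t) u v w)" by (simp add: 1 \<phi>_def[abs_def])
        have l: "linear (\<lambda>d. b i (c t) (\<Gamma> (c t) d u) v w + b i (c t) u (\<Gamma> (c t) d v) w + b i (c t) u v (\<Gamma> (c t) d w) + e i (c t) d u v w)" for u v w
          using has_derivative_linear[OF deriv_b[OF cU[OF t] p]] .
        show ?thesis
          unfolding has_field_derivative_def \<phi>
          by (rule has_derivative_eq_rhs[OF D]) (simp only: linear_cmul[OF l] fun_eq_iff, simp add: 1 \<phi>'_def)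
      next
        case 2
        note D = has_derivative_compose[OF dc deriv_e[OF u p]]
        have \<phi>: "\<phi> j = (\<lambda>t. e i (c t) z u v w)" by (simp add: 2 \<phi>_def[abs_def])
        note l = has_derivative_linear[OF deriv_e[OF cU[OF t] p]]
        show ?thesis
          unfolding has_field_derivative_def \<phi>
          by (rule has_derivative_eq_rhs[OF D]) (simp only: linear_cmul[OF l] fun_eq_iff, simp add: 2 \<phi>'_def)
      qed
    qed
    show "\<bar>\<phi>' j t\<bar> \<le> K * (\<Sum>j\<in>I. \<bar>\<phi> j t\<bar>)" if j: "j \<in> I" and t: "0 \<le> t" "t \<le> 1" for j t
    proof -
      have s: "r * \<Sigma> t \<le> r' * \<Sigma> t" if "r \<le> r'" for r r' using that \<Sigma>p by (intro mult_right_mono)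
      from j consider (1) u v w where "j = Inl (u, v, w)" "u \<in> Basis" "v \<in> Basis" "w \<in> Basis"
        | (2) z u v w where "j = Inr (z, u, v, w)" "z \<in> Basis" "u \<in> Basis" "v \<in> Basis" "w \<in> Basis"
        unfolding I_def by blast
      then have "\<bar>\<phi>' j t\<bar> \<le> K * \<Sigma> t"
      proof cases
        case 1
        have "\<bar>b i (c t) (\<Gamma> (c t) d u) v w\<bar> \<le> G * \<Sigma> t" "\<bar>b i (c t) u (\<Gamma> (c t) d v) w\<bar> \<le> G * \<Sigma> t"
          "\<bar>b i (c t) u v (\<Gamma> (c t) d w)\<bar> \<le> G * \<Sigma> t" "\<bar>e i (c t) d u v w\<bar> \<le> norm d * \<Sigma> t"
          using bb[OF t, of "\<Gamma> (c t) d u" v w] bb[OF t, of u "\<Gamma> (c t) d v" w] bb[OF t, of u v "\<Gamma> (c t) d w"]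
            ee[OF t, of d u v w] s[OF G\<Gamma>[OF t 1(2)]] s[OF G\<Gamma>[OF t 1(3)]] s[OF G\<Gamma>[OF t 1(4)]] 1 by (auto intro: order_trans)
        then have "\<bar>\<phi>' j t\<bar> \<le> 3 * (G * \<Sigma> t) + norm d * \<Sigma> t" unfolding 1 \<phi>'_def sum.case prod.case by linarith
        also have "\<dots> \<le> K * \<Sigma> t" using s[of "3 * G + norm d" K] Gp by (simp add: K_def algebra_simps)
        finally show ?thesis .
      next
        case 2
        have n: "norm z = 1" "norm u = 1" "norm v = 1" "norm w = 1" using 2 by auto
        have gd: "norm (shape (c t) v w z) * norm d \<le> G * norm d"
          using Gs[OF t 2(4,5), of z] 2 by (intro mult_right_mono) auto
        have "\<bar>e i (c t) (\<Gamma> (c t) d z) u v w\<bar> \<le> G * \<Sigma> t" "\<bar>e i (c t) z (\<Gamma> (c t) d u) v w\<bar> \<le> G * \<Sigma> t"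
          "\<bar>e i (c t) z u (\<Gamma> (c t) d v) w\<bar> \<le> G * \<Sigma> t" "\<bar>e i (c t) z u v (\<Gamma> (c t) d w)\<bar> \<le> G * \<Sigma> t"
          using ee[OF t, of "\<Gamma> (c t) d z" u v w] ee[OF t, of z "\<Gamma> (c t) d u" v w] ee[OF t, of z u "\<Gamma> (c t) d v" w]
            ee[OF t, of z u v "\<Gamma> (c t) d w"]
            s[OF G\<Gamma>[OF t 2(2)]] s[OF G\<Gamma>[OF t 2(3)]] s[OF G\<Gamma>[OF t 2(4)]] s[OF G\<Gamma>[OF t 2(5)]]
          unfolding n by (auto intro: order_trans)
        moreover have "\<bar>b i (c t) (shape (c t) z u d) v w\<bar> \<le> G * \<Sigma> t" "\<bar>b i (c t) (shape (c t) v w d) z u\<bar> \<le> G * \<Sigma> t"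
          "\<bar>b i (c t) (shape (c t) v w z) d u\<bar> \<le> G * norm d * \<Sigma> t" "\<bar>b i (c t) u d (shape (c t) v w z)\<bar> \<le> G * norm d * \<Sigma> t"
          using bb[OF t, of "shape (c t) z u d" v w] bb[OF t, of "shape (c t) v w d" z u] bb[OF t, of "shape (c t) v w z" d u]
            bb[OF t, of u d "shape (c t) v w z"] s[OF Gs[OF t 2(2,3), of d]] s[OF Gs[OF t 2(4,5), of d]] s[OF gd]
          unfolding n by (auto intro: order_trans simp: mult.commute)
        ultimately have "\<bar>\<phi>' j t\<bar> \<le> 6 * (G * \<Sigma> t) + 2 * (G * norm d * \<Sigma> t)" unfolding 2 \<phi>'_def sum.case prod.case by linarith
        also have "\<dots> \<le> K * \<Sigma> t" using s[of "6 * G + 2 * (G * norm d)" K] Gp by (simp add: K_def algebra_simps)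
        finally show ?thesis .
      qed
      then show ?thesis unfolding \<Sigma>_def .
    qed
    show "\<phi> j 0 = 0" if "j \<in> I" for j using init by (auto simp: \<phi>_def c_def split: sum.split)
  qed (rule j)
  then have 0: "\<Sigma> 1 = 0" unfolding \<Sigma>_def by simp
  have "c 1 = y" by (simp add: c_def d_def)
  then show ?thesis using bb[of 1 u v w] ee[of 1 z u v w] unfolding 0 by simp
qed

end

lemma sum_UNIV_single:
  fixes f :: "'i::finite \<Rightarrow> 'a::comm_monoid_add"
  assumes "\<And>j. j \<noteq> i \<Longrightarrow> f j = 0" shows "sum f UNIV = f i"
  using assms by (subst sum.remove[of _ i]) auto

text \<open>The rank condition holds because the span of \<open>p i\<close> and \<open>q i\<close>
  is a definite plane, in which some nonzero vector is orthogonal to a given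
  \<open>y\<close>.\<close>

lemma lorentz_splitting_frame:
  fixes p q r :: "3 \<Rightarrow> 'h::euclidean_space \<times> real"
  assumes pp: "\<And>i. lorentz (p i) (p i) = 1" and qq: "\<And>i. lorentz (q i) (q i) = 1" and rr: "\<And>i. lorentz (r i) (r i) \<noteq> 0"
    and o: "\<And>i j. i \<noteq> j \<Longrightarrow> lorentz (p i) (p j) = 0" "\<And>i j. i \<noteq> j \<Longrightarrow> lorentz (q i) (q j) = 0"
      "\<And>i j. i \<noteq> j \<Longrightarrow> lorentz (r i) (r j) = 0"
      "\<And>i j. lorentz (p i) (q j) = 0" "\<And>i j. lorentz (p i) (r j) = 0" "\<And>i j. lorentz (q i) (r j) = 0"
  shows "lorentz_splitting (\<lambda>i z. lorentz z (p i) *\<^sub>R p i + lorentz z (q i) *\<^sub>R q i + (lorentz z (r i) / lorentz (r i) (r i)) *\<^sub>R r i)"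
proof -
  have o': "lorentz (q i) (p j) = 0" "lorentz (r i) (p j) = 0" "lorentz (r i) (q j) = 0" for i j
    by (simp_all only: o(4-6) lorentz_sym[of "q i" "p j"] lorentz_sym[of "r i" "p j"] lorentz_sym[of "r i" "q j"])
  let ?P = "\<lambda>i z. lorentz z (p i) *\<^sub>R p i + lorentz z (q i) *\<^sub>R q i + (lorentz z (r i) / lorentz (r i) (r i)) *\<^sub>R r i"
  have 1: "linear (?P i)" for i by (rule linearI) (simp_all add: lorentz_simps algebra_simps add_divide_distrib)
  have 2: "lorentz (?P i y) z = lorentz y (?P i z)" for i y z
    by (simp add: lorentz_simps lorentz_sym[of "p i" z] lorentz_sym[of "q i" z] lorentz_sym[of "r i" z])
  have 3: "?P i (?P i z) = ?P i z" for i z using rr by (simp add: lorentz_simps pp qq o(4-6) o')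
  have 4: "?P i (?P j z) = 0" if "i \<noteq> j" for i j z using that by (simp add: lorentz_simps o(1-3)[OF that[symmetric]] o' o(4-6))
  have 5: "\<exists>z. z \<noteq> 0 \<and> ?P i z = z \<and> lorentz z y = 0" for i y
  proof (cases "lorentz y (p i) = 0 \<and> lorentz y (q i) = 0")
    case True
    have "p i \<noteq> 0" using pp[of i] by (auto simp: lorentz_simps)
    moreover have "?P i (p i) = p i" by (simp add: pp o(4-6))
    ultimately show ?thesis using True lorentz_sym[of "p i" y] by (intro exI[of _ "p i"]) auto
  next
    case False
    define z where "z = lorentz y (q i) *\<^sub>R p i - lorentz y (p i) *\<^sub>R q i"
    have "lorentz z z = (lorentz y (q i))\<^sup>2 + (lorentz y (p i))\<^sup>2"
      by (simp add: z_def lorentz_simps pp qq o(4-6) o' power2_eq_square)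
    then have "z \<noteq> 0" using False by (auto simp: lorentz_simps)
    moreover have "?P i z = z" by (simp add: z_def lorentz_simps pp qq o(4-6) o')
    moreover have "lorentz z y = 0" by (simp add: z_def lorentz_simps lorentz_sym[of _ y] mult.commute)
    ultimately show ?thesis by blast
  qed
  show ?thesis unfolding lorentz_splitting_def using 1 2 3 4 5 by blast
qed

section \<open>Propagation of the product structure\<close>

context split_chart
begin

text \<open>The pointwise conditions implied by the equations
  \<open>lorentz (P i (F y)) (F y) = k i\<close> on an open set, in a form that the differential
  equations propagate.\<close>

definition good where
  "good x \<longleftrightarrow> (\<forall>i u v w. b i x u v w = 0) \<and> (\<forall>i z u v w. e i x z u v w = 0) \<and>
    (\<forall>i u. lorentz (P i (D1 x u)) (F x) = 0) \<and> (\<forall>i. lorentz (P i (F x)) (F x) = k i)"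

lemma P_F_frame:
  assumes 1: "\<And>i u. lorentz (P i (D1 x u)) (F x) = 0" and 2: "\<And>i. lorentz (P i (F x)) (F x) = k i"
  shows P_F_tangent: "lorentz (P i (F x)) (D1 x u) = 0" and P_F_orth: "i \<noteq> j \<Longrightarrow> lorentz (P i (F x)) (P j (F x)) = 0"
    and P_F_norm: "lorentz (P i (F x)) (P i (F x)) = k i"
proof -
  show "lorentz (P i (F x)) (D1 x u) = 0" using 1[of i u] P_adj lorentz_sym by metis
  show "i \<noteq> j \<Longrightarrow> lorentz (P i (F x)) (P j (F x)) = 0" by (simp add: P_adj P_orth lorentz_simps)
  have "lorentz (P i (F x)) (P i (F x)) = lorentz (F x) (P i (F x))" by (simp only: P_adj P_idem)
  then show "lorentz (P i (F x)) (P i (F x)) = k i" using 2[of i] lorentz_sym by metis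
qed

text \<open>Each \<open>P i\<close> has a tangent vector \<open>D1 x u\<close> in its image, and
  vanishing of \<open>e\<close> makes \<open>A x u u\<close> a multiple of \<open>P i (F x)\<close>,
  nonzero because its product with \<open>F x\<close> is \<open>- h x u u\<close>. A null normal
  would be orthogonal to the three vectors \<open>P i (F x)\<close>, which span the normal space,
  and hence be zero.\<close>

lemma good_no_null:
  assumes x: "x \<in> U" and g: "good x" shows "\<not> null_normal x w"
proof
  assume w: "null_normal x w"
  have g1: "lorentz (P i (D1 x u)) (F x) = 0" and g2: "lorentz (P i (F x)) (F x) = k i" for i u
    using g by (auto simp: good_def)
  define y where "y i = P i (F x)" for i
  have yT: "lorentz (y i) (D1 x u) = 0" for i u unfolding y_def by (rule P_F_tangent[OF g1 g2])
  have yo: "lorentz (y i) (y j) = 0" if "i \<noteq> j" for i j unfolding y_def by (rule P_F_orth[OF g1 g2 that])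
  have yy: "lorentz (y i) (y i) = k i" for i unfolding y_def by (rule P_F_norm[OF g1 g2])
  have yn: "lorentz (y i) (y i) \<noteq> 0" for i using yy k0 by simp
  have wy: "lorentz w (y i) = 0" for i
  proof -
    obtain z where z: "z \<noteq> 0" "P i z = z" "lorentz z (y i) = 0" using P_rank by blast
    have "lorentz z (y j) = 0" for j
    proof (cases "j = i")
      case False
      have "lorentz z (y j) = lorentz (P j z) (F x)" by (simp add: y_def P_adj)
      also have "P j z = 0" using P_orth[OF False, of z] z(2) by simp
      finally show ?thesis by (simp add: lorentz_simps)
    qed (use z in simp)
    then have "\<exists>u. z = D1 x u" by (intro tangent_if_orthogonal[OF x six yT yo yn])
    then obtain u where u: "z = D1 x u" by blast
    have u0: "u \<noteq> 0" using u z(1) linear_0[OF D1_linear[OF x]] by auto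
    define a where "a j = lorentz (A x u u) (y j)" for j
    have ex: "A x u u = (\<Sum>j\<in>UNIV. (a j / k j) *\<^sub>R y j)"
      using normal_expansion[where z = "A x u u", OF x six yT yo yn] A_D1[OF x] by (simp add: a_def yy)
    have a0: "a j = 0" if "j \<noteq> i" for j
    proof -
      have "P j (D1 x u) = 0" using P_orth[OF that, of z] z(2) u by simp
      moreover have "e j x u u u u = 0" using g by (simp add: good_def)
      ultimately have "0 = lorentz (P j (A x u u)) (A x u u)" by (simp add: e_def lorentz_simps)
      also have "\<dots> = (\<Sum>l\<in>UNIV. (a l / k l) * lorentz (P j (A x u u)) (y l))"
        by (subst (2) ex) (simp add: lorentz_simps)
      also have "\<dots> = (a j / k j) * lorentz (P j (A x u u)) (y j)"
        by (rule sum_UNIV_single) (simp add: y_def P_adj P_orth lorentz_simps)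
      also have "lorentz (P j (A x u u)) (y j) = a j" by (simp add: y_def a_def P_adj P_idem)
      finally show ?thesis using k0[of j] by simp
    qed
    have A1: "A x u u = (a i / k i) *\<^sub>R y i" unfolding ex by (rule sum_UNIV_single) (simp add: a0)
    have "- h x u u = (a i / k i) * k i"
      using A_F(1)[OF x, of u u] unfolding A1 by (simp add: lorentz_simps y_def g2)
    then have "a i \<noteq> 0" using h_pos[OF x u0] k0[of i] by auto
    moreover have "(a i / k i) * lorentz w (y i) = 0"
      using null_normalD(5)[OF w, of u u] unfolding A1 by (simp add: lorentz_simps)
    ultimately show ?thesis using k0[of i] by simp
  qed
  have "w = (\<Sum>i\<in>UNIV. (lorentz w (y i) / lorentz (y i) (y i)) *\<^sub>R y i)"
    by (intro normal_expansion[OF x six yT yo yn] null_normalD(3)[OF w])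
  then have "w = 0" by (simp add: wy)
  then show False using null_normalD(2)[OF w] by (simp add: lorentz_simps)
qed

lemma split_eta:
  assumes x: "x \<in> U" and sp: "split_frame x f \<eta>" shows "\<eta> i = A x (f i) (f i)"
proof -
  note D = split_frameD[OF sp]
  have "h x (f i) (J x (f i)) = h x (J x (f i)) (J x (J x (f i)))" by (rule J_orth[OF x, symmetric])
  also have "\<dots> = - h x (f i) (J x (f i))" by (simp add: J_sq[OF x] bilinearD[OF h_bil[OF x]] h_sym[OF x, of "J x (f i)"])
  finally have 0: "h x (f i) (J x (f i)) = 0" by simp
  have "A x (f i) (f i) = (h x (f i) (f i) * h x (f i) (f i) + h x (f i) (J x (f i)) * h x (f i) (J x (f i))) *\<^sub>R \<eta> i"
    unfolding D(8) by (rule sum_UNIV_single) (simp add: D(2,3))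
  then show ?thesis by (simp add: D(1) 0)
qed

text \<open>Without null normals every point has a split frame, so \<open>A\<close> is parallel and
  \<open>b\<close>, \<open>e\<close> stay zero. By \<open>split_F\<close> and
  \<open>split_eta\<close> the vector \<open>F z\<close> is a combination of values of
  \<open>A\<close>, so vanishing of \<open>b\<close> makes \<open>lorentz (P i (F z)) (F z)\<close>
  stationary.\<close>

lemma good_propagates:
  assumes S: "convex S" "S \<subseteq> U" and x: "x \<in> S" "good x" and nn: "\<And>y w. y \<in> S \<Longrightarrow> \<not> null_normal y w" and y: "y \<in> S"
  shows "good y"
proof -
  have SU: "z \<in> U" if "z \<in> S" for z using that S(2) by blast
  have sp: "\<exists>f \<eta>. split_frame z f \<eta>" if "z \<in> S" for z using dichotomy[OF SU[OF that]] nn[OF that] by blast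
  have par: "nablaA z u v w = 0" if "z \<in> S" for z u v w
    using sp[OF that] split_nablaA_zero[OF SU[OF that] six] by blast
  have be: "b i z u v w = 0 \<and> e i z a u v w = 0" if "z \<in> S" for i z a u v w
    by (rule parallel_zero_propagates[OF S x(1) that par]) (use x(2) in \<open>auto simp: good_def\<close>)
  have f1: "lorentz (P i (D1 z u)) (F z) = 0" if z: "z \<in> S" for i z u
  proof -
    obtain f \<eta> where s: "split_frame z f \<eta>" using sp[OF z] by blast
    have "lorentz (P i (D1 z u)) (\<eta> j) = 0" for j
      unfolding split_eta[OF SU[OF z] s] using be[OF z, of i u "f j" "f j"] by (simp add: b_def)
    then show ?thesis by (subst split_F[OF SU[OF z] six s]) (simp add: lorentz_simps)
  qed
  have f2: "lorentz (P i (F y)) (F y) = k i" for i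
  proof -
    have "((\<lambda>z. lorentz (P i (F z)) (F z)) has_derivative (\<lambda>_. 0)) (at z within S)" if z: "z \<in> S" for z
    proof -
      have "((\<lambda>z. P i (F z)) has_derivative (\<lambda>d. P i (D1 z d))) (at z)"
        by (rule bounded_linear.has_derivative[OF linear_conv_bounded_linear[THEN iffD1, OF P_lin] deriv_F[OF SU[OF z]]])
      from has_derivative_lorentz[OF this deriv_F[OF SU[OF z]]]
      have D: "((\<lambda>z. lorentz (P i (F z)) (F z)) has_derivative (\<lambda>d. lorentz (P i (F z)) (D1 z d) + lorentz (P i (D1 z d)) (F z))) (at z)" .
      have "lorentz (P i (F z)) (D1 z d) = lorentz (P i (D1 z d)) (F z)" for d using P_adj lorentz_sym by metis
      then have "((\<lambda>z. lorentz (P i (F z)) (F z)) has_derivative (\<lambda>d. 0)) (at z)" using D by (simp add: f1[OF z])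
      then show ?thesis by (rule has_derivative_at_withinI)
    qed
    from has_derivative_zero_constant[OF S(1) this]
    obtain c where "\<And>z. z \<in> S \<Longrightarrow> lorentz (P i (F z)) (F z) = c" by blast
    then have "lorentz (P i (F y)) (F y) = lorentz (P i (F x)) (F x)" using x(1) y by simp
    then show ?thesis using x(2) by (simp add: good_def)
  qed
  show ?thesis unfolding good_def using be[OF y] f1[OF y] f2 by blast
qed

lemma good_limit:
  assumes x: "x \<in> U" and X: "X \<longlonglongrightarrow> x" and g: "\<And>n. good (X n)"
  shows "good x"
proof -
  note c = isCont_tendsto_compose[OF _ X]
  have A: "(\<lambda>n. A (X n) u v) \<longlonglongrightarrow> A x u v" for u v
    by (rule c[OF has_derivative_continuous[OF deriv_A[OF x]]])
  have D: "(\<lambda>n. D1 (X n) u) \<longlonglongrightarrow> D1 x u" for u by (rule c[OF isCont_D1[OF x]])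
  have Ff: "(\<lambda>n. F (X n)) \<longlonglongrightarrow> F x" by (rule c[OF isCont_F[OF x]])
  have DS: "(\<lambda>n. D1 (X n) (shape (X n) v w z)) \<longlonglongrightarrow> D1 x (shape x v w z)" for v w z
  proof -
    obtain S' where S': "((\<lambda>y. shape y v w z) has_derivative S') (at x)"
      using shape_differentiable[OF x] unfolding differentiable_def by blast
    have "continuous (at x) (\<lambda>y. D1 y (shape y v w z))"
      by (rule has_derivative_continuous[OF has_derivative_linear_family[OF open_U x D1_linear deriv_D1[OF x] S']])
    then show ?thesis by (rule isCont_tendsto_compose[OF _ X])
  qed
  have P: "(\<lambda>n. P i (Y n)) \<longlonglongrightarrow> P i y" if "Y \<longlonglongrightarrow> y" for i Y y
    by (rule bounded_linear.tendsto[OF linear_conv_bounded_linear[THEN iffD1, OF P_lin] that])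
  have "b i x u v w = 0" for i u v w
  proof -
    have "(\<lambda>n. b i (X n) u v w) \<longlonglongrightarrow> b i x u v w" unfolding b_def by (intro tendsto_lorentz P A D)
    then show ?thesis using g by (simp add: good_def LIMSEQ_const_iff)
  qed
  moreover have "e i x z u v w = 0" for i z u v w
  proof -
    have "(\<lambda>n. e i (X n) z u v w) \<longlonglongrightarrow> e i x z u v w" unfolding e_def by (intro tendsto_diff tendsto_lorentz P A D DS)
    then show ?thesis using g by (simp add: good_def LIMSEQ_const_iff)
  qed
  moreover have "lorentz (P i (D1 x u)) (F x) = 0" for i u
  proof -
    have "(\<lambda>n. lorentz (P i (D1 (X n) u)) (F (X n))) \<longlonglongrightarrow> lorentz (P i (D1 x u)) (F x)" by (intro tendsto_lorentz P D Ff)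
    then show ?thesis using g by (simp add: good_def LIMSEQ_const_iff)
  qed
  moreover have "lorentz (P i (F x)) (F x) = k i" for i
  proof -
    have "(\<lambda>n. lorentz (P i (F (X n))) (F (X n))) \<longlonglongrightarrow> lorentz (P i (F x)) (F x)" by (intro tendsto_lorentz P Ff)
    then show ?thesis using g by (simp add: good_def LIMSEQ_const_iff)
  qed
  ultimately show ?thesis unfolding good_def by blast
qed

text \<open>Good points form a closed set by continuity. They form an open set because they have no
  null normal, which is an open condition, and goodness spreads over balls without null
  normals.\<close>

lemma good_everywhere:
  assumes cU: "convex U" and x0: "x0 \<in> U" "good x0" and y: "y \<in> U"
  shows "good y"
proof -
  let ?V = "{x \<in> U. good x}"
  have "open ?V"
  proof (rule openI)
    fix x assume "x \<in> ?V"
    then have x: "x \<in> U" "good x" by simp_all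
    have "x \<in> {x \<in> U. \<not> (\<exists>w. null_normal x w)}" using x good_no_null by blast
    then obtain r where r: "r > 0" "ball x r \<subseteq> {x \<in> U. \<not> (\<exists>w. null_normal x w)}"
      using open_no_null_normal openE by blast
    have "good z" if "z \<in> ball x r" for z
      by (rule good_propagates[OF convex_ball _ _ x(2) _ that]) (use r in auto)
    then show "\<exists>e>0. ball x e \<subseteq> ?V" using r by blast
  qed
  then have 1: "openin (top_of_set U) ?V" by (metis (no_types, lifting) mem_Collect_eq open_subset subsetI)
  have "?V = U \<inter> closure ?V"
  proof (intro equalityI subsetI)
    fix x assume "x \<in> U \<inter> closure ?V"
    then obtain X where "\<And>n. X n \<in> ?V" "X \<longlonglongrightarrow> x" "x \<in> U" using closure_sequential by blast
    then show "x \<in> ?V" using good_limit by simp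
  next
    fix x assume "x \<in> ?V"
    then show "x \<in> U \<inter> closure ?V" using closure_subset[of ?V] by (simp add: subset_iff)
  qed
  then have 2: "closedin (top_of_set U) ?V" by (metis closed_closure closedin_closed)
  have "?V = {} \<or> ?V = U" using convex_connected[OF cU] 1 2 unfolding connected_clopen by blast
  then show ?thesis using x0 y by blast
qed

text \<open>Differentiating the quadric equations twice recovers goodness. These equations do not
  depend on a chart, so this is the way into the next chart.\<close>

lemma good_from_open:
  assumes O: "open Q" "Q \<subseteq> U" "x \<in> Q" and c: "\<And>y i. y \<in> Q \<Longrightarrow> lorentz (P i (F y)) (F y) = k i"
  shows "good x"
proof -
  have x: "x \<in> U" and QU: "y \<in> Q \<Longrightarrow> y \<in> U" for y using O by auto
  note bl = linear_conv_bounded_linear[THEN iffD1, OF P_lin]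
  have g1: "lorentz (P i (D1 y u)) (F y) = 0" if y: "y \<in> Q" for y i u
  proof -
    have "lorentz (P i (F y)) (D1 y u) + lorentz (P i (D1 y u)) (F y) = 0"
      by (rule has_derivative_locally_constant[OF O(1) y has_derivative_lorentz[OF bounded_linear.has_derivative[OF bl deriv_F[OF QU[OF y]]] deriv_F[OF QU[OF y]]]])
        (rule c)
    moreover have "lorentz (P i (F y)) (D1 y u) = lorentz (P i (D1 y u)) (F y)" using P_adj lorentz_sym by metis
    ultimately show ?thesis by simp
  qed
  note g1x = g1[OF O(3)] and g2 = c[OF O(3)]
  define y where "y i = P i (F x)" for i
  have yT: "lorentz (y i) (D1 x u) = 0" for i u unfolding y_def by (rule P_F_tangent[OF g1x g2])
  have yo: "lorentz (y i) (y j) = 0" if "i \<noteq> j" for i j unfolding y_def by (rule P_F_orth[OF g1x g2 that])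
  have yy: "lorentz (y i) (y i) = k i" for i unfolding y_def by (rule P_F_norm[OF g1x g2])
  have yn: "lorentz (y i) (y i) \<noteq> 0" for i using yy k0 by simp
  define a where "a i v u = lorentz (A x v u) (y i)" for i v u
  \<comment> \<open>The second derivative of the quadric equation exchanges the component of
    \<open>A\<close> along \<open>P i (F x)\<close> for a product of tangent vectors.\<close>
  have a: "a i v u = - lorentz (P i (D1 x u)) (D1 x v)" for i v u
  proof -
    have "lorentz (P i (D1 x u)) (D1 x v) + lorentz (P i (D2 x v u)) (F x) = 0"
      by (rule has_derivative_locally_constant[OF O(1,3) has_derivative_lorentz[OF bounded_linear.has_derivative[OF bl deriv_D1[OF x]] deriv_F[OF x]]])
        (rule g1)
    moreover have "lorentz (P i (A x v u)) (F x) = a i v u" by (simp only: a_def y_def P_adj)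
    ultimately show ?thesis unfolding D2_A[OF x] PD lorentz_simps g1x by simp
  qed
  have Aex: "A x v w = (\<Sum>j\<in>UNIV. (a j v w / k j) *\<^sub>R y j)" for v w
    using normal_expansion[where z = "A x v w", OF x six yT yo yn] A_D1[OF x] by (simp add: a_def yy)
  have Pt: "lorentz (P i (D1 x u)) (y j) = 0" for i u j
  proof (cases "i = j")
    case True
    have "lorentz (P i (D1 x u)) (P i (F x)) = lorentz (P i (D1 x u)) (F x)" by (simp only: P_adj P_idem)
    then show ?thesis using True g1x by (simp add: y_def)
  next
    case False
    then show ?thesis by (simp add: y_def P_adj P_orth lorentz_simps)
  qed
  have b0: "b i x u v w = 0" for i u v w
    unfolding b_def Aex by (simp add: lorentz_simps Pt)
  have e0: "e i x z u v w = 0" for i z u v w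
  proof -
    have "\<exists>u'. P i (D1 x u) = D1 x u'" by (intro tangent_if_orthogonal[OF x six yT yo yn] Pt)
    then obtain u' where u': "P i (D1 x u) = D1 x u'" by blast
    have "lorentz (P i (A x z u)) (A x v w) = (\<Sum>j\<in>UNIV. (a j v w / k j) * lorentz (P i (A x z u)) (y j))"
      by (subst Aex[of v w]) (simp add: lorentz_simps)
    also have "\<dots> = (a i v w / k i) * lorentz (P i (A x z u)) (y i)"
      by (rule sum_UNIV_single) (simp add: y_def P_adj P_orth lorentz_simps)
    also have "lorentz (P i (A x z u)) (y i) = a i z u" by (simp add: y_def a_def P_adj P_idem)
    finally have L: "lorentz (P i (A x z u)) (A x v w) = (a i v w / k i) * a i z u" .
    have "lorentz (D1 x u') (D1 x (shape x v w z)) = lorentz (A x v w) (A x z u')"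
      by (simp add: isom[OF x] h_sym[OF x, of u'] shape_eq[OF x])
    also have "\<dots> = (\<Sum>j\<in>UNIV. (a j v w / k j) * a j z u')"
      by (subst Aex[of v w]) (simp add: lorentz_simps a_def lorentz_sym)
    also have "\<dots> = (a i v w / k i) * a i z u'"
    proof (rule sum_UNIV_single)
      fix j assume "j \<noteq> i"
      then have "P j (D1 x u') = 0" unfolding u'[symmetric] by (rule P_orth)
      then show "(a j v w / k j) * a j z u' = 0" by (simp add: a[of j z u'] lorentz_simps)
    qed
    also have "a i z u' = a i z u" unfolding a u'[symmetric] P_idem ..
    finally show ?thesis unfolding e_def u' L by simp
  qed
  show ?thesis unfolding good_def using b0 e0 g1x g2 by blast
qed

end

context hyperbolic_chart
begin

text \<open>\<open>P i\<close> projects onto the span of the \<open>i\<close>-th complex line and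
  its normal, so \<open>b\<close> and \<open>e\<close> can be read off from the form of
  \<open>A\<close>. The sum of the \<open>k i\<close> is -1 because it equals
  \<open>lorentz (F x) (F x)\<close>.\<close>

lemma split_frame_good:
  assumes x: "x \<in> U" and six: "DIM('m) = 6" and sp: "split_frame x f \<eta>"
  defines "P \<equiv> \<lambda>i z. lorentz z (D1 x (f i)) *\<^sub>R D1 x (f i) + lorentz z (D1 x (J x (f i))) *\<^sub>R D1 x (J x (f i))
      + (lorentz z (\<eta> i) / lorentz (\<eta> i) (\<eta> i)) *\<^sub>R \<eta> i"
  defines "k \<equiv> \<lambda>i. 1 / lorentz (\<eta> i) (\<eta> i)"
  shows "split_chart U F h J P k" and "split_chart.good F h P k x" and "(\<Sum>i\<in>UNIV. k i) = -1"
    and "z = (\<Sum>i\<in>UNIV. P i z)"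
proof -
  note D = split_frameD[OF sp]
  have fJ: "h x (f i) (J x (f j)) = 0" for i j
  proof (cases "i = j")
    case True
    have "h x (f i) (J x (f i)) = h x (J x (f i)) (J x (J x (f i)))" by (rule J_orth[OF x, symmetric])
    also have "\<dots> = - h x (f i) (J x (f i))" by (simp add: J_sq[OF x] bilinearD[OF h_bil[OF x]] h_sym[OF x, of "J x (f i)"])
    finally show ?thesis using True by simp
  qed (use D(3) in blast)
  have fJ': "h x (J x (f i)) (f j) = 0" for i j using fJ[of j i] h_sym[OF x] by metis
  have \<eta>D: "lorentz (D1 x u) (\<eta> i) = 0" for u i using D(4) lorentz_sym by metis
  have spl: "lorentz_splitting P"
    unfolding P_def
    by (rule lorentz_splitting_frame[of "\<lambda>i. D1 x (f i)" "\<lambda>i. D1 x (J x (f i))" \<eta>])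
      (simp_all add: isom[OF x] J_orth[OF x] D(1,2,6,7) fJ \<eta>D)
  then show sc: "split_chart U F h J P k"
    unfolding split_chart_def split_chart_axioms_def using hyperbolic_chart_axioms six D(7) by (simp add: k_def)
  interpret S: split_chart U F h J P k by (rule sc)
  define \<theta> where "\<theta> i u v = h x u (f i) * h x v (f i) + h x u (J x (f i)) * h x v (J x (f i))" for i u v
  have A\<eta>: "lorentz (A x u v) (\<eta> i) = \<theta> i u v * lorentz (\<eta> i) (\<eta> i)" for u v i
    unfolding D(8) lorentz_simps \<theta>_def[symmetric] by (rule trans[OF sum_UNIV_single[of i]]) (simp_all add: D(6))
  define pu where "pu i u = h x u (f i) *\<^sub>R f i + h x u (J x (f i)) *\<^sub>R J x (f i)" for i u
  have PT: "P i (D1 x u) = D1 x (pu i u)" for i u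
    by (simp add: P_def isom[OF x] \<eta>D pu_def D1D[OF x])
  have b0: "S.b i x u v w = 0" for i u v w by (simp add: S.b_def PT A_D1[OF x])
  have PA: "P i (A x z u) = \<theta> i z u *\<^sub>R \<eta> i" for i z u
    using D(7)[of i] by (simp add: P_def A_D1[OF x] A\<eta>)
  have \<theta>pu: "\<theta> j z (pu i u) = (if i = j then \<theta> i z u else 0)" for i j z u
    by (simp add: \<theta>_def pu_def bilinearD[OF h_bil[OF x]] D(1,2) fJ fJ' J_orth[OF x])
  have e0: "S.e i x z u v w = 0" for i z u v w
  proof -
    have "lorentz (D1 x (pu i u)) (D1 x (shape x v w z)) = lorentz (A x v w) (A x z (pu i u))"
      by (simp add: isom[OF x] h_sym[OF x, of "pu i u"] shape_eq[OF x])
    also have "A x z (pu i u) = \<theta> i z u *\<^sub>R \<eta> i"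
      unfolding D(8)[of z] \<theta>_def[symmetric] \<theta>pu by (rule trans[OF sum_UNIV_single[of i]]) simp_all
    finally show ?thesis unfolding S.e_def PT PA by (simp add: lorentz_simps lorentz_sym)
  qed
  have f1: "lorentz (P i (D1 x u)) (F x) = 0" for i u unfolding PT by (rule F_D1[OF x])
  have FD: "lorentz (F x) (D1 x u) = 0" for u using F_D1[OF x] lorentz_sym by metis
  have f2: "lorentz (P i (F x)) (F x) = k i" for i
    by (simp add: P_def FD F_D1[OF x] lorentz_sym[of "F x" "\<eta> _"] D(5) lorentz_simps k_def)
  show "S.good x" unfolding S.good_def using b0 e0 f1 f2 by blast
  have "-1 = lorentz (F x) (F x)" by (simp add: F_norm[OF x])
  also have "\<dots> = (\<Sum>i\<in>UNIV. k i)"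
    by (subst (2) split_F[OF x six sp]) (simp add: lorentz_simps lorentz_sym[of "F x"] D(5) k_def sum_negf)
  finally show "(\<Sum>i\<in>UNIV. k i) = -1" by simp
  show "z = (\<Sum>i\<in>UNIV. P i z)"
  proof -
    define y where "y = z - (\<Sum>i\<in>UNIV. P i z)"
    have Pp: "lorentz (P j z) (\<eta> i) = (if i = j then lorentz z (\<eta> i) else 0)" for i j
      using D(7)[of i] D(6)[of j i] by (auto simp: P_def lorentz_simps \<eta>D)
    have y\<eta>: "lorentz y (\<eta> i) = 0" for i
    proof -
      have "(\<Sum>j\<in>UNIV. lorentz (P j z) (\<eta> i)) = lorentz z (\<eta> i)"
        by (rule trans[OF sum_UNIV_single[of i]]) (simp_all add: Pp)
      then show ?thesis by (simp add: y_def lorentz_simps)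
    qed
    have "\<exists>u. y = D1 x u" by (intro tangent_if_orthogonal[OF x six D(4) D(6) D(7)] y\<eta>)
    then obtain u where u: "y = D1 x u" by blast
    have yf: "lorentz y (D1 x (f i)) = 0" "lorentz y (D1 x (J x (f i))) = 0" for i
    proof -
      have "(\<Sum>j\<in>UNIV. lorentz (P j z) (D1 x (f i))) = lorentz z (D1 x (f i))"
        by (rule trans[OF sum_UNIV_single[of i]]) (simp_all add: P_def lorentz_simps D(4) isom[OF x] D(1,2) fJ')
      then show "lorentz y (D1 x (f i)) = 0" by (simp add: y_def lorentz_simps)
      have "(\<Sum>j\<in>UNIV. lorentz (P j z) (D1 x (J x (f i)))) = lorentz z (D1 x (J x (f i)))"
        by (rule trans[OF sum_UNIV_single[of i]]) (simp_all add: P_def lorentz_simps D(4) isom[OF x] D(1,2) fJ J_orth[OF x])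
      then show "lorentz y (D1 x (J x (f i))) = 0" by (simp add: y_def lorentz_simps)
    qed
    have "\<theta> i u u = 0" for i using yf[of i] unfolding u isom[OF x] by (simp add: \<theta>_def)
    then have "A x u u = 0" unfolding D(8)[of u u] \<theta>_def[symmetric] by simp
    then have "h x u u = 0" using A_F(1)[OF x, of u u] by (simp add: lorentz_simps)
    then have "u = 0" using h_pos[OF x, of u] by fastforce
    then have "y = 0" using u linear_0[OF D1_linear[OF x]] by simp
    then show ?thesis by (simp add: y_def)
  qed
qed

end

section \<open>From charts to the manifold\<close>

lemma Ck_on_subset: "Ck_on k f S \<Longrightarrow> T \<subseteq> S \<Longrightarrow> Ck_on k f T"
  by (induction k arbitrary: f) (auto intro: continuous_on_subset)

lemma smooth_on_subset: "smooth_on f S \<Longrightarrow> T \<subseteq> S \<Longrightarrow> smooth_on f T"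
  unfolding smooth_on_def using Ck_on_subset by blast

text \<open>The second derivatives in the two charts differ by a tangent vector once the arguments
  are transformed, so their normal parts, and with them \<open>gauss\<close>, transform as
  tensors.\<close>

lemma hyperbolic_chart_change:
  fixes \<tau> :: "'m::euclidean_space \<Rightarrow> 'm" and F G :: "'m \<Rightarrow> 'h::euclidean_space \<times> real"
  assumes c: "hyperbolic_chart U F h J" and d: "hyperbolic_chart V G h' J'"
    and \<tau>: "smooth_on \<tau> U" "\<And>y. y \<in> U \<Longrightarrow> \<tau> y \<in> V" and FG: "\<And>y. y \<in> U \<Longrightarrow> F y = G (\<tau> y)" and x: "x \<in> U"
  defines "T \<equiv> frechet_derivative \<tau> (at x)"
  shows "surj T"
    and "hyperbolic_chart.gauss F h x u v w z = hyperbolic_chart.gauss G h' (\<tau> x) (T u) (T v) (T w) (T z)"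
proof -
  interpret C: hyperbolic_chart U F h J by (rule c)
  interpret D: hyperbolic_chart V G h' J' by (rule d)
  note dt = smooth_on_has_derivative[OF \<tau>(1)]
  have D1: "C.D1 y u = D.D1 (\<tau> y) (frechet_derivative \<tau> (at y) u)" if y: "y \<in> U" for y u
  proof -
    have "(G \<circ> \<tau> has_derivative (D.D1 (\<tau> y) \<circ> frechet_derivative \<tau> (at y))) (at y)"
      by (rule diff_chain_at[OF dt[OF y] D.deriv_F[OF \<tau>(2)[OF y]]])
    then have "(F has_derivative (D.D1 (\<tau> y) \<circ> frechet_derivative \<tau> (at y))) (at y)"
      by (subst has_derivative_cong_open[OF C.open_U y, where g = "G \<circ> \<tau>"]) (simp_all add: FG)
    from has_derivative_unique[OF C.deriv_F[OF y] this] show ?thesis by simp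
  qed
  have lT: "linear T" unfolding T_def using dt[OF x] has_derivative_linear by blast
  have "inj T"
    unfolding linear_injective_0[OF lT] using D1[OF x] C.D1_inj[OF x] linear_0[OF D.D1_linear[OF \<tau>(2)[OF x]]]
    unfolding T_def by metis
  then show sT: "surj T" using linear_injective_imp_surjective[OF lT] by blast
  note tx = \<tau>(2)[OF x]
  have A: "C.A x u v = D.A (\<tau> x) (T u) (T v)" for u v
  proof -
    obtain t2 where t2: "((\<lambda>y. frechet_derivative \<tau> (at y) v) has_derivative t2) (at x)"
      using smooth_on_has_derivative[OF smooth_on_derivative[OF \<tau>(1)] x] by blast
    have B: "((\<lambda>y. D.D1 (\<tau> y) v) has_derivative (\<lambda>u. D.D2 (\<tau> x) (T u) v)) (at x)" for v
      using diff_chain_at[OF dt[OF x] D.deriv_D1[OF tx]] by (simp add: o_def T_def)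
    have "((\<lambda>y. D.D1 (\<tau> y) (frechet_derivative \<tau> (at y) v)) has_derivative
      (\<lambda>u. D.D2 (\<tau> x) (T u) (T v) + D.D1 (\<tau> x) (t2 u))) (at x)"
      unfolding T_def
      by (rule has_derivative_linear_family[OF C.open_U x _ B[unfolded T_def] t2]) (rule D.D1_linear[OF \<tau>(2)])
    then have "((\<lambda>y. C.D1 y v) has_derivative (\<lambda>u. D.D2 (\<tau> x) (T u) (T v) + D.D1 (\<tau> x) (t2 u))) (at x)"
      by (subst has_derivative_cong_open[OF C.open_U x D1]) simp_all
    from has_derivative_unique[OF C.deriv_D1[OF x] this]
    have D2: "C.D2 x u v = D.D2 (\<tau> x) (T u) (T v) + D.D1 (\<tau> x) (t2 u)" by metis
    define q where "q = t2 u + D.\<Gamma> (\<tau> x) (T u) (T v) - T (C.\<Gamma> x u v)"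
    have Aq: "C.A x u v = D.A (\<tau> x) (T u) (T v) + D.D1 (\<tau> x) q"
      unfolding C.A_def D2 D.A_def D1[OF x] q_def T_def[symmetric]
      by (simp add: linear_add[OF D.D1_linear[OF tx]] linear_diff[OF D.D1_linear[OF tx]])
    \<comment> \<open>The discrepancy \<open>D.D1 (\<tau> x) q\<close> is both tangent and normal;
      since \<open>T\<close> is onto, it can be paired with itself.\<close>
    obtain q' where q': "q = T q'" using sT by blast
    have "lorentz (C.A x u v) (C.D1 x q') = 0" by (rule C.A_D1[OF x])
    then have "lorentz (D.D1 (\<tau> x) q) (D.D1 (\<tau> x) q) = 0"
      unfolding Aq D1[OF x] T_def[symmetric] q'[symmetric] by (simp add: lorentz_simps D.A_D1[OF tx])
    then have "q = 0" using D.h_pos[OF tx, of q] D.isom[OF tx, of q q] by fastforce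
    then show ?thesis using Aq linear_0[OF D.D1_linear[OF tx]] by simp
  qed
  show "C.gauss x u v w z = D.gauss (\<tau> x) (T u) (T v) (T w) (T z)" by (simp add: C.gauss_def D.gauss_def A)
qed

locale kaehler_hyperbolic = kaehler_manifold X A g J
  for X :: "'a topology" and A :: "('a, 'm::euclidean_space) chart set" and g J +
  fixes f :: "'a \<Rightarrow> 'h::euclidean_space \<times> real"
  assumes imm: "isometric_immersion_hyperbolic X A g f"
    and dim_h: "DIM('h) = DIM('m) + 2" and dim_m: "DIM('m) = 6 \<or> DIM('m) \<ge> 8"
    and no_flat: "\<not> (\<exists>W. openin X W \<and> W \<noteq> {} \<and> (\<forall>p\<in>W. flat_point A g p))"
begin

lemma chart_inj: "c \<in> A \<Longrightarrow> inj_on (snd c) (fst c)"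
proof -
  assume c: "c \<in> A"
  have "fst c \<subseteq> topspace X" using open_domain[OF c] openin_subset by blast
  then show ?thesis using homeomorphic_imp_injective_map[OF chart_homeomorphic[OF c]] by (simp add: Int_absorb1)
qed

lemma param_in: "x \<in> coord_image c \<Longrightarrow> param c x \<in> fst c"
  unfolding coord_image_def param_def by (rule inv_into_into)

lemma snd_param: "x \<in> coord_image c \<Longrightarrow> snd c (param c x) = x"
  unfolding coord_image_def param_def by (rule f_inv_into_f)

lemma param_snd: "c \<in> A \<Longrightarrow> p \<in> fst c \<Longrightarrow> param c (snd c p) = p"
  unfolding param_def using chart_inj inv_into_f_f by metis

lemma coord_in: "p \<in> fst c \<Longrightarrow> snd c p \<in> coord_image c"
  unfolding coord_image_def by blast

lemma param_topspace: "c \<in> A \<Longrightarrow> x \<in> coord_image c \<Longrightarrow> param c x \<in> topspace X"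
  using subsetD[OF openin_subset[OF open_domain] param_in] .

lemma openin_param_image:
  assumes c: "c \<in> A" and S: "open S" "S \<subseteq> coord_image c" shows "openin X (param c ` S)"
proof -
  have sub: "fst c \<subseteq> topspace X" using open_domain[OF c] openin_subset by blast
  have "openin (subtopology X (fst c)) {p \<in> topspace (subtopology X (fst c)). snd c p \<in> S}"
    by (rule openin_continuous_map_preimage[OF homeomorphic_imp_continuous_map[OF chart_homeomorphic[OF c]]])
      (rule open_subset[OF S(2,1)])
  moreover have "{p \<in> topspace (subtopology X (fst c)). snd c p \<in> S} = param c ` S"
  proof (intro equalityI subsetI)
    fix p assume "p \<in> {p \<in> topspace (subtopology X (fst c)). snd c p \<in> S}"
    then have "p \<in> fst c" "snd c p \<in> S" by auto
    then show "p \<in> param c ` S" by (intro image_eqI[of p "param c" "snd c p"]) (simp_all add: param_snd[OF c])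
  next
    fix p assume "p \<in> param c ` S"
    then obtain x where x: "x \<in> S" "p = param c x" by blast
    then show "p \<in> {p \<in> topspace (subtopology X (fst c)). snd c p \<in> S}"
      using S(2) sub param_in[of x c] snd_param[of x c] by auto
  qed
  ultimately show ?thesis using openin_trans_full[OF _ open_domain[OF c]] by simp
qed

lemma open_coord_image:
  assumes c: "c \<in> A" and N: "openin X N" shows "open (snd c ` (fst c \<inter> N))"
proof -
  have "openin (subtopology X (fst c)) (fst c \<inter> N)" by (metis Int_commute N openin_subtopology_Int2)
  then have "openin (top_of_set (coord_image c)) (snd c ` (fst c \<inter> N))"
    using homeomorphic_imp_open_map[OF chart_homeomorphic[OF c]] unfolding open_map_def by blast
  then show ?thesis using openin_open_trans[OF _ open_image[OF c]] by blast
qed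

lemma chart_at: "p \<in> topspace X \<Longrightarrow> \<exists>c\<in>A. p \<in> fst c"
  using charts_cover by blast

lemma hyperbolic_chart:
  assumes c: "c \<in> A" and U: "open U" "U \<subseteq> coord_image c"
  shows "hyperbolic_chart U (f \<circ> param c) (g c) (J c)"
proof -
  have i: "smooth_on (f \<circ> param c) (coord_image c)"
    "\<And>x u v. x \<in> coord_image c \<Longrightarrow> lorentz (frechet_derivative (f \<circ> param c) (at x) u) (frechet_derivative (f \<circ> param c) (at x) v) = g c x u v"
    "f ` topspace X \<subseteq> hyperbolic_space"
    using imm c unfolding isometric_immersion_def by blast+
  have m: "x \<in> coord_image c" if "x \<in> U" for x using that U by blast
  show ?thesis
    unfolding hyperbolic_chart_def
  proof (intro conjI allI impI)
    show "smooth_on (f \<circ> param c) U" by (rule smooth_on_subset[OF i(1) U(2)])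
    show "(f \<circ> param c) x \<in> hyperbolic_space" if "x \<in> U" for x
      using param_topspace[OF c m[OF that]] i(3) by auto
    show "smooth_on (\<lambda>x. J c x u) U" for u by (rule smooth_on_subset[OF J_smooth[OF c] U(2)])
  qed (use m U i(2) dim_h dim_m metric_bilinear[OF c] metric_sym[OF c] metric_pos[OF c] J_linear[OF c] J_square[OF c]
      J_orthogonal[OF c] J_parallel[OF c] in blast)+
qed

text \<open>\<open>flat_point\<close> refers to every chart around the point, so the vanishing of
  \<open>gauss\<close> in one chart has to be carried over to the others.\<close>

lemma not_flat_in_chart:
  assumes c: "c \<in> A" and S: "open S" "S \<subseteq> coord_image c" "S \<noteq> {}"
  shows "\<exists>x\<in>S. \<exists>u v w z. hyperbolic_chart.gauss (f \<circ> param c) (g c) x u v w z \<noteq> 0"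
proof (rule ccontr)
  assume "\<not> ?thesis"
  then have 0: "hyperbolic_chart.gauss (f \<circ> param c) (g c) x u v w z = 0" if "x \<in> S" for x u v w z using that by blast
  have "flat_point A g p" if pS: "p \<in> param c ` S" for p
    unfolding flat_point_def
  proof (intro ballI impI allI)
    fix d u v w assume d: "d \<in> A" and pd: "p \<in> fst d"
    obtain x where x: "x \<in> S" "p = param c x" using pS by blast
    define U where "U = S \<inter> snd c ` (fst c \<inter> fst d)"
    let ?t = "transition c d"
    have U: "open U" unfolding U_def by (intro open_Int S(1) open_coord_image[OF c] open_domain[OF d])
    have US: "U \<subseteq> coord_image c" unfolding U_def using S(2) by blast
    have pU: "param c y \<in> fst d" if "y \<in> U" for y using that param_snd[OF c] unfolding U_def by auto
    have xU: "x \<in> U" unfolding U_def using x pd S(2) param_in[of x c] snd_param[of x c] by (auto intro!: image_eqI[of x _ p])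
    have C: "hyperbolic_chart U (f \<circ> param c) (g c) (J c)" by (rule hyperbolic_chart[OF c U US])
    have D: "hyperbolic_chart (coord_image d) (f \<circ> param d) (g d) (J d)"
      by (rule hyperbolic_chart[OF d open_image[OF d] order_refl])
    have t: "smooth_on ?t U" by (rule smooth_on_subset[OF smooth_transition[OF c d]]) (simp add: U_def)
    have tV: "?t y \<in> coord_image d" if "y \<in> U" for y using coord_in[OF pU[OF that]] by (simp add: transition_def)
    have ff: "(f \<circ> param c) y = (f \<circ> param d) (?t y)" if "y \<in> U" for y
      using param_snd[OF d pU[OF that]] by (simp add: transition_def)
    note ch = hyperbolic_chart_change[OF C D t tV ff xU]
    interpret D: hyperbolic_chart "coord_image d" "f \<circ> param d" "g d" "J d" by (rule D)
    have tx: "?t x = snd d p" by (simp add: transition_def x)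
    have sd: "snd d p \<in> coord_image d" by (rule coord_in[OF pd])
    have "D.gauss (snd d p) u v w z = 0" for u v w z
    proof -
      obtain u' v' w' z' where "u = frechet_derivative ?t (at x) u'" "v = frechet_derivative ?t (at x) v'"
        "w = frechet_derivative ?t (at x) w'" "z = frechet_derivative ?t (at x) z'" using ch(1) by (meson surjD)
      then show ?thesis using ch(2)[of u' v' w' z'] 0[OF x(1), of u' v' w' z'] unfolding tx by metis
    qed
    then have "g d (snd d p) (curvature (g d) (snd d p) u v w) z = 0" for z by (simp add: D.gauss_equation[OF sd])
    then show "curvature (g d) (snd d p) u v w = 0" using D.h_pos[OF sd] by fastforce
  qed
  then show False using no_flat openin_param_image[OF c S(1,2)] S(3) by blast
qed

text \<open>A continuation principle: when validity on a nonempty open part of a convex coordinate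
  piece always spreads to the whole piece, the interior of the set where \<open>Q\<close> holds is
  also closed.\<close>

lemma connected_propagation:
  assumes start: "c \<in> A" "open S" "S \<subseteq> coord_image c" "S \<noteq> {}" "\<And>x. x \<in> S \<Longrightarrow> Q (param c x)"
    and step: "\<And>c B S x. c \<in> A \<Longrightarrow> open B \<Longrightarrow> convex B \<Longrightarrow> B \<subseteq> coord_image c \<Longrightarrow> open S \<Longrightarrow> S \<subseteq> B \<Longrightarrow> S \<noteq> {}
      \<Longrightarrow> (\<And>y. y \<in> S \<Longrightarrow> Q (param c y)) \<Longrightarrow> x \<in> B \<Longrightarrow> Q (param c x)"
    and p: "p \<in> topspace X"
  shows "Q p"
proof -
  define V where "V = \<Union>{N. openin X N \<and> (\<forall>q\<in>N. Q q)}"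
  have V1: "openin X V" unfolding V_def by (rule openin_Union) blast
  have "\<exists>N. openin X N \<and> p \<in> N \<and> N \<subseteq> topspace X - V" if p: "p \<in> topspace X - V" for p
  proof -
    obtain d where d: "d \<in> A" "p \<in> fst d" using p chart_at by blast
    obtain r where r: "r > 0" "ball (snd d p) r \<subseteq> coord_image d"
      using open_image[OF d(1)] coord_in[OF d(2)] openE by blast
    let ?B = "ball (snd d p) r" and ?N = "param d ` ball (snd d p) r"
    have N: "openin X ?N" by (rule openin_param_image[OF d(1) open_ball r(2)])
    have pN: "p \<in> ?N" using param_snd[OF d] r(1) by (intro image_eqI[of p "param d" "snd d p"]) simp_all
    have "q \<notin> V" if q: "q \<in> ?N" for q
    proof
      assume "q \<in> V"
      obtain y where y: "y \<in> ?B" "q = param d y" using q by blast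
      let ?S = "?B \<inter> snd d ` (fst d \<inter> V)"
      have yS: "y \<in> ?S" using y \<open>q \<in> V\<close> r(2) param_in[of y d] snd_param[of y d] by (auto intro!: image_eqI[of y _ q])
      have SQ: "Q (param d z)" if "z \<in> ?S" for z using that param_snd[OF d(1)] unfolding V_def by auto
      have S: "open ?S" by (intro open_Int open_ball open_coord_image[OF d(1) V1])
      have "Q z" if "z \<in> ?N" for z
        using step[OF d(1) open_ball convex_ball r(2) S _ _ SQ] yS that by blast
      then have "p \<in> V" unfolding V_def using N pN by blast
      then show False using p by blast
    qed
    then show ?thesis using N pN openin_subset[OF N] by blast
  qed
  then have V2: "closedin X V" unfolding closedin_def using openin_subset[OF V1] openin_subopen by (metis (no_types, lifting))
  have "param c ` S \<subseteq> V" unfolding V_def using openin_param_image[OF start(1-3)] start(5) by blast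
  then have "V \<noteq> {}" using start(4) by blast
  then have "V = topspace X" using connected V1 V2 unfolding connected_space_clopen_in by blast
  then show ?thesis using p unfolding V_def by blast
qed

lemma null_normal_global:
  assumes null: "\<And>c x. c \<in> A \<Longrightarrow> x \<in> coord_image c \<Longrightarrow> \<exists>w. hyperbolic_chart.null_normal (f \<circ> param c) x w"
    and ne: "topspace X \<noteq> {}"
  shows "\<exists>w. lorentz w w = 0 \<and> snd w > 0 \<and> (\<forall>p\<in>topspace X. lorentz (f p) w = -1)"
proof -
  have W: "\<exists>w. \<forall>x\<in>B. hyperbolic_chart.null_normal (f \<circ> param c) x w"
    if B: "c \<in> A" "open B" "convex B" "B \<subseteq> coord_image c" for c B
  proof -
    have "horospherical_chart B (f \<circ> param c) (g c) (J c)"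
      unfolding horospherical_chart_def horospherical_chart_axioms_def
    proof (intro conjI allI impI)
      show "\<exists>w. hyperbolic_chart.null_normal (f \<circ> param c) x w" if "x \<in> B" for x
        by (rule null[OF B(1) subsetD[OF B(4) that]])
      show "\<exists>x\<in>S. \<exists>u v w z. hyperbolic_chart.gauss (f \<circ> param c) (g c) x u v w z \<noteq> 0"
        if "open S" "S \<subseteq> B" "S \<noteq> {}" for S
        by (rule not_flat_in_chart[OF B(1) that(1) order_trans[OF that(2) B(4)] that(3)])
    qed (rule hyperbolic_chart[OF B(1,2,4)])
    from horospherical_chart.W_constant[OF this B(3)] show ?thesis .
  qed
  obtain p c where p: "p \<in> topspace X" "c \<in> A" "p \<in> fst c" using ne chart_at by blast
  obtain r where r: "r > 0" "ball (snd c p) r \<subseteq> coord_image c"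
    using open_image[OF p(2)] coord_in[OF p(3)] openE by blast
  obtain w where w: "\<And>x. x \<in> ball (snd c p) r \<Longrightarrow> hyperbolic_chart.null_normal (f \<circ> param c) x w"
    using W[OF p(2) open_ball convex_ball r(2)] by blast
  interpret C: hyperbolic_chart "ball (snd c p) r" "f \<circ> param c" "g c" "J c"
    by (rule hyperbolic_chart[OF p(2) open_ball r(2)])
  have c0: "snd c p \<in> ball (snd c p) r" using r by simp
  have w0: "lorentz w w = 0" "snd w > 0" using C.null_normalD(1)[OF w[OF c0]] C.null_normal_bound(2)[OF c0 w[OF c0]] by auto
  have "lorentz (f q) w = -1" if q: "q \<in> topspace X" for q
  proof (rule connected_propagation[OF p(2) open_ball r(2) _ _ _ q])
    show "ball (snd c p) r \<noteq> {}" using r by simp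
    show "lorentz (f (param c x)) w = -1" if "x \<in> ball (snd c p) r" for x
      using C.null_normalD(2)[OF w[OF that]] lorentz_sym[of w] by simp
  next
    fix c B S x
    assume c: "c \<in> A" "open B" "convex B" "B \<subseteq> coord_image c" and S: "open S" "S \<subseteq> B" "S \<noteq> {}"
      and SQ: "\<And>y. y \<in> S \<Longrightarrow> lorentz (f (param c y)) w = - 1" and x: "x \<in> B"
    interpret E: hyperbolic_chart B "f \<circ> param c" "g c" "J c" by (rule hyperbolic_chart[OF c(1,2,4)])
    obtain w' where w': "\<And>x. x \<in> B \<Longrightarrow> E.null_normal x w'" using W[OF c] by blast
    obtain y where y: "y \<in> S" using S(3) by blast
    have SB: "z \<in> B" if "z \<in> S" for z using that S(2) by blast
    \<comment> \<open>Differentiating \<open>lorentz (f p) w = -1\<close> twice on the open set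
      shows that \<open>w\<close> is a null normal there; uniqueness identifies it with the constant
      one of this piece.\<close>
    have 1: "lorentz (E.D1 z u) w = 0" if z: "z \<in> S" for z u
      using has_derivative_locally_constant[OF S(1) z has_derivative_lorentz[OF E.deriv_F[OF SB[OF z]] has_derivative_const[of w]], of "-1" u] SQ
      by (simp add: lorentz_simps)
    have 2: "lorentz (E.D2 y u v) w = 0" for u v
      using has_derivative_locally_constant[OF S(1) y has_derivative_lorentz[OF E.deriv_D1[OF SB[OF y]] has_derivative_const[of w]], of v 0 u] 1
      by (simp add: lorentz_simps)
    have "E.null_normal y w"
      unfolding E.null_normal_def
      using w0(1) SQ[OF y] 1[OF y] 2 lorentz_sym[of w "f (param c y)"] lorentz_sym[of w "E.D1 y u" for u]
        lorentz_sym[of w "E.D2 y u v" for u v] by simp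
    then have "w' = w" using E.null_normal_unique[OF SB[OF y] w'[OF SB[OF y]]] by blast
    then show "lorentz (f (param c x)) w = -1" using E.null_normalD(2)[OF w'[OF x]] lorentz_sym[of w] by simp
  qed
  then show ?thesis using w0 by blast
qed

text \<open>The projectors are fixed at \<open>x0\<close>; the scalar equations are then continued
  from piece to piece, entering each by \<open>good_from_open\<close> and filling it by
  \<open>good_everywhere\<close>.\<close>

lemma split_global:
  assumes c: "c \<in> A" "x0 \<in> coord_image c" and no: "\<not> (\<exists>w. hyperbolic_chart.null_normal (f \<circ> param c) x0 w)"
  obtains P :: "3 \<Rightarrow> 'h \<times> real \<Rightarrow> 'h \<times> real" and e \<eta>
  where "DIM('m) = 6" "hyperbolic_chart.split_frame (f \<circ> param c) (g c) (J c) x0 e \<eta>"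
    and "\<And>p i. p \<in> topspace X \<Longrightarrow> lorentz (P i (f p)) (f p) = 1 / lorentz (\<eta> i) (\<eta> i)"
    and "P = (\<lambda>i z. let D = frechet_derivative (f \<circ> param c) (at x0) in
      lorentz z (D (e i)) *\<^sub>R D (e i) + lorentz z (D (J c x0 (e i))) *\<^sub>R D (J c x0 (e i))
      + (lorentz z (\<eta> i) / lorentz (\<eta> i) (\<eta> i)) *\<^sub>R \<eta> i)"
    and "\<And>z. z = (\<Sum>i\<in>UNIV. P i z)" "(\<Sum>i\<in>UNIV. 1 / lorentz (\<eta> i) (\<eta> i)) = -1"
    and "\<And>d U. d \<in> A \<Longrightarrow> open U \<Longrightarrow> U \<subseteq> coord_image d \<Longrightarrow> split_chart U (f \<circ> param d) (g d) (J d) P (\<lambda>i. 1 / lorentz (\<eta> i) (\<eta> i))"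
proof -
  obtain r where r: "r > 0" "ball x0 r \<subseteq> coord_image c" using open_image[OF c(1)] c(2) openE by blast
  have x0: "x0 \<in> ball x0 r" using r by simp
  interpret C: hyperbolic_chart "ball x0 r" "f \<circ> param c" "g c" "J c" by (rule hyperbolic_chart[OF c(1) open_ball r(2)])
  obtain e \<eta> where six: "DIM('m) = 6" and sp: "C.split_frame x0 e \<eta>" using C.dichotomy[OF x0] no by blast
  define P where "P = (\<lambda>i z. lorentz z (C.D1 x0 (e i)) *\<^sub>R C.D1 x0 (e i) + lorentz z (C.D1 x0 (J c x0 (e i))) *\<^sub>R C.D1 x0 (J c x0 (e i))
      + (lorentz z (\<eta> i) / lorentz (\<eta> i) (\<eta> i)) *\<^sub>R \<eta> i)"
  define k where "k = (\<lambda>i. 1 / lorentz (\<eta> i) (\<eta> i))"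
  note sg = C.split_frame_good[OF x0 six sp, folded P_def k_def]
  interpret S: split_chart "ball x0 r" "f \<circ> param c" "g c" "J c" P k by (rule sg(1))
  have split: "split_chart U (f \<circ> param d) (g d) (J d) P k" if d: "d \<in> A" "open U" "U \<subseteq> coord_image d" for d U
    unfolding split_chart_def split_chart_axioms_def
    using hyperbolic_chart[OF d] S.lorentz_splitting_axioms six S.k0 by blast
  have gl: "\<forall>i. lorentz (P i (f p)) (f p) = k i" if p: "p \<in> topspace X" for p
  proof (rule connected_propagation[OF c(1) open_ball r(2) _ _ _ p])
    show "ball x0 r \<noteq> {}" using r by simp
    show "\<forall>i. lorentz (P i (f (param c x))) (f (param c x)) = k i" if x: "x \<in> ball x0 r" for x
      using S.good_everywhere[OF convex_ball x0 sg(2) x] by (simp add: S.good_def)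
  next
    fix d B S x
    assume d: "d \<in> A" "open B" "convex B" "B \<subseteq> coord_image d" and Q: "open S" "S \<subseteq> B" "S \<noteq> {}"
      and SQ: "\<And>y. y \<in> S \<Longrightarrow> \<forall>i. lorentz (P i (f (param d y))) (f (param d y)) = k i" and x: "x \<in> B"
    interpret T: split_chart B "f \<circ> param d" "g d" "J d" P k by (rule split[OF d(1,2,4)])
    obtain y where y: "y \<in> S" using Q(3) by blast
    have "T.good y" by (rule T.good_from_open[OF Q(1,2) y]) (use SQ in simp)
    then have "T.good x" using T.good_everywhere[OF d(3) _ _ x] y Q(2) by blast
    then show "\<forall>i. lorentz (P i (f (param d x))) (f (param d x)) = k i" by (simp add: T.good_def)
  qed
  show ?thesis
    by (rule that[of e \<eta> P]) (use six sp gl sg(3,4) split in \<open>simp_all add: k_def P_def C.D1_def Let_def\<close>)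
qed

end

section \<open>Models of the horosphere and of the product\<close>

lemma christoffel_euclidean: "christoffel (euclidean_metric c) x u v = (0 :: 'r::euclidean_space)"
proof -
  have "christoffel (euclidean_metric c) x = (\<lambda>u v. 0 :: 'r)"
    unfolding christoffel_def
  proof (rule the_equality)
    show "bilinear (\<lambda>u v. 0 :: 'r) \<and> (\<forall>(u::'r) v. (0::'r) = 0) \<and> (\<forall>u v w. frechet_derivative (\<lambda>y. euclidean_metric c y v w) (at x) u
        = euclidean_metric c x 0 w + euclidean_metric c x v 0)"
      by (auto simp: euclidean_metric_def bilinear_def linear_iff frechet_derivative_const)
  next
    fix \<Gamma> :: "'r \<Rightarrow> 'r \<Rightarrow> 'r"
    assume "bilinear \<Gamma> \<and> (\<forall>u v. \<Gamma> u v = \<Gamma> v u) \<and> (\<forall>u v w. frechet_derivative (\<lambda>y. euclidean_metric c y v w) (at x) u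
        = euclidean_metric c x (\<Gamma> u v) w + euclidean_metric c x v (\<Gamma> u w))"
    then have s: "\<Gamma> u v = \<Gamma> v u" and a: "\<Gamma> u v \<bullet> w = - (\<Gamma> u w \<bullet> v)" for u v w
      by (auto simp: euclidean_metric_def frechet_derivative_const inner_commute)
        (metis add.inverse_unique add.commute inner_commute)
    \<comment> \<open>A trilinear form that is symmetric in the first two arguments and skew in the
      last two is zero.\<close>
    have "\<Gamma> u v \<bullet> w = 0" for u v w
      using a[of u v w] s[of u w] a[of w u v] s[of w v] a[of v w u] s[of v u] by simp
    then show "\<Gamma> = (\<lambda>u v. 0)" by (metis inner_eq_zero_iff)
  qed
  then show ?thesis by simp
qed

lemma linear_isometry_onto_hyperplane:
  fixes a :: "'h::euclidean_space"
  assumes "a \<noteq> 0" and dim: "DIM('h) = DIM('r::euclidean_space) + 1"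
  obtains L :: "'r::euclidean_space \<Rightarrow> 'h" and M where "linear L" "linear M" "\<And>y. L y \<bullet> a = 0" "\<And>y. M (L y) = y" "M a = 0"
    "\<And>y y'. L y \<bullet> L y' = y \<bullet> y'" "\<And>z. z = L (M z) + (z \<bullet> a / (a \<bullet> a)) *\<^sub>R a"
proof -
  have "dim {x. a \<bullet> x = 0} = dim (UNIV :: 'r set)" using dim_hyperplane[OF assms(1)] dim by simp
  from isometries_subspaces[OF subspace_UNIV subspace_hyperplane this[symmetric]]
  obtain L :: "'r \<Rightarrow> 'h" and g where L: "linear L" "L ` UNIV = {x. a \<bullet> x = 0}" "\<And>x. norm (L x) = norm x"
    by (metis UNIV_I)
  have La: "L y \<bullet> a = 0" for y using L(2) by (auto simp: inner_commute)
  have LL: "L y \<bullet> L y' = y \<bullet> y'" for y y'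
  proof -
    have "norm (L y + L y') = norm (y + y')" using L(3)[of "y + y'"] by (simp add: linear_add[OF L(1)])
    then show ?thesis by (simp add: dot_norm L(3))
  qed
  define M where "M = adjoint L"
  have M: "y \<bullet> M z = L y \<bullet> z" for y z unfolding M_def by (rule adjoint_works[OF L(1)])
  have MoL: "M (L y) = y" for y by (rule vector_eq_ldot[THEN iffD1]) (simp add: M LL)
  have Ma: "M a = 0" by (rule vector_eq_ldot[THEN iffD1]) (simp add: M La)
  have lM: "linear M" unfolding M_def by (rule adjoint_linear[OF L(1)])
  have dec: "z = L (M z) + (z \<bullet> a / (a \<bullet> a)) *\<^sub>R a" for z
  proof -
    have "a \<bullet> (z - (z \<bullet> a / (a \<bullet> a)) *\<^sub>R a) = 0" using assms(1) by (simp add: inner_diff_right inner_commute)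
    then obtain y where y: "z - (z \<bullet> a / (a \<bullet> a)) *\<^sub>R a = L y" using L(2) by blast
    then have "M z = y" using MoL[of y] by (metis (no_types) Ma lM diff_zero linear_cmul linear_diff scaleR_zero_right)
    then show ?thesis using y by (simp add: algebra_simps)
  qed
  show thesis by (rule that[OF L(1) lM La MoL Ma LL dec])
qed

text \<open>A horosphere is a paraboloid: a base point, a flat part isometric to the complement of
  \<open>a\<close>, and a quadratic multiple of \<open>w\<close> that compensates the length of the
  flat part, as the base point has product -1 with \<open>w\<close>. On vectors orthogonal to
  \<open>w\<close> the map \<pi> loses only a multiple of \<open>w\<close>, which is null, so
  products are preserved.\<close>

lemma horosphere_model:
  fixes w :: "'h::euclidean_space \<times> real"
  assumes w: "lorentz w w = 0" "snd w > 0" and dim: "DIM('h) = DIM('r::euclidean_space) + 1"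
  obtains j :: "'r::euclidean_space \<Rightarrow> 'h \<times> real" and \<pi> where "horosphere_embedding j" "linear \<pi>"
    "\<And>x. x \<in> hyperbolic_space \<Longrightarrow> lorentz x w = -1 \<Longrightarrow> x = j (\<pi> x)"
    "\<And>u v. lorentz u w = 0 \<Longrightarrow> lorentz v w = 0 \<Longrightarrow> \<pi> u \<bullet> \<pi> v = lorentz u v"
proof -
  obtain a k where wak: "w = (a, k)" by (cases w)
  have k: "k > 0" and ak: "a \<bullet> a = k * k" using w by (simp_all add: wak lorentz_def)
  then have "a \<noteq> 0" by auto
  then obtain L :: "'r \<Rightarrow> 'h" and M where LM: "linear L" "linear M" "\<And>y. L y \<bullet> a = 0" "\<And>y. M (L y) = y" "M a = 0"
    "\<And>y y'. L y \<bullet> L y' = y \<bullet> y'" "\<And>z. z = L (M z) + (z \<bullet> a / (a \<bullet> a)) *\<^sub>R a"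
    using linear_isometry_onto_hyperplane[OF _ dim] by blast
  have aL: "a \<bullet> L y = 0" for y using LM(3) by (simp add: inner_commute)
  \<comment> \<open>For the base point \<open>((s / k) *\<^sub>R a, t)\<close> the norm condition is
    \<open>s * s - t * t = -1\<close> and the level condition \<open>(s - t) * k = -1\<close>; these
    are the solutions.\<close>
  define t s where "t = (k + 1 / k) / 2" and "s = (k - 1 / k) / 2"
  have ts: "t > 0" "(s - t) * k = -1" "s * s - t * t = -1"
    using k by (simp_all add: t_def s_def field_simps add_pos_pos)
  define j where "j y = ((s / k) *\<^sub>R a, t) + (L y, 0) + (y \<bullet> y / 2) *\<^sub>R w" for y
  define \<pi> where "\<pi> x = M (fst x)" for x :: "'h \<times> real"
  have l\<pi>: "linear \<pi>" unfolding \<pi>_def by (rule linearI) (simp_all add: linear_add[OF LM(2)] linear_cmul[OF LM(2)])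
  have jw: "lorentz (j y) w = -1" for y
    using ts(2) k by (simp add: j_def wak lorentz_def inner_add_left LM(3) ak algebra_simps)
  have jj: "lorentz (j y) (j y) = -1" for y
  proof -
    have "lorentz ((s / k) *\<^sub>R a, t) ((s / k) *\<^sub>R a, t) = -1" using ts(3) k by (simp add: lorentz_def ak)
    moreover have "lorentz ((s / k) *\<^sub>R a, t) w = -1" "lorentz w ((s / k) *\<^sub>R a, t) = -1"
      using ts(2) k by (simp_all add: lorentz_def wak ak algebra_simps)
    moreover have "lorentz ((s / k) *\<^sub>R a, t) (L y, 0) = 0" "lorentz (L y, 0) ((s / k) *\<^sub>R a, t) = 0"
        "lorentz w (L y, 0) = 0" "lorentz (L y, 0) w = 0" "lorentz (L y, 0) (L y, 0) = y \<bullet> y"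
      by (simp_all add: lorentz_def wak aL LM(3,6))
    ultimately show ?thesis unfolding j_def lorentz_simps w(1) by simp
  qed
  have jt: "snd (j y) > 0" for y using ts(1) k by (simp add: j_def wak add_pos_nonneg)
  have j\<pi>: "x = j (\<pi> x)" if x: "x \<in> hyperbolic_space" and xw: "lorentz x w = -1" for x
  proof -
    obtain b \<tau> where b: "x = (b, \<tau>)" by (cases x)
    define y where "y = M b"
    define \<beta> where "\<beta> = b \<bullet> a / (a \<bullet> a)"
    have bd: "b = L y + \<beta> *\<^sub>R a" unfolding y_def \<beta>_def by (rule LM(7))
    have bb: "b \<bullet> b = y \<bullet> y + \<beta> * \<beta> * (k * k)"
      by (subst (1 2) bd) (simp add: inner_add_left inner_add_right LM(3,6) aL ak)
    have "b \<bullet> a = \<beta> * (k * k)" by (subst bd) (simp add: inner_add_left LM(3) ak)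
    then have 1: "\<beta> * (k * k) - \<tau> * k = -1" using xw by (simp add: b wak lorentz_def)
    have 2: "y \<bullet> y + \<beta> * \<beta> * (k * k) - \<tau> * \<tau> = -1" using x bb by (simp add: b lorentz_def hyperboloid_def)
    have 3: "\<tau> = \<beta> * k + 1 / k" using 1 k by (simp add: field_simps)
    have "y \<bullet> y + 1 = 2 * \<beta> + 1 / (k * k)" using 2 k unfolding 3 by (simp add: algebra_simps)
    then have 4: "\<beta> = (y \<bullet> y) / 2 + 1 / 2 - 1 / (2 * (k * k))" using k by (simp add: field_simps)
    have "\<beta> = s / k + (y \<bullet> y) / 2" using k unfolding 4 s_def by (simp add: field_simps)
    moreover have "\<tau> = t + (y \<bullet> y) / 2 * k" using k unfolding 3 4 t_def by (simp add: field_simps)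
    ultimately have xj: "x = j y" unfolding b bd j_def wak by (simp add: algebra_simps)
    have "\<pi> x = y" by (simp add: \<pi>_def y_def b)
    then show ?thesis using xj by metis
  qed
  have \<pi>\<pi>: "\<pi> u \<bullet> \<pi> v = lorentz u v" if "lorentz u w = 0" "lorentz v w = 0" for u v
  proof -
    have d: "fst z = L (\<pi> z) + (snd z / k) *\<^sub>R a" if "lorentz z w = 0" for z
    proof -
      have "fst z \<bullet> a = snd z * k" using that by (simp add: lorentz_def wak)
      then show ?thesis using LM(7)[of "fst z"] k by (simp add: \<pi>_def ak)
    qed
    show ?thesis unfolding lorentz_def d[OF that(1)] d[OF that(2)]
      using k by (simp add: inner_add_left inner_add_right LM(3,6) aL ak)
  qed
  have \<pi>j: "\<pi> (j y) = y" for y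
    by (simp add: \<pi>_def j_def wak linear_add[OF LM(2)] linear_cmul[OF LM(2)] LM(4,5))
  define dj where "dj x u = (L u, 0) + (x \<bullet> u) *\<^sub>R w" for x u
  have dj: "(j has_derivative dj x) (at x)" for x
  proof -
    have "(L has_derivative L) (at x)"
      by (rule bounded_linear_imp_has_derivative[OF linear_conv_bounded_linear[THEN iffD1, OF LM(1)]])
    then show ?thesis
      unfolding j_def dj_def by (auto intro!: derivative_eq_intros simp: inner_commute)
  qed
  have ddj: "((\<lambda>x. dj x v) has_derivative (\<lambda>u. (u \<bullet> v) *\<^sub>R w)) (at x)" for x v
    unfolding dj_def by (auto intro!: derivative_eq_intros)
  have fdj: "frechet_derivative j (at x) = dj x" for x using frechet_derivative_at[OF dj] by simp
  have fddj: "frechet_derivative (\<lambda>x. dj x v) (at x) = (\<lambda>u. (u \<bullet> v) *\<^sub>R w)" for x v using frechet_derivative_at[OF ddj] by simp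
  have sj: "smooth_on j UNIV"
    by (rule smooth_onI[OF open_UNIV dj], rule smooth_onI[OF open_UNIV ddj], rule smooth_on_const)
  have E: "param (UNIV, id) = (id :: 'r \<Rightarrow> 'r)" "coord_image (UNIV, id) = (UNIV :: 'r set)"
    by (auto simp: param_def coord_image_def)
  have djdj: "lorentz (dj x u) (dj x v) = u \<bullet> v" for x u v
    by (simp add: dj_def lorentz_simps w(1)) (simp add: lorentz_def wak aL LM(3,6))
  have "isometric_immersion_hyperbolic euclidean euclidean_atlas euclidean_metric j"
    unfolding isometric_immersion_def euclidean_atlas_def
    using sj djdj jj jt by (auto simp: E fdj euclidean_metric_def hyperboloid_def)
  moreover have "embedding_map euclidean euclidean j"
  proof (rule section_imp_embedding_map)
    have "continuous_on UNIV j" by (rule smooth_on_continuous[OF sj])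
    moreover have "continuous_on UNIV \<pi>" by (rule linear_continuous_on[OF linear_conv_bounded_linear[THEN iffD1, OF l\<pi>]])
    ultimately show "section_map euclidean euclidean j"
      unfolding section_map_def retraction_maps_def by (intro exI[of _ \<pi>]) (simp add: \<pi>j)
  qed
  moreover have "umbilical euclidean_atlas euclidean_metric j"
    unfolding umbilical_def
  proof (intro ballI)
    fix c x assume "c \<in> (euclidean_atlas :: ('r, 'r) chart set)" "x \<in> coord_image c"
    then have c: "c = (UNIV, id)" by (simp add: euclidean_atlas_def)
    have "hyperbolic_sff euclidean_metric j c x u v = euclidean_metric c x u v *\<^sub>R (w - j x)" for u v
      by (simp add: c hyperbolic_sff_def E fdj fddj christoffel_euclidean)
        (simp add: euclidean_metric_def dj_def linear_0[OF LM(1)] algebra_simps flip: zero_prod_def)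
    then show "\<exists>\<eta>. \<forall>u v. hyperbolic_sff euclidean_metric j c x u v = euclidean_metric c x u v *\<^sub>R \<eta>" by blast
  qed
  moreover have "is_horosphere (range j)"
    unfolding is_horosphere_def
  proof (intro exI[of _ w] conjI)
    show "range j = {x \<in> hyperbolic_space. lorentz x w = - 1}"
      using j\<pi> jw jj jt by (auto simp: hyperboloid_def)
  qed (use w in auto)
  ultimately have "horosphere_embedding j" unfolding horosphere_embedding_def by blast
  then show thesis using that l\<pi> j\<pi> \<pi>\<pi> by blast
qed

lemma future_timelike_inner:
  assumes "x \<in> hyperbolic_space" "y \<in> hyperbolic_space" shows "lorentz x y < 0"
proof -
  obtain a s b t where xy: "x = (a, s)" "y = (b, t)" by (cases x, cases y)
  have s: "s > 0" "t > 0" "a \<bullet> a < s\<^sup>2" "b \<bullet> b < t\<^sup>2"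
    using assms by (auto simp: xy hyperboloid_def lorentz_def power2_eq_square)
  have "norm a < s" "norm b < t" using s by (auto intro: power2_less_imp_less simp: power2_norm_eq_inner)
  then have "norm a * norm b < s * t" by (intro mult_strict_mono') auto
  then show ?thesis using norm_cauchy_schwarz[of a b] by (simp add: xy lorentz_def)
qed

text \<open>Components in an orthonormal frame; the time coordinate carries a minus sign because
  \<open>r 1\<close> has square -1.\<close>

definition split_coords :: "(3 \<Rightarrow> 'h::euclidean_space \<times> real) \<Rightarrow> (3 \<Rightarrow> 'h \<times> real) \<Rightarrow> (3 \<Rightarrow> 'h \<times> real) \<Rightarrow> 'h \<times> real
    \<Rightarrow> ((real ^ 2) \<times> (real ^ 3) \<times> (real ^ 3)) \<times> real" where
  "split_coords p q r z = ((vector [lorentz z (p 1), lorentz z (q 1)],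
     vector [lorentz z (p 2), lorentz z (q 2), lorentz z (r 2)],
     vector [lorentz z (p 3), lorentz z (q 3), lorentz z (r 3)]), - lorentz z (r 1))"

definition split_point :: "(3 \<Rightarrow> 'h::euclidean_space \<times> real) \<Rightarrow> (3 \<Rightarrow> 'h \<times> real) \<Rightarrow> (3 \<Rightarrow> 'h \<times> real)
    \<Rightarrow> ((real ^ 2) \<times> (real ^ 3) \<times> (real ^ 3)) \<times> real \<Rightarrow> 'h \<times> real" where
  "split_point p q r = (\<lambda>((x, y, z), t). (x $ 1 *\<^sub>R p 1 + x $ 2 *\<^sub>R q 1 + t *\<^sub>R r 1)
     + (y $ 1 *\<^sub>R p 2 + y $ 2 *\<^sub>R q 2 + y $ 3 *\<^sub>R r 2) + (z $ 1 *\<^sub>R p 3 + z $ 2 *\<^sub>R q 3 + z $ 3 *\<^sub>R r 3))"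

text \<open>The coordinates form a linear Lorentz isometry, which keeps the future sheet since
  \<open>r 1\<close> is future pointing.\<close>

lemma split_coords_isometry:
  fixes p q r :: "3 \<Rightarrow> 'h::euclidean_space \<times> real"
  assumes pp: "\<And>i. lorentz (p i) (p i) = 1" and qq: "\<And>i. lorentz (q i) (q i) = 1"
    and rr: "lorentz (r 1) (r 1) = -1" "lorentz (r 2) (r 2) = 1" "lorentz (r 3) (r 3) = 1"
    and o: "\<And>i j. i \<noteq> j \<Longrightarrow> lorentz (p i) (p j) = 0" "\<And>i j. i \<noteq> j \<Longrightarrow> lorentz (q i) (q j) = 0"
      "\<And>i j. i \<noteq> j \<Longrightarrow> lorentz (r i) (r j) = 0"
      "\<And>i j. lorentz (p i) (q j) = 0" "\<And>i j. lorentz (p i) (r j) = 0" "\<And>i j. lorentz (q i) (r j) = 0"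
    and complete: "\<And>z. z = (\<Sum>i\<in>UNIV. lorentz z (p i) *\<^sub>R p i + lorentz z (q i) *\<^sub>R q i + (lorentz (r i) (r i) * lorentz z (r i)) *\<^sub>R r i)"
    and fut: "snd (r 1) > 0"
  shows "split_coords p q r (split_point p q r a) = a" and "split_point p q r (split_coords p q r z) = z"
    and "linear (split_point p q r)"
    and "hyperbolic_isometry (split_coords p q r)"
proof -
  have o': "lorentz (q i) (p j) = 0" "lorentz (r i) (p j) = 0" "lorentz (r i) (q j) = 0" for i j
    by (simp_all only: o(4-6) lorentz_sym[of "q i" "p j"] lorentz_sym[of "r i" "p j"] lorentz_sym[of "r i" "q j"])
  let ?\<Phi> = "split_coords p q r" and ?\<Psi> = "split_point p q r"
  have ne: "(1::3) \<noteq> 2" "(1::3) \<noteq> 3" "(2::3) \<noteq> 3" "(2::3) \<noteq> 1" "(3::3) \<noteq> 1" "(3::3) \<noteq> 2" by simp_all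
  note O = pp qq rr o(4-6) o' o(1)[OF ne(1)] o(1)[OF ne(2)] o(1)[OF ne(3)] o(1)[OF ne(4)] o(1)[OF ne(5)] o(1)[OF ne(6)]
    o(2)[OF ne(1)] o(2)[OF ne(2)] o(2)[OF ne(3)] o(2)[OF ne(4)] o(2)[OF ne(5)] o(2)[OF ne(6)]
    o(3)[OF ne(1)] o(3)[OF ne(2)] o(3)[OF ne(3)] o(3)[OF ne(4)] o(3)[OF ne(5)] o(3)[OF ne(6)]
  show \<Phi>\<Psi>: "?\<Phi> (?\<Psi> a) = a" for a
  proof -
    obtain x y z t where a: "a = ((x, y, z), t)" by (metis surj_pair)
    show ?thesis unfolding a split_coords_def split_point_def
      by (simp add: lorentz_simps O vec_eq_iff forall_2 forall_3 del: vector_def)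
  qed
  show \<Psi>\<Phi>: "?\<Psi> (?\<Phi> z) = z" for z
    using complete[of z, symmetric] by (simp add: split_coords_def split_point_def sum_3 rr)
  show l\<Psi>: "linear ?\<Psi>" by (rule linearI) (simp_all add: split_point_def algebra_simps split: prod.splits)
  have \<Psi>l: "lorentz (?\<Psi> a) (?\<Psi> b) = lorentz a b" for a b
  proof -
    obtain x y z t where a: "a = ((x, y, z), t)" by (metis surj_pair)
    obtain x' y' z' t' where b: "b = ((x', y', z'), t')" by (metis surj_pair)
    show ?thesis unfolding a b split_point_def prod.case lorentz_simps O
      by (simp add: lorentz_def inner_vec_def sum_2 sum_3)
  qed
  have \<Phi>l: "lorentz (?\<Phi> z) (?\<Phi> z') = lorentz z z'" for z z' using \<Psi>l[of "?\<Phi> z" "?\<Phi> z'"] by (simp add: \<Psi>\<Phi>)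
  have r1: "r 1 \<in> hyperbolic_space" using rr fut by (simp add: hyperboloid_def)
  have \<Phi>H: "?\<Phi> z \<in> hyperbolic_space" if z: "z \<in> hyperbolic_space" for z
    using z future_timelike_inner[OF z r1] \<Phi>l[of z z] by (simp add: hyperboloid_def) (simp add: split_coords_def)
  \<comment> \<open>If the image of \<open>a\<close> lay on the past sheet, that of
    \<open>- a\<close> would lie on the future sheet, and applying \<open>?\<Phi>\<close> would put
    \<open>- a\<close> into hyperbolic space.\<close>
  have \<Psi>H: "?\<Psi> a \<in> hyperbolic_space" if a: "a \<in> hyperbolic_space" for a
  proof (rule ccontr)
    assume n: "?\<Psi> a \<notin> hyperbolic_space"
    have n1: "lorentz (?\<Psi> a) (?\<Psi> a) = -1" using a by (simp add: \<Psi>l hyperboloid_def)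
    have "snd (?\<Psi> a) \<noteq> 0"
    proof
      assume "snd (?\<Psi> a) = 0"
      then show False using n1 inner_ge_zero[of "fst (?\<Psi> a)"] by (simp add: lorentz_def)
    qed
    then have "snd (?\<Psi> a) < 0" using n n1 by (simp add: hyperboloid_def)
    then have "- ?\<Psi> a \<in> hyperbolic_space" using n1 by (simp add: hyperboloid_def lorentz_simps)
    then have "?\<Phi> (?\<Psi> (- a)) \<in> hyperbolic_space" using \<Phi>H by (simp add: linear_neg[OF l\<Psi>])
    then show False using a by (simp add: \<Phi>\<Psi> hyperboloid_def)
  qed
  have "bij_betw ?\<Phi> hyperbolic_space hyperbolic_space"
    by (rule bij_betw_byWitness[where f' = ?\<Psi>]) (use \<Phi>\<Psi> \<Psi>\<Phi> \<Phi>H \<Psi>H in auto)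
  then show "hyperbolic_isometry ?\<Phi>" unfolding hyperbolic_isometry_def hyperbolic_dist_def \<Phi>l by blast
qed

context split_chart
begin

text \<open>The map \<open>(u, s) \<mapsto> \<Sum>\<^sub>i s\<^sub>i P\<^sub>i(F u)\<close> is a local diffeomorphism onto an open set; on the product of
  quadrics all \<open>s\<^sub>i\<close> equal \<open>1\<close>.\<close>

lemma open_in_quadrics:
  assumes complete: "\<And>z. z = (\<Sum>i\<in>UNIV. P i z)" and Q: "\<And>y i. y \<in> U \<Longrightarrow> lorentz (P i (F y)) (F y) = k i" and x: "x \<in> U"
  obtains N where "open N" "F x \<in> N" "\<And>z. z \<in> N \<Longrightarrow> (\<And>i. lorentz (P i z) z = k i) \<Longrightarrow> z \<in> F ` U"
proof -
  have good: "good x" by (rule good_from_open[OF open_U order_refl x Q])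
  have g1: "lorentz (P i (D1 x u)) (F x) = 0" and g2: "lorentz (P i (F x)) (F x) = k i" for i u
    using good by (auto simp: good_def)
  define H where "H a = (\<Sum>i\<in>UNIV. (snd a $ i) *\<^sub>R P i (F (fst a)))" for a :: "'m \<times> (real ^ 3)"
  define H' where "H' a = (\<Sum>i\<in>UNIV. P i (D1 x (fst a)) + (snd a $ i) *\<^sub>R P i (F x))" for a :: "'m \<times> (real ^ 3)"
  have bl: "bounded_linear (P i)" for i by (rule linear_conv_bounded_linear[THEN iffD1, OF P_lin])
  define v1 :: "real ^ 3" where "v1 = (\<chi> i. 1)" 
  have lH: "linear H'"
    unfolding H'_def by (rule linearI) (simp_all add: PD D1D[OF x] algebra_simps sum.distrib scaleR_sum_right)
  have dH: "(H has_derivative H') (at (x, v1))"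
  proof -
    have F1: "((\<lambda>a. F (fst a)) has_derivative (\<lambda>a. D1 x (fst a))) (at (x, v1))"
      using diff_chain_at[OF has_derivative_fst[OF has_derivative_ident], of F "D1 x" "(x, v1)"] deriv_F[OF x] by (simp add: o_def)
    have c: "((\<lambda>a. snd a $ i) has_derivative (\<lambda>a. snd a $ i)) (at (x, v1))" for i
      by (rule bounded_linear_imp_has_derivative[OF bounded_linear_compose[OF bounded_linear_vec_nth bounded_linear_snd]])
    show ?thesis unfolding H_def H'_def
      by (rule has_derivative_eq_rhs[OF has_derivative_sum[OF has_derivative_scaleR[OF c bounded_linear.has_derivative[OF bl F1]]]])
        (simp add: v1_def)
  qed
  have inj: "inj H'"
    unfolding linear_injective_0[OF lH]
  proof (intro allI impI)
    fix a assume a: "H' a = 0"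
    have T: "lorentz (P i (D1 x u)) (P j (F x)) = 0" for i j u
    proof (cases "i = j")
      case True then show ?thesis using P_adj[of i "P i (D1 x u)" "F x"] by (simp add: P_idem g1)
    next
      case False then show ?thesis by (simp add: P_adj P_orth lorentz_simps)
    qed
    have "(\<Sum>i\<in>UNIV. snd a $ i * lorentz (P i (F x)) (P j (F x))) = 0" for j
    proof -
      have "lorentz (H' a) (P j (F x)) = 0" by (simp add: a lorentz_simps)
      then show ?thesis unfolding H'_def by (simp add: lorentz_simps T)
    qed
    moreover have "(\<Sum>i\<in>UNIV. snd a $ i * lorentz (P i (F x)) (P j (F x))) = snd a $ j * k j" for j
      by (rule trans[OF sum_UNIV_single[of j]]) (simp_all add: P_F_orth[OF g1 g2] P_F_norm[OF g1 g2])
    ultimately have s0: "snd a $ j = 0" for j using k0[of j] by (metis mult_eq_0_iff)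
    then have "D1 x (fst a) = 0" using a complete[of "D1 x (fst a)"] by (simp add: H'_def)
    then have "fst a = 0" using D1_inj[OF x] by blast
    moreover have "snd a = 0" using s0 by (simp add: vec_eq_iff)
    ultimately show "a = 0" by (simp add: prod_eq_iff)
  qed
  \<comment> \<open>Source and target are both nine-dimensional: six coordinates and three
    scalings.\<close>
  have "dim (range H') = DIM('h \<times> real)"
    using dim_image_eq[OF lH, of UNIV] inj six dim_h by simp
  then have "surj H'" using dim_eq_full[of "range H'"] span_eq_iff[of "range H'"] linear_subspace_image[OF lH subspace_UNIV] by simp
  then obtain R where R: "linear R" "H' \<circ> R = id" using linear_surjective_right_inverse[OF lH] by blast
  \<comment> \<open>Only positive scalings, so that a square equal to 1 leaves no ambiguity of sign
    below.\<close>
  define S where "S = U \<times> {s :: real ^ 3. \<forall>i. 0 < s $ i}"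
  have "{s :: real ^ 3. \<forall>i. 0 < s $ i} = (\<Inter>i. {s. 0 < s $ i})" by auto
  then have oS: "open S" unfolding S_def
    by (intro open_Times open_U) (auto intro!: open_INT open_Collect_less continuous_intros)
  have xS: "(x, v1) \<in> S" using x by (simp add: S_def v1_def)
  have cH: "continuous_on S H"
  proof -
    have "continuous_on U F" by (rule smooth_on_continuous[OF F_smooth])
    then have "continuous_on S (\<lambda>a. F (fst a))" unfolding S_def by (auto intro!: continuous_on_compose2[of U F _ fst] continuous_intros)
    then have "continuous_on S (\<lambda>a. P i (F (fst a)))" for i by (rule bounded_linear.continuous_on[OF bl])
    then show ?thesis unfolding H_def by (intro continuous_intros)
  qed
  have int: "H (x, v1) \<in> interior (H ` S)"
    by (rule sussmann_open_mapping[OF oS cH xS dH linear_conv_bounded_linear[THEN iffD1, OF R(1)] R(2) order_refl])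
      (use xS oS in \<open>simp add: interior_open\<close>)
  have Hx: "H (x, v1) = F x" unfolding H_def by (simp add: v1_def complete[of "F x", symmetric])
  have fin: "z \<in> F ` U" if z: "z \<in> interior (H ` S)" and zk: "\<And>i. lorentz (P i z) z = k i" for z
  proof -
    obtain u s where us: "u \<in> U" "\<And>i. 0 < s $ i" "z = H (u, s)" using z interior_subset by (force simp: S_def)
    have Pz: "P i z = (s $ i) *\<^sub>R P i (F u)" for i
      unfolding us(3) H_def linear_sum[OF P_lin] fst_conv snd_conv PD
      by (rule trans[OF sum_UNIV_single[of i]]) (simp_all add: P_orth P_idem)
    have "s $ i = 1" for i
    proof -
      have "k i = lorentz (P i z) (P i z)" by (metis P_adj P_idem zk)
      also have "\<dots> = s $ i * (s $ i * lorentz (P i (F u)) (P i (F u)))" by (simp add: Pz lorentz_simps)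
      also have "lorentz (P i (F u)) (P i (F u)) = k i" by (metis P_adj P_idem Q[OF us(1)])
      finally have "(s $ i)\<^sup>2 = 1" using k0[of i] by (simp add: power2_eq_square)
      then show ?thesis using us(2)[of i] by (simp add: power2_eq_1_iff)
    qed
    then have "z = F u" using complete[of z] complete[of "F u"] Pz by simp
    then show ?thesis using us(1) by blast
  qed
  show thesis by (rule that[OF open_interior _ fin]) (use int Hx in simp_all)
qed

end

section \<open>The two conclusions\<close>

context kaehler_hyperbolic
begin

lemma extrinsic_product_case:
  assumes c: "c \<in> A" "x0 \<in> coord_image c" and no: "\<not> (\<exists>w. hyperbolic_chart.null_normal (f \<circ> param c) x0 w)"
  shows "DIM('m) = 6" and "\<exists>\<Phi> c1 c2 c3. hyperbolic_isometry \<Phi> \<and>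
              c1 < 0 \<and> c2 > 0 \<and> c3 > 0 \<and> 1 / c1 + 1 / c2 + 1 / c3 = - 1 \<and>
              openin (top_of_set (extrinsic_product c1 c2 c3)) ((\<Phi> \<circ> f) ` topspace X)"
proof -
  obtain P :: "3 \<Rightarrow> 'h \<times> real \<Rightarrow> 'h \<times> real" and e \<eta> where six: "DIM('m) = 6"
    and sp: "hyperbolic_chart.split_frame (f \<circ> param c) (g c) (J c) x0 e \<eta>"
    and Pf: "\<And>p i. p \<in> topspace X \<Longrightarrow> lorentz (P i (f p)) (f p) = 1 / lorentz (\<eta> i) (\<eta> i)"
    and Pdef: "P = (\<lambda>i z. let D = frechet_derivative (f \<circ> param c) (at x0) in
      lorentz z (D (e i)) *\<^sub>R D (e i) + lorentz z (D (J c x0 (e i))) *\<^sub>R D (J c x0 (e i))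
      + (lorentz z (\<eta> i) / lorentz (\<eta> i) (\<eta> i)) *\<^sub>R \<eta> i)"
    and complete: "\<And>z. z = (\<Sum>i\<in>UNIV. P i z)" and sumk: "(\<Sum>i\<in>UNIV. 1 / lorentz (\<eta> i) (\<eta> i)) = -1"
    and split: "\<And>d U. d \<in> A \<Longrightarrow> open U \<Longrightarrow> U \<subseteq> coord_image d \<Longrightarrow> split_chart U (f \<circ> param d) (g d) (J d) P (\<lambda>i. 1 / lorentz (\<eta> i) (\<eta> i))"
  proof (rule split_global[OF c no], goal_cases)
    case (1 P e \<eta>)
    show thesis by (rule 1(1)) (fact 1)+
  qed
  show "DIM('m) = 6" by (rule six)
  interpret C: hyperbolic_chart "coord_image c" "f \<circ> param c" "g c" "J c"
    by (rule hyperbolic_chart[OF c(1) open_image[OF c(1)] order_refl])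
  note D = C.split_frameD[OF sp] and x = c(2)
  define K where "K i = lorentz (\<eta> i) (\<eta> i)" for i
  have K0: "K i \<noteq> 0" for i unfolding K_def by (rule D(7))
  have fJ: "g c x0 (e i) (J c x0 (e j)) = 0" for i j
  proof (cases "i = j")
    case True
    have "g c x0 (e i) (J c x0 (e i)) = g c x0 (J c x0 (e i)) (J c x0 (J c x0 (e i)))" by (rule C.J_orth[OF x, symmetric])
    also have "\<dots> = - g c x0 (e i) (J c x0 (e i))"
      by (simp add: C.J_sq[OF x] bilinearD[OF C.h_bil[OF x]] C.h_sym[OF x, of "J c x0 (e i)"])
    finally show ?thesis using True by simp
  qed (use D(3) in blast)
  \<comment> \<open>The reciprocals of the squares add up to -1, so one square is negative; the
    other normals are orthogonal to this timelike vector and therefore spacelike.\<close>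
  have "\<exists>i. K i < 0"
  proof (rule ccontr)
    assume "\<not> (\<exists>i. K i < 0)"
    then have "0 \<le> (\<Sum>i\<in>UNIV. 1 / K i)" by (intro sum_nonneg) (simp add: not_less)
    then show False using sumk by (simp add: K_def)
  qed
  then obtain i0 where i0: "K i0 < 0" by blast
  have Kpos: "K j > 0" if "j \<noteq> i0" for j
    unfolding K_def
  proof (rule lorentz_orthogonal_timelike)
    show "lorentz ((1 / sqrt (- K i0)) *\<^sub>R \<eta> i0) ((1 / sqrt (- K i0)) *\<^sub>R \<eta> i0) = -1"
      using i0 by (simp add: lorentz_simps flip: K_def)
    show "lorentz (\<eta> j) ((1 / sqrt (- K i0)) *\<^sub>R \<eta> i0) = 0" using D(6)[OF that] by (simp add: lorentz_simps)
    show "\<eta> j \<noteq> 0" using K0[of j] by (auto simp: K_def lorentz_simps)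
  qed
  \<comment> \<open>The transposition of 1 and \<open>i0\<close> puts the timelike factor
    first.\<close>
  define \<sigma> where "\<sigma> i = (if i = 1 then i0 else if i = i0 then 1 else i)" for i :: 3
  have \<sigma>\<sigma>: "\<sigma> (\<sigma> i) = i" for i by (simp add: \<sigma>_def)
  have \<sigma>i: "\<sigma> i \<noteq> \<sigma> j" if "i \<noteq> j" for i j using that \<sigma>\<sigma> by metis
  have \<sigma>1: "\<sigma> 1 = i0" by (simp add: \<sigma>_def)
  have b\<sigma>: "bij \<sigma>" by (rule o_bij[where g = \<sigma>]) (simp_all add: fun_eq_iff \<sigma>\<sigma>)
  define p where "p i = C.D1 x0 (e (\<sigma> i))" for i
  define q where "q i = C.D1 x0 (J c x0 (e (\<sigma> i)))" for i
  \<comment> \<open>The sign makes \<open>r 1\<close> future pointing.\<close>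
  define \<epsilon> where "\<epsilon> i = (if snd (\<eta> (\<sigma> i)) < 0 then -1 else 1 :: real)" for i
  define r where "r i = (\<epsilon> i / sqrt \<bar>K (\<sigma> i)\<bar>) *\<^sub>R \<eta> (\<sigma> i)" for i
  have \<epsilon>: "\<epsilon> i * \<epsilon> i = 1" for i by (simp add: \<epsilon>_def)
  have rr': "lorentz (r i) (r i) = K (\<sigma> i) / \<bar>K (\<sigma> i)\<bar>" for i
    using \<epsilon>[of i] by (simp add: r_def lorentz_simps flip: K_def)
  have r1: "lorentz (r 1) (r 1) = -1" using i0 by (simp add: rr' \<sigma>1)
  have r23: "lorentz (r i) (r i) = 1" if "i \<noteq> 1" for i using Kpos[of "\<sigma> i"] \<sigma>i[OF that] by (simp add: rr' \<sigma>1)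
  have r2: "lorentz (r 2) (r 2) = 1" and r3: "lorentz (r 3) (r 3) = 1" using r23[of 2] r23[of 3] by simp_all
  have D\<eta>: "lorentz (C.D1 x0 u) (\<eta> i) = 0" for u i using D(4) lorentz_sym by metis
  have Pz: "P (\<sigma> i) z = lorentz z (p i) *\<^sub>R p i + lorentz z (q i) *\<^sub>R q i + (lorentz (r i) (r i) * lorentz z (r i)) *\<^sub>R r i" for i z
  proof -
    have "lorentz (r i) (r i) * lorentz z (r i) * (\<epsilon> i / sqrt \<bar>K (\<sigma> i)\<bar>)
        = K (\<sigma> i) / \<bar>K (\<sigma> i)\<bar> * lorentz z (\<eta> (\<sigma> i)) * (\<epsilon> i * \<epsilon> i) / (sqrt \<bar>K (\<sigma> i)\<bar> * sqrt \<bar>K (\<sigma> i)\<bar>)"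
      unfolding rr' by (subst r_def) (simp only: lorentz_simps times_divide_eq_right times_divide_eq_left divide_divide_eq_left real_scaleR_def mult_ac)
    also have "\<dots> = lorentz z (\<eta> (\<sigma> i)) / K (\<sigma> i)"
      using K0[of "\<sigma> i"] unfolding \<epsilon> by (cases "K (\<sigma> i) > 0") (simp_all add: field_simps)
    finally have "(lorentz (r i) (r i) * lorentz z (r i)) *\<^sub>R r i = (lorentz z (\<eta> (\<sigma> i)) / K (\<sigma> i)) *\<^sub>R \<eta> (\<sigma> i)"
      by (metis r_def scaleR_scaleR)
    then show ?thesis unfolding Pdef Let_def by (simp only: p_def q_def C.D1_def K_def)
  qed
  have complete': "z = (\<Sum>i\<in>UNIV. lorentz z (p i) *\<^sub>R p i + lorentz z (q i) *\<^sub>R q i + (lorentz (r i) (r i) * lorentz z (r i)) *\<^sub>R r i)" for z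
    unfolding Pz[symmetric] sum.reindex_bij_betw[OF b\<sigma>, of "\<lambda>i. P i z"] by (rule complete)
  have "snd (r 1) \<noteq> 0"
  proof
    assume "snd (r 1) = 0"
    then show False using r1 inner_ge_zero[of "fst (r 1)"] by (simp add: lorentz_def)
  qed
  moreover have "snd (r 1) \<ge> 0" by (simp add: r_def \<epsilon>_def zero_le_mult_iff divide_le_0_iff)
  ultimately have fut: "snd (r 1) > 0" by simp
  let ?\<Phi> = "split_coords p q r" and ?\<Psi> = "split_point p q r"
  have "?\<Phi> (?\<Psi> a) = a" and "?\<Psi> (?\<Phi> z) = z" and "linear ?\<Psi>" and "hyperbolic_isometry ?\<Phi>" for a z
    by ((rule split_coords_isometry[of p q r]; (rule complete' fut r1 r2 r3 | simp add: p_def q_def r_def lorentz_simps C.isom[OF x]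
        C.J_orth[OF x] D(1,2,6) \<sigma>i fJ D\<eta>)))+
  note iso = this
  have quad: "lorentz (P (\<sigma> i) z) z = (lorentz z (p i))\<^sup>2 + (lorentz z (q i))\<^sup>2 + lorentz (r i) (r i) * (lorentz z (r i))\<^sup>2" for i z
    unfolding Pz lorentz_simps by (simp add: lorentz_sym[of "p i" z] lorentz_sym[of "q i" z] lorentz_sym[of "r i" z] power2_eq_square)
  \<comment> \<open>In these coordinates the product is cut out by the three quadric equations and
    the choice of the future sheet in the first factor.\<close>
  have prod: "?\<Phi> z \<in> extrinsic_product (K (\<sigma> 1)) (K (\<sigma> 2)) (K (\<sigma> 3)) \<longleftrightarrow> (\<forall>i. lorentz (P i z) z = 1 / K i) \<and> lorentz z (r 1) < 0" for z
  proof -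
    have "(\<forall>i. lorentz (P i z) z = 1 / K i) \<longleftrightarrow> (\<forall>i. lorentz (P (\<sigma> i) z) z = 1 / K (\<sigma> i))" using \<sigma>\<sigma> by metis
    also have "\<dots> \<longleftrightarrow> (lorentz z (p 1))\<^sup>2 + (lorentz z (q 1))\<^sup>2 - (lorentz z (r 1))\<^sup>2 = 1 / K (\<sigma> 1) \<and>
        (lorentz z (p 2))\<^sup>2 + (lorentz z (q 2))\<^sup>2 + (lorentz z (r 2))\<^sup>2 = 1 / K (\<sigma> 2) \<and>
        (lorentz z (p 3))\<^sup>2 + (lorentz z (q 3))\<^sup>2 + (lorentz z (r 3))\<^sup>2 = 1 / K (\<sigma> 3)"
      by (simp add: forall_3 quad r1 r2 r3)
    finally show ?thesis
      by (auto simp: split_coords_def extrinsic_product_def hyperboloid_def sphere_curv_def lorentz_def[where 'h = "real ^ 2"]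
          inner_vec_def sum_2 sum_3 power2_eq_square)
  qed
  let ?E = "extrinsic_product (K (\<sigma> 1)) (K (\<sigma> 2)) (K (\<sigma> 3))"
  have fH: "f p \<in> hyperbolic_space" if "p \<in> topspace X" for p using imm that unfolding isometric_immersion_def by blast
  have "r 1 \<in> hyperbolic_space" using r1 fut by (simp add: hyperboloid_def)
  then have inE: "?\<Phi> (f p) \<in> ?E" if "p \<in> topspace X" for p
    unfolding prod using Pf[OF that] future_timelike_inner[OF fH[OF that]] by (simp add: K_def)
  have op: "openin (top_of_set ?E) ((?\<Phi> \<circ> f) ` topspace X)"
    unfolding openin_subopen[of _ "(?\<Phi> \<circ> f) ` topspace X"]
  proof
    fix y assume "y \<in> (?\<Phi> \<circ> f) ` topspace X"
    then obtain s where s: "s \<in> topspace X" "y = ?\<Phi> (f s)" by auto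
    obtain d where d: "d \<in> A" "s \<in> fst d" using chart_at[OF s(1)] by blast
    interpret T: split_chart "coord_image d" "f \<circ> param d" "g d" "J d" P "\<lambda>i. 1 / lorentz (\<eta> i) (\<eta> i)"
      by (rule split[OF d(1) open_image[OF d(1)] order_refl])
    have Q: "lorentz (P i ((f \<circ> param d) y)) ((f \<circ> param d) y) = 1 / lorentz (\<eta> i) (\<eta> i)" if "y \<in> coord_image d" for y i
      using Pf[OF param_topspace[OF d(1) that]] by simp
    obtain N where N: "open N" "(f \<circ> param d) (snd d s) \<in> N"
      "\<And>z. z \<in> N \<Longrightarrow> (\<And>i. lorentz (P i z) z = 1 / lorentz (\<eta> i) (\<eta> i)) \<Longrightarrow> z \<in> (f \<circ> param d) ` coord_image d"
      using T.open_in_quadrics[OF complete Q coord_in[OF d(2)]] by blast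
    have "open (?\<Psi> -` N)"
      by (rule open_vimage[OF N(1) linear_continuous_on[OF linear_conv_bounded_linear[THEN iffD1, OF iso(3)]]])
    then have 1: "openin (top_of_set ?E) (?E \<inter> ?\<Psi> -` N)" by (rule openin_open_Int)
    have 2: "y \<in> ?E \<inter> ?\<Psi> -` N" using N(2) inE[OF s(1)] by (simp add: s(2) iso(2) param_snd[OF d])
    have 3: "?E \<inter> ?\<Psi> -` N \<subseteq> (?\<Phi> \<circ> f) ` topspace X"
    proof
      fix a assume a: "a \<in> ?E \<inter> ?\<Psi> -` N"
      then have "\<forall>i. lorentz (P i (?\<Psi> a)) (?\<Psi> a) = 1 / K i" using prod[of "?\<Psi> a"] by (simp add: iso(1))
      then have "?\<Psi> a \<in> (f \<circ> param d) ` coord_image d" using N(3)[of "?\<Psi> a"] a by (simp add: K_def)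
      then obtain u where u: "u \<in> coord_image d" "?\<Psi> a = f (param d u)" by auto
      then have "a = (?\<Phi> \<circ> f) (param d u)" using iso(1)[of a] by simp
      then show "a \<in> (?\<Phi> \<circ> f) ` topspace X" using param_topspace[OF d(1) u(1)] by blast
    qed
    show "\<exists>T. openin (top_of_set ?E) T \<and> y \<in> T \<and> T \<subseteq> (?\<Phi> \<circ> f) ` topspace X" using 1 2 3 by blast
  qed
  have "(\<Sum>i\<in>UNIV. 1 / K (\<sigma> i)) = -1"
    unfolding sum.reindex_bij_betw[OF b\<sigma>, of "\<lambda>i. 1 / K i"] using sumk by (simp add: K_def)
  then have sum: "1 / K (\<sigma> 1) + 1 / K (\<sigma> 2) + 1 / K (\<sigma> 3) = -1" by (simp add: sum_3)
  have K1: "K (\<sigma> 1) < 0" using i0 by (simp add: \<sigma>1)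
  have "K (\<sigma> 2) > 0" "K (\<sigma> 3) > 0" using \<sigma>i[of 2 1] \<sigma>i[of 3 1] \<sigma>1 by (auto intro!: Kpos)
  then show "\<exists>\<Phi> c1 c2 c3. hyperbolic_isometry \<Phi> \<and>
              c1 < 0 \<and> c2 > 0 \<and> c3 > 0 \<and> 1 / c1 + 1 / c2 + 1 / c3 = - 1 \<and>
              openin (top_of_set (extrinsic_product c1 c2 c3)) ((\<Phi> \<circ> f) ` topspace X)"
    using iso(4) K1 sum op by blast
qed

lemma horosphere_case:
  assumes null: "\<And>c x. c \<in> A \<Longrightarrow> x \<in> coord_image c \<Longrightarrow> \<exists>w. hyperbolic_chart.null_normal (f \<circ> param c) x w"
    and dim: "DIM('h) = DIM('r::euclidean_space) + 1"
  shows "\<exists>(h :: 'a \<Rightarrow> 'r::euclidean_space) j. isometric_immersion_euclidean X A g h \<and>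
              horosphere_embedding j \<and> (\<forall>p\<in>topspace X. f p = j (h p))"
proof -
  have "\<exists>w. lorentz w w = 0 \<and> snd w > 0 \<and> (\<forall>p\<in>topspace X. lorentz (f p) w = -1)"
  proof (cases "topspace X = {}")
    case True
    \<comment> \<open>A connected space may be empty; then any future null vector serves.\<close>
    obtain b :: 'h where "b \<in> Basis" using nonempty_Basis by blast
    then show ?thesis using True by (intro exI[of _ "(b, 1)"]) (simp add: lorentz_def)
  qed (rule null_normal_global[OF null])
  then obtain w where w: "lorentz w w = 0" "snd w > 0" "\<And>p. p \<in> topspace X \<Longrightarrow> lorentz (f p) w = -1" by blast
  obtain j :: "'r \<Rightarrow> 'h \<times> real" and \<pi> where j: "horosphere_embedding j" "linear \<pi>"
    "\<And>x. x \<in> hyperbolic_space \<Longrightarrow> lorentz x w = -1 \<Longrightarrow> x = j (\<pi> x)"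
    "\<And>u v. lorentz u w = 0 \<Longrightarrow> lorentz v w = 0 \<Longrightarrow> \<pi> u \<bullet> \<pi> v = lorentz u v"
    using horosphere_model[OF w(1,2) dim] by blast
  note bl = linear_conv_bounded_linear[THEN iffD1, OF j(2)]
  have fH: "f p \<in> hyperbolic_space" if "p \<in> topspace X" for p using imm that unfolding isometric_immersion_def by blast
  have "isometric_immersion_euclidean X A g (\<pi> \<circ> f)"
    unfolding isometric_immersion_def
  proof (intro conjI ballI allI)
    fix c assume c: "c \<in> A"
    interpret C: hyperbolic_chart "coord_image c" "f \<circ> param c" "g c" "J c"
      by (rule hyperbolic_chart[OF c open_image[OF c] order_refl])
    show "smooth_on (\<pi> \<circ> f \<circ> param c) (coord_image c)"
      using smooth_on_linear_compose[OF bl C.open_U C.F_smooth] by (simp add: o_def)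
    fix x u v assume x: "x \<in> coord_image c"
    have "(\<pi> \<circ> f \<circ> param c has_derivative (\<lambda>u. \<pi> (C.D1 x u))) (at x)"
      using bounded_linear.has_derivative[OF bl C.deriv_F[OF x]] by (simp add: o_def)
    then have D: "frechet_derivative (\<pi> \<circ> f \<circ> param c) (at x) = (\<lambda>u. \<pi> (C.D1 x u))" using frechet_derivative_at by metis
    \<comment> \<open>The differential of \<open>f\<close> takes values orthogonal to
      \<open>w\<close>, where \<pi> preserves the Lorentzian form.\<close>
    have "lorentz (C.D1 x u) w = 0" for u
      using has_derivative_locally_constant[OF C.open_U x has_derivative_lorentz[OF C.deriv_F[OF x] has_derivative_const[of w]], of "-1" u]
        w(3)[OF param_topspace[OF c]] by (simp add: lorentz_simps)
    then show "frechet_derivative (\<pi> \<circ> f \<circ> param c) (at x) u \<bullet> frechet_derivative (\<pi> \<circ> f \<circ> param c) (at x) v = g c x u v"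
      unfolding D by (simp add: j(4) C.isom[OF x])
  qed simp
  moreover have "\<forall>p\<in>topspace X. f p = j ((\<pi> \<circ> f) p)" using j(3)[OF fH w(3)] by simp
  ultimately show ?thesis using j(1) by blast
qed

end

theorem theorem6:
  fixes n :: nat
    and X :: "'a topology"
    and A :: "('a, 'm::euclidean_space) chart set"
    and g :: "('a, 'm) metric"
    and J :: "('a, 'm) endo_field"
    and f :: "'a \<Rightarrow> 'h::euclidean_space \<times> real"
  assumes "n \<ge> 3"
    and "DIM('m) = 2 * n"
    and "DIM('h) = 2 * n + 2"
    and "DIM('r::euclidean_space) = 2 * n + 1"
    and "kaehler_manifold X A g J"
    and "isometric_immersion_hyperbolic X A g f"
    and "\<not> (\<exists>W. openin X W \<and> W \<noteq> {} \<and> (\<forall>p\<in>W. flat_point A g p))"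
  shows "(n = 3 \<and>
           (\<exists>\<Phi> c1 c2 c3. hyperbolic_isometry \<Phi> \<and>
              c1 < 0 \<and> c2 > 0 \<and> c3 > 0 \<and> 1 / c1 + 1 / c2 + 1 / c3 = - 1 \<and>
              openin (top_of_set (extrinsic_product c1 c2 c3)) ((\<Phi> \<circ> f) ` topspace X)))
       \<or> (\<exists>(h :: 'a \<Rightarrow> 'r) j. isometric_immersion_euclidean X A g h \<and>
              horosphere_embedding j \<and> (\<forall>p\<in>topspace X. f p = j (h p)))"
proof -
  have "kaehler_hyperbolic X A g J f"
    unfolding kaehler_hyperbolic_def kaehler_hyperbolic_axioms_def using assms by (intro conjI) auto
  then interpret kaehler_hyperbolic X A g J f .
  show ?thesis
  proof (cases "\<exists>c\<in>A. \<exists>x\<in>coord_image c. \<not> (\<exists>w. hyperbolic_chart.null_normal (f \<circ> param c) x w)")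
    case True
    then obtain c x where c: "c \<in> A" "x \<in> coord_image c" "\<not> (\<exists>w. hyperbolic_chart.null_normal (f \<circ> param c) x w)" by blast
    have "n = 3" using extrinsic_product_case(1)[OF c] assms(2) by simp
    then show ?thesis using extrinsic_product_case(2)[OF c] by (intro disjI1 conjI)
  next
    case False
    have "DIM('h) = DIM('r) + 1" using assms(3,4) by simp
    from horosphere_case[OF _ this] False show ?thesis by (intro disjI2) blast
  qed
qed

end
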